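(* The 0-1 Knapsack problem can be solved by a deterministic algorithm with time complexity \[O\big(n + w_{\max}^{2.5}\,\mathrm{poly}\log w_{\max}\big).\] Alternatively, it can also be solved by a deterministic algorithm with time complexity \[O\big(n\,w_{\max}^{1.5}\,\mathrm{poly}\log w_{\max}\big).\]
   Context: In the 0-1 Knapsack problem, the input is a capacity $t\in\mathbb{Z}^+$ and $n$ items $(w_1,p_1),\dots,(w_n,p_n)$ with $w_i,p_i\in\mathbb{Z}^+$ (weight and profit of item $i$). The task is to find a subset $S\subseteq[n]$ with $\sum_{i\in S}w_i\le t$ maximizing $\sum_{i\in S}p_i$. Here $w_{\max}=\max_i w_i$ denotes the maximum item weight. The computational model is the word-RAM with $\Theta(\log n)$-bit words, and all input integers ($t,w_i,p_i$) are assumed to fit in a single machine word. *)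

theory Defs
  imports Complex_Main
begin

type_synonym reg = nat

datatype binop =
  Add | Sub | Mul | Div | Mod | And | Or | Xor | Shl | Shr

datatype instr =
    Const reg nat
  | Move reg reg
  | Op binop reg reg reg
  | Load reg reg
  | Store reg reg
  | Jump nat
  | JumpEq reg reg nat
  | JumpLess reg reg nat

type_synonym program = "instr list"

record config =
  pc :: nat
  regs :: "reg \<Rightarrow> nat"
  mem :: "nat \<Rightarrow> nat"

text \<open>
  The word-RAM with words of \<open>W\<close> bits. Words are natural numbers below \<open>2 ^ W\<close>, arithmetic is modulo
  \<open>2 ^ W\<close>, and every instruction takes unit time. An address is the content of a register, so that
  at most \<open>2 ^ W\<close> memory cells are accessible. A program is independent of \<open>W\<close> and refers to
  finitely many registers. In \<open>Op f d r s\<close> and \<open>Load d r\<close> the destination comes first;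
  \<open>Store r s\<close> writes register \<open>s\<close> to the address in register \<open>r\<close>.
\<close>

context includes bit_operations_syntax
begin

fun eval_binop :: "nat \<Rightarrow> binop \<Rightarrow> nat \<Rightarrow> nat \<Rightarrow> nat" where
  "eval_binop W Add x y = take_bit W (x + y)"
| "eval_binop W Sub x y = take_bit W (x + 2 ^ W - y)"
| "eval_binop W Mul x y = take_bit W (x * y)"
| "eval_binop W Div x y = x div y"
| "eval_binop W Mod x y = x mod y"
| "eval_binop W And x y = x AND y"
| "eval_binop W Or x y = x OR y"
| "eval_binop W Xor x y = x XOR y"
| "eval_binop W Shl x y = take_bit W (push_bit y x)"
| "eval_binop W Shr x y = drop_bit y x"

end

fun exec_instr :: "nat \<Rightarrow> instr \<Rightarrow> config \<Rightarrow> config" where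
  "exec_instr W (Const d k) s = s\<lparr>pc := pc s + 1, regs := (regs s)(d := take_bit W k)\<rparr>"
| "exec_instr W (Move d r) s = s\<lparr>pc := pc s + 1, regs := (regs s)(d := regs s r)\<rparr>"
| "exec_instr W (Op f d r r') s =
     s\<lparr>pc := pc s + 1, regs := (regs s)(d := eval_binop W f (regs s r) (regs s r'))\<rparr>"
| "exec_instr W (Load d r) s = s\<lparr>pc := pc s + 1, regs := (regs s)(d := mem s (regs s r))\<rparr>"
| "exec_instr W (Store r r') s = s\<lparr>pc := pc s + 1, mem := (mem s)(regs s r := regs s r')\<rparr>"
| "exec_instr W (Jump l) s = s\<lparr>pc := l\<rparr>"
| "exec_instr W (JumpEq r r' l) s = s\<lparr>pc := (if regs s r = regs s r' then l else pc s + 1)\<rparr>"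
| "exec_instr W (JumpLess r r' l) s = s\<lparr>pc := (if regs s r < regs s r' then l else pc s + 1)\<rparr>"

text \<open>The machine halts when the program counter leaves the program; it then stays put.\<close>

definition halted :: "program \<Rightarrow> config \<Rightarrow> bool" where
  "halted P s \<longleftrightarrow> length P \<le> pc s"

definition step :: "nat \<Rightarrow> program \<Rightarrow> config \<Rightarrow> config" where
  "step W P s = (if halted P s then s else exec_instr W (P ! pc s) s)"

text \<open>A knapsack instance is a capacity together with the list of its (weight, profit) pairs.\<close>

type_synonym item = "nat \<times> nat"

definition knapsack_instance :: "nat \<Rightarrow> item list \<Rightarrow> bool" where
  "knapsack_instance t items \<longleftrightarrow>
     0 < t \<and> items \<noteq> [] \<and> (\<forall>(w, p) \<in> set items. 0 < w \<and> 0 < p)"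

definition feasible :: "nat \<Rightarrow> item list \<Rightarrow> nat set \<Rightarrow> bool" where
  "feasible t items S \<longleftrightarrow> S \<subseteq> {..<length items} \<and> (\<Sum>i\<in>S. fst (items ! i)) \<le> t"

definition knapsack_solution :: "nat \<Rightarrow> item list \<Rightarrow> nat set \<Rightarrow> bool" where
  "knapsack_solution t items S \<longleftrightarrow>
     is_arg_max (\<lambda>S. \<Sum>i\<in>S. snd (items ! i)) (feasible t items) S"

definition w_max :: "item list \<Rightarrow> nat" where
  "w_max items = Max (fst ` set items)"

text \<open>
  The input occupies the memory cells \<open>n, t, w\<^sub>0, p\<^sub>0, w\<^sub>1, p\<^sub>1, \<dots>\<close> from address 0 on; everything else is
  zero. The output is the indicator vector of the chosen set, in the cells \<open>0, \<dots>, n - 1\<close>.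
\<close>

definition input_words :: "nat \<Rightarrow> item list \<Rightarrow> nat list" where
  "input_words t items = length items # t # concat (map (\<lambda>(w, p). [w, p]) items)"

definition init_config :: "nat list \<Rightarrow> config" where
  "init_config xs =
     \<lparr>pc = 0, regs = (\<lambda>_. 0), mem = (\<lambda>a. if a < length xs then xs ! a else 0)\<rparr>"

definition output_set :: "nat \<Rightarrow> config \<Rightarrow> nat set" where
  "output_set n s = {i. i < n \<and> mem s i = 1}"

definition solves_within :: "nat \<Rightarrow> program \<Rightarrow> nat \<Rightarrow> item list \<Rightarrow> real \<Rightarrow> bool" where
  "solves_within W P t items B \<longleftrightarrow>
     (\<exists>T. real T \<le> B \<and>
        (let s = (step W P ^^ T) (init_config (input_words t items))
         in halted P s \<and> (\<forall>i<length items. mem s i \<in> {0, 1}) \<and>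
            knapsack_solution t items (output_set (length items) s)))"

text \<open>
  Solvability in time \<open>O(f n w\<^sub>m\<^sub>a\<^sub>x)\<close> on the word-RAM with \<open>\<Theta>(log n)\<close>-bit words. Input integers that
  fit in a word of \<open>\<Theta>(log n)\<close> bits are those bounded by some \<open>(n + 1) ^ c\<close>, with \<open>c\<close> an arbitrary
  constant. As usual, the constant hidden in the word length has to be large enough in terms of
  \<open>c\<close>: words of exactly the length of the input integers cannot even address an input of
  \<open>2 * n + 2\<close> words when \<open>n\<close> is close to \<open>2 ^ W\<close>. The condition \<open>c < a\<close> guarantees that every input
  integer fits in a single word. One program serves all \<open>c\<close> and all word lengths; only the factor
  \<open>C\<close> hidden in the time bound may depend on the constants \<open>c\<close>, \<open>a\<close>, \<open>b\<close> of the model. Logarithms are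
  taken of \<open>n + 1\<close> so that they do not vanish for \<open>n = 1\<close>.
\<close>

definition knapsack_solvable_in_O :: "(nat \<Rightarrow> nat \<Rightarrow> real) \<Rightarrow> bool" where
  "knapsack_solvable_in_O f \<longleftrightarrow>
     (\<exists>P. \<forall>c::nat. \<exists>a>c. \<forall>b::nat. \<exists>C::real. \<forall>W t items.
        knapsack_instance t items \<longrightarrow>
        (\<forall>x \<in> set (input_words t items). x \<le> (length items + 1) ^ c) \<longrightarrow>
        real a * log 2 (real (length items + 1)) \<le> real W \<longrightarrow>
        real W \<le> real b * log 2 (real (length items + 1)) \<longrightarrow>
        solves_within W P t items (C * f (length items) (w_max items)))"

end

theory Submission
  imports Defs
begin

text \<open>
  Sort the items by density and let \<open>b\<close> be the first one that does not fit when they are packed greedily. Every solution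
  differs from the greedy prefix by a set \<open>D\<close> of removals (items before \<open>b\<close>) and insertions (items from \<open>b\<close> on); up to the linear
  term \<open>p\<^sub>b / w\<^sub>b\<close> times the change of weight, an item of \<open>D\<close> costs a penalty that grows with its distance from \<open>b\<close>. Choose
  \<open>D\<close> with least penalty for its change of weight, then with least total distance, and write \<open>W\<close> for the maximal weight.

  \<^item> No nonempty part of \<open>D\<close> has weight change 0, so \<open>|D| \<le> 2 W\<close>, and \<open>D\<close> takes an initial segment of every class of
    equal sign and weight.
  \<^item> \<open>D\<close> has only \<open>O(sqrt W log\<^sup>2 W)\<close> classes: many distinct weights of one sign have many popular pairwise sums, and
    an addition theorem of Scherk modulo the largest of them yields a part of \<open>D\<close> whose removals and insertions balance.
  \<^item> Scherk's theorem also bounds how deep \<open>D\<close> can reach into expensive classes, which leaves \<open>O(W log\<^sup>2 W)\<close> candidate items.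
  \<^item> If the candidates are processed by bit-reversed rank, every class contributes to a prefix sum of \<open>D\<close> proportionally to
    the time up to an error \<open>O(W log W)\<close>. Hence all prefix sums are \<open>O(W\<^sup>1\<^sup>.\<^sup>5 log\<^sup>3 W)\<close>, and a dynamic program over a
    window of that width finds \<open>D\<close>.

  With \<open>min n (W log\<^sup>2 W)\<close> candidates, one program meets both time bounds. It is written in a small while language
  with a clock, verified by weakest preconditions, and compiled to the word-RAM.
\<close>

text \<open>Removals and insertions of equal total weight can be undone together, so the question is
  how many distinct weights force such a balance. Scherk's theorem answers it modulo
  \<open>m\<close>: each further set of residues enlarges the set of reachable subsums by its own
  size, so about \<open>m\<close> divided by that size many sets lead to 0. Penalties alone yield no
  contradiction, as exchanges between items of equal density leave them unchanged; the distance
  makes such exchanges strict improvements.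

  Sums of \<open>D\<close> may have order \<open>W * W\<close>, and few classes alone do not help,
  since a class may hold many items. What helps is the order: bit reversal is van der Corput's
  low-discrepancy sequence, a deterministic substitute for a random order, and costs one logarithm.
  The other two logarithms of the window come from the dyadic ranges of weights and from the
  threshold of popularity. Candidates carry one logarithm for the dyadic ranges and one for a
  harmonic sum over ranks. Hence \<open>log W\<close> to the fifth in the first bound; all work
  outside the table is linear in \<open>n\<close> and \<open>W\<close>.\<close>

section \<open>Zero sums and popular sums\<close>

text \<open>Scherk's theorem in the integers modulo \<open>m\<close>. The induction on \<open>B\<close> uses Dyson's e-transform, which replaces \<open>A, B\<close> by
  \<open>A \<union> (e + B)\<close> and \<open>B \<inter> (A - e)\<close>.\<close>

lemma scherk_mod:
  fixes m :: int
  assumes m: "m > 0" and "finite B" "A \<subseteq> {0..<m}" "B \<subseteq> {0..<m}" "0 \<in> A" "0 \<in> B"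
    and "\<And>a b. a \<in> A \<Longrightarrow> b \<in> B \<Longrightarrow> (a + b) mod m = 0 \<Longrightarrow> a = 0 \<and> b = 0"
  shows "card A + card B \<le> card ((\<lambda>(a, b). (a + b) mod m) ` (A \<times> B)) + 1"
  using assms(2-)
proof (induction "card B" arbitrary: A B rule: less_induct)
  case less
  let ?S = "\<lambda>A B. (\<lambda>(a, b). (a + b) mod m) ` (A \<times> B)"
  have finA: "finite A" using less.prems(2) finite_subset by blast
  have finS: "finite (?S A B)" using finA less.prems(1) by simp
  show ?case
  proof (cases "B = {0}")
    case True
    have "A \<subseteq> ?S A B"
    proof
      fix a assume "a \<in> A"
      then have "a = (a + 0) mod m" using less.prems(2) by auto
      then show "a \<in> ?S A B" using \<open>a \<in> A\<close> less.prems(5) by force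
    qed
    then have "card A \<le> card (?S A B)" using finS card_mono by blast
    then show ?thesis using True by simp
  next
    case False
    then obtain y where y: "y \<in> B" "y \<noteq> 0" using less.prems(5) by blast
    have inj: "inj_on (\<lambda>x. (c + x) mod m) {0..<m}" for c
    proof (rule inj_onI)
      fix u v assume uv: "u \<in> {0..<m}" "v \<in> {0..<m}" "(c + u) mod m = (c + v) mod m"
      then have "m dvd (c + u) - (c + v)" using mod_eq_dvd_iff by blast
      then have "u mod m = v mod m" by (simp add: mod_eq_dvd_iff)
      then show "u = v" using uv by simp
    qed
    \<comment> \<open>If translation by \<open>y\<close> mapped \<open>A\<close> into itself it
      would permute \<open>A\<close> and hit 0, against the uniqueness of the zero sum. The
      \<open>a\<close> found here is the shift of the transform; it expels \<open>y\<close> from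
      \<open>B\<close>, so the induction descends.\<close>
    have "\<exists>a\<in>A. (a + y) mod m \<notin> A"
    proof (rule ccontr)
      assume "\<not> ?thesis"
      then have sub: "(\<lambda>a. (y + a) mod m) ` A \<subseteq> A" by (auto simp: add.commute)
      have "inj_on (\<lambda>a. (y + a) mod m) A" using inj less.prems(2) inj_on_subset by blast
      then have "(\<lambda>a. (y + a) mod m) ` A = A" using sub finA endo_inj_surj by blast
      then obtain a where "a \<in> A" "(y + a) mod m = 0" using less.prems(4) by (metis (no_types, lifting) imageE)
      then show False using less.prems(6)[of a y] y by (simp add: add.commute)
    qed
    then obtain a where a: "a \<in> A" "(a + y) mod m \<notin> A" by blast
    define g where "g x = (a + x) mod m" for x
    define B1 where "B1 = {x \<in> B. g x \<in> A}"
    define A1 where "A1 = A \<union> g ` B"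
    have ginj: "inj_on g B" unfolding g_def using inj less.prems(3) inj_on_subset by blast
    have B1: "B1 \<subseteq> B" "y \<notin> B1" using a by (auto simp: B1_def g_def)
    have finB1: "finite B1" using B1 less.prems(1) finite_subset by blast
    have lt: "card B1 < card B" using B1 y less.prems(1) by (metis psubsetI psubset_card_mono)
    have A1eq: "A1 = A \<union> g ` (B - B1)" by (auto simp: A1_def B1_def)
    have "A \<inter> g ` (B - B1) = {}" by (auto simp: B1_def)
    then have "card A1 = card A + card (g ` (B - B1))"
      unfolding A1eq using finA less.prems(1) by (simp add: card_Un_disjoint)
    also have "card (g ` (B - B1)) = card (B - B1)" by (rule card_image) (meson Diff_subset ginj inj_on_subset)
    also have "card (B - B1) = card B - card B1" using B1 finB1 by (simp add: card_Diff_subset)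
    finally have cards: "card A1 + card B1 = card A + card B" using lt by simp
    have "a \<ge> 0" "a < m" using a less.prems(2) by auto
    then have 0: "0 \<in> B1" using a less.prems(5) by (simp add: B1_def g_def)
    have uniq: "z = 0 \<and> x = 0" if z: "z \<in> A1" and x: "x \<in> B1" and s: "(z + x) mod m = 0" for z x
    proof (cases "z \<in> A")
      case True
      moreover have "x \<in> B" using x by (simp add: B1_def)
      ultimately show ?thesis using less.prems(6)[of z x] s by simp
    next
      case False
      then obtain v where v: "v \<in> B" "z = g v" using z by (auto simp: A1_def)
      \<comment> \<open>A zero sum that uses a new element \<open>g v\<close> becomes one of the old
        sets when \<open>x\<close> and \<open>v\<close> trade places, as \<open>g x\<close> lies in
        \<open>A\<close>.\<close>
      have "(g x + v) mod m = (g v + x) mod m" by (simp add: g_def mod_simps algebra_simps)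
      then have "(g x + v) mod m = 0" using s v by simp
      then have gx: "g x = 0" "v = 0" using less.prems(6) x v by (auto simp: B1_def)
      then have "a = 0 \<and> x = 0" using less.prems(6)[of a x] a x B1 by (auto simp: g_def)
      then show ?thesis using v gx by (simp add: g_def)
    qed
    have "card A1 + card B1 \<le> card (?S A1 B1) + 1"
    proof (rule less.hyps[OF lt finB1 _ _ _ 0 uniq])
      show "A1 \<subseteq> {0..<m}" using less.prems(2) m by (auto simp: A1_def g_def)
      show "B1 \<subseteq> {0..<m}" using B1 less.prems(3) by blast
      show "0 \<in> A1" using less.prems(4) by (simp add: A1_def)
    qed
    also have "?S A1 B1 \<subseteq> ?S A B"
    proof
      fix u assume "u \<in> ?S A1 B1"
      then obtain z x where zx: "z \<in> A1" "x \<in> B1" "u = (z + x) mod m" by auto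
      show "u \<in> ?S A B"
      proof (cases "z \<in> A")
        case True
        moreover have "x \<in> B" using zx by (simp add: B1_def)
        ultimately show ?thesis using zx by force
      next
        case False
        then obtain v where v: "v \<in> B" "z = g v" using zx by (auto simp: A1_def)
        have "u = (g x + v) mod m" using zx v by (simp add: g_def mod_simps algebra_simps)
        moreover have "g x \<in> A" using zx by (simp add: B1_def)
        ultimately show ?thesis using v by force
      qed
    qed
    then have "card (?S A1 B1) + 1 \<le> card (?S A B) + 1" using finS card_mono by (metis add_le_mono1)
    finally show ?thesis using cards by simp
  qed
qed

text \<open>In the absence of such a subsum, every \<open>V j\<close> can be adjoined to the
  residues of the subsums so far under the uniqueness hypothesis of Scherk's theorem, so these
  residues grow by the number of residues of \<open>V j\<close>. Together with the residue 0 of the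
  empty sum they would number more than \<open>m\<close>. Only one element is taken from each
  \<open>V j\<close>, but the sets \<open>V j\<close> may coincide.\<close>

lemma zero_subsum_mod:
  fixes m :: int and V :: "nat \<Rightarrow> int set"
  assumes m: "m > 0" and big: "nat m \<le> (\<Sum>j<J. card ((\<lambda>x. x mod m) ` V j))"
  shows "\<exists>I v. I \<subseteq> {..<J} \<and> I \<noteq> {} \<and> (\<forall>j\<in>I. v j \<in> V j) \<and> m dvd (\<Sum>j\<in>I. v j)"
proof (rule ccontr)
  assume no: "\<not> ?thesis"
  then have no': "\<not> m dvd (\<Sum>j\<in>I. v j)" if "I \<subseteq> {..<J}" "I \<noteq> {}" "\<And>j. j \<in> I \<Longrightarrow> v j \<in> V j" for I v
    using that by blast
  define S where "S j = {(\<Sum>i\<in>I. v i) mod m | I v. I \<subseteq> {..<j} \<and> (\<forall>i\<in>I. v i \<in> V i)}" for j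
  have S_ran: "S j \<subseteq> {0..<m}" for j using m by (auto simp: S_def)
  then have finS: "finite (S j)" for j using finite_subset by blast
  have "1 + (\<Sum>i<j. card ((\<lambda>x. x mod m) ` V i)) \<le> card (S j)" if "j \<le> J" for j
    using that
  proof (induction j)
    case 0
    have "S 0 = {0}" by (auto simp: S_def)
    then show ?case by simp
  next
    case (Suc j)
    let ?V = "(\<lambda>x. x mod m) ` V j"
    have V_ran: "insert 0 ?V \<subseteq> {0..<m}" using m by auto
    have finV: "finite (insert 0 ?V)" by (rule finite_subset[OF V_ran]) simp
    \<comment> \<open>Since 0 is not a residue of \<open>V j\<close>, inserting it adds one element,
      which makes up for the \<open>+ 1\<close> of Scherk's bound.\<close>
    have nz: "0 \<notin> ?V"
    proof
      assume "0 \<in> ?V"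
      then obtain x where "x \<in> V j" "m dvd x" by (auto simp: dvd_eq_mod_eq_0)
      then show False using no'[of "{j}" "\<lambda>_. x"] Suc.prems by simp
    qed
    have S0: "0 \<in> S j" unfolding S_def by (rule CollectI, rule exI[of _ "{}"]) simp
    have join: "(s + x mod m) mod m \<in> S (Suc j) \<and> ((s + x mod m) mod m \<noteq> 0)" if s: "s \<in> S j" and x: "x \<in> V j" for s x
    proof -
      obtain I v where I: "I \<subseteq> {..<j}" "\<forall>i\<in>I. v i \<in> V i" "s = (\<Sum>i\<in>I. v i) mod m" using s by (auto simp: S_def)
      define I' where "I' = insert j I"
      define v' where "v' = v(j := x)"
      have fin: "finite I" "j \<notin> I" using I finite_subset by auto
      have "(\<Sum>i\<in>I'. v' i) = x + (\<Sum>i\<in>I. v i)"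
        unfolding I'_def v'_def using fin by (simp add: sum.insert) (rule sum.cong, auto)
      then have e: "(s + x mod m) mod m = (\<Sum>i\<in>I'. v' i) mod m" using I by (simp add: mod_simps algebra_simps)
      have I': "I' \<subseteq> {..<Suc j}" "\<forall>i\<in>I'. v' i \<in> V i" "I' \<noteq> {}" using I x fin by (auto simp: I'_def v'_def)
      have "(\<Sum>i\<in>I'. v' i) mod m \<in> S (Suc j)" unfolding S_def using I' by blast
      moreover have "\<not> m dvd (\<Sum>i\<in>I'. v' i)"
      proof
        assume d: "m dvd (\<Sum>i\<in>I'. v' i)"
        have "I' \<subseteq> {..<J}" using I' Suc.prems by auto
        then show False using no'[of I' v'] d I' by blast
      qed
      ultimately show ?thesis using e by (simp add: dvd_eq_mod_eq_0)
    qed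
    have "card (S j) + card (insert 0 ?V) \<le> card ((\<lambda>(a, b). (a + b) mod m) ` (S j \<times> insert 0 ?V)) + 1"
    proof (rule scherk_mod[OF m finV S_ran V_ran S0])
      show "0 \<in> insert 0 ?V" by simp
      fix a b assume ab: "a \<in> S j" "b \<in> insert 0 ?V" "(a + b) mod m = 0"
      then have "b = 0" using join by force
      moreover have "a mod m = a" using ab(1) S_ran[of j] by auto
      ultimately show "a = 0 \<and> b = 0" using ab(3) by simp
    qed
    moreover have "(\<lambda>(a, b). (a + b) mod m) ` (S j \<times> insert 0 ?V) \<subseteq> S (Suc j)"
    proof safe
      fix a b x assume a: "a \<in> S j" "x \<in> V j"
      show "(a + x mod m) mod m \<in> S (Suc j)" using join a by blast
    next
      fix a assume "a \<in> S j"
      then obtain I v where "a = (\<Sum>i\<in>I. v i) mod m" "I \<subseteq> {..<j}" "\<forall>i\<in>I. v i \<in> V i" unfolding S_def by blast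
      moreover then have "I \<subseteq> {..<Suc j}" by auto
      ultimately have "a \<in> S (Suc j)" unfolding S_def by blast
      moreover have "a mod m = a" using \<open>a \<in> S j\<close> S_ran[of j] by auto
      ultimately show "(a + 0) mod m \<in> S (Suc j)" by simp
    qed
    then have "card ((\<lambda>(a, b). (a + b) mod m) ` (S j \<times> insert 0 ?V)) \<le> card (S (Suc j))"
      by (rule card_mono[OF finS])
    ultimately have "card (S j) + card (insert 0 ?V) \<le> card (S (Suc j)) + 1" by linarith
    then show ?case using Suc nz finV by simp
  qed
  from this[of J] have "nat m < card (S J)" using big by simp
  moreover have "card (S J) \<le> card {0..<m}" using S_ran card_mono by blast
  ultimately show False by simp
qed

section \<open>Blocks of bounded weight, popular sums, and common subset sums of two sets\<close>

lemma block_with_sum: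
  fixes wt :: "'a \<Rightarrow> nat"
  assumes "finite R" "\<And>x. x \<in> R \<Longrightarrow> wt x \<le> W" "b \<le> sum wt R" "0 < b"
  shows "\<exists>Y\<subseteq>R. b \<le> sum wt Y \<and> sum wt Y < b + W"
  using assms
proof (induction R rule: finite_induct)
  case empty then show ?case by simp
next
  case (insert x R)
  show ?case
  proof (cases "b \<le> sum wt R")
    case True then show ?thesis using insert by (metis insertCI order_trans subset_insertI)
  next
    case False
    then have "sum wt (insert x R) < b + W" using insert.hyps insert.prems(1)[of x] by simp
    then show ?thesis using insert.prems by blast
  qed
qed

text \<open>Blocks are cut off one after another; each uses less than \<open>b + W\<close>, so the
  hypothesis on the total pays for \<open>J\<close> of them.\<close>

lemma disjoint_blocks:
  fixes wt :: "'a \<Rightarrow> nat"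
  assumes "finite R" "\<And>x. x \<in> R \<Longrightarrow> wt x \<le> W" "J * (b + W) \<le> sum wt R" "0 < b"
  shows "\<exists>Y. (\<forall>j<J. Y j \<subseteq> R \<and> b \<le> sum wt (Y j) \<and> sum wt (Y j) < b + W) \<and>
     (\<forall>i<J. \<forall>j<J. i \<noteq> j \<longrightarrow> Y i \<inter> Y j = {})"
  using assms
proof (induction J arbitrary: R)
  case 0 then show ?case by simp
next
  case (Suc J)
  then obtain Z where Z: "Z \<subseteq> R" "b \<le> sum wt Z" "sum wt Z < b + W" using block_with_sum[of R wt W b] by auto
  have "sum wt (R - Z) = sum wt R - sum wt Z" using Suc.prems(1) Z by (simp add: sum_diff_nat finite_subset)
  then have "J * (b + W) \<le> sum wt (R - Z)" using Suc.prems(3) Z by simp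
  then obtain Y where Y: "\<forall>j<J. Y j \<subseteq> R - Z \<and> b \<le> sum wt (Y j) \<and> sum wt (Y j) < b + W"
     "\<forall>i<J. \<forall>j<J. i \<noteq> j \<longrightarrow> Y i \<inter> Y j = {}" using Suc.IH[of "R - Z"] Suc.prems by auto
  define Y' where "Y' = Y(J := Z)"
  have "\<forall>j<Suc J. Y' j \<subseteq> R \<and> b \<le> sum wt (Y' j) \<and> sum wt (Y' j) < b + W"
    using Y Z by (auto simp: Y'_def less_Suc_eq)
  moreover have "\<forall>i<Suc J. \<forall>j<Suc J. i \<noteq> j \<longrightarrow> Y' i \<inter> Y' j = {}"
    using Y by (auto simp: Y'_def less_Suc_eq)
  ultimately show ?case by blast
qed

definition pairs_with_sum :: "nat set \<Rightarrow> nat \<Rightarrow> (nat \<times> nat) set" where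
  "pairs_with_sum A n = {(x, y). x \<in> A \<and> y \<in> A \<and> x < y \<and> x + y = n}"

lemma finite_pairs_with_sum: "finite A \<Longrightarrow> finite (pairs_with_sum A n)"
  by (rule finite_subset[of _ "A \<times> A"]) (auto simp: pairs_with_sum_def)

text \<open>Pairs are chosen one sum after another. An element already used lies in at most one pair
  with a given sum, so the elements used so far, fewer than \<open>2 * length ns\<close>, cannot
  block all representations of the next sum.\<close>

lemma subset_from_popular_sums:
  assumes A: "finite A" and "\<And>n. n \<in> set ns \<Longrightarrow> 2 * length ns \<le> card (pairs_with_sum A n)"
  shows "\<exists>X\<subseteq>A. sum id X = sum_list ns \<and> card X = 2 * length ns"
  using assms(2)
proof (induction ns)
  case Nil then show ?case by (intro exI[of _ "{}"]) auto
next
  case (Cons n ns)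
  have "\<exists>X\<subseteq>A. sum id X = sum_list ns \<and> card X = 2 * length ns"
    by (rule Cons.IH) (use Cons.prems in force)
  then obtain X where X: "X \<subseteq> A" "sum id X = sum_list ns" "card X = 2 * length ns" by blast
  have finX: "finite X" using X A finite_subset by blast
  let ?P = "pairs_with_sum A n"
  let ?bad = "{q \<in> ?P. fst q \<in> X \<or> snd q \<in> X}"
  let ?f = "\<lambda>q. if fst q \<in> X then fst q else snd q"
  have "inj_on ?f ?bad"
    by (rule inj_onI) (auto simp: pairs_with_sum_def split: if_splits)
  moreover have "?f ` ?bad \<subseteq> X" by auto
  ultimately have "card ?bad \<le> card X" using finX card_inj_on_le by blast
  also have "\<dots> < card ?P" using X Cons.prems[of n] by simp
  finally have "?bad \<noteq> ?P" by auto
  then obtain q where "q \<in> ?P" "q \<notin> ?bad" by blast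
  then obtain x y where xy: "(x, y) \<in> ?P" "x \<notin> X" "y \<notin> X" by (cases q) auto
  then have "x \<in> A" "y \<in> A" "x \<noteq> y" "x + y = n" by (auto simp: pairs_with_sum_def)
  then show ?case using X xy finX by (intro exI[of _ "insert x (insert y X)"]) auto
qed

text \<open>Trades a representation count for the dyadic thresholds it reaches, so that
  \<open>popular_sums\<close> can choose the best of \<open>l + 1\<close> thresholds by
  pigeonhole.\<close>

lemma card_le_dyadic_sum: "(r::nat) < 2 ^ Suc m \<Longrightarrow> r \<le> (\<Sum>i\<in>{i. i \<le> m \<and> 2 ^ i \<le> r}. 2 ^ i)"
proof (induction m arbitrary: r)
  case 0
  then consider "r = 0" | "r = 1" by force
  then show ?case
  proof cases
    case 2
    have "{i. i \<le> 0 \<and> (2::nat) ^ i \<le> 1} = {0}" by auto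
    then show ?thesis unfolding 2 by simp
  qed simp
next
  case (Suc m)
  show ?case
  proof (cases "r < 2 ^ Suc m")
    case True
    then have "{i. i \<le> Suc m \<and> 2 ^ i \<le> r} = {i. i \<le> m \<and> 2 ^ i \<le> r}"
      by (auto simp: le_Suc_eq)
    then show ?thesis using Suc.IH[OF True] by simp
  next
    case False
    have "{i. i \<le> Suc m \<and> 2 ^ i \<le> r} = {..Suc m}"
    proof safe
      fix i assume "i \<le> Suc m"
      then have "(2::nat) ^ i \<le> 2 ^ Suc m" by (intro power_increasing) auto
      then show "2 ^ i \<le> r" using False by simp
    qed
    moreover have "(\<Sum>i\<le>Suc m. (2::nat) ^ i) = 2 ^ Suc (Suc m) - 1"
      using sum_power2[of "Suc (Suc m)"] by (simp only: atLeast0LessThan lessThan_Suc_atMost)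
    ultimately show ?thesis using Suc.prems by simp
  qed
qed

lemma double_card_pairs:
  fixes A :: "nat set" assumes "finite A"
  shows "2 * card {(x, y). x \<in> A \<and> y \<in> A \<and> x < y} = card A * (card A - 1)"
proof -
  let ?L = "{(x, y). x \<in> A \<and> y \<in> A \<and> x < y}" and ?U = "{(x, y). x \<in> A \<and> y \<in> A \<and> y < x}"
  let ?D = "(\<lambda>x. (x, x)) ` A"
  have fin: "finite ?L" "finite ?U" by (rule finite_subset[of _ "A \<times> A"]; use assms in auto)+
  have U: "?U = (\<lambda>(x, y). (y, x)) ` ?L" by auto
  have "card ?U = card ?L" unfolding U by (rule card_image) (auto simp: inj_on_def)
  moreover have "card ?D = card A" by (rule card_image) (auto simp: inj_on_def)
  moreover have "A \<times> A = (?L \<union> ?U) \<union> ?D" by auto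
  then have "card (A \<times> A) = card (?L \<union> ?U) + card ?D"
    using fin assms by (simp only:) (rule card_Un_disjoint, auto)
  moreover have "card (?L \<union> ?U) = card ?L + card ?U" by (rule card_Un_disjoint) (use fin in auto)
  ultimately have "card A * card A = 2 * card ?L + card A" using assms by (simp add: card_cartesian_product)
  then show ?thesis by (simp add: diff_mult_distrib2)
qed

lemma card_pairs_with_sum_le: assumes "finite A" shows "2 * card (pairs_with_sum A n) \<le> card A"
proof -
  let ?P = "pairs_with_sum A n"
  have fin: "finite ?P" by (rule finite_pairs_with_sum[OF assms])
  have "card (fst ` ?P \<union> snd ` ?P) = card (fst ` ?P) + card (snd ` ?P)"
    by (rule card_Un_disjoint) (use fin in \<open>auto simp: pairs_with_sum_def\<close>)
  moreover have "card (fst ` ?P) = card ?P" "card (snd ` ?P) = card ?P"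
    by (rule card_image, auto simp: inj_on_def pairs_with_sum_def)+
  moreover have "card (fst ` ?P \<union> snd ` ?P) \<le> card A"
    by (rule card_mono) (use assms in \<open>auto simp: pairs_with_sum_def\<close>)
  ultimately show ?thesis by simp
qed

text \<open>All pairs from \<open>A\<close> are distributed over the sums below
  \<open>4 * G\<close>. Splitting the counts into dyadic thresholds leaves one threshold
  \<open>R\<close> that accounts for an average share of the pairs. Only the product
  \<open>R * card B\<close> is controlled: few sums with many representations and many sums with few
  are equally useful for \<open>common_subset_sum\<close>.\<close>

lemma popular_sums:
  fixes A :: "nat set"
  assumes "finite A" "card A < 2 ^ Suc l" "A \<subseteq> {G..<2 * G}"
  shows "\<exists>R B. 0 < R \<and> (\<forall>n\<in>B. R \<le> card (pairs_with_sum A n)) \<and> B \<subseteq> {2 * G..<4 * G} \<and>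
     card A * (card A - 1) \<le> 2 * (l + 1) * (R * card B)"
proof -
  define r where "r n = card (pairs_with_sum A n)" for n
  let ?N = "{2 * G..<4 * G}"
  define B where "B i = {n \<in> ?N. 2 ^ i \<le> r n}" for i
  have r_le: "r n \<le> card A" for n using card_pairs_with_sum_le[OF assms(1), of n] by (simp add: r_def)
  have UN: "{(x, y). x \<in> A \<and> y \<in> A \<and> x < y} = (\<Union>n\<in>?N. pairs_with_sum A n)"
  proof safe
    fix x y assume "x \<in> A" "y \<in> A" "x < y"
    moreover then have "x + y \<in> ?N" using assms(3) by force
    ultimately show "(x, y) \<in> (\<Union>n\<in>?N. pairs_with_sum A n)" unfolding pairs_with_sum_def by blast
  qed (auto simp: pairs_with_sum_def)
  have "card {(x, y). x \<in> A \<and> y \<in> A \<and> x < y} = (\<Sum>n\<in>?N. r n)"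
    unfolding UN r_def by (rule card_UN_disjoint) (auto simp: finite_pairs_with_sum assms, auto simp: pairs_with_sum_def)
  also have "\<dots> \<le> (\<Sum>n\<in>?N. \<Sum>i\<in>{i. i \<le> l \<and> 2 ^ i \<le> r n}. 2 ^ i)"
    by (rule sum_mono, rule card_le_dyadic_sum) (use r_le assms(2) in \<open>meson le_less_trans\<close>)
  also have "\<dots> = (\<Sum>n\<in>?N. \<Sum>i\<in>{..l}. if 2 ^ i \<le> r n then 2 ^ i else 0)"
    by (rule sum.cong[OF refl], rule sum.mono_neutral_cong_left) auto
  also have "\<dots> = (\<Sum>i\<in>{..l}. \<Sum>n\<in>?N. if 2 ^ i \<le> r n then 2 ^ i else 0)" by (rule sum.swap)
  also have "\<dots> = (\<Sum>i\<in>{..l}. 2 ^ i * card (B i))"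
  proof (rule sum.cong[OF refl])
    fix i
    have "(\<Sum>n\<in>?N. if 2 ^ i \<le> r n then 2 ^ i else 0) = (\<Sum>n\<in>B i. (2::nat) ^ i)"
      unfolding B_def by (rule sum.mono_neutral_cong_right) auto
    then show "(\<Sum>n\<in>?N. if 2 ^ i \<le> r n then 2 ^ i else 0) = 2 ^ i * card (B i)" by simp
  qed
  finally have le: "card {(x, y). x \<in> A \<and> y \<in> A \<and> x < y} \<le> (\<Sum>i\<in>{..l}. 2 ^ i * card (B i))" .
  define M where "M = Max ((\<lambda>i. 2 ^ i * card (B i)) ` {..l})"
  have "M \<in> (\<lambda>i. 2 ^ i * card (B i)) ` {..l}" unfolding M_def by (rule Max_in) auto
  then obtain i where i: "M = 2 ^ i * card (B i)" by blast
  have "(\<Sum>i\<in>{..l}. 2 ^ i * card (B i)) \<le> (\<Sum>i\<in>{..l}. M)"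
    by (rule sum_mono) (simp add: M_def)
  also have "\<dots> = (l + 1) * M" by simp
  finally have "card A * (card A - 1) \<le> 2 * (l + 1) * (2 ^ i * card (B i))"
    using le i double_card_pairs[OF assms(1)] by (simp add: algebra_simps)
  then show ?thesis by (intro exI[of _ "2 ^ i"] exI[of _ "B i"]) (auto simp: B_def r_def)
qed

text \<open>\<open>R\<close> is cut into blocks of weight between \<open>b\<close> and
  \<open>b + W\<close>, where \<open>b\<close> is the largest popular sum. By
  \<open>zero_subsum_mod\<close>, one can subtract a popular sum from each of some of the blocks so
  that a multiple of \<open>b\<close> remains. As \<open>b\<close> is popular too, the total weight
  of these blocks is a sum of few popular sums, and \<open>subset_from_popular_sums\<close> realises
  it inside \<open>A\<close>.\<close>

lemma common_subset_sum:
  fixes A :: "nat set" and wt :: "'a \<Rightarrow> nat"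
  assumes A: "finite A" "A \<subseteq> {G..<2 * G}" and k: "card A = k" "k < 2 ^ Suc l"
    and R: "finite R" "\<And>x. x \<in> R \<Longrightarrow> wt x \<le> W" and GW: "G \<le> W"
    and tot: "k * G \<le> sum wt R + W" and dense: "60 * W * (l + 1) \<le> k * (k - 1)" and W0: "0 < W"
  shows "\<exists>X Y. X \<subseteq> A \<and> Y \<subseteq> R \<and> X \<noteq> {} \<and> sum id X = sum wt Y"
proof -
  obtain r B where r0: "0 < r" and rB: "\<forall>n\<in>B. r \<le> card (pairs_with_sum A n)" and B: "B \<subseteq> {2 * G..<4 * G}"
    and "k * (k - 1) \<le> 2 * (l + 1) * (r * card B)"
    using popular_sums[OF A(1) _ A(2), of l] k by auto
  then have "(l + 1) * (60 * W) \<le> (l + 1) * (2 * (r * card B))" using dense by (simp add: algebra_simps)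
  then have "60 * W \<le> 2 * (r * card B)" by (simp only: mult_le_cancel1)
  \<comment> \<open>The constant 30 is what the estimates below consume:
    \<open>J * card B \<le> 6 * G\<close> and \<open>b + W \<le> 5 * W\<close>. The hypothesis has
    60 because of the factor 2 in \<open>popular_sums\<close>.\<close>
  then have rBW: "30 * W \<le> r * card B" by simp
  have finB: "finite B" using B finite_subset by blast
  have Bne: "B \<noteq> {}" and cB: "0 < card B" using rBW W0 by (auto simp: card_gt_0_iff finB)
  \<comment> \<open>The maximum makes every difference of a block weight and a popular sum
    nonnegative, and it makes distinct elements of \<open>B\<close> incongruent modulo
    \<open>b\<close>.\<close>
  define b where "b = Max B"
  have bB: "b \<in> B" unfolding b_def using finB Bne by simp
  have b_le: "x \<le> b" if "x \<in> B" for x unfolding b_def using finB that by simp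
  have b_rng: "2 * G \<le> b" "b < 4 * G" using bB B by auto
  then have G0: "0 < G" and b0: "0 < b" by auto
  have "card B \<le> 2 * G" using card_mono[OF _ B] by simp
  define J where "J = (b + card B - 1) div card B"
  have JB: "b \<le> J * card B"
  proof -
    have "b + card B - 1 < J * card B + card B" unfolding J_def
      using cB by (metis add.commute div_mult_mod_eq mod_less_divisor nat_add_left_cancel_less)
    then show ?thesis by simp
  qed
  have JB6: "J * card B \<le> 6 * G"
  proof -
    have "J * card B \<le> b + card B - 1" unfolding J_def by simp
    then show ?thesis using \<open>card B \<le> 2 * G\<close> b_rng by simp
  qed
  have rk: "2 * r \<le> k" using rB bB card_pairs_with_sum_le[OF A(1), of b] k by force
  have Jtot: "J * (b + W) \<le> G * r"
  proof -
    have "J * (b + W) * card B \<le> 6 * G * (5 * W)"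
      using mult_mono[OF JB6, of "b + W" "5 * W"] b_rng GW by (simp add: algebra_simps)
    also have "\<dots> \<le> G * r * card B" using rBW by (simp add: algebra_simps)
    finally show ?thesis using cB by simp
  qed
  \<comment> \<open>\<open>A\<close> has at most \<open>G\<close> elements, so \<open>dense\<close>
    makes \<open>W\<close> small against \<open>k * G\<close>. Hence \<open>tot\<close> leaves for
    \<open>R\<close> at least half of \<open>k * G\<close>, while the blocks need at most
    \<open>G * r\<close>, and \<open>r\<close> is at most half of \<open>k\<close>.\<close>
  have "k \<le> G" using card_mono[OF _ A(2)] k by simp
  then have "k - 1 \<le> G" by simp
  then have "k * (k - 1) \<le> k * G" by (rule mult_le_mono2)
  moreover have "2 * W \<le> 60 * W * (l + 1)" by simp
  ultimately have "2 * W \<le> k * G" using dense by linarith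
  then have "2 * (k * G) \<le> 2 * sum wt R + k * G" using tot by linarith
  then have "k * G \<le> 2 * sum wt R" by linarith
  moreover have "2 * (G * r) \<le> k * G" using rk by simp
  ultimately have "J * (b + W) \<le> sum wt R" using Jtot by linarith
  from disjoint_blocks[OF R this b0] obtain Y where Y: "\<forall>j<J. Y j \<subseteq> R \<and> b \<le> sum wt (Y j) \<and> sum wt (Y j) < b + W"
     "\<forall>i<J. \<forall>j<J. i \<noteq> j \<longrightarrow> Y i \<inter> Y j = {}" by blast
  define V where "V j = (\<lambda>x. int (sum wt (Y j)) - int x) ` B" for j
  have cV: "card ((\<lambda>x. x mod int b) ` V j) = card B" for j
  proof -
    have "(\<lambda>x. x mod int b) ` V j = (\<lambda>x. (int (sum wt (Y j)) - int x) mod int b) ` B" by (auto simp: V_def)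
    moreover have "inj_on (\<lambda>x. (int (sum wt (Y j)) - int x) mod int b) B"
    proof (rule inj_onI)
      fix x y assume xy: "x \<in> B" "y \<in> B" "(int (sum wt (Y j)) - int x) mod int b = (int (sum wt (Y j)) - int y) mod int b"
      then have "int b dvd int y - int x" by (simp add: mod_eq_dvd_iff)
      moreover have "0 < x" "0 < y" using xy(1,2) B G0 by auto
      then have "\<bar>int y - int x\<bar> < int b"
        using b_le[OF xy(1)] b_le[OF xy(2)] by linarith
      ultimately have "int y - int x = 0" using dvd_imp_le_int[of "int y - int x" "int b"] by linarith
      then show "x = y" by simp
    qed
    ultimately show ?thesis by (simp add: card_image)
  qed
  have "nat (int b) \<le> (\<Sum>j<J. card ((\<lambda>x. x mod int b) ` V j))" using JB by (simp add: cV)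
  then obtain I v where I: "I \<subseteq> {..<J}" "I \<noteq> {}" "\<forall>j\<in>I. v j \<in> V j" "int b dvd (\<Sum>j\<in>I. v j)"
    using zero_subsum_mod[of "int b" V J] b0 by auto
  have finI: "finite I" using I finite_subset by blast
  have "\<forall>j\<in>I. \<exists>x\<in>B. v j = int (sum wt (Y j)) - int x" using I by (auto simp: V_def)
  then obtain \<beta> where \<beta>: "\<And>j. j \<in> I \<Longrightarrow> \<beta> j \<in> B \<and> v j = int (sum wt (Y j)) - int (\<beta> j)" by metis
  have v_nn: "0 \<le> v j \<and> v j \<le> int (b + W)" if "j \<in> I" for j
  proof -
    have "j < J" using I that by auto
    then have "b \<le> sum wt (Y j)" "sum wt (Y j) < b + W" using Y by auto
    moreover have "\<beta> j \<le> b" using b_le \<beta>[OF that] by blast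
    ultimately show ?thesis using \<beta>[OF that] by (simp del: of_nat_sum)
  qed
  obtain q where q: "(\<Sum>j\<in>I. v j) = int b * q" using I by (auto simp: dvd_def)
  have "0 \<le> (\<Sum>j\<in>I. v j)" using v_nn by (simp add: sum_nonneg)
  then have q0: "0 \<le> q" using q b0 by (simp add: zero_le_mult_iff)
  define m where "m = nat q"
  have cI: "card I \<le> J" using card_mono[OF _ I(1)] by simp
  have "(\<Sum>j\<in>I. v j) \<le> (\<Sum>j\<in>I. int (b + W))" using v_nn by (intro sum_mono) auto
  also have "\<dots> \<le> int (J * (b + W))" using cI by (simp add: mult_right_mono flip: of_nat_mult of_nat_add)
  finally have "int (b * m) \<le> int (J * (b + W))" using q q0 by (simp add: m_def)
  then have bm: "b * m \<le> J * (b + W)" by linarith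
  \<comment> \<open>The quotient \<open>m\<close> tells how often \<open>b\<close> itself has to be
    added as a popular sum.\<close>
  define ns where "ns = map \<beta> (sorted_list_of_set I) @ replicate m b"
  have len: "length ns = card I + m" by (simp add: ns_def finI)
  have "sum_list (map \<beta> (sorted_list_of_set I)) = (\<Sum>j\<in>I. \<beta> j)"
    using finI by (metis distinct_sorted_list_of_set set_sorted_list_of_set sum.distinct_set_conv_list)
  then have sumns: "sum_list ns = (\<Sum>j\<in>I. \<beta> j) + m * b" by (simp add: ns_def sum_list_replicate)
  have "int (\<Sum>j\<in>I. sum wt (Y j)) = (\<Sum>j\<in>I. v j + int (\<beta> j))"
    unfolding of_nat_sum[of _ I] by (rule sum.cong[OF refl]) (simp add: \<beta>)
  also have "\<dots> = int ((\<Sum>j\<in>I. \<beta> j) + m * b)" using q q0 by (simp add: sum.distrib m_def mult.commute)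
  finally have sums: "(\<Sum>j\<in>I. sum wt (Y j)) = sum_list ns" using sumns by linarith
  \<comment> \<open>The same 30 pays here: multiplied by \<open>2 * G\<close>, the contributions of
    \<open>card I\<close> and \<open>m\<close> together are at most
    \<open>J * (4 * G + W)\<close>.\<close>
  have lenr: "2 * length ns \<le> r"
  proof -
    have "2 * G * m \<le> 2 * G * J + J * W"
    proof (cases "J \<le> m")
      case True
      then obtain d where d: "m = J + d" using le_Suc_ex by blast
      then have "b * d \<le> J * W" using bm by (simp add: algebra_simps)
      moreover have "2 * G * d \<le> b * d" using b_rng(1) by (rule mult_le_mono1)
      ultimately have "2 * G * d \<le> J * W" by linarith
      then show ?thesis unfolding d by (simp only: distrib_left add_le_cancel_left)
    next
      case False
      then have "2 * G * m \<le> 2 * G * J" by simp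
      then show ?thesis by linarith
    qed
    moreover have "2 * G * card I \<le> 2 * G * J" using cI by simp
    moreover have "2 * G * length ns = 2 * G * card I + 2 * G * m" unfolding len by (rule distrib_left)
    moreover have "J * (4 * G + W) = 2 * G * J + 2 * G * J + J * W" by (simp add: algebra_simps)
    ultimately have 1: "2 * G * length ns \<le> J * (4 * G + W)" by linarith
    have "J * (4 * G + W) * card B \<le> 6 * G * (5 * W)"
      using mult_mono[OF JB6, of "4 * G + W" "5 * W"] GW by (simp add: algebra_simps)
    also have "\<dots> \<le> G * r * card B" using rBW by (simp add: algebra_simps)
    finally have "J * (4 * G + W) \<le> G * r" using cB by simp
    moreover have "G * (2 * length ns) = 2 * G * length ns" by simp
    ultimately have "G * (2 * length ns) \<le> G * r" using 1 by linarith
    then show ?thesis using G0 by simp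
  qed
  have "\<exists>X\<subseteq>A. sum id X = sum_list ns \<and> card X = 2 * length ns"
  proof (rule subset_from_popular_sums[OF A(1)])
    fix n assume "n \<in> set ns"
    then have "n \<in> B" using \<beta> bB finI by (auto simp: ns_def split: if_splits)
    then show "2 * length ns \<le> card (pairs_with_sum A n)" using rB lenr by force
  qed
  then obtain X where X: "X \<subseteq> A" "sum id X = sum_list ns" "card X = 2 * length ns" by blast
  have "card I > 0" using I finI by (simp add: card_gt_0_iff)
  then have "X \<noteq> {}" using X len by auto
  moreover have "sum wt (\<Union>j\<in>I. Y j) = (\<Sum>j\<in>I. sum wt (Y j))"
  proof (rule sum.UNION_disjoint[OF finI])
    show "\<forall>i\<in>I. finite (Y i)" using Y I R(1) finite_subset by (metis lessThan_iff subsetD)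
    show "\<forall>i\<in>I. \<forall>j\<in>I. i \<noteq> j \<longrightarrow> Y i \<inter> Y j = {}" using Y I by (metis lessThan_iff subsetD)
  qed
  moreover have "(\<Union>j\<in>I. Y j) \<subseteq> R" using Y I by (metis UN_least lessThan_iff subsetD)
  ultimately show ?thesis using X sums by metis
qed

section \<open>The structure of an optimal exchange\<close>

fun lg2 :: "nat \<Rightarrow> nat" where
  "lg2 v = (if v < 2 then 0 else Suc (lg2 (v div 2)))"
declare lg2.simps [simp del]

lemma lg2_bounds: "0 < v \<Longrightarrow> 2 ^ lg2 v \<le> v \<and> v < 2 ^ Suc (lg2 v)"
proof (induction v rule: lg2.induct)
  case (1 v)
  show ?case
  proof (cases "v < 2")
    case True then have "v = 1" using 1 by simp
    then show ?thesis by (simp add: lg2.simps)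
  next
    case False
    then have "2 ^ lg2 (v div 2) \<le> v div 2 \<and> v div 2 < 2 ^ Suc (lg2 (v div 2))" using 1 by simp
    moreover have "lg2 v = Suc (lg2 (v div 2))" using False by (subst lg2.simps) simp
    ultimately show ?thesis by simp linarith
  qed
qed

lemma lg2_mono: assumes "0 < v" "v \<le> w" shows "lg2 v \<le> lg2 w"
proof -
  have "(2::nat) ^ lg2 v < 2 ^ Suc (lg2 w)" using lg2_bounds[of v] lg2_bounds[of w] assms by linarith
  then show ?thesis using power_less_imp_less_exp[of "2::nat"] by (metis less_Suc_eq_le one_less_numeral_iff semiring_norm(76))
qed

text \<open>Bit reversal of \<open>H\<close>-bit numbers. Taking the items of a class in the order of the reversed ranks spreads any initial
  segment of ranks evenly over time.\<close>

fun brev :: "nat \<Rightarrow> nat \<Rightarrow> nat" where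
  "brev 0 x = 0"
| "brev (Suc H) x = (if x < 2 ^ H then 2 * brev H x else 2 * brev H (x - 2 ^ H) + 1)"

lemma brev_less: "brev H x < 2 ^ H"
proof (induction H arbitrary: x)
  case (Suc H)
  show ?case using Suc[of x] Suc[of "x - 2 ^ H"] by auto
qed simp

text \<open>For a class of which the first \<open>k\<close> ranks are used, this is the number of
  items processed before time \<open>i\<close>. An even spread would give
  \<open>k * i / 2 ^ H\<close>; \<open>bcnt_discrepancy\<close> bounds the deviation, scaled by
  \<open>2 ^ H\<close> to stay in the integers.\<close>

definition bcnt :: "nat \<Rightarrow> nat \<Rightarrow> nat \<Rightarrow> nat" where
  "bcnt H k i = card {x. x < k \<and> brev H x < i}"

text \<open>Ranks below \<open>2 ^ H\<close> have even reversals, and \<open>2 * r < i\<close> means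
  that \<open>r\<close> is below half of \<open>i\<close> rounded up, which is
  \<open>i - i div 2\<close>.\<close>

lemma bcnt_Suc_low: "k \<le> 2 ^ H \<Longrightarrow> bcnt (Suc H) k i = bcnt H k (i - i div 2)"
  unfolding bcnt_def by (rule arg_cong[of _ _ card]) auto

text \<open>The lower half is complete. In the upper half the reversals are odd, and
  \<open>2 * r + 1 < i\<close> means that \<open>r\<close> is below half of \<open>i\<close> rounded
  down.\<close>

lemma bcnt_Suc_high:
  assumes "2 ^ H \<le> k"
  shows "bcnt (Suc H) k i = bcnt H (2 ^ H) (i - i div 2) + bcnt H (k - 2 ^ H) (i div 2)"
proof -
  let ?L = "{x. x < 2 ^ H \<and> brev H x < i - i div 2}" and ?U = "{x. x < k - 2 ^ H \<and> brev H x < i div 2}"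
  have "{x. x < k \<and> brev (Suc H) x < i} = ?L \<union> (\<lambda>x. x + 2 ^ H) ` ?U"
  proof (intro set_eqI iffI)
    fix x assume x: "x \<in> {x. x < k \<and> brev (Suc H) x < i}"
    show "x \<in> ?L \<union> (\<lambda>x. x + 2 ^ H) ` ?U"
    proof (cases "x < 2 ^ H")
      case True then show ?thesis using x by auto
    next
      case False
      then have "x - 2 ^ H \<in> ?U" "x = (x - 2 ^ H) + 2 ^ H" using x by auto
      then show ?thesis by blast
    qed
  qed (use assms in \<open>auto split: if_splits\<close>)
  moreover have "card (?L \<union> (\<lambda>x. x + 2 ^ H) ` ?U) = card ?L + card ((\<lambda>x. x + 2 ^ H) ` ?U)"
    by (rule card_Un_disjoint) auto
  moreover have "card ((\<lambda>x. x + 2 ^ H) ` ?U) = card ?U" by (rule card_image) (auto simp: inj_on_def)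
  ultimately show ?thesis by (simp add: bcnt_def)
qed

text \<open>Counting form of the fact that bit reversal is a permutation; the recursion delivers it
  directly, and injectivity is derived from it in \<open>prefix_sum_bound\<close>.\<close>

lemma bcnt_full: "i \<le> 2 ^ H \<Longrightarrow> bcnt H (2 ^ H) i = i"
proof (induction H arbitrary: i)
  case 0
  then consider "i = 0" | "i = 1" by fastforce
  then show ?case
  proof cases
    case 2
    have "{x::nat. x < 1 \<and> (0::nat) < 1} = {0}" by auto
    then show ?thesis unfolding 2 bcnt_def by simp
  qed (simp add: bcnt_def)
next
  case (Suc H)
  have "i - i div 2 \<le> 2 ^ H" "i div 2 \<le> 2 ^ H" using Suc.prems by auto
  then show ?case using bcnt_Suc_high[of H "2 ^ Suc H" i] Suc.IH by (simp add: mult_2)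
qed

lemma abs_double_add_le:
  fixes h :: int
  assumes "e = 2 * x + y" "\<bar>x\<bar> \<le> h" "0 \<le> y" "y \<le> p"
  shows "\<bar>e\<bar> \<le> 2 * h + p"
  using assms by linarith

text \<open>Each bit doubles the scaled error and adds at most \<open>2 ^ H\<close> for rounding
  half of \<open>i\<close> up or down. Unscaled, a bit costs at most half an item, whence a bound
  linear in \<open>H\<close>.\<close>

lemma bcnt_discrepancy:
  assumes "k \<le> 2 ^ H" "i \<le> 2 ^ H"
  shows "\<bar>2 ^ H * int (bcnt H k i) - int k * int i\<bar> \<le> int H * 2 ^ H"
  using assms
proof (induction H arbitrary: k i)
  case 0
  then have "k \<le> 1" "i \<le> 1" by auto
  then consider "k = 0" | "i = 0" | "k = 1" "i = 1" by linarith
  then show ?case using bcnt_full[of 1 0] by cases (auto simp: bcnt_def)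
next
  case (Suc H)
  define u where "u = i - i div 2"
  define d where "d = i div 2"
  have ud: "i = u + d" "d \<le> u" "u \<le> d + 1" "u \<le> 2 ^ H" "d \<le> 2 ^ H" using Suc.prems by (auto simp: u_def d_def)
  show ?case
  proof (cases "k \<le> 2 ^ H")
    case True
    have IH: "\<bar>2 ^ H * int (bcnt H k u) - int k * int u\<bar> \<le> int H * 2 ^ H" by (rule Suc.IH[OF True ud(4)])
    have e: "2 ^ Suc H * int (bcnt H k u) - int k * int i =
      2 * (2 ^ H * int (bcnt H k u) - int k * int u) + int k * (int u - int d)" using ud(1) by (simp add: algebra_simps)
    have "0 \<le> int k * (int u - int d)" using ud by simp
    moreover have "int k * (int u - int d) \<le> 2 ^ H * 1" by (rule mult_mono) (use True ud in auto)
    ultimately have "\<bar>2 ^ Suc H * int (bcnt H k u) - int k * int i\<bar> \<le> 2 * (int H * 2 ^ H) + 2 ^ H * 1"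
      by (rule abs_double_add_le[OF e IH])
    also have "\<dots> \<le> int (Suc H) * 2 ^ Suc H" by (simp add: algebra_simps)
    finally show ?thesis using bcnt_Suc_low[OF True] by (simp add: u_def)
  next
    case False
    define k' where "k' = k - 2 ^ H"
    have k': "k = 2 ^ H + k'" "k' \<le> 2 ^ H" using False Suc.prems by (auto simp: k'_def)
    have IH: "\<bar>2 ^ H * int (bcnt H k' d) - int k' * int d\<bar> \<le> int H * 2 ^ H" by (rule Suc.IH[OF k'(2) ud(5)])
    have e: "bcnt (Suc H) k i = u + bcnt H k' d"
      using bcnt_Suc_high[of H k i] False bcnt_full[OF ud(4)] by (simp add: u_def d_def k'_def)
    have e2: "2 ^ Suc H * int (bcnt (Suc H) k i) - int k * int i =
       2 * (2 ^ H * int (bcnt H k' d) - int k' * int d) + (2 ^ H - int k') * (int u - int d)"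
      unfolding e unfolding k'(1) ud(1) by (simp add: algebra_simps)
    have "0 \<le> (2 ^ H - int k') * (int u - int d)" using ud k' by simp
    moreover have "(2 ^ H - int k') * (int u - int d) \<le> 2 ^ H * 1" by (rule mult_mono) (use k' ud in auto)
    ultimately have "\<bar>2 ^ Suc H * int (bcnt (Suc H) k i) - int k * int i\<bar> \<le> 2 * (int H * 2 ^ H) + 2 ^ H * 1"
      by (rule abs_double_add_le[OF e2 IH])
    also have "\<dots> \<le> int (Suc H) * 2 ^ Suc H" by (simp add: algebra_simps)
    finally show ?thesis .
  qed
qed

text \<open>Elements can be removed so that the remaining sum never leaves
  \<open>{- int W..<int W}\<close>: a positive one while the sum is positive, a negative one
  otherwise. Two equal intermediate sums would differ by a zero-sum subset, so all are distinct and
  fit into \<open>2 * W\<close> values.\<close>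

lemma zero_sum_free_card:
  fixes val :: "'a \<Rightarrow> int"
  assumes "finite D" "\<And>k. k \<in> D \<Longrightarrow> \<bar>val k\<bar> \<le> int W" "\<And>U. U \<subseteq> D \<Longrightarrow> U \<noteq> {} \<Longrightarrow> sum val U \<noteq> 0"
    and "- int W \<le> sum val D" "sum val D < int W"
  shows "card D \<le> 2 * W"
proof -
  have "\<exists>T. T \<subseteq> {- int W..<int W} \<and> card T = card D \<and> (\<forall>x\<in>T. \<exists>U\<subseteq>D. U \<noteq> {} \<and> sum val U = x)"
    using assms
  proof (induction "card D" arbitrary: D)
    case 0 then show ?case by (intro exI[of _ "{}"]) auto
  next
    case (Suc m)
    have ne: "D \<noteq> {}" using Suc by auto
    have "\<exists>k\<in>D. - int W \<le> sum val D - val k \<and> sum val D - val k < int W"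
    proof (cases "sum val D > 0")
      case True
      then obtain k where "k \<in> D" "val k > 0" using sum_nonpos[of D val] by force
      then show ?thesis using Suc.prems(2)[of k] True Suc.prems(5) by (intro bexI[of _ k]) auto
    next
      case False
      then have neg: "sum val D < 0" using Suc.prems(3)[of D] ne by force
      then obtain k where "k \<in> D" "val k < 0" using sum_nonneg[of D val] by force
      then show ?thesis using Suc.prems(2)[of k] neg Suc.prems(4) by (intro bexI[of _ k]) auto
    qed
    then obtain k where k: "k \<in> D" "- int W \<le> sum val D - val k" "sum val D - val k < int W" by blast
    have s: "sum val (D - {k}) = sum val D - val k" using k Suc.prems(1) by (simp add: sum_diff1)
    have c: "m = card (D - {k})" using Suc.hyps(2) k Suc.prems(1) by simp
    have "\<exists>T. T \<subseteq> {- int W..<int W} \<and> card T = card (D - {k}) \<and> (\<forall>x\<in>T. \<exists>U\<subseteq>D - {k}. U \<noteq> {} \<and> sum val U = x)"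
      by (rule Suc.hyps(1)[OF c]) (use Suc.prems k s in auto)
    then obtain T where T: "T \<subseteq> {- int W..<int W}" "card T = card (D - {k})"
      "\<forall>x\<in>T. \<exists>U\<subseteq>D - {k}. U \<noteq> {} \<and> sum val U = x" by blast
    have new: "sum val D \<notin> T"
    proof
      assume "sum val D \<in> T"
      then obtain U where U: "U \<subseteq> D - {k}" "sum val U = sum val D" using T by blast
      have "sum val (D - U) = 0" using U Suc.prems(1) by (subst sum_diff) auto
      moreover have "D - U \<noteq> {}" using U k by blast
      ultimately show False using Suc.prems(3)[of "D - U"] by blast
    qed
    have "finite T" using T finite_subset by blast
    then have "card (insert (sum val D) T) = card D" using new T c Suc.hyps(2) by simp
    moreover have "\<forall>x\<in>insert (sum val D) T. \<exists>U\<subseteq>D. U \<noteq> {} \<and> sum val U = x"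
    proof
      fix x assume x: "x \<in> insert (sum val D) T"
      show "\<exists>U\<subseteq>D. U \<noteq> {} \<and> sum val U = x"
      proof (cases "x = sum val D")
        case True then show ?thesis using ne by (intro exI[of _ D]) simp
      next
        case False
        then obtain U where "U \<subseteq> D - {k}" "U \<noteq> {}" "sum val U = x" using T(3) x by blast
        then show ?thesis by (intro exI[of _ U]) auto
      qed
    qed
    moreover have "insert (sum val D) T \<subseteq> {- int W..<int W}" using T Suc.prems by auto
    ultimately show ?case by blast
  qed
  then obtain T where "T \<subseteq> {- int W..<int W}" "card T = card D" by blast
  then show ?thesis using card_mono[of "{- int W..<int W}" T] by simp
qed

text \<open>Items below \<open>b\<close> can be removed, the others inserted; \<open>pos\<close> is the distance from the break item.\<close>

definition pos :: "nat \<Rightarrow> nat \<Rightarrow> nat" where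
  "pos b k = (if k < b then b - k else k - b + 1)"

lemma pos_inj: "(b \<le> i) = (b \<le> j) \<Longrightarrow> pos b i = pos b j \<Longrightarrow> i = j"
  by (auto simp: pos_def split: if_splits)

section \<open>Classes, ranks and minimal exchange sets\<close>

locale cand =
  fixes n b W :: nat and wt pen :: "nat \<Rightarrow> nat"
  assumes wt: "k < n \<Longrightarrow> 0 < wt k \<and> wt k \<le> W"
    and dens: "i < n \<Longrightarrow> j < n \<Longrightarrow> (b \<le> i) = (b \<le> j) \<Longrightarrow> pos b i \<le> pos b j \<Longrightarrow> pen i * wt j \<le> pen j * wt i"
begin

definition val :: "nat \<Rightarrow> int" where "val k = (if b \<le> k then int (wt k) else - int (wt k))"

definition cls :: "bool \<Rightarrow> nat \<Rightarrow> nat set" where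
  "cls s v = {k. k < n \<and> (b \<le> k) = s \<and> wt k = v}"

definition rank :: "nat \<Rightarrow> nat" where
  "rank k = card {k' \<in> cls (b \<le> k) (wt k). pos b k' < pos b k}"

text \<open>The secondary criterion. Distances are weighted by \<open>wt\<close>, so that for two
  sets of equal total weight a threshold that separates their distances also separates
  \<open>Psi\<close>.\<close>

definition Psi :: "nat set \<Rightarrow> nat" where "Psi D = (\<Sum>k\<in>D. wt k * pos b k)"

definition minimal :: "nat set \<Rightarrow> bool" where
  "minimal D \<longleftrightarrow> D \<subseteq> {..<n} \<and> (\<forall>E\<subseteq>{..<n}. sum val E = sum val D \<longrightarrow>
     sum pen D < sum pen E \<or> (sum pen D = sum pen E \<and> Psi D \<le> Psi E))"

text \<open>A class is worth extending to rank \<open>2 r + 2\<close> only if few classes of comparable weight reach rank \<open>r\<close> at a better density: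
  otherwise items of cheaper classes could replace some of its items.\<close>

definition quota_ok :: "nat \<Rightarrow> bool" where
  "quota_ok e \<longleftrightarrow> card {k. k < n \<and> (b \<le> k) = (b \<le> e) \<and> rank k = rank e \<and> lg2 (wt k) = lg2 (wt e) \<and> pos b k \<le> pos b e}
     \<le> 8 * W div (rank e + 1) + 2"

text \<open>One test at rank \<open>r\<close> decides about the ranks \<open>2 * r + 2\<close> and
  \<open>2 * r + 3\<close>. The factor two leaves room in \<open>selected\<close>: up to
  \<open>r + 1\<close> items can be taken from the far end of what \<open>D\<close> uses of such a
  class, and all of them are still farther away than the tested one.\<close>

definition sel :: "nat \<Rightarrow> bool" where
  "sel k \<longleftrightarrow> rank k < 2 \<or> (\<exists>e \<in> cls (b \<le> k) (wt k). rank e + 1 = rank k div 2 \<and> quota_ok e)"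

lemma finite_cls [simp]: "finite (cls s v)" by (simp add: cls_def)

lemma in_cls: "k < n \<Longrightarrow> k \<in> cls (b \<le> k) (wt k)" by (simp add: cls_def)

lemma clsD: "k \<in> cls s v \<Longrightarrow> k < n \<and> (b \<le> k) = s \<and> wt k = v" by (simp add: cls_def)

lemma rank_cls: "k \<in> cls s v \<Longrightarrow> rank k = card {k' \<in> cls s v. pos b k' < pos b k}"
  by (auto simp: rank_def cls_def)

lemma cls_pos_eq: "k \<in> cls s v \<Longrightarrow> k' \<in> cls s v' \<Longrightarrow> pos b k = pos b k' \<Longrightarrow> k = k'"
  using pos_inj by (auto simp: cls_def)

lemma rank_mono: assumes "k \<in> cls s v" "k' \<in> cls s v" "pos b k < pos b k'" shows "rank k < rank k'"
proof -
  have "{x \<in> cls s v. pos b x < pos b k} \<subset> {x \<in> cls s v. pos b x < pos b k'}" using assms by auto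
  then show ?thesis using assms by (simp add: rank_cls psubset_card_mono)
qed

lemma rank_le_iff: assumes "k \<in> cls s v" "k' \<in> cls s v" shows "rank k \<le> rank k' \<longleftrightarrow> pos b k \<le> pos b k'"
  using rank_mono[OF assms] rank_mono[OF assms(2,1)] cls_pos_eq[OF assms]
  by (metis leD le_neq_implies_less linorder_linear order_refl)

lemma bij_rank: "bij_betw rank (cls s v) {..<card (cls s v)}"
proof -
  have inj: "inj_on rank (cls s v)"
    by (rule inj_onI) (metis cls_pos_eq less_irrefl linorder_neqE_nat rank_mono)
  have "rank ` cls s v \<subseteq> {..<card (cls s v)}"
  proof
    fix r assume "r \<in> rank ` cls s v"
    then obtain k where k: "k \<in> cls s v" "r = rank k" by blast
    have "{k' \<in> cls s v. pos b k' < pos b k} \<subset> cls s v" using k by auto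
    then show "r \<in> {..<card (cls s v)}" using k by (simp add: rank_cls psubset_card_mono)
  qed
  moreover have "card (rank ` cls s v) = card {..<card (cls s v)}" using inj by (simp add: card_image)
  ultimately have "rank ` cls s v = {..<card (cls s v)}" by (simp add: card_subset_eq)
  then show ?thesis using inj by (simp add: bij_betw_def)
qed

lemma card_rank_interval:
  assumes "r + m \<le> card (cls s v)"
  shows "card {k \<in> cls s v. r \<le> rank k \<and> rank k < r + m} = m"
proof -
  have "bij_betw rank {k \<in> cls s v. r \<le> rank k \<and> rank k < r + m} {r..<r + m}"
    using bij_rank[of s v] assms by (auto simp: bij_betw_def inj_on_def image_iff set_eq_iff) (metis less_le_trans)
  then show ?thesis using bij_betw_same_card by fastforce
qed

lemma minimal_exists:
  assumes "D0 \<subseteq> {..<n}"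
  shows "\<exists>D. minimal D \<and> sum val D = sum val D0 \<and> sum pen D \<le> sum pen D0"
proof -
  let ?P = "\<lambda>E. E \<subseteq> {..<n} \<and> sum val E = sum val D0"
  obtain D1 where D1: "?P D1" "\<forall>E. ?P E \<longrightarrow> sum pen D1 \<le> sum pen E"
    using ex_has_least_nat[of ?P D0 "sum pen"] assms by blast
  obtain D where D: "?P D \<and> sum pen D = sum pen D1" "\<forall>E. ?P E \<and> sum pen E = sum pen D1 \<longrightarrow> Psi D \<le> Psi E"
    using ex_has_least_nat[of "\<lambda>E. ?P E \<and> sum pen E = sum pen D1" D1 Psi] D1 by blast
  have "minimal D" unfolding minimal_def using D D1 by (metis le_neq_implies_less)
  then show ?thesis using D D1 assms by auto
qed

text \<open>Every structural statement below exhibits such \<open>U\<close> and \<open>E\<close>.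
  Penalties may tie, for instance between items of equal density; the strict decrease of
  \<open>Psi\<close> alone contradicts minimality.\<close>

lemma exchange:
  assumes D: "minimal D" and U: "U \<subseteq> D" and E: "E \<subseteq> {..<n}" "E \<inter> (D - U) = {}" and s: "sum val U = sum val E"
    and p: "sum pen E \<le> sum pen U" and "Psi E < Psi U"
  shows False
proof -
  have fin: "finite D" "finite U" "finite E" using D U E finite_subset unfolding minimal_def by (metis finite_lessThan)+
  let ?D = "(D - U) \<union> E"
  have sumU: "sum f ?D + sum f U = sum f D + sum f E" for f :: "nat \<Rightarrow> 'x::ab_group_add"
  proof -
    have "sum f ?D = sum f (D - U) + sum f E" by (rule sum.union_disjoint) (use fin E in auto)
    moreover have "sum f D = sum f (D - U) + sum f U" using sum.subset_diff[OF U fin(1)] by simp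
    ultimately show ?thesis by simp
  qed
  \<comment> \<open>Natural numbers form no group, so the identity is established once more for
    \<open>pen\<close> and the summands of \<open>Psi\<close>.\<close>
  have nsum: "sum f ?D + sum f U = sum f D + sum f E" for f :: "nat \<Rightarrow> nat"
  proof -
    have "sum f ?D = sum f (D - U) + sum f E" by (rule sum.union_disjoint) (use fin E in auto)
    moreover have "sum f D = sum f (D - U) + sum f U" using sum.subset_diff[OF U fin(1)] by simp
    ultimately show ?thesis by simp
  qed
  have "sum val ?D = sum val D" using sumU[of val] s by simp
  moreover have "?D \<subseteq> {..<n}" using D E by (auto simp: minimal_def)
  ultimately have "sum pen D < sum pen ?D \<or> (sum pen D = sum pen ?D \<and> Psi D \<le> Psi ?D)" using D unfolding minimal_def by blast
  moreover have "sum pen ?D \<le> sum pen D" using nsum[of pen] p by simp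
  moreover have "Psi ?D < Psi D" using nsum[of "\<lambda>k. wt k * pos b k"] assms(7) by (simp add: Psi_def)
  ultimately show False by simp
qed

lemma Psi_pos: assumes "U \<subseteq> {..<n}" "U \<noteq> {}" shows "0 < Psi U"
  unfolding Psi_def
proof (rule sum_pos)
  show "finite U" using assms finite_subset by blast
  fix k assume "k \<in> U"
  then have "0 < wt k" using wt assms by blast
  then show "0 < wt k * pos b k" by (simp add: pos_def)
qed fact

context
  fixes D assumes D: "minimal D" and sD: "0 \<le> sum val D" "sum val D < int W"
begin

lemma D_sub: "D \<subseteq> {..<n}" using D by (simp add: minimal_def)
lemma D_fin [simp]: "finite D" using D_sub finite_subset by blast

text \<open>A zero-sum part could be dropped: this preserves the value, does not raise the penalty
  and lowers \<open>Psi\<close>.\<close>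

lemma D_zero_sum_free: "U \<subseteq> D \<Longrightarrow> U \<noteq> {} \<Longrightarrow> sum val U \<noteq> 0"
  using exchange[OF D, of U "{}"] Psi_pos[of U] D_sub by (auto simp: Psi_def)

lemma D_card: "card D \<le> 2 * W"
proof (rule zero_sum_free_card[OF D_fin _ D_zero_sum_free])
  show "\<And>k. k \<in> D \<Longrightarrow> \<bar>val k\<bar> \<le> int W" using D_sub wt by (force simp: val_def)
qed (use sD in auto)

lemma D_prefix: assumes "k \<in> D" "k \<in> cls s v" "k' \<in> cls s v" "pos b k' < pos b k" shows "k' \<in> D"
proof (rule ccontr)
  assume "k' \<notin> D"
  have c: "k < n" "k' < n" "(b \<le> k) = (b \<le> k')" "wt k = wt k'" using assms by (auto simp: cls_def)
  then have "pen k' * wt k \<le> pen k * wt k'" using dens[of k' k] assms by simp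
  then have "pen k' \<le> pen k" using c wt[of k] by simp
  moreover have "val k = val k'" using c by (simp add: val_def)
  moreover have "wt k' * pos b k' < wt k * pos b k" using c assms wt[of k] by simp
  ultimately show False using exchange[OF D, of "{k}" "{k'}"] \<open>k' \<notin> D\<close> assms c by (auto simp: Psi_def)
qed

definition K :: "bool \<Rightarrow> nat \<Rightarrow> nat" where "K s v = card (D \<inter> cls s v)"

lemma D_cls_iff: assumes "k \<in> cls s v" shows "k \<in> D \<longleftrightarrow> rank k < K s v"
proof
  assume k: "k \<in> D"
  have "{k' \<in> cls s v. pos b k' < pos b k} \<subseteq> D \<inter> cls s v" using D_prefix[OF k assms] by blast
  moreover have "k \<in> D \<inter> cls s v" "k \<notin> {k' \<in> cls s v. pos b k' < pos b k}" using k assms by auto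
  ultimately have "{k' \<in> cls s v. pos b k' < pos b k} \<subset> D \<inter> cls s v" by blast
  then show "rank k < K s v" using assms by (simp add: rank_cls K_def psubset_card_mono)
next
  assume r: "rank k < K s v"
  show "k \<in> D"
  proof (rule ccontr)
    assume k: "k \<notin> D"
    have "D \<inter> cls s v \<subseteq> {k' \<in> cls s v. pos b k' < pos b k}"
    proof safe
      fix x assume x: "x \<in> D" "x \<in> cls s v"
      show "pos b x < pos b k"
      proof (rule ccontr)
        assume "\<not> pos b x < pos b k"
        moreover have "pos b x \<noteq> pos b k" using cls_pos_eq[OF x(2) assms] x(1) k by blast
        ultimately have "pos b k < pos b x" by linarith
        then show False using D_prefix[OF x assms] k by blast
      qed
    qed
    then have "K s v \<le> rank k" using assms by (simp add: rank_cls K_def card_mono)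
    then show False using r by simp
  qed
qed

lemma K_le_card: "K s v \<le> card (cls s v)" by (simp add: K_def card_mono)

lemma sum_K: assumes "finite S" shows "(\<Sum>v\<in>S. K s v) \<le> 2 * W"
proof -
  have "(\<Sum>v\<in>S. K s v) = card (\<Union>v\<in>S. D \<inter> cls s v)"
    unfolding K_def by (rule card_UN_disjoint[symmetric]) (use assms in \<open>auto simp: cls_def\<close>)
  also have "\<dots> \<le> card D" by (rule card_mono) auto
  finally show ?thesis using D_card by simp
qed

text \<open>With too many weights of one sign in one dyadic range, \<open>common_subset_sum\<close>
  applies to one item for each of these weights on the one hand and all items of the other sign on
  the other. Equal weights with opposite signs form a zero-sum part of \<open>D\<close>.\<close>

lemma support_bound:
  assumes sq: "W \<le> sq * sq"
  shows "card {v. \<exists>k\<in>D. (b \<le> k) = s \<and> wt k = v \<and> lg2 v = g} \<le> 8 * sq * (lg2 W + 1)"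
proof (rule ccontr)
  define A where "A = {v. \<exists>k\<in>D. (b \<le> k) = s \<and> wt k = v \<and> lg2 v = g}"
  assume "\<not> card {v. \<exists>k\<in>D. (b \<le> k) = s \<and> wt k = v \<and> lg2 v = g} \<le> 8 * sq * (lg2 W + 1)"
  then have big: "8 * sq * (lg2 W + 1) < card A" by (simp add: A_def)
  have Aw: "A \<subseteq> wt ` D" by (auto simp: A_def)
  then have finA: "finite A" by (rule finite_subset) simp
  have "A \<noteq> {}" using big by auto
  then obtain k0 where k0: "k0 \<in> D" by (auto simp: A_def)
  then have W0: "0 < W" using wt D_sub by force
  have AG: "A \<subseteq> {2 ^ g..<2 * 2 ^ g}"
  proof
    fix v assume "v \<in> A"
    then obtain k where "k \<in> D" "wt k = v" "lg2 v = g" by (auto simp: A_def)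
    then show "v \<in> {2 ^ g..<2 * 2 ^ g}" using lg2_bounds[of v] wt[of k] D_sub by auto
  qed
  have AW: "A \<subseteq> {1..W}" using Aw wt D_sub by force
  then have "card A \<le> W" using card_mono[of "{1..W}" A] by simp
  also have "W < 2 ^ Suc (lg2 W)" using lg2_bounds W0 by blast
  finally have cA: "card A < 2 ^ Suc (lg2 W)" .
  obtain v0 where "v0 \<in> A" using \<open>A \<noteq> {}\<close> by blast
  then have GW: "2 ^ g \<le> W" using AG AW by fastforce
  let ?R = "{k \<in> D. (b \<le> k) \<noteq> s}" and ?S = "{k \<in> D. (b \<le> k) = s}"
  have "\<forall>v\<in>A. \<exists>k\<in>?S. wt k = v" by (auto simp: A_def)
  then obtain f where f: "\<And>v. v \<in> A \<Longrightarrow> f v \<in> ?S \<and> wt (f v) = v" by metis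
  have finj: "inj_on f A" by (rule inj_onI) (metis f)
  have sg: "sum val U = (if s then 1 else -1) * int (sum wt U)" if "U \<subseteq> ?S" for U
  proof -
    have "sum val U = (\<Sum>k\<in>U. (if s then 1 else -1) * int (wt k))" by (rule sum.cong[OF refl]) (use that in \<open>auto simp: val_def\<close>)
    then show ?thesis by (simp add: sum_distrib_left)
  qed
  have sgR: "sum val U = (if s then -1 else 1) * int (sum wt U)" if "U \<subseteq> ?R" for U
  proof -
    have "sum val U = (\<Sum>k\<in>U. (if s then -1 else 1) * int (wt k))" by (rule sum.cong[OF refl]) (use that in \<open>auto simp: val_def\<close>)
    then show ?thesis by (simp add: sum_distrib_left)
  qed
  have "card A * 2 ^ g = (\<Sum>v\<in>A. 2 ^ g)" by simp
  also have "\<dots> \<le> sum id A" by (rule sum_mono) (use AG in auto)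
  also have "sum id A = sum wt (f ` A)" using f finj by (simp add: sum.reindex)
  also have "\<dots> \<le> sum wt ?S" by (rule sum_mono2) (use f in auto)
  \<comment> \<open>The two sides of \<open>D\<close> differ in weight by less than
    \<open>W\<close>, so the other side is as heavy as \<open>common_subset_sum\<close>
    demands.\<close>
  also have "sum wt ?S \<le> sum wt ?R + W"
  proof -
    have "sum val D = sum val ?S + sum val ?R" by (subst sum.union_disjoint[symmetric]) (auto intro: sum.cong)
    then have "\<bar>int (sum wt ?S) - int (sum wt ?R)\<bar> < int W"
      using sg[of ?S] sgR[of ?R] sD by (auto split: if_splits simp del: of_nat_sum)
    then show ?thesis by linarith
  qed
  finally have tot: "card A * 2 ^ g \<le> sum wt ?R + W" .
  \<comment> \<open>The constant 8 of the claim is chosen here: its square 64 is just above the 60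
    of \<open>common_subset_sum\<close>.\<close>
  have "60 * W * (lg2 W + 1) \<le> (8 * sq * (lg2 W + 1)) * (8 * sq * (lg2 W + 1))"
  proof -
    have "60 * W * (lg2 W + 1) * 1 \<le> 64 * (sq * sq) * (lg2 W + 1) * (lg2 W + 1)"
      by (intro mult_le_mono) (use sq in auto)
    then show ?thesis by (simp add: algebra_simps)
  qed
  also have "\<dots> \<le> card A * (card A - 1)" by (rule mult_le_mono) (use big in auto)
  finally have dense: "60 * W * (lg2 W + 1) \<le> card A * (card A - 1)" .
  have "\<exists>X Y. X \<subseteq> A \<and> Y \<subseteq> ?R \<and> X \<noteq> {} \<and> sum id X = sum wt Y"
  proof (rule common_subset_sum[OF finA AG refl cA _ _ GW tot dense W0])
    show "finite ?R" by simp
    show "wt x \<le> W" if "x \<in> ?R" for x using that wt D_sub by auto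
  qed
  then obtain X Y where XY: "X \<subseteq> A" "Y \<subseteq> ?R" "X \<noteq> {}" "sum id X = sum wt Y" by blast
  have fX: "f ` X \<subseteq> ?S" using f XY by blast
  have "sum wt (f ` X) = sum (wt \<circ> f) X" by (rule sum.reindex) (rule inj_on_subset[OF finj XY(1)])
  also have "\<dots> = sum id X" by (rule sum.cong[OF refl]) (use f XY(1) in auto)
  finally have "sum wt (f ` X) = sum id X" .
  then have "sum val (f ` X) + sum val Y = 0" using sg[OF fX] sgR[OF XY(2)] XY(4) by (auto simp del: of_nat_sum)
  moreover have "sum val (f ` X \<union> Y) = sum val (f ` X) + sum val Y"
  proof (rule sum.union_disjoint)
    show "finite (f ` X)" by (rule finite_subset[of _ D]) (use fX in auto)
    show "finite Y" by (rule finite_subset[of _ D]) (use XY in auto)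
    show "f ` X \<inter> Y = {}" using fX XY(2) by blast
  qed
  moreover have "f ` X \<union> Y \<subseteq> D" "f ` X \<union> Y \<noteq> {}" using fX XY by auto
  ultimately show False using D_zero_sum_free[of "f ` X \<union> Y"] by simp
qed

lemma class_count:
  assumes sq: "W \<le> sq * sq"
  shows "card ((\<lambda>k. (b \<le> k, wt k)) ` D) \<le> 16 * sq * (lg2 W + 1) ^ 2"
proof -
  let ?A = "\<lambda>s g. {v. \<exists>k\<in>D. (b \<le> k) = s \<and> wt k = v \<and> lg2 v = g}"
  have sub: "(\<lambda>k. (b \<le> k, wt k)) ` D \<subseteq> (\<Union>s\<in>{True, False}. \<Union>g\<in>{..lg2 W}. Pair s ` ?A s g)"
  proof safe
    fix k assume k: "k \<in> D"
    then have "k < n" using D_sub by auto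
    then have "lg2 (wt k) \<le> lg2 W" using wt[of k] lg2_mono by simp
    then have "(b \<le> k, wt k) \<in> Pair (b \<le> k) ` ?A (b \<le> k) (lg2 (wt k))" "lg2 (wt k) \<in> {..lg2 W}" using k by auto
    then show "(b \<le> k, wt k) \<in> (\<Union>s\<in>{True, False}. \<Union>g\<in>{..lg2 W}. Pair s ` ?A s g)"
      by (intro UN_I[of "b \<le> k"] UN_I[of "lg2 (wt k)"]) auto
  qed
  have fin: "finite (?A s g)" for s g by (rule finite_subset[of _ "wt ` D"]) auto
  have one: "card (\<Union>g\<in>{..lg2 W}. Pair s ` ?A s g) \<le> (lg2 W + 1) * (8 * sq * (lg2 W + 1))" for s
  proof -
    have "card (\<Union>g\<in>{..lg2 W}. Pair s ` ?A s g) \<le> (\<Sum>g\<in>{..lg2 W}. card (Pair s ` ?A s g))" by (rule card_UN_le) simp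
    also have "\<dots> \<le> (\<Sum>g\<in>{..lg2 W}. 8 * sq * (lg2 W + 1))"
      by (rule sum_mono, rule order_trans[OF card_image_le[OF fin] support_bound[OF sq]])
    finally show ?thesis by simp
  qed
  have "card ((\<lambda>k. (b \<le> k, wt k)) ` D) \<le> card (\<Union>s\<in>{True, False}. \<Union>g\<in>{..lg2 W}. Pair s ` ?A s g)"
    by (rule card_mono[OF _ sub]) (use fin in auto)
  also have "\<dots> \<le> (\<Sum>s\<in>{True, False}. card (\<Union>g\<in>{..lg2 W}. Pair s ` ?A s g))" by (rule card_UN_le) simp
  also have "\<dots> \<le> 2 * ((lg2 W + 1) * (8 * sq * (lg2 W + 1)))" using one[of True] one[of False] by simp
  finally show ?thesis by (simp add: power2_eq_square algebra_simps)
qed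

text \<open>Up to an error of \<open>H\<close> items, a class has contributed the fraction
  \<open>i / 2 ^ H\<close> of its items before time \<open>i\<close>. The main terms add up to this
  fraction of \<open>sum val D\<close>, which lies between 0 and \<open>W\<close>; the errors cost
  \<open>H * W\<close> for each of the few classes. \<open>E\<close> stands for items of time
  \<open>i\<close> itself that are already processed, at most one in every class, which accounts for
  \<open>H + 1\<close>.\<close>

lemma prefix_sum_bound:
  assumes sq: "W \<le> sq * sq" and H: "2 * W \<le> 2 ^ H" and E: "E \<subseteq> {k \<in> D. brev H (rank k) = i}"
  shows "\<bar>sum val ({k \<in> D. brev H (rank k) < i} \<union> E)\<bar> \<le> int (W + (H + 1) * W * (16 * sq * (lg2 W + 1) ^ 2))"
proof -
  let ?c = "\<lambda>k. (b \<le> k, wt k)"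
  let ?S = "?c ` D" and ?N = "card (?c ` D)" and ?L = "{k \<in> D. brev H (rank k) < i}"
  let ?sv = "\<lambda>c. (if fst c then int (snd c) else - int (snd c))"
  have val: "val k = ?sv (?c k)" for k by (simp add: val_def)
  have sv: "\<bar>?sv c\<bar> \<le> int W" if "c \<in> ?S" for c using that wt D_sub by force
  have part: "sum f T = (\<Sum>c\<in>?S. sum f {k \<in> T. ?c k = c})" if "T \<subseteq> D" for f :: "nat \<Rightarrow> int" and T
  proof (rule sum.group[symmetric])
    show "finite T" using that by (rule finite_subset) simp
  qed (use that in auto)
  have valT: "sum val T = (\<Sum>c\<in>?S. ?sv c * int (card {k \<in> T. ?c k = c}))" if "T \<subseteq> D" for T
  proof -
    have "sum val {k \<in> T. ?c k = c} = ?sv c * int (card {k \<in> T. ?c k = c})" for c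
    proof -
      have "sum val {k \<in> T. ?c k = c} = (\<Sum>k\<in>{k \<in> T. ?c k = c}. ?sv c)" by (rule sum.cong) (auto simp: val_def)
      then show ?thesis by simp
    qed
    then show ?thesis using part[OF that, of val] by simp
  qed
  have abs_le: "\<bar>\<Sum>c\<in>?S. ?sv c * x c\<bar> \<le> int ?N * (int W * m)" if x: "\<And>c. c \<in> ?S \<Longrightarrow> \<bar>x c\<bar> \<le> m" for x and m :: int
  proof -
    have "\<bar>\<Sum>c\<in>?S. ?sv c * x c\<bar> \<le> (\<Sum>c\<in>?S. \<bar>?sv c * x c\<bar>)" by (rule sum_abs)
    also have "\<dots> \<le> (\<Sum>c\<in>?S. int W * m)"
      by (rule sum_mono) (simp only: abs_mult, rule mult_mono, use sv x in auto)
    finally show ?thesis by simp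
  qed
  have Kc: "{k \<in> D. ?c k = (s, v)} = D \<inter> cls s v" for s v using D_sub by (auto simp: cls_def)
  have cnt: "card {k \<in> ?L. ?c k = (s, v)} = bcnt H (K s v) i" for s v
  proof -
    have "bij_betw rank {k \<in> ?L. ?c k = (s, v)} {x. x < K s v \<and> brev H x < i}"
    proof -
      have eq: "{k \<in> ?L. ?c k = (s, v)} = {k \<in> cls s v. rank k < K s v \<and> brev H (rank k) < i}"
        using D_cls_iff D_sub by (auto simp: cls_def)
      have "inj_on rank (cls s v)" using bij_rank bij_betw_def by blast
      then have "inj_on rank {k \<in> ?L. ?c k = (s, v)}" unfolding eq by (rule inj_on_subset) auto
      moreover have "rank ` {k \<in> cls s v. rank k < K s v \<and> brev H (rank k) < i} = {x. x < K s v \<and> brev H x < i}"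
      proof safe
        fix x assume x: "x < K s v" "brev H x < i"
        then have "x \<in> {..<card (cls s v)}" using K_le_card[of s v] by simp
        then obtain k where "k \<in> cls s v" "rank k = x" using bij_rank[of s v] by (metis bij_betw_imp_surj_on imageE)
        then show "x \<in> rank ` {k \<in> cls s v. rank k < K s v \<and> brev H (rank k) < i}" using x by blast
      qed
      ultimately show ?thesis unfolding eq by (simp add: bij_betw_def)
    qed
    then show ?thesis unfolding bcnt_def by (rule bij_betw_same_card)
  qed
  have cnt': "card {k \<in> ?L. ?c k = c} = bcnt H (K (fst c) (snd c)) i" for c
    using cnt[of "fst c" "snd c"] by (simp only: prod.collapse)
  have Kc': "card {k \<in> D. ?c k = c} = K (fst c) (snd c)" for c
    using Kc[of "fst c" "snd c"] by (simp only: prod.collapse K_def)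
  have valL: "sum val ?L = (\<Sum>c\<in>?S. ?sv c * int (bcnt H (K (fst c) (snd c)) i))"
    unfolding cnt'[symmetric] by (rule valT) auto
  have main: "\<bar>sum val ?L\<bar> \<le> int W + int ?N * (int W * int H)"
  proof (cases "i \<le> 2 ^ H")
    case True
    let ?e = "\<lambda>c. 2 ^ H * int (bcnt H (K (fst c) (snd c)) i) - int (K (fst c) (snd c)) * int i"
    have Kle: "K s v \<le> 2 ^ H" for s v using sum_K[of "{v}" s] H by simp
    have "2 ^ H * sum val ?L = (\<Sum>c\<in>?S. ?sv c * (2 ^ H * int (bcnt H (K (fst c) (snd c)) i)))"
      unfolding valL sum_distrib_left by (rule sum.cong[OF refl]) (simp only: mult.left_commute)
    also have "\<dots> = (\<Sum>c\<in>?S. ?sv c * ?e c) + int i * (\<Sum>c\<in>?S. ?sv c * int (K (fst c) (snd c)))"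
      unfolding sum_distrib_left sum.distrib[symmetric] by (rule sum.cong[OF refl]) (simp add: algebra_simps)
    also have "(\<Sum>c\<in>?S. ?sv c * int (K (fst c) (snd c))) = sum val D"
      unfolding valT[OF order_refl] Kc' by (rule refl)
    finally have e: "2 ^ H * sum val ?L = (\<Sum>c\<in>?S. ?sv c * ?e c) + int i * sum val D" .
    have "\<bar>\<Sum>c\<in>?S. ?sv c * ?e c\<bar> \<le> int ?N * (int W * (int H * 2 ^ H))"
      by (rule abs_le) (rule bcnt_discrepancy[OF Kle True])
    moreover have "int i * sum val D \<le> 2 ^ H * int W" by (rule mult_mono) (use True sD in \<open>auto simp flip: of_nat_le_iff\<close>)
    moreover have "0 \<le> int i * sum val D" using sD by simp
    ultimately have "\<bar>2 ^ H * sum val ?L\<bar> \<le> 2 ^ H * int W + int ?N * (int W * (int H * 2 ^ H))" unfolding e by linarith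
    then have "2 ^ H * \<bar>sum val ?L\<bar> \<le> 2 ^ H * (int W + int ?N * (int W * int H))" by (simp add: abs_mult algebra_simps)
    then show ?thesis by simp
  next
    case False
    have "brev H (rank k) < i" for k using brev_less[of H "rank k"] False by linarith
    then have "?L = D" by auto
    moreover have "0 \<le> int ?N * (int W * int H)" by simp
    ultimately show ?thesis using sD by (simp only:)
  qed
  have ED: "E \<subseteq> D" using E by auto
  have Ec: "card {k \<in> E. ?c k = c} \<le> 1" for c
  proof -
    obtain s v where c: "c = (s, v)" by (cases c)
    have inj: "k = k'" if k: "k \<in> E" "?c k = (s, v)" "k' \<in> E" "?c k' = (s, v)" for k k'
    proof -
      have "k \<in> cls s v" "k' \<in> cls s v" using k ED D_sub by (auto simp: cls_def)
      have "brev H (rank k) = brev H (rank k')" using k E by auto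
      have lt: "rank k < 2 ^ H" "rank k' < 2 ^ H"
        using D_cls_iff[OF \<open>k \<in> cls s v\<close>] D_cls_iff[OF \<open>k' \<in> cls s v\<close>] k ED sum_K[of "{v}" s] H by auto
      \<comment> \<open>If a value \<open>y\<close> were missed, the counts below \<open>y\<close>
        and below \<open>Suc y\<close> would agree, against \<open>bcnt_full\<close>; and a map of a
        finite set onto itself is injective.\<close>
      have "inj_on (brev H) {..<2 ^ H}" 
      proof -
        have "brev H ` {..<2 ^ H} = {..<2 ^ H}"
        proof (rule ccontr)
          assume "brev H ` {..<2 ^ H} \<noteq> {..<2 ^ H}"
          moreover have "brev H ` {..<2 ^ H} \<subseteq> {..<2 ^ H}" using brev_less by auto
          ultimately obtain y where "y \<in> {..<2 ^ H}" "y \<notin> brev H ` {..<2 ^ H}" by blast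
          then have y: "y < 2 ^ H" "\<And>x. x < 2 ^ H \<Longrightarrow> brev H x \<noteq> y" by auto
          have "{x. x < 2 ^ H \<and> brev H x < y} = {x. x < 2 ^ H \<and> brev H x < Suc y}" using y by (auto simp: less_Suc_eq)
          then have "bcnt H (2 ^ H) y = bcnt H (2 ^ H) (Suc y)" by (simp add: bcnt_def)
          then show False using bcnt_full[of y H] bcnt_full[of "Suc y" H] y by simp
        qed
        then show ?thesis by (simp add: eq_card_imp_inj_on)
      qed
      then have "rank k = rank k'" using \<open>brev H (rank k) = brev H (rank k')\<close> lt by (auto dest: inj_onD)
      then show "k = k'" using bij_rank[of s v] \<open>k \<in> cls s v\<close> \<open>k' \<in> cls s v\<close> by (metis bij_betw_imp_inj_on inj_onD)
    qed
    have "finite {k \<in> E. ?c k = (s, v)}" by (rule finite_subset[of _ D]) (use ED in auto)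
    then show ?thesis unfolding c using card_le_Suc0_iff_eq[of "{k \<in> E. ?c k = (s, v)}"] inj by auto
  qed
  have "\<bar>sum val E\<bar> \<le> int ?N * (int W * 1)" unfolding valT[OF ED] by (rule abs_le) (use Ec in auto)
  moreover have "sum val (?L \<union> E) = sum val ?L + sum val E"
    by (rule sum.union_disjoint) (use E finite_subset[OF ED] in auto)
  ultimately have "\<bar>sum val (?L \<union> E)\<bar> \<le> int W + int ?N * (int W * int H) + int ?N * int W" using main by linarith
  also have "\<dots> = int (W + (H + 1) * W * ?N)" by (simp add: algebra_simps)
  also have "\<dots> \<le> int (W + (H + 1) * W * (16 * sq * (lg2 W + 1) ^ 2))"
    using class_count[OF sq] by (simp only: of_nat_le_iff add_le_cancel_left mult_le_mono2)
  finally show ?thesis .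
qed

text \<open>Suppose that the tested item \<open>e\<close> fails its quota. Then many classes of
  comparable weight have an item of rank \<open>j - 1\<close> that is no farther than
  \<open>e\<close>. As \<open>card D \<le> 2 * W\<close>, enough of them hold at most
  \<open>j / 2\<close> items of \<open>D\<close>, and \<open>zero_subsum_mod\<close> modulo the
  weight \<open>w\<close> of \<open>k\<close> allows to exchange \<open>c\<close> far items of the
  class of \<open>k\<close> for equally heavy near items of those classes, against
  minimality.\<close>

lemma selected:
  assumes k: "k \<in> D" shows "sel k"
proof (cases "rank k < 2")
  case True then show ?thesis by (simp add: sel_def)
next
  case False
  define s where "s = (b \<le> k)"
  define w where "w = wt k"
  define j where "j = rank k div 2"
  have j1: "1 \<le> j" "2 * j \<le> rank k" using False by (auto simp: j_def)
  have kn: "k < n" using k D_sub by auto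
  have kc: "k \<in> cls s w" unfolding s_def w_def by (rule in_cls[OF kn])
  have w0: "0 < w" "w \<le> W" using wt[OF kn] by (auto simp: w_def)
  have rk: "rank k < K s w" using D_cls_iff[OF kc] k by simp
  have "j - 1 \<in> {..<card (cls s w)}" using rk K_le_card[of s w] j1 by simp
  then obtain e where e: "e \<in> cls s w" "rank e = j - 1" using bij_rank[of s w] by (metis bij_betw_imp_surj_on imageE)
  have ewt: "wt e = w" "(b \<le> e) = s" "e < n" using e by (auto simp: cls_def)
  have "quota_ok e"
  proof (rule ccontr)
    assume nq: "\<not> quota_ok e"
    define Q where "Q = {x. x < n \<and> (b \<le> x) = s \<and> rank x = j - 1 \<and> lg2 (wt x) = lg2 w \<and> pos b x \<le> pos b e}"
    have finQ: "finite Q" by (simp add: Q_def)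
    have "8 * W div j + 2 < card Q" using nq e ewt j1 by (simp add: quota_ok_def Q_def)
    moreover have eQ: "e \<in> Q" using e ewt by (simp add: Q_def)
    ultimately have cQ: "8 * W div j + 2 \<le> card (Q - {e})" by simp
    have Qcls: "x \<in> cls s (wt x)" if "x \<in> Q" for x using that by (simp add: Q_def cls_def)
    have wtinj: "inj_on wt Q"
    proof (rule inj_onI)
      fix x y assume xy: "x \<in> Q" "y \<in> Q" "wt x = wt y"
      then have "x \<in> cls s (wt x)" "y \<in> cls s (wt x)" "rank x = rank y" using Qcls[of x] Qcls[of y] by (auto simp: Q_def)
      then show "x = y" using bij_rank[of s "wt x"] by (metis bij_betw_imp_inj_on inj_onD)
    qed
    \<comment> \<open>Classes of which \<open>D\<close> takes more than \<open>j / 2\<close> items;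
      there are at most \<open>4 * W div j\<close> of them because \<open>D\<close> has at most
      \<open>2 * W\<close> items. The 8 in the quota leaves more than that number for
      \<open>V\<close>.\<close>
    define bad where "bad = {x \<in> Q - {e}. j < 2 * K s (wt x)}"
    define V where "V = {x \<in> Q - {e}. 2 * K s (wt x) \<le> j}"
    have finV: "finite V" "finite bad" using finQ by (auto simp: V_def bad_def)
    have "Q - {e} = bad \<union> V" "bad \<inter> V = {}" by (auto simp: bad_def V_def)
    then have cbV: "card (Q - {e}) = card bad + card V" using finV by (simp add: card_Un_disjoint)
    have "card bad * j \<le> 4 * W"
    proof -
      have "card bad * j = (\<Sum>x\<in>bad. j)" by simp
      also have "\<dots> \<le> (\<Sum>x\<in>bad. 2 * K s (wt x))" by (rule sum_mono) (simp add: bad_def)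
      also have "\<dots> = 2 * (\<Sum>x\<in>bad. K s (wt x))" by (simp add: sum_distrib_left)
      also have "(\<Sum>x\<in>bad. K s (wt x)) = (\<Sum>v\<in>wt ` bad. K s v)"
        by (rule sum.reindex[symmetric, unfolded o_def]) (rule inj_on_subset[OF wtinj], auto simp: bad_def)
      also have "2 * (\<Sum>v\<in>wt ` bad. K s v) \<le> 2 * (2 * W)" using sum_K[of "wt ` bad" s] finV by simp
      finally show ?thesis by simp
    qed
    then have "card bad \<le> 4 * W div j" using j1 by (simp add: less_eq_div_iff_mult_less_eq)
    moreover have "2 * (4 * W div j) \<le> 8 * W div j"
    proof -
      have "2 * (4 * W div j) * j \<le> 8 * W" using div_times_less_eq_dividend[of "4 * W" j] by linarith
      then show ?thesis using j1 by (simp add: less_eq_div_iff_mult_less_eq)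
    qed
    ultimately have "4 * W div j + 1 \<le> card V" using cQ cbV by linarith
    then have "(4 * W div j + 1) * j \<le> card V * j" by (rule mult_le_mono1)
    moreover have "4 * W < (4 * W div j + 1) * j" using j1 by (simp add: dividend_less_div_times)
    ultimately have cV: "4 * W < card V * j" by linarith
    then have V0: "0 < card V" by (metis gr0I mult_0 not_less_zero)
    \<comment> \<open>The number of copies of the weights of \<open>V\<close> needed to collect
      \<open>w\<close> residues. As \<open>card V * j\<close> exceeds \<open>4 * W\<close>, it is
      about \<open>j / 4\<close>; so even \<open>T\<close> additional items in one class of
      \<open>V\<close> stay below rank \<open>j\<close>.\<close>
    define T where "T = (w + card V - 1) div card V"
    have TV: "w \<le> T * card V"
    proof -
      have "w + card V - 1 < T * card V + card V" unfolding T_def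
        using V0 by (metis add.commute div_mult_mod_eq mod_less_divisor nat_add_left_cancel_less)
      then show ?thesis by simp
    qed
    have T4: "4 * T \<le> j + 3"
    proof -
      have "T * card V \<le> w + card V - 1" unfolding T_def by simp
      then have "(T - 1) * card V < w" using w0 V0 by (simp add: diff_mult_distrib)
      then have "4 * ((T - 1) * card V) < j * card V" using cV w0 by (simp only: mult.commute[of j])
      then have "(4 * (T - 1)) * card V < j * card V" by simp
      then have "4 * (T - 1) < j" by (simp only: mult_less_cancel2)
      then show ?thesis by linarith
    qed
    let ?G = "2 ^ lg2 w :: nat"
    have wG: "?G \<le> w" "w < 2 * ?G" using lg2_bounds[of w] w0 by auto
    have VG: "?G \<le> wt x \<and> wt x < 2 * ?G \<and> x \<in> Q" if "x \<in> V" for x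
    proof -
      have "x \<in> Q" using that by (simp add: V_def)
      then have "x < n" "lg2 (wt x) = lg2 w" by (auto simp: Q_def)
      then show ?thesis using lg2_bounds[of "wt x"] wt[of x] \<open>x \<in> Q\<close> by auto
    qed
    have cVm: "card ((\<lambda>x. x mod int w) ` ((\<lambda>x. int (wt x)) ` V)) = card V"
    proof -
      have "inj_on (\<lambda>x. int (wt x) mod int w) V"
      proof (rule inj_onI)
        fix x y assume xy: "x \<in> V" "y \<in> V" "int (wt x) mod int w = int (wt y) mod int w"
        then have "int w dvd int (wt x) - int (wt y)" by (simp add: mod_eq_dvd_iff)
        \<comment> \<open>Weights of one dyadic range differ by less than its lower end, which is at
          most \<open>w\<close>; hence they are distinct modulo \<open>w\<close>.\<close>
        moreover have "\<bar>int (wt x) - int (wt y)\<bar> < int w" using VG[OF xy(1)] VG[OF xy(2)] wG by linarith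
        ultimately have "int (wt x) - int (wt y) = 0" using dvd_imp_le_int[of "int (wt x) - int (wt y)" "int w"] by linarith
        then show "x = y" using wtinj VG xy(1,2) by (auto dest: inj_onD)
      qed
      then show ?thesis by (simp add: image_image card_image)
    qed
    have "nat (int w) \<le> (\<Sum>i<T. card ((\<lambda>x. x mod int w) ` ((\<lambda>x. int (wt x)) ` V)))" unfolding cVm using TV by simp
    then obtain I u where I: "I \<subseteq> {..<T}" "I \<noteq> {}" "\<forall>i\<in>I. u i \<in> (\<lambda>x. int (wt x)) ` V" "int w dvd (\<Sum>i\<in>I. u i)"
      using zero_subsum_mod[of "int w" "\<lambda>_. (\<lambda>x. int (wt x)) ` V" T] w0 by auto
    have "\<forall>i\<in>I. \<exists>x\<in>V. u i = int (wt x)" using I(3) by auto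
    then obtain f where f: "\<And>i. i \<in> I \<Longrightarrow> f i \<in> V \<and> u i = int (wt (f i))" by metis
    have finI: "finite I" using I(1) finite_subset by blast
    have cI: "card I \<le> T" "0 < card I" using card_mono[OF _ I(1)] I(2) finI by (auto simp: card_gt_0_iff)
    have "int (\<Sum>i\<in>I. wt (f i)) = (\<Sum>i\<in>I. u i)" unfolding of_nat_sum by (rule sum.cong[OF refl]) (simp add: f)
    then have "int w dvd int (\<Sum>i\<in>I. wt (f i))" using I(4) by simp
    then have "w dvd (\<Sum>i\<in>I. wt (f i))" by (simp only: of_nat_dvd_iff)
    then obtain c where c: "(\<Sum>i\<in>I. wt (f i)) = w * c" by blast
    have c1: "0 < c"
    proof -
      have "0 < wt (f i)" if "i \<in> I" for i
      proof -
        have "?G \<le> wt (f i)" using f[OF that] VG by blast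
        then show ?thesis using less_le_trans[of 0 ?G "wt (f i)"] by simp
      qed
      then have "0 < (\<Sum>i\<in>I. wt (f i))" using finI I(2) by (intro sum_pos) auto
      then show ?thesis using c by (cases c) auto
    qed
    \<comment> \<open>At most \<open>T\<close> weights are involved, each below
      \<open>2 * ?G\<close> and therefore below \<open>2 * w\<close>.\<close>
    have c2: "c \<le> 2 * T - 1"
    proof -
      have "(\<Sum>i\<in>I. wt (f i)) < (\<Sum>i\<in>I. 2 * w)"
      proof (rule sum_strict_mono[OF finI I(2)])
        fix i assume "i \<in> I"
        then have "wt (f i) < 2 * ?G" using f VG by blast
        then show "wt (f i) < 2 * w" using wG by linarith
      qed
      also have "\<dots> \<le> T * (2 * w)" using cI by simp
      finally have "w * c < w * (2 * T)" using c by (simp add: algebra_simps)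
      then have "c < 2 * T" by simp
      then show ?thesis by simp
    qed
    have cj: "c \<le> j" using c2 T4 j1 cI by linarith
    define mul where "mul x = card {i \<in> I. f i = x}" for x
    have mulT: "mul x \<le> T" for x
      unfolding mul_def by (rule order_trans[OF card_mono cI(1)]) (use finI in auto)
    have Kmul: "K s (wt x) + mul x \<le> j" if "x \<in> V" for x
    proof -
      have "2 * K s (wt x) \<le> j" using that by (simp add: V_def)
      then show ?thesis using mulT[of x] T4 j1 by presburger
    qed
    define Ex where "Ex x = {y \<in> cls s (wt x). K s (wt x) \<le> rank y \<and> rank y < K s (wt x) + mul x}" for x
    define E where "E = (\<Union>x\<in>V. Ex x)"
    \<comment> \<open>The last \<open>c\<close> items that \<open>D\<close> takes from the class of
      \<open>k\<close>. Their ranks start at \<open>K s w - c\<close>, which exceeds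
      \<open>j\<close>, so all are farther away than \<open>e\<close>; items of \<open>E\<close>
      have ranks below \<open>j\<close> in their classes and are no farther than
      \<open>e\<close>.\<close>
    define U where "U = {y \<in> cls s w. K s w - c \<le> rank y \<and> rank y < K s w - c + c}"
    have Kc: "c \<le> K s w" "2 * j + 1 \<le> K s w" using rk j1 cj by auto
    have cU: "card U = c" unfolding U_def by (rule card_rank_interval) (use Kc K_le_card[of s w] in simp)
    have cEx: "card (Ex x) = mul x" if "x \<in> V" for x
    proof -
      have "x \<in> cls s (wt x)" "rank x = j - 1" using VG[OF that] Qcls by (auto simp: Q_def)
      then have "j - 1 < card (cls s (wt x))" using bij_rank[of s "wt x"] by (metis bij_betwE lessThan_iff)
      then show ?thesis unfolding Ex_def by (intro card_rank_interval) (use Kmul[OF that] in linarith)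
    qed
    have E_sum: "sum g E = (\<Sum>x\<in>V. sum g (Ex x))" for g :: "nat \<Rightarrow> nat"
      unfolding E_def
    proof (rule sum.UNION_disjoint[OF finV(1)])
      show "\<forall>x\<in>V. finite (Ex x)" by (simp add: Ex_def)
      show "\<forall>x\<in>V. \<forall>y\<in>V. x \<noteq> y \<longrightarrow> Ex x \<inter> Ex y = {}" using wtinj VG by (auto simp: Ex_def cls_def inj_on_def)
    qed
    have Ewt: "sum wt E = w * c"
    proof -
      have "sum wt (Ex x) = wt x * mul x" if "x \<in> V" for x
      proof -
        have "sum wt (Ex x) = (\<Sum>y\<in>Ex x. wt x)" by (rule sum.cong) (auto simp: Ex_def cls_def)
        then show ?thesis using cEx[OF that] by simp
      qed
      then have "sum wt E = (\<Sum>x\<in>V. wt x * mul x)" unfolding E_sum by simp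
      also have "\<dots> = (\<Sum>x\<in>V. \<Sum>i\<in>{i \<in> I. f i = x}. wt (f i))"
        by (rule sum.cong[OF refl]) (simp add: mul_def)
      also have "\<dots> = (\<Sum>i\<in>I. wt (f i))" by (rule sum.group) (use finI finV f in auto)
      finally show ?thesis using c by simp
    qed
    have Uwt: "sum wt U = w * c"
    proof -
      have "sum wt U = (\<Sum>y\<in>U. w)" by (rule sum.cong) (auto simp: U_def cls_def)
      then show ?thesis using cU by simp
    qed
    have Ecls: "y < n \<and> (b \<le> y) = s \<and> pos b y \<le> pos b e \<and> y \<notin> D" if yE: "y \<in> E" for y
    proof -
      obtain x where x: "x \<in> V" "y \<in> Ex x" using yE by (auto simp: E_def)
      have xQ: "x \<in> Q" using VG[OF x(1)] by simp
      have y: "y \<in> cls s (wt x)" "K s (wt x) \<le> rank y" "rank y < K s (wt x) + mul x" using x(2) by (auto simp: Ex_def)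
      have "rank y \<le> rank x" using y Kmul[OF x(1)] xQ by (simp add: Q_def)
      then have "pos b y \<le> pos b x" using rank_le_iff[OF y(1) Qcls[OF xQ]] by simp
      then show ?thesis using y D_cls_iff[OF y(1)] xQ by (auto simp: Q_def cls_def)
    qed
    have Ucls: "y \<in> cls s w \<and> pos b e < pos b y \<and> y \<in> D" if "y \<in> U" for y
    proof -
      have y: "y \<in> cls s w" "K s w - c \<le> rank y" "rank y < K s w" using that Kc by (auto simp: U_def)
      have "rank e < rank y" using y e Kc cj j1 by linarith
      then show ?thesis using y D_cls_iff[OF y(1)] rank_le_iff[OF y(1) e(1)] by auto
    qed
    have Esub: "E \<subseteq> {..<n}" and Usub: "U \<subseteq> D" using Ecls Ucls by auto
    have finE: "finite E" "finite U" using Esub Usub finite_subset D_fin by blast+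
    have vs: "sum val X = (if s then 1 else -1) * int (sum wt X)" if "\<And>y. y \<in> X \<Longrightarrow> (b \<le> y) = s" for X
    proof -
      have "sum val X = (\<Sum>y\<in>X. (if s then 1 else -1) * int (wt y))" by (rule sum.cong[OF refl]) (use that in \<open>auto simp: val_def\<close>)
      then show ?thesis by (simp add: sum_distrib_left)
    qed
    have "sum val U = sum val E"
      using vs[of U] vs[of E] Ewt Uwt Ecls Ucls clsD by metis
    moreover have "sum pen E \<le> sum pen U"
    proof -
      have "sum pen E * w = (\<Sum>y\<in>E. pen y * wt e)" using ewt by (simp add: sum_distrib_right)
      also have "\<dots> \<le> (\<Sum>y\<in>E. pen e * wt y)"
        by (rule sum_mono) (use dens[of _ e] Ecls ewt in auto)
      also have "\<dots> = (\<Sum>y\<in>U. pen e) * w" using Ewt cU by (simp add: sum_distrib_left[symmetric])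
      also have "(\<Sum>y\<in>U. pen e) \<le> sum pen U"
      proof (rule sum_mono)
        fix y assume "y \<in> U"
        then have y: "y \<in> cls s w" "pos b e < pos b y" using Ucls by auto
        then have "pen e * wt y \<le> pen y * wt e" using dens[of e y] ewt by (auto simp: cls_def)
        then show "pen e \<le> pen y" using y ewt w0 by (auto simp: cls_def)
      qed
      then have "(\<Sum>y\<in>U. pen e) * w \<le> sum pen U * w" by (rule mult_le_mono1)
      finally show ?thesis using w0 by simp
    qed
    \<comment> \<open>Both sets have weight \<open>w * c\<close>, and \<open>pos b e\<close>
      separates their distances.\<close>
    moreover have "Psi E < Psi U"
    proof -
      have "Psi E \<le> (\<Sum>y\<in>E. wt y * pos b e)" unfolding Psi_def by (rule sum_mono) (use Ecls in auto)
      also have "\<dots> = (\<Sum>y\<in>U. wt y * pos b e)" using Ewt Uwt by (simp add: sum_distrib_right[symmetric])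
      also have "\<dots> < Psi U" unfolding Psi_def
      proof (rule sum_strict_mono)
        show "finite U" by (rule finE)
        show "U \<noteq> {}" using cU c1 by auto
        fix y assume "y \<in> U"
        then have "wt y = w" "pos b e < pos b y" using Ucls clsD by blast+
        then show "wt y * pos b e < wt y * pos b y" using w0 by simp
      qed
      finally show ?thesis .
    qed
    moreover have "E \<inter> (D - U) = {}" using Ecls by blast
    ultimately show False using exchange[OF D Usub Esub] by blast
  qed
  moreover have "rank e + 1 = rank k div 2" using e j1 by (simp add: j_def)
  ultimately show ?thesis unfolding sel_def using e s_def w_def by blast
qed

end

text \<open>Interface to the dynamic program: it need not find the competitor \<open>D0\<close>
  itself, only this replacement, which consists of candidates and whose prefix sums never leave the
  window.\<close>

theorem good_solution:
  assumes "D0 \<subseteq> {..<n}" "0 \<le> sum val D0" "sum val D0 < int W" "W \<le> sq * sq" "2 * W \<le> 2 ^ H"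
  shows "\<exists>D. D \<subseteq> {..<n} \<and> sum val D = sum val D0 \<and> sum pen D \<le> sum pen D0 \<and>
    (\<forall>k\<in>D. sel k \<and> rank k < 2 ^ H) \<and>
    (\<forall>i E. E \<subseteq> {k \<in> D. brev H (rank k) = i} \<longrightarrow>
       \<bar>sum val ({k \<in> D. brev H (rank k) < i} \<union> E)\<bar> \<le> int (W + (H + 1) * W * (16 * sq * (lg2 W + 1) ^ 2)))"
proof -
  obtain D where D: "minimal D" "sum val D = sum val D0" "sum pen D \<le> sum pen D0"
    using minimal_exists[OF assms(1)] by blast
  have s: "0 \<le> sum val D" "sum val D < int W" using D assms by auto
  have "rank k < 2 ^ H" if "k \<in> D" for k
  proof -
    have "k \<in> cls (b \<le> k) (wt k)" using that D_sub[OF D(1) s] in_cls by blast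
    then have "rank k < K D (b \<le> k) (wt k)" using D_cls_iff[OF D(1) s] that by blast
    then show ?thesis using sum_K[OF D(1) s, of "{wt k}" "b \<le> k"] assms(5) by simp
  qed
  then show ?thesis using D D_sub[OF D(1) s] selected[OF D(1) s] prefix_sum_bound[OF D(1) s assms(4,5)]
    by (intro exI[of _ D]) blast
qed

end

section \<open>Sorting, dynamic programming and the greedy solution\<close>

definition bucket :: "('a \<Rightarrow> nat) \<Rightarrow> nat \<Rightarrow> 'a list \<Rightarrow> 'a list" where
  "bucket f m xs = concat (map (\<lambda>d. filter (\<lambda>x. f x = d) xs) [0..<m])"

lemma bucket_0 [simp]: "bucket f 0 xs = []" by (simp add: bucket_def)
lemma bucket_Suc: "bucket f (Suc m) xs = bucket f m xs @ filter (\<lambda>x. f x = m) xs" by (simp add: bucket_def)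

lemma set_bucket: "set (bucket f m xs) = {x \<in> set xs. f x < m}" by (auto simp: bucket_def)

lemma length_bucket_filter: "length (bucket f m xs) = length (filter (\<lambda>x. f x < m) xs)"
proof (induction m)
  case (Suc m)
  have "length (filter (\<lambda>x. f x < Suc m) xs) = length (filter (\<lambda>x. f x < m) xs) + length (filter (\<lambda>x. f x = m) xs)"
    by (induction xs) auto
  then show ?case using Suc by (simp add: bucket_Suc)
qed simp

lemma length_bucket: "(\<And>x. x \<in> set xs \<Longrightarrow> f x < m) \<Longrightarrow> length (bucket f m xs) = length xs"
  by (simp add: length_bucket_filter filter_True)

lemma distinct_bucket: "distinct xs \<Longrightarrow> distinct (bucket f m xs)"
  by (induction m) (auto simp: bucket_Suc set_bucket)

text \<open>Stability: elements of one bucket keep the previous order \<open>R\<close>. This is what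
  makes successive passes lexicographic.\<close>

lemma sorted_wrt_bucket:
  assumes "sorted_wrt R xs"
  shows "sorted_wrt (\<lambda>x y. f x < f y \<or> (f x = f y \<and> R x y)) (bucket f m xs)"
proof (induction m)
  case (Suc m)
  have "sorted_wrt R (filter (\<lambda>x. f x = m) xs)" using assms by (rule sorted_wrt_filter)
  then have "sorted_wrt (\<lambda>x y. f x < f y \<or> (f x = f y \<and> R x y)) (filter (\<lambda>x. f x = m) xs)"
    by (rule sorted_wrt_mono_rel[rotated]) auto
  then show ?case using Suc by (auto simp: bucket_Suc sorted_wrt_append set_bucket)
qed simp

text \<open>Digits are complemented, so that the least significant digit radix sort is descending.\<close>

definition dig :: "nat \<Rightarrow> nat \<Rightarrow> nat \<Rightarrow> nat" where "dig B d x = B - 1 - x div d mod B"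

text \<open>Modulo \<open>d * B\<close> a key is its next digit times \<open>d\<close> plus its part
  modulo \<open>d\<close>; the digit decides, and stability keeps the old order on ties.\<close>

lemma radix_step:
  assumes "sorted_wrt (\<lambda>x y. key y mod d \<le> key x mod d) xs" "0 < B" "0 < d"
  shows "sorted_wrt (\<lambda>x y. key y mod (d * B) \<le> key x mod (d * B)) (bucket (\<lambda>x. dig B d (key x)) B xs)"
proof (rule sorted_wrt_mono_rel[OF _ sorted_wrt_bucket[OF assms(1)]])
  fix x y
  let ?a = "key x div d mod B" and ?b = "key y div d mod B"
  assume "dig B d (key x) < dig B d (key y) \<or> dig B d (key x) = dig B d (key y) \<and> key y mod d \<le> key x mod d"
  moreover have "?a < B" "?b < B" using assms by auto
  ultimately consider "?b < ?a" | "?b = ?a" "key y mod d \<le> key x mod d" unfolding dig_def by linarith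
  then show "key y mod (d * B) \<le> key x mod (d * B)"
  proof cases
    case 1
    have "d * ?b + key y mod d < d * Suc ?b" using assms by simp
    also have "\<dots> \<le> d * ?a" using 1 by (intro mult_le_mono2) simp
    finally show ?thesis by (simp add: mod_mult2_eq)
  next
    case 2 then show ?thesis by (simp add: mod_mult2_eq)
  qed
qed

section \<open>A harmonic sum and the number of selected items\<close>

lemma sum_div_dyadic: "(\<Sum>j=1..<2 ^ h. N div j) \<le> h * N" for N :: nat
proof (induction h)
  case (Suc h)
  have "{1..<2 ^ Suc h} = {1..<2 ^ h} \<union> {2 ^ h..<2 ^ Suc h :: nat}" by auto
  moreover have "{1..<2 ^ h} \<inter> {2 ^ h..<2 ^ Suc h :: nat} = {}" by auto
  ultimately have "(\<Sum>j=1..<2 ^ Suc h. N div j) = (\<Sum>j=1..<2 ^ h. N div j) + (\<Sum>j=2 ^ h..<2 ^ Suc h. N div j)"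
    by (simp only: sum.union_disjoint finite_atLeastLessThan)
  \<comment> \<open>Each of the \<open>h\<close> dyadic ranges contributes at most \<open>N\<close>:
    it has \<open>2 ^ h\<close> terms, each at most \<open>N div 2 ^ h\<close>.\<close>
  also have "(\<Sum>j=2 ^ h..<2 ^ Suc h. N div j) \<le> (\<Sum>j::nat=2 ^ h..<2 ^ Suc h. N div 2 ^ h)"
    by (rule sum_mono) (auto intro: div_le_mono2)
  also have "\<dots> = 2 ^ h * (N div 2 ^ h)" by simp
  also have "\<dots> \<le> N" by simp
  finally show ?case using Suc by simp
qed simp

context cand
begin

text \<open>Ranks 0 and 1 occur at most once for every sign and weight. For fixed sign, dyadic range
  and rank \<open>r \<ge> 2\<close>, the selected items inject into the tested items of rank
  \<open>r div 2 - 1\<close> that passed. The quota bounds these by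
  \<open>8 * W div (r div 2) + 2\<close>, and summing over \<open>r\<close> is harmonic.\<close>

lemma selected_count:
  "card {k. k < n \<and> sel k \<and> rank k < 2 ^ H} \<le> 4 * W + 2 * ((lg2 W + 1) * (16 * H * W + 2 * 2 ^ H))"
proof -
  let ?T = "{k. k < n \<and> sel k \<and> rank k < 2 ^ H}"
  let ?X = "\<lambda>s g r. {k. k < n \<and> (b \<le> k) = s \<and> lg2 (wt k) = g \<and> rank k = r \<and> sel k}"
  have inj: "inj_on (\<lambda>k. (b \<le> k, wt k, rank k)) {..<n}"
  proof (rule inj_onI)
    fix x y assume "x \<in> {..<n}" "y \<in> {..<n}" "(b \<le> x, wt x, rank x) = (b \<le> y, wt y, rank y)"
    then have "x \<in> cls (b \<le> x) (wt x)" "y \<in> cls (b \<le> x) (wt x)" "rank x = rank y" by (auto simp: cls_def)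
    then show "x = y" using bij_rank[of "b \<le> x" "wt x"] by (metis bij_betw_imp_inj_on inj_onD)
  qed
  have low: "card {k. k < n \<and> rank k < 2} \<le> 4 * W"
  proof -
    have "(\<lambda>k. (b \<le> k, wt k, rank k)) ` {k. k < n \<and> rank k < 2} \<subseteq> UNIV \<times> {1..W} \<times> {..<2}"
      using wt by (auto simp: Suc_le_eq)
    then have "card {k. k < n \<and> rank k < 2} \<le> card ((UNIV :: bool set) \<times> {1..W} \<times> {..<2::nat})"
      by (intro card_inj_on_le[of "\<lambda>k. (b \<le> k, wt k, rank k)"] inj_on_subset[OF inj]) auto
    then show ?thesis by (simp add: card_cartesian_product)
  qed
  have X: "card (?X s g r) \<le> 8 * W div (r div 2) + 2" if r: "2 \<le> r" for s g r
  proof -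
    define Y where "Y = {e. e < n \<and> (b \<le> e) = s \<and> lg2 (wt e) = g \<and> rank e = r div 2 - 1 \<and> quota_ok e}"
    have "\<forall>k\<in>?X s g r. \<exists>e. e \<in> cls s (wt k) \<and> rank e + 1 = r div 2 \<and> quota_ok e" using r by (auto simp: sel_def)
    from bchoice[OF this] obtain f where "\<forall>k\<in>?X s g r. f k \<in> cls s (wt k) \<and> rank (f k) + 1 = r div 2 \<and> quota_ok (f k)" ..
    then have f: "f k \<in> cls s (wt k) \<and> rank (f k) + 1 = r div 2 \<and> quota_ok (f k)" if "k \<in> ?X s g r" for k using that by (rule bspec)
    have "inj_on f (?X s g r)"
    proof (rule inj_onI)
      fix x y assume xy: "x \<in> ?X s g r" "y \<in> ?X s g r" "f x = f y"
      have "wt x = wt y" using f[OF xy(1)] f[OF xy(2)] xy(3) by (auto simp: cls_def)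
      then show "x = y" using xy inj by (auto simp: inj_on_def)
    qed
    moreover have "f ` ?X s g r \<subseteq> Y" 
    proof
      fix e assume "e \<in> f ` ?X s g r"
      then obtain k where k: "k \<in> ?X s g r" "e = f k" by blast
      then show "e \<in> Y" using f[OF k(1)] by (auto simp: Y_def cls_def)
    qed
    moreover have finY: "finite Y" by (simp add: Y_def)
    ultimately have "card (?X s g r) \<le> card Y" by (meson card_inj_on_le)
    also have "card Y \<le> 8 * W div (r div 2) + 2"
    proof (cases "Y = {}")
      case False
      \<comment> \<open>The farthest of the tested items counts all the others in its own
        quota.\<close>
      define m where "m = Max (pos b ` Y)"
      have "m \<in> pos b ` Y" unfolding m_def using finY False by simp
      then obtain e where e: "e \<in> Y" "pos b e = m" by blast
      have qe: "quota_ok e" using e by (simp add: Y_def)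
      have "Y \<subseteq> {k. k < n \<and> (b \<le> k) = (b \<le> e) \<and> rank k = rank e \<and> lg2 (wt k) = lg2 (wt e) \<and> pos b k \<le> pos b e}"
        using e finY by (auto simp: Y_def m_def)
      then have "card Y \<le> card {k. k < n \<and> (b \<le> k) = (b \<le> e) \<and> rank k = rank e \<and> lg2 (wt k) = lg2 (wt e) \<and> pos b k \<le> pos b e}"
        by (intro card_mono) auto
      also have "\<dots> \<le> 8 * W div (rank e + 1) + 2" using qe unfolding quota_ok_def .
      also have "rank e + 1 = r div 2" using e r by (simp add: Y_def)
      finally show ?thesis .
    qed simp
    finally show ?thesis .
  qed
  have sub: "?T \<subseteq> {k. k < n \<and> rank k < 2} \<union> (\<Union>s\<in>{True, False}. \<Union>g\<in>{..lg2 W}. \<Union>r\<in>{2..<2 ^ H}. ?X s g r)"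
  proof
    fix k assume k: "k \<in> ?T"
    show "k \<in> {k. k < n \<and> rank k < 2} \<union> (\<Union>s\<in>{True, False}. \<Union>g\<in>{..lg2 W}. \<Union>r\<in>{2..<2 ^ H}. ?X s g r)"
    proof (cases "rank k < 2")
      case True then show ?thesis using k by simp
    next
      case False
      have "lg2 (wt k) \<le> lg2 W" using k wt[of k] lg2_mono by simp
      then show ?thesis using k False
        by (intro UnI2 UN_I[of "b \<le> k"] UN_I[of "lg2 (wt k)"] UN_I[of "rank k"]) auto
    qed
  qed
  have sr: "card (\<Union>r\<in>{2..<2 ^ H}. ?X s g r) \<le> 16 * H * W + 2 * 2 ^ H" for s g
  proof -
    have "card (\<Union>r\<in>{2..<2 ^ H}. ?X s g r) \<le> (\<Sum>r=2..<2 ^ H. card (?X s g r))" by (rule card_UN_le) simp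
    also have "\<dots> \<le> (\<Sum>r=2..<2 ^ H. 8 * W div (r div 2) + 2)" by (rule sum_mono) (use X in auto)
    also have "\<dots> = (\<Sum>r=2..<2 ^ H. 8 * W div (r div 2)) + 2 * (2 ^ H - 2)" by (subst sum.distrib) simp
    also have "(\<Sum>r=2..<2 ^ H. 8 * W div (r div 2)) \<le> 16 * H * W"
    proof -
      have "(\<Sum>r=2..<2 ^ H. 8 * W div (r div 2)) = (\<Sum>j\<in>(\<lambda>r. r div 2) ` {2..<2 ^ H}. \<Sum>r\<in>{r \<in> {2..<2 ^ H}. r div 2 = j}. 8 * W div (r div 2))"
        by (rule sum.image_gen) simp
      also have "\<dots> \<le> (\<Sum>j\<in>(\<lambda>r. r div 2) ` {2..<2 ^ H}. 2 * (8 * W div j))"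
      proof (rule sum_mono)
        fix j :: nat
        have "{r \<in> {2..<2 ^ H}. r div 2 = j} \<subseteq> {2 * j, 2 * j + 1}" by auto
        then have "card {r \<in> {2..<2 ^ H}. r div 2 = j} \<le> card {2 * j, 2 * j + 1}" by (intro card_mono) auto
        then have c: "card {r \<in> {2..<2 ^ H}. r div 2 = j} \<le> 2" by simp
        have "(\<Sum>r\<in>{r \<in> {2..<2 ^ H}. r div 2 = j}. 8 * W div (r div 2)) = (\<Sum>r\<in>{r \<in> {2..<2 ^ H}. r div 2 = j}. 8 * W div j)"
          by (rule sum.cong) auto
        also have "\<dots> = card {r \<in> {2..<2 ^ H}. r div 2 = j} * (8 * W div j)" by simp
        also have "\<dots> \<le> 2 * (8 * W div j)" using c by (rule mult_le_mono1)
        finally show "(\<Sum>r\<in>{r \<in> {2..<2 ^ H}. r div 2 = j}. 8 * W div (r div 2)) \<le> 2 * (8 * W div j)" .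
      qed
      also have "\<dots> \<le> (\<Sum>j=1..<2 ^ H. 2 * (8 * W div j))" by (rule sum_mono2) auto
      also have "\<dots> \<le> 2 * (H * (8 * W))" unfolding sum_distrib_left[symmetric] using sum_div_dyadic[of "8 * W" H] by simp
      finally show ?thesis by simp
    qed
    finally show ?thesis by simp
  qed
  have sg: "card (\<Union>g\<in>{..lg2 W}. \<Union>r\<in>{2..<2 ^ H}. ?X s g r) \<le> (lg2 W + 1) * (16 * H * W + 2 * 2 ^ H)" for s
  proof -
    have "card (\<Union>g\<in>{..lg2 W}. \<Union>r\<in>{2..<2 ^ H}. ?X s g r) \<le> (\<Sum>g\<in>{..lg2 W}. card (\<Union>r\<in>{2..<2 ^ H}. ?X s g r))" by (rule card_UN_le) simp
    also have "\<dots> \<le> (\<Sum>g\<in>{..lg2 W}. 16 * H * W + 2 * 2 ^ H)" by (rule sum_mono) (rule sr)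
    finally show ?thesis by simp
  qed
  have "card ?T \<le> card ({k. k < n \<and> rank k < 2} \<union> (\<Union>s\<in>{True, False}. \<Union>g\<in>{..lg2 W}. \<Union>r\<in>{2..<2 ^ H}. ?X s g r))"
    by (rule card_mono[OF _ sub]) auto
  also have "\<dots> \<le> card {k. k < n \<and> rank k < 2} + card (\<Union>s\<in>{True, False}. \<Union>g\<in>{..lg2 W}. \<Union>r\<in>{2..<2 ^ H}. ?X s g r)"
    by (rule card_Un_le)
  also have "card (\<Union>s\<in>{True, False}. \<Union>g\<in>{..lg2 W}. \<Union>r\<in>{2..<2 ^ H}. ?X s g r) \<le>
      (\<Sum>s\<in>{True, False}. card (\<Union>g\<in>{..lg2 W}. \<Union>r\<in>{2..<2 ^ H}. ?X s g r))" by (rule card_UN_le) simp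
  also have "\<dots> \<le> 2 * ((lg2 W + 1) * (16 * H * W + 2 * 2 ^ H))" using sg[of True] sg[of False] by simp
  finally show ?thesis using low by simp
qed

end

text \<open>A cell of the table is 0 if the sum is unreachable and one more than the least penalty otherwise.\<close>

definition relax :: "nat \<Rightarrow> nat \<Rightarrow> nat \<Rightarrow> nat" where
  "relax x y q = (if y = 0 then x else if x = 0 \<or> y + q < x then y + q else x)"

locale dp = cand +
  fixes L :: nat and its :: "nat list"
  assumes its: "set its \<subseteq> {..<n}" "distinct its"
begin

definition prv :: "nat \<Rightarrow> nat \<Rightarrow> nat" where "prv k y = (if b \<le> k then y - wt k else y + wt k)"

text \<open>Cell \<open>y\<close> stands for the signed sum \<open>y - (W + L)\<close>, which keeps
  indices natural. Margins of width \<open>W\<close> on both sides, constantly 0, absorb the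
  accesses outside the window; for \<open>y\<close> in the window, \<open>prv\<close> therefore
  needs no range check and its subtraction never truncates.\<close>

fun F :: "nat \<Rightarrow> nat \<Rightarrow> nat" where
  "F 0 y = (if y = W + L then 1 else 0)"
| "F (Suc k) y = (if W \<le> y \<and> y \<le> W + 2 * L then relax (F k y) (F k (prv (its ! k) y)) (pen (its ! k)) else 0)"

fun bt :: "nat \<Rightarrow> nat \<Rightarrow> nat set" where
  "bt 0 y = {}"
| "bt (Suc k) y = (if F (Suc k) y = F k y then bt k y else insert (its ! k) (bt k (prv (its ! k) y)))"

lemma F_range: "F k y \<noteq> 0 \<Longrightarrow> W \<le> y \<and> y \<le> W + 2 * L" by (cases k) (auto split: if_splits)

lemma its_nth: "k < length its \<Longrightarrow> its ! k < n" using its nth_mem by blast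

lemma bt_correct:
  assumes "k \<le> length its" "F k y \<noteq> 0"
  shows "bt k y \<subseteq> set (take k its) \<and> sum val (bt k y) = int y - int (W + L) \<and> F k y = sum pen (bt k y) + 1"
  using assms
proof (induction k arbitrary: y)
  case 0 then show ?case by (auto split: if_splits)
next
  case (Suc k)
  let ?x = "its ! k"
  have k: "k < length its" using Suc by simp
  have tk: "take (Suc k) its = take k its @ [?x]" using k by (rule take_Suc_conv_app_nth)
  have rng: "W \<le> y" "y \<le> W + 2 * L" using F_range[OF Suc.prems(2)] by auto
  show ?case
  proof (cases "F (Suc k) y = F k y")
    case True
    then show ?thesis using Suc.IH[of y] Suc.prems k tk by auto
  next
    case False
    have ne: "F k (prv ?x y) \<noteq> 0" and e: "F (Suc k) y = F k (prv ?x y) + pen ?x"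
      using False rng by (auto simp: relax_def split: if_splits)
    have IH: "bt k (prv ?x y) \<subseteq> set (take k its)" "sum val (bt k (prv ?x y)) = int (prv ?x y) - int (W + L)"
      "F k (prv ?x y) = sum pen (bt k (prv ?x y)) + 1" using Suc.IH[OF _ ne] k by auto
    have "distinct (take (Suc k) its)" using its by simp
    then have "?x \<notin> set (take k its)" unfolding tk by simp
    then have nin: "?x \<notin> bt k (prv ?x y)" using IH by blast
    have fin: "finite (bt k (prv ?x y))" using IH(1) finite_subset by blast
    have "wt ?x \<le> W" using wt its_nth[OF k] by simp
    then have v: "int y = int (prv ?x y) + val ?x" using rng by (simp add: prv_def val_def)
    show ?thesis using False IH e nin fin v tk by (auto simp: sum.insert simp del: F.simps)
  qed
qed

text \<open>Sets with a prefix sum outside the window may be missed by the table. It is only claimed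
  to know those that stay inside, which is what \<open>good_solution\<close> supplies.\<close>

lemma F_complete:
  assumes D: "D \<subseteq> set its" and bnd: "\<And>k. k \<le> length its \<Longrightarrow> \<bar>sum val (D \<inter> set (take k its))\<bar> \<le> int L"
    and "k \<le> length its"
  shows "F k (nat (int (W + L) + sum val (D \<inter> set (take k its)))) \<noteq> 0 \<and>
    F k (nat (int (W + L) + sum val (D \<inter> set (take k its)))) \<le> sum pen (D \<inter> set (take k its)) + 1"
  using assms(3)
proof (induction k)
  case 0 then show ?case by (simp del: of_nat_add)
next
  case (Suc k)
  let ?x = "its ! k"
  let ?S = "\<lambda>k. D \<inter> set (take k its)"
  have k: "k < length its" using Suc by simp
  have tk: "take (Suc k) its = take k its @ [?x]" using k by (rule take_Suc_conv_app_nth)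
  have "distinct (take (Suc k) its)" using its by simp
  then have nin: "?x \<notin> set (take k its)" unfolding tk by simp
  define y where "y = nat (int (W + L) + sum val (?S (Suc k)))"
  define z where "z = nat (int (W + L) + sum val (?S k))"
  have y: "int y = int (W + L) + sum val (?S (Suc k))" 
    unfolding y_def using bnd[OF Suc.prems] by (intro int_nat_eq[THEN trans] if_P) linarith
  have z: "int z = int (W + L) + sum val (?S k)" 
    unfolding z_def using bnd[of k] k by (intro int_nat_eq[THEN trans] if_P) linarith
  have rng: "W \<le> y" "y \<le> W + 2 * L" using y bnd[of "Suc k"] Suc.prems by linarith+
  have IH: "F k z \<noteq> 0" "F k z \<le> sum pen (?S k) + 1" using Suc by (auto simp: z_def)
  have Fy: "F (Suc k) y = relax (F k y) (F k (prv ?x y)) (pen ?x)" using rng by simp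
  show ?case
  proof (cases "?x \<in> D")
    case False
    then have S: "?S (Suc k) = ?S k" using tk by auto
    then have "y = z" by (simp add: y_def z_def)
    then have "F (Suc k) y \<noteq> 0 \<and> F (Suc k) y \<le> F k z" using Fy IH by (auto simp: relax_def)
    then show ?thesis using IH S unfolding y_def[symmetric] by (auto simp del: F.simps)
  next
    case True
    then have S: "?S (Suc k) = insert ?x (?S k)" using tk by auto
    then have sv: "sum val (?S (Suc k)) = val ?x + sum val (?S k)" "sum pen (?S (Suc k)) = pen ?x + sum pen (?S k)" using nin by auto
    have "wt ?x \<le> W" using wt its_nth[OF k] by simp
    then have "prv ?x y = z" using y z sv(1) rng by (auto simp: prv_def val_def)
    then have "F (Suc k) y \<noteq> 0 \<and> F (Suc k) y \<le> F k z + pen ?x" using Fy IH by (auto simp: relax_def)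
    then show ?thesis using IH sv unfolding y_def[symmetric] by (auto simp del: F.simps)
  qed
qed

end

text \<open>A prefix of the list may end within a group of equal keys; \<open>E\<close> is the part
  of this group that it contains. The form matches \<open>prefix_sum_bound\<close>.\<close>

lemma prefix_of_sorted:
  fixes key :: "'a \<Rightarrow> nat"
  assumes D: "D \<subseteq> set xs" and s: "sorted (map key xs)"
  shows "\<exists>i E. E \<subseteq> {x \<in> D. key x = i} \<and> D \<inter> set (take k xs) = {x \<in> D. key x < i} \<union> E"
proof (cases "k < length xs")
  case True
  let ?i = "key (xs ! k)"
  have lo: "key x \<le> ?i" if x: "x \<in> set (take k xs)" for x
  proof -
    obtain j where "j < k" "x = xs ! j" using x True by (auto simp: in_set_conv_nth)
    then show ?thesis using s True sorted_nth_mono[of "map key xs" j k] by simp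
  qed
  have hi: "x \<in> set (take k xs)" if x: "x \<in> set xs" "key x < ?i" for x
  proof -
    obtain j where j: "j < length xs" "x = xs ! j" using x by (auto simp: in_set_conv_nth)
    have "j < k"
    proof (rule ccontr)
      assume "\<not> j < k"
      then have "?i \<le> key x" using s True j sorted_nth_mono[of "map key xs" k j] by simp
      then show False using x by simp
    qed
    then show ?thesis using j by (auto simp: in_set_conv_nth intro!: exI[of _ j])
  qed
  show ?thesis
  proof (intro exI conjI)
    show "{x \<in> D \<inter> set (take k xs). key x = ?i} \<subseteq> {x \<in> D. key x = ?i}" by auto
    show "D \<inter> set (take k xs) = {x \<in> D. key x < ?i} \<union> {x \<in> D \<inter> set (take k xs). key x = ?i}"
      using lo hi D by (auto simp: le_less)
  qed
next
  case False
  define i where "i = Suc (Max (insert 0 (key ` set xs)))"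
  have "key x < i" if "x \<in> set xs" for x using that by (auto simp: i_def less_Suc_eq_le)
  then have "D \<inter> set (take k xs) = {x \<in> D. key x < i} \<union> {}" using False D by auto
  then show ?thesis by blast
qed

section \<open>Exchanges around the break item\<close>

locale greedy =
  fixes n b t W :: nat and w p :: "nat \<Rightarrow> nat"
  assumes w: "k < n \<Longrightarrow> 0 < w k \<and> w k \<le> W"
    and srt: "i \<le> j \<Longrightarrow> j < n \<Longrightarrow> p j * w i \<le> p i * w j"
    and bn: "b < n" and fits: "sum w {..<b} \<le> t" and over: "t < sum w {..<Suc b}"
begin

text \<open>The profit lost against the density \<open>p b / w b\<close> of the break item,
  multiplied by \<open>w b\<close> to remain an integer. Because the items are sorted by density,
  neither subtraction truncates.\<close>

definition pn :: "nat \<Rightarrow> nat" where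
  "pn k = (if b \<le> k then p b * w k - p k * w b else p k * w b - p b * w k)"

lemma pn_int: "k < n \<Longrightarrow> int (pn k) = (if b \<le> k then int (p b * w k) - int (p k * w b) else int (p k * w b) - int (p b * w k))"
  using srt[of b k] srt[of k b] bn by (auto simp: pn_def of_nat_diff)

sublocale cand n b W w pn
proof
  show "\<And>k. k < n \<Longrightarrow> 0 < w k \<and> w k \<le> W" by (rule w)
  fix i j assume ij: "i < n" "j < n" "(b \<le> i) = (b \<le> j)" "pos b i \<le> pos b j"
  have "int (pn i) * int (w j) \<le> int (pn j) * int (w i)"
  proof (cases "b \<le> i")
    case True
    then have "i \<le> j" using ij by (auto simp: pos_def)
    then have "p j * w i * w b \<le> p i * w j * w b" using srt ij by (intro mult_le_mono1) auto
    then have "int (p j) * int (w i) * int (w b) \<le> int (p i) * int (w j) * int (w b)" by (simp only: flip: of_nat_mult)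
    moreover have "int (pn i) = int (p b * w i) - int (p i * w b)" "int (pn j) = int (p b * w j) - int (p j * w b)"
      using True ij pn_int by simp_all
    ultimately show ?thesis by (simp only:) (simp add: algebra_simps)
  next
    case False
    then have "j \<le> i" using ij by (auto simp: pos_def)
    then have "p i * w j * w b \<le> p j * w i * w b" using srt ij by (intro mult_le_mono1) auto
    then have "int (p i) * int (w j) * int (w b) \<le> int (p j) * int (w i) * int (w b)" by (simp only: flip: of_nat_mult)
    moreover have "int (pn i) = int (p i * w b) - int (p b * w i)" "int (pn j) = int (p j * w b) - int (p b * w j)"
      using False ij pn_int by simp_all
    ultimately show ?thesis by (simp only:) (simp add: algebra_simps)
  qed
  then show "pn i * w j \<le> pn j * w i" by (simp only: flip: of_nat_mult)
qed

text \<open>Symmetric difference with the greedy prefix, hence an involution between solutions and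
  exchange sets.\<close>

definition flip :: "nat set \<Rightarrow> nat set" where "flip D = ({..<b} - D) \<union> (D - {..<b})"

lemma flip_sub: "D \<subseteq> {..<n} \<Longrightarrow> flip D \<subseteq> {..<n}" using bn by (auto simp: flip_def)
lemma flip_flip: "flip (flip D) = D" by (auto simp: flip_def)

lemma flip_sum:
  fixes g :: "nat \<Rightarrow> int" assumes "D \<subseteq> {..<n}"
  shows "sum g (flip D) = sum g {..<b} + (\<Sum>k\<in>D. if b \<le> k then g k else - g k)"
proof -
  have fin: "finite D" using assms finite_subset by blast
  have "sum g (flip D) = sum g ({..<b} - D) + sum g (D - {..<b})" unfolding flip_def
    by (rule sum.union_disjoint) (use fin in auto)
  moreover have "sum g {..<b} = sum g ({..<b} - D) + sum g ({..<b} \<inter> D)"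
    by (subst sum.union_disjoint[symmetric]) (auto intro!: sum.cong)
  moreover have "(\<Sum>k\<in>D. if b \<le> k then g k else - g k) = (\<Sum>k\<in>D - {..<b}. g k) + (\<Sum>k\<in>{..<b} \<inter> D. - g k)"
  proof -
    have "D = (D - {..<b}) \<union> ({..<b} \<inter> D)" by auto
    then have "(\<Sum>k\<in>D. if b \<le> k then g k else - g k) =
       (\<Sum>k\<in>D - {..<b}. if b \<le> k then g k else - g k) + (\<Sum>k\<in>{..<b} \<inter> D. if b \<le> k then g k else - g k)"
      using sum.union_disjoint[of "D - {..<b}" "{..<b} \<inter> D" "\<lambda>k. if b \<le> k then g k else - g k"] fin by auto
    moreover have "(\<Sum>k\<in>D - {..<b}. if b \<le> k then g k else - g k) = (\<Sum>k\<in>D - {..<b}. g k)" by (rule sum.cong) auto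
    moreover have "(\<Sum>k\<in>{..<b} \<inter> D. if b \<le> k then g k else - g k) = (\<Sum>k\<in>{..<b} \<inter> D. - g k)" by (rule sum.cong) auto
    ultimately show ?thesis by simp
  qed
  ultimately show ?thesis by (simp add: sum_negf)
qed

lemma flip_weight: "D \<subseteq> {..<n} \<Longrightarrow> int (sum w (flip D)) = int (sum w {..<b}) + sum val D"
  using flip_sum[of D "\<lambda>k. int (w k)"] by (simp add: val_def)

lemma flip_profit:
  assumes "D \<subseteq> {..<n}"
  shows "int (w b) * int (sum p (flip D)) = int (w b) * int (sum p {..<b}) + (int (p b) * sum val D - int (sum pn D))"
proof -
  have "(\<Sum>k\<in>D. if b \<le> k then int (w b * p k) else - int (w b * p k)) = (\<Sum>k\<in>D. int (p b) * val k - int (pn k))"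
    by (rule sum.cong[OF refl]) (use assms pn_int in \<open>auto simp: val_def algebra_simps\<close>)
  then show ?thesis using flip_sum[OF assms, of "\<lambda>k. int (w b * p k)"]
    by (simp add: sum_subtractf sum_distrib_left)
qed

abbreviation "slack \<equiv> t - sum w {..<b}"

lemma slack: "slack < w b" "slack < W" using fits over w[OF bn] by auto

text \<open>By \<open>flip_profit\<close> this is \<open>w b\<close> times the change of
  profit.\<close>

definition gain :: "nat set \<Rightarrow> int" where "gain D = int (p b) * sum val D - int (sum pn D)"

text \<open>An exchange that lowers the weight cannot gain, because its linear term is at most 0 and
  penalties only subtract. So it suffices to compare changes of weight between 0 and
  \<open>slack\<close>, which is below \<open>W\<close>.\<close>

theorem flip_optimal:
  assumes D: "D \<subseteq> {..<n}" "sum val D \<le> int slack" "0 \<le> gain D"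
    and opt: "\<And>E. E \<subseteq> {..<n} \<Longrightarrow> 0 \<le> sum val E \<Longrightarrow> sum val E \<le> int slack \<Longrightarrow> gain E \<le> gain D"
  shows "sum w (flip D) \<le> t" "S \<subseteq> {..<n} \<Longrightarrow> sum w S \<le> t \<Longrightarrow> sum p S \<le> sum p (flip D)"
proof -
  have "int slack = int t - int (sum w {..<b})" using fits by (simp only: of_nat_diff)
  then show "sum w (flip D) \<le> t" using flip_weight[OF D(1)] D(2) by linarith
  assume S: "S \<subseteq> {..<n}" "sum w S \<le> t"
  define E where "E = flip S"
  have E: "E \<subseteq> {..<n}" "flip E = S" using S flip_sub flip_flip by (auto simp: E_def)
  have sl: "int slack = int t - int (sum w {..<b})" using fits by (simp only: of_nat_diff)
  have "int (sum w S) = int (sum w {..<b}) + sum val E" using flip_weight[OF E(1)] unfolding E(2) .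
  then have sE: "sum val E \<le> int slack" unfolding sl using S(2) by linarith
  have "gain E \<le> gain D"
  proof (cases "0 \<le> sum val E")
    case True then show ?thesis using opt E sE by blast
  next
    case False
    then have "int (p b) * sum val E \<le> 0" by (simp add: mult_nonneg_nonpos)
    then have "gain E \<le> 0" unfolding gain_def by linarith
    then show ?thesis using D by linarith
  qed
  then have "int (w b) * int (sum p S) \<le> int (w b) * int (sum p (flip D))"
    using flip_profit[OF E(1)] flip_profit[OF D(1)] E by (simp add: gain_def)
  then show "sum p S \<le> sum p (flip D)" using w[OF bn] by (simp add: mult_le_cancel_left del: of_nat_sum)
qed

end

section \<open>A while language compiled to the word-RAM\<close>

datatype exp = N nat | V nat | A nat exp | Bin binop exp exp
datatype cnd = Less exp exp | Equal exp exp
datatype com = Skip | Asg nat exp | Upd nat exp exp | Seq com com (infixr ";;" 60)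
  | If cnd com com | While cnd com

type_synonym vars = "nat \<Rightarrow> nat"
type_synonym arrs = "nat \<Rightarrow> nat \<Rightarrow> nat"
type_synonym state = "vars \<times> arrs \<times> nat"

fun bop :: "binop \<Rightarrow> nat \<Rightarrow> nat \<Rightarrow> nat" where
  "bop Add x y = x + y"
| "bop Sub x y = x - y"
| "bop Mul x y = x * y"
| "bop Div x y = x div y"
| "bop Mod x y = x mod y"
| "bop _ x y = 0"

text \<open>Rules out wrap-around, so that programs can be verified over unbounded natural numbers.
  Division by zero may stay, since machine and language both use \<open>div\<close> and
  \<open>mod\<close> on natural numbers. The bit operations are excluded.\<close>

fun bop_ok :: "nat \<Rightarrow> binop \<Rightarrow> nat \<Rightarrow> nat \<Rightarrow> bool" where
  "bop_ok B Add x y \<longleftrightarrow> x + y < B"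
| "bop_ok B Sub x y \<longleftrightarrow> y \<le> x"
| "bop_ok B Mul x y \<longleftrightarrow> x * y < B"
| "bop_ok B Div x y \<longleftrightarrow> True"
| "bop_ok B Mod x y \<longleftrightarrow> True"
| "bop_ok B _ x y \<longleftrightarrow> False"

fun ev :: "exp \<Rightarrow> vars \<Rightarrow> arrs \<Rightarrow> nat" where
  "ev (N c) v a = c"
| "ev (V x) v a = v x"
| "ev (A k e) v a = a k (ev e v a)"
| "ev (Bin f e1 e2) v a = bop f (ev e1 v a) (ev e2 v a)"

text \<open>Interleaving the arrays with stride 32 lets each of them grow without allocation, and
  the shift by \<open>b\<close> puts all of them above the input, which stays in place as array
  0.\<close>

definition addr_ok :: "nat \<Rightarrow> nat \<Rightarrow> nat \<Rightarrow> nat \<Rightarrow> bool" where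
  "addr_ok B b k i \<longleftrightarrow> (if k = 0 then i < b else k < 32 \<and> (i + b) * 32 + k < B)"

fun ok :: "nat \<Rightarrow> nat \<Rightarrow> exp \<Rightarrow> vars \<Rightarrow> arrs \<Rightarrow> bool" where
  "ok B b (N c) v a \<longleftrightarrow> c < B"
| "ok B b (V x) v a \<longleftrightarrow> x < 64"
| "ok B b (A k e) v a \<longleftrightarrow> ok B b e v a \<and> addr_ok B b k (ev e v a)"
| "ok B b (Bin f e1 e2) v a \<longleftrightarrow> ok B b e1 v a \<and> ok B b e2 v a \<and> bop_ok B f (ev e1 v a) (ev e2 v a)"

fun cval :: "cnd \<Rightarrow> vars \<Rightarrow> arrs \<Rightarrow> bool" where
  "cval (Less e1 e2) v a \<longleftrightarrow> ev e1 v a < ev e2 v a"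
| "cval (Equal e1 e2) v a \<longleftrightarrow> ev e1 v a = ev e2 v a"

fun cok :: "nat \<Rightarrow> nat \<Rightarrow> cnd \<Rightarrow> vars \<Rightarrow> arrs \<Rightarrow> bool" where
  "cok B b (Less e1 e2) v a \<longleftrightarrow> ok B b e1 v a \<and> ok B b e2 v a"
| "cok B b (Equal e1 e2) v a \<longleftrightarrow> ok B b e1 v a \<and> ok B b e2 v a"

text \<open>The clock charges per assignment or test and not per instruction: one unit is meant to
  cover a stretch of code no longer than the program. A test costs 2 or 3 so as to include the jumps
  around the branches.\<close>

inductive exec :: "nat \<Rightarrow> nat \<Rightarrow> com \<Rightarrow> state \<Rightarrow> state \<Rightarrow> bool" for B b where
  Skip: "exec B b Skip s s"
| Asg: "ok B b e v a \<Longrightarrow> x < 63 \<Longrightarrow> exec B b (Asg x e) (v, a, t) (v(x := ev e v a), a, t + 1)"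
| Upd: "ok B b e1 v a \<Longrightarrow> ok B b e2 v a \<Longrightarrow> addr_ok B b k (ev e1 v a) \<Longrightarrow>
    exec B b (Upd k e1 e2) (v, a, t) (v, a(k := (a k)(ev e1 v a := ev e2 v a)), t + 1)"
| Seq: "exec B b c1 s s1 \<Longrightarrow> exec B b c2 s1 s2 \<Longrightarrow> exec B b (c1 ;; c2) s s2"
| IfT: "cok B b g v a \<Longrightarrow> cval g v a \<Longrightarrow> exec B b c1 (v, a, t + 2) s \<Longrightarrow> exec B b (If g c1 c2) (v, a, t) s"
| IfF: "cok B b g v a \<Longrightarrow> \<not> cval g v a \<Longrightarrow> exec B b c2 (v, a, t + 2) s \<Longrightarrow> exec B b (If g c1 c2) (v, a, t) s"
| WhileF: "cok B b g v a \<Longrightarrow> \<not> cval g v a \<Longrightarrow> exec B b (While g c) (v, a, t) (v, a, t + 2)"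
| WhileT: "cok B b g v a \<Longrightarrow> cval g v a \<Longrightarrow> exec B b c (v, a, t + 3) s \<Longrightarrow> exec B b (While g c) s s2 \<Longrightarrow>
    exec B b (While g c) (v, a, t) s2"

text \<open>Variables live in registers below 63 and temporaries in registers from 64 on. Register 63 holds the
  length \<open>b\<close> of the input, which is array 0; cell \<open>i\<close> of array \<open>k > 0\<close> is at address \<open>(i + b) * 32 + k\<close>.\<close>

definition caddr :: "nat \<Rightarrow> nat \<Rightarrow> instr list" where
  "caddr k d = (if k = 0 then [] else
     [Op Add (64 + d) (64 + d) 63, Const (65 + d) 32, Op Mul (64 + d) (64 + d) (65 + d),
      Const (65 + d) k, Op Add (64 + d) (64 + d) (65 + d)])"

fun cexp :: "exp \<Rightarrow> nat \<Rightarrow> instr list" where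
  "cexp (N c) d = [Const (64 + d) c]"
| "cexp (V x) d = [Move (64 + d) x]"
| "cexp (A k e) d = cexp e d @ caddr k d @ [Load (64 + d) (64 + d)]"
| "cexp (Bin f e1 e2) d = cexp e1 d @ cexp e2 (d + 1) @ [Op f (64 + d) (64 + d) (65 + d)]"

fun ccnd :: "cnd \<Rightarrow> nat \<Rightarrow> instr list" where
  "ccnd (Less e1 e2) l = (cexp e1 0 @ cexp e2 1) @ [JumpLess 64 65 l]"
| "ccnd (Equal e1 e2) l = (cexp e1 0 @ cexp e2 1) @ [JumpEq 64 65 l]"

text \<open>Code length does not depend on the position of the code, so jump targets are known
  before the code to be skipped is generated.\<close>

fun clen :: "com \<Rightarrow> nat" where
  "clen Skip = 0"
| "clen (Asg x e) = length (cexp e 0) + 1"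
| "clen (Upd k e1 e2) = length (cexp e1 0 @ caddr k 0 @ cexp e2 1) + 1"
| "clen (c1 ;; c2) = clen c1 + clen c2"
| "clen (If g c1 c2) = length (ccnd g 0) + clen c2 + 1 + clen c1"
| "clen (While g c) = length (ccnd g 0) + 1 + clen c + 1"

fun ccom :: "nat \<Rightarrow> com \<Rightarrow> instr list" where
  "ccom l Skip = []"
| "ccom l (Asg x e) = cexp e 0 @ [Move x 64]"
| "ccom l (Upd k e1 e2) = (cexp e1 0 @ caddr k 0 @ cexp e2 1) @ [Store 64 65]"
| "ccom l (c1 ;; c2) = ccom l c1 @ ccom (l + clen c1) c2"
| "ccom l (If g c1 c2) = (let l2 = l + length (ccnd g 0); l1 = l2 + clen c2 + 1 in
     ccnd g l1 @ ccom l2 c2 @ [Jump (l1 + clen c1)] @ ccom l1 c1)"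
| "ccom l (While g c) = (let lb = l + length (ccnd g 0) + 1 in
     ccnd g lb @ [Jump (lb + clen c + 1)] @ ccom lb c @ [Jump l])"

lemma length_ccnd: "length (ccnd g l) = length (ccnd g 0)" by (cases g) auto

lemma length_ccnd_0 [simp]: "NO_MATCH 0 l \<Longrightarrow> length (ccnd g l) = length (ccnd g 0)" by (rule length_ccnd)

lemma length_ccom: "length (ccom l c) = clen c"
  by (induction l c rule: ccom.induct) (auto simp: Let_def)

section \<open>Simulation of the while language by the compiled code\<close>

definition rel :: "nat \<Rightarrow> nat \<Rightarrow> vars \<Rightarrow> arrs \<Rightarrow> config \<Rightarrow> bool" where
  "rel W b v a s \<longleftrightarrow> (\<forall>x<64. regs s x = v x) \<and> v 63 = b \<and> (\<forall>i<b. mem s i = a 0 i) \<and>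
     (\<forall>k i. 0 < k \<and> k < 32 \<longrightarrow> mem s ((i + b) * 32 + k) = a k i) \<and>
     (\<forall>x. regs s x < 2 ^ W) \<and> (\<forall>x. mem s x < 2 ^ W)"

fun jump :: "instr \<Rightarrow> bool" where
  "jump (Jump l) = True" | "jump (JumpEq r r' l) = True" | "jump (JumpLess r r' l) = True" | "jump _ = False"

lemma straight_line:
  assumes "P = p @ is @ q" "pc s = length p" "\<forall>i\<in>set is. \<not> jump i"
  shows "(step W P ^^ length is) s = fold (exec_instr W) is s \<and>
    pc (fold (exec_instr W) is s) = length p + length is"
  using assms
proof (induction "is" arbitrary: p s)
  case Nil then show ?case by simp
next
  case (Cons i "is")
  have "P ! pc s = i" using Cons.prems by (simp add: nth_append)
  moreover have "\<not> halted P s" using Cons.prems by (simp add: halted_def)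
  ultimately have st: "step W P s = exec_instr W i s" by (simp add: step_def)
  have "pc (exec_instr W i s) = length (p @ [i])" using Cons.prems by (cases i) auto
  then have "(step W P ^^ length is) (exec_instr W i s) = fold (exec_instr W) is (exec_instr W i s) \<and>
    pc (fold (exec_instr W) is (exec_instr W i s)) = length (p @ [i]) + length is"
    using Cons.IH[of "p @ [i]" "exec_instr W i s"] Cons.prems by simp
  then show ?case by (simp add: funpow_Suc_right st del: funpow.simps)
qed

lemma nojump_caddr: "i \<in> set (caddr k d) \<Longrightarrow> \<not> jump i" by (auto simp: caddr_def split: if_splits)
lemma nojump_cexp: "i \<in> set (cexp e d) \<Longrightarrow> \<not> jump i"
  by (induction e d rule: cexp.induct) (auto dest: nojump_caddr)

lemma eval_bop:
  assumes "bop_ok (2 ^ W) f x y" "x < 2 ^ W" "y < 2 ^ W"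
  shows "eval_binop W f x y = bop f x y" "bop f x y < 2 ^ W"
proof -
  show lt: "bop f x y < 2 ^ W" using assms
    by (cases f) (auto intro: le_less_trans[OF div_le_dividend] le_less_trans[OF mod_less_eq_dividend])
  show "eval_binop W f x y = bop f x y" using assms lt
    by (cases f) (auto simp: take_bit_nat_eq_self_iff take_bit_eq_mod mod_if intro!: mod_less)
qed

text \<open>Frame condition for evaluation at depth \<open>d\<close>: variables and the pending
  operands of smaller depth survive, as only registers from \<open>64 + d\<close> on serve as
  scratch space.\<close>

definition same_below :: "nat \<Rightarrow> config \<Rightarrow> config \<Rightarrow> bool" where
  "same_below d s s' \<longleftrightarrow> (\<forall>x<d. regs s' x = regs s x) \<and> mem s' = mem s"

lemma rel_same_below: "rel W b v a s \<Longrightarrow> same_below (64 + d) s s' \<Longrightarrow> \<forall>x. regs s' x < 2 ^ W \<Longrightarrow> rel W b v a s'"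
  by (auto simp: rel_def same_below_def)

lemma caddr_correct:
  assumes r: "rel W b v a s" and i: "regs s (64 + d) = i" and ok: "addr_ok (2 ^ W) b k i" and W: "32 < (2::nat) ^ W"
  defines "s' \<equiv> fold (exec_instr W) (caddr k d) s"
  shows "rel W b v a s'" "same_below (64 + d) s s'" "mem s' (regs s' (64 + d)) = a k i"
    "regs s' (64 + d) = (if k = 0 then i else (i + b) * 32 + k)"
proof -
  have 63: "regs s 63 = b" using r by (auto simp: rel_def)
  have "rel W b v a s' \<and> same_below (64 + d) s s' \<and> regs s' (64 + d) = (if k = 0 then i else (i + b) * 32 + k)"
  proof (cases "k = 0")
    case True then show ?thesis using r i by (simp add: s'_def caddr_def same_below_def)
  next
    case False
    have k: "k < 32" "(i + b) * 32 + k < 2 ^ W" using ok False by (auto simp: addr_ok_def)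
    then have le: "i + b < 2 ^ W" "(i + b) * 32 < 2 ^ W" "k < 2 ^ W" by auto
    have tb: "x < 2 ^ W \<Longrightarrow> take_bit W x = x" for x :: nat by (simp add: take_bit_nat_eq_self_iff)
    have e: "s' = s\<lparr>pc := pc s + 5, regs := (regs s)(64 + d := (i + b) * 32 + k, 65 + d := k)\<rparr>"
    proof -
      have "take_bit W (i * 32 + b * 32) = i * 32 + b * 32" "take_bit W (i * 32 + b * 32 + k) = i * 32 + b * 32 + k"
        using tb[OF le(2)] tb[OF k(2)] by (simp_all add: algebra_simps)
      then show ?thesis using False i 63 by (simp add: s'_def caddr_def tb[OF le(1)] tb[OF le(3)] tb[OF W] fun_upd_twist)
    qed
    have "same_below (64 + d) s s'" by (simp add: e same_below_def)
    moreover then have "rel W b v a s'"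
      by (rule rel_same_below[OF r]) (use r k le in \<open>auto simp: e rel_def\<close>)
    ultimately show ?thesis using False by (simp add: e)
  qed
  then show *: "rel W b v a s'" "same_below (64 + d) s s'" "regs s' (64 + d) = (if k = 0 then i else (i + b) * 32 + k)" by auto
  show "mem s' (regs s' (64 + d)) = a k i" using * ok by (auto simp: rel_def addr_ok_def)
qed

lemma cexp_correct:
  assumes "rel W b v a s" "ok (2 ^ W) b e v a" "32 < (2::nat) ^ W"
  shows "rel W b v a (fold (exec_instr W) (cexp e d) s) \<and> same_below (64 + d) s (fold (exec_instr W) (cexp e d) s) \<and>
    regs (fold (exec_instr W) (cexp e d) s) (64 + d) = ev e v a"
  using assms
proof (induction e arbitrary: d s)
  case (N c)
  have tb: "take_bit W c = c" using N by (simp add: take_bit_nat_eq_self_iff)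
  then show ?case using N by (auto simp: rel_def same_below_def)
next
  case (V x)
  then have "v x = regs s x" by (simp add: rel_def)
  moreover have "regs s x < 2 ^ W" using V unfolding rel_def by blast
  ultimately have "v x < 2 ^ W" by simp
  then show ?case using V by (auto simp: rel_def same_below_def)
next
  case (A k e)
  define s1 where "s1 = fold (exec_instr W) (cexp e d) s"
  define s2 where "s2 = fold (exec_instr W) (caddr k d) s1"
  have s1: "rel W b v a s1" "same_below (64 + d) s s1" "regs s1 (64 + d) = ev e v a"
    using A by (auto simp: s1_def)
  have s2: "rel W b v a s2" "same_below (64 + d) s1 s2" "mem s2 (regs s2 (64 + d)) = a k (ev e v a)"
    unfolding s2_def using caddr_correct[OF s1(1,3)] A.prems by auto
  define s3 where "s3 = fold (exec_instr W) (cexp (A k e) d) s"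
  have eq: "s3 = s2\<lparr>pc := pc s2 + 1, regs := (regs s2)(64 + d := a k (ev e v a))\<rparr>"
    using s2 by (simp add: s1_def s2_def s3_def)
  have sb: "same_below (64 + d) s2 s3" unfolding eq by (simp add: same_below_def)
  have "a k (ev e v a) < 2 ^ W" using s2 by (metis rel_def)
  then have "rel W b v a s3"
    by (intro rel_same_below[OF s2(1) sb]) (use s2 in \<open>auto simp: eq rel_def\<close>)
  moreover have "same_below (64 + d) s s3"
    using sb s1 s2 by (simp add: same_below_def)
  ultimately show ?case unfolding s3_def[symmetric] by (simp add: eq)
next
  case (Bin f e1 e2)
  define s1 where "s1 = fold (exec_instr W) (cexp e1 d) s"
  define s2 where "s2 = fold (exec_instr W) (cexp e2 (d + 1)) s1"
  have s1: "rel W b v a s1" "same_below (64 + d) s s1" "regs s1 (64 + d) = ev e1 v a"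
    using Bin.IH(1)[of s d] Bin.prems by (auto simp: s1_def)
  have s2: "rel W b v a s2" "same_below (65 + d) s1 s2" "regs s2 (65 + d) = ev e2 v a"
    using Bin.IH(2)[of s1 "d + 1"] Bin.prems s1 by (auto simp: s2_def)
  have r1: "regs s2 (64 + d) = ev e1 v a" using s1 s2 by (simp add: same_below_def)
  have lt: "ev e1 v a < 2 ^ W" "ev e2 v a < 2 ^ W" using r1 s2 by (auto simp: rel_def) (metis r1, metis)
  note eb = eval_bop[OF _ lt, of f]
  define s3 where "s3 = fold (exec_instr W) (cexp (Bin f e1 e2) d) s"
  have eq: "s3 =
     s2\<lparr>pc := pc s2 + 1, regs := (regs s2)(64 + d := ev (Bin f e1 e2) v a)\<rparr>"
    using s2 r1 eb Bin.prems by (simp add: s1_def s2_def s3_def)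
  have sb: "same_below (64 + d) s2 s3" unfolding eq by (simp add: same_below_def)
  have "ev (Bin f e1 e2) v a < 2 ^ W" using eb Bin.prems by simp
  then have "rel W b v a s3"
    by (intro rel_same_below[OF s2(1) sb]) (use s2 in \<open>auto simp: eq rel_def\<close>)
  moreover have "same_below (64 + d) s s3"
    using sb s1 s2 by (simp add: same_below_def)
  ultimately show ?case unfolding s3_def[symmetric] by (simp add: eq)
qed

lemma two_exps_correct:
  assumes "rel W b v a s" "ok (2 ^ W) b e1 v a" "ok (2 ^ W) b e2 v a" "32 < (2::nat) ^ W"
  defines "s' \<equiv> fold (exec_instr W) (cexp e1 0 @ cexp e2 1) s"
  shows "rel W b v a s'" "regs s' 64 = ev e1 v a" "regs s' 65 = ev e2 v a"
proof -
  define s1 where "s1 = fold (exec_instr W) (cexp e1 0) s"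
  have s1: "rel W b v a s1" "regs s1 64 = ev e1 v a"
    using cexp_correct[OF assms(1,2,4), of 0] by (auto simp: s1_def)
  have "rel W b v a s'" "same_below 65 s1 s'" "regs s' 65 = ev e2 v a"
    using cexp_correct[OF s1(1) assms(3,4), of 1] by (auto simp: s'_def s1_def)
  then show "rel W b v a s'" "regs s' 64 = ev e1 v a" "regs s' 65 = ev e2 v a"
    using s1 by (auto simp: same_below_def)
qed

lemma rel_pc [simp]: "rel W b v a (s\<lparr>pc := x\<rparr>) = rel W b v a s" by (simp add: rel_def)

lemma step_at:
  assumes "P = p @ [i] @ q" "pc s = length p"
  shows "step W P s = exec_instr W i s"
  using assms by (simp add: step_def halted_def nth_append)

lemma ccnd_correct:
  assumes "P = p @ ccnd g l @ q" "pc s = length p" "rel W b v a s" "cok (2 ^ W) b g v a" "32 < (2::nat) ^ W"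
  shows "\<exists>s'. (step W P ^^ length (ccnd g 0)) s = s' \<and> rel W b v a s' \<and>
    pc s' = (if cval g v a then l else length p + length (ccnd g 0))"
proof -
  obtain e1 e2 j where g: "ccnd g l = (cexp e1 0 @ cexp e2 1) @ [j]" "ok (2 ^ W) b e1 v a" "ok (2 ^ W) b e2 v a"
    "j = JumpLess 64 65 l \<and> cval g v a = (ev e1 v a < ev e2 v a) \<or>
     j = JumpEq 64 65 l \<and> cval g v a = (ev e1 v a = ev e2 v a)"
    using assms(4) by (cases g) auto
  let ?c = "cexp e1 0 @ cexp e2 1"
  have len: "length (ccnd g 0) = length ?c + 1" using g(1) by (metis length_ccnd length_append_singleton Suc_eq_plus1)
  define s1 where "s1 = fold (exec_instr W) ?c s"
  have s1: "(step W P ^^ length ?c) s = s1" "pc s1 = length (p @ ?c)"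
    using straight_line[of P p ?c "[j] @ q" s W] assms(1,2) g(1) by (auto simp: s1_def dest: nojump_cexp)
  note r = two_exps_correct[OF assms(3) g(2,3) assms(5), folded s1_def]
  have st: "step W P s1 = exec_instr W j s1" by (rule step_at[of _ "p @ ?c" _ q]) (use assms(1) g(1) s1 in simp_all)
  have "(step W P ^^ length (ccnd g 0)) s = step W P s1" unfolding len using s1(1) by simp
  moreover have "rel W b v a (step W P s1)" "pc (step W P s1) = (if cval g v a then l else length p + length (ccnd g 0))"
    unfolding st using g(4) r s1(2) len by auto
  ultimately show ?thesis by blast
qed

lemma rel_asg: "rel W b v a s \<Longrightarrow> x < 63 \<Longrightarrow> rel W b (v(x := regs s y)) a (s\<lparr>pc := l, regs := (regs s)(x := regs s y)\<rparr>)"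
  by (auto simp: rel_def)

text \<open>No two cells share an address: the residue modulo 32 determines the array, the quotient
  the index, and addresses outside array 0 are at least \<open>b\<close>.\<close>

lemma rel_upd:
  assumes r: "rel W b v a s" and k: "addr_ok (2 ^ W) b k i" and ad: "ad = (if k = 0 then i else (i + b) * 32 + k)"
  shows "rel W b v (a(k := (a k)(i := regs s y))) (s\<lparr>pc := l, mem := (mem s)(ad := regs s y)\<rparr>)"
proof -
  have lt: "j < (x + b) * 32 + m" if "j < b" for j x m :: nat
  proof -
    have "b \<le> (x + b) * 32" by (rule order_trans[of _ "x + b"]) simp_all
    then show ?thesis using that by linarith
  qed
  then have "(x + b) * 32 + m \<noteq> i" if "i < b" for x m :: nat using that by (metis less_irrefl)
  moreover have "x = i \<and> m = k" if "(x + b) * 32 + m = (i + b) * 32 + k" "m < 32" "k < 32" for x m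
  proof -
    have "((x + b) * 32 + m) mod 32 = ((i + b) * 32 + k) mod 32" using that(1) by (rule arg_cong)
    then have "m mod 32 = k mod 32" by (simp only: mod_mult_self3)
    then have "m = k" using that by simp
    then show ?thesis using that by simp
  qed
  moreover have "j \<noteq> (i + b) * 32 + k" if "j < b" for j using that lt by (metis less_irrefl)
  ultimately show ?thesis using r k unfolding rel_def addr_ok_def ad by (auto split: if_splits)
qed

lemma simI:
  assumes "(step W P ^^ m) cf = s2" "rel W b (fst s') (fst (snd s')) s2" "pc s2 = l" "m + x \<le> y"
  shows "\<exists>m. rel W b (fst s') (fst (snd s')) ((step W P ^^ m) cf) \<and> pc ((step W P ^^ m) cf) = l \<and> m + x \<le> y"
  using assms by blast

text \<open>Each unit of the clock pays for \<open>length P\<close> machine steps, which is enough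
  for any stretch of \<open>P\<close> without a backward jump. With the clock on both sides of the
  inequality, the bound is additive under composition.\<close>

lemma exec_sim:
  assumes "exec (2 ^ W) b c s s'" "32 < (2::nat) ^ W" "P = p @ ccom (length p) c @ q"
    "rel W b (fst s) (fst (snd s)) cf" "pc cf = length p"
  shows "\<exists>m. rel W b (fst s') (fst (snd s')) ((step W P ^^ m) cf) \<and>
     pc ((step W P ^^ m) cf) = length p + clen c \<and> m + length P * snd (snd s) \<le> length P * snd (snd s')"
  using assms
proof (induction arbitrary: p q cf rule: exec.induct)
  case (Skip s) show ?case by (rule exI[of _ 0]) (use Skip in simp)
next
  case (Asg e v a x t)
  define s1 where "s1 = fold (exec_instr W) (cexp e 0) cf"
  have s1: "(step W P ^^ length (cexp e 0)) cf = s1" "pc s1 = length (p @ cexp e 0)"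
    using straight_line[of P p "cexp e 0" "[Move x 64] @ q" cf W] Asg by (auto simp: s1_def dest: nojump_cexp)
  have r: "rel W b v a s1" "regs s1 64 = ev e v a" using cexp_correct[of W b v a cf e 0] Asg by (auto simp: s1_def)
  have "step W P s1 = exec_instr W (Move x 64) s1" by (rule step_at[of _ "p @ cexp e 0" _ q]) (use Asg s1 in simp_all)
  then have "(step W P ^^ (length (cexp e 0) + 1)) cf = exec_instr W (Move x 64) s1" using s1 by simp
  moreover have "rel W b (v(x := ev e v a)) a (exec_instr W (Move x 64) s1)"
    using rel_asg[OF r(1) Asg(2), of 64] r by simp
  moreover have "length (cexp e 0) + 1 \<le> length P" using Asg by simp
  ultimately show ?case by (intro simI) (use s1 in \<open>auto simp: algebra_simps\<close>)
next
  case (Upd e1 v a e2 k t)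
  let ?c = "cexp e1 0 @ caddr k 0 @ cexp e2 1"
  define s1 where "s1 = fold (exec_instr W) (cexp e1 0) cf"
  define s2 where "s2 = fold (exec_instr W) (caddr k 0) s1"
  define s3 where "s3 = fold (exec_instr W) (cexp e2 1) s2"
  have st: "(step W P ^^ length ?c) cf = s3" "pc s3 = length (p @ ?c)"
    using straight_line[of P p ?c "[Store 64 65] @ q" cf W] Upd
    by (auto simp: s1_def s2_def s3_def dest: nojump_cexp nojump_caddr)
  have s1: "rel W b v a s1" "regs s1 (64 + 0) = ev e1 v a" using cexp_correct[of W b v a cf e1 0] Upd by (auto simp: s1_def)
  have s2: "rel W b v a s2" "regs s2 64 = (if k = 0 then ev e1 v a else (ev e1 v a + b) * 32 + k)"
    using caddr_correct[OF s1, of k] Upd by (auto simp: s2_def)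
  have s3: "rel W b v a s3" "regs s3 65 = ev e2 v a" "regs s3 64 = regs s2 64"
    using cexp_correct[OF s2(1), of e2 1] Upd by (auto simp: s3_def same_below_def)
  have "step W P s3 = exec_instr W (Store 64 65) s3" by (rule step_at[of _ "p @ ?c" _ q]) (use Upd st in simp_all)
  then have "(step W P ^^ (length ?c + 1)) cf = exec_instr W (Store 64 65) s3" using st by simp
  moreover have "rel W b v (a(k := (a k)(ev e1 v a := ev e2 v a))) (exec_instr W (Store 64 65) s3)"
    using rel_upd[OF s3(1) Upd(3), of "regs s3 64" 65] s2 s3 by simp
  moreover have "length ?c + 1 \<le> length P" using Upd by simp
  ultimately show ?case by (intro simI) (use st in \<open>auto simp: algebra_simps\<close>)
next
  case (Seq c1 s s1 c2 s2)
  have P1: "P = p @ ccom (length p) c1 @ (ccom (length p + clen c1) c2 @ q)" using Seq.prems by simp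
  obtain m1 where m1: "rel W b (fst s1) (fst (snd s1)) ((step W P ^^ m1) cf)"
     "pc ((step W P ^^ m1) cf) = length p + clen c1" "m1 + length P * snd (snd s) \<le> length P * snd (snd s1)"
    using Seq.IH(1)[OF Seq.prems(1) P1 Seq.prems(3,4)] by blast
  have l: "length (p @ ccom (length p) c1) = length p + clen c1" by (simp add: length_ccom)
  have P2: "P = (p @ ccom (length p) c1) @ ccom (length (p @ ccom (length p) c1)) c2 @ q"
    unfolding l using Seq.prems by simp
  obtain m2 where m2: "rel W b (fst s2) (fst (snd s2)) ((step W P ^^ m2) ((step W P ^^ m1) cf))"
     "pc ((step W P ^^ m2) ((step W P ^^ m1) cf)) = length p + clen c1 + clen c2"
     "m2 + length P * snd (snd s1) \<le> length P * snd (snd s2)"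
    using Seq.IH(2)[OF Seq.prems(1) P2 m1(1)] m1(2) l by auto
  have "(step W P ^^ (m2 + m1)) cf = (step W P ^^ m2) ((step W P ^^ m1) cf)" by (simp add: funpow_add)
  then show ?case by (rule simI) (use m1 m2 in auto)
next
  case (IfT g v a c1 t s c2)
  let ?l2 = "length p + length (ccnd g 0)" and ?n = "length (ccnd g 0)"
  let ?l1 = "?l2 + clen c2 + 1"
  let ?pre = "p @ ccnd g ?l1 @ ccom ?l2 c2 @ [Jump (?l1 + clen c1)]"
  have P0: "P = p @ ccnd g ?l1 @ (ccom ?l2 c2 @ [Jump (?l1 + clen c1)] @ ccom ?l1 c1 @ q)"
    using IfT.prems by (simp add: Let_def)
  obtain s1 where s1: "(step W P ^^ ?n) cf = s1" "rel W b v a s1" "pc s1 = ?l1"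
    using ccnd_correct[OF P0 _ _ IfT(1) IfT.prems(1), of cf] IfT by auto
  have l: "length ?pre = ?l1" by (simp add: length_ccom)
  have P1: "P = ?pre @ ccom (length ?pre) c1 @ q" unfolding l using P0 by simp
  obtain m where m: "rel W b (fst s) (fst (snd s)) ((step W P ^^ m) s1)"
     "pc ((step W P ^^ m) s1) = ?l1 + clen c1" "m + length P * (t + 2) \<le> length P * snd (snd s)"
    using IfT.IH[OF IfT.prems(1) P1, of s1] s1 l by auto
  have "?n \<le> length P" using arg_cong[OF P0, of length] by simp
  then have "m + ?n + length P * t \<le> length P * snd (snd s)" using m(3) by (simp add: algebra_simps)
  moreover have "(step W P ^^ (m + ?n)) cf = (step W P ^^ m) s1" using s1 by (simp add: funpow_add)
  ultimately show ?case by (intro simI) (use m in auto)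
next
  case (IfF g v a c2 t s c1)
  let ?l2 = "length p + length (ccnd g 0)" and ?n = "length (ccnd g 0)"
  let ?l1 = "?l2 + clen c2 + 1"
  let ?pre = "p @ ccnd g ?l1"
  have P0: "P = p @ ccnd g ?l1 @ (ccom ?l2 c2 @ [Jump (?l1 + clen c1)] @ ccom ?l1 c1 @ q)"
    using IfF.prems by (simp add: Let_def)
  obtain s1 where s1: "(step W P ^^ ?n) cf = s1" "rel W b v a s1" "pc s1 = ?l2"
    using ccnd_correct[OF P0 _ _ IfF(1) IfF.prems(1), of cf] IfF by auto
  have l: "length ?pre = ?l2" by simp
  have P1: "P = ?pre @ ccom (length ?pre) c2 @ ([Jump (?l1 + clen c1)] @ ccom ?l1 c1 @ q)" unfolding l using P0 by simp
  obtain m where m: "rel W b (fst s) (fst (snd s)) ((step W P ^^ m) s1)"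
     "pc ((step W P ^^ m) s1) = ?l2 + clen c2" "m + length P * (t + 2) \<le> length P * snd (snd s)"
    using IfF.IH[OF IfF.prems(1) P1, of s1] s1 l by auto
  have "step W P ((step W P ^^ m) s1) = exec_instr W (Jump (?l1 + clen c1)) ((step W P ^^ m) s1)"
    by (rule step_at[of _ "?pre @ ccom ?l2 c2" _ "ccom ?l1 c1 @ q"]) (use P0 m l in \<open>simp_all add: length_ccom\<close>)
  then have j: "(step W P ^^ (1 + (m + ?n))) cf = ((step W P ^^ m) s1)\<lparr>pc := ?l1 + clen c1\<rparr>"
    using s1 by (simp add: funpow_add)
  have "?n + 1 \<le> length P" using arg_cong[OF P0, of length] by simp
  then have "1 + (m + ?n) + length P * t \<le> length P * snd (snd s)" using m(3) by (simp add: algebra_simps)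
  then show ?case by (intro simI[OF j]) (use m in auto)
next
  case (WhileF g v a c t)
  let ?n = "length (ccnd g 0)" let ?lb = "length p + ?n + 1"
  have P0: "P = p @ ccnd g ?lb @ ([Jump (?lb + clen c + 1)] @ ccom ?lb c @ [Jump (length p)] @ q)"
    using WhileF.prems by (simp add: Let_def)
  obtain s1 where s1: "(step W P ^^ ?n) cf = s1" "rel W b v a s1" "pc s1 = length p + ?n"
    using ccnd_correct[OF P0 _ _ WhileF(1) WhileF.prems(1), of cf] WhileF by auto
  have "step W P s1 = exec_instr W (Jump (?lb + clen c + 1)) s1"
    by (rule step_at[of _ "p @ ccnd g ?lb" _ "ccom ?lb c @ [Jump (length p)] @ q"]) (use P0 s1 in simp_all)
  then have j: "(step W P ^^ (1 + ?n)) cf = s1\<lparr>pc := ?lb + clen c + 1\<rparr>" using s1 by (simp add: funpow_add)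
  have "?n + 1 \<le> length P" using arg_cong[OF P0, of length] by simp
  then show ?case by (intro simI[OF j]) (use s1 in \<open>auto simp: algebra_simps\<close>)
next
  case (WhileT g v a c t s s2)
  let ?n = "length (ccnd g 0)" let ?lb = "length p + ?n + 1"
  let ?pre = "p @ ccnd g ?lb @ [Jump (?lb + clen c + 1)]"
  have P0: "P = p @ ccnd g ?lb @ ([Jump (?lb + clen c + 1)] @ ccom ?lb c @ [Jump (length p)] @ q)"
    using WhileT.prems by (simp add: Let_def)
  obtain s1 where s1: "(step W P ^^ ?n) cf = s1" "rel W b v a s1" "pc s1 = ?lb"
    using ccnd_correct[OF P0 _ _ WhileT(1) WhileT.prems(1), of cf] WhileT by auto
  have l: "length ?pre = ?lb" by simp
  have P1: "P = ?pre @ ccom (length ?pre) c @ ([Jump (length p)] @ q)" unfolding l using P0 by simp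
  obtain m where m: "rel W b (fst s) (fst (snd s)) ((step W P ^^ m) s1)"
     "pc ((step W P ^^ m) s1) = ?lb + clen c" "m + length P * (t + 3) \<le> length P * snd (snd s)"
    using WhileT.IH(1)[OF WhileT.prems(1) P1, of s1] s1 l by auto
  have "step W P ((step W P ^^ m) s1) = exec_instr W (Jump (length p)) ((step W P ^^ m) s1)"
    by (rule step_at[of _ "?pre @ ccom ?lb c" _ q]) (use P0 m l in \<open>simp_all add: length_ccom\<close>)
  then have j: "(step W P ^^ (1 + (m + ?n))) cf = ((step W P ^^ m) s1)\<lparr>pc := length p\<rparr>"
    using s1 by (simp add: funpow_add)
  obtain m2 where m2: "rel W b (fst s2) (fst (snd s2)) ((step W P ^^ m2) (((step W P ^^ m) s1)\<lparr>pc := length p\<rparr>))"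
     "pc ((step W P ^^ m2) (((step W P ^^ m) s1)\<lparr>pc := length p\<rparr>)) = length p + clen (While g c)"
     "m2 + length P * snd (snd s) \<le> length P * snd (snd s2)"
    using WhileT.IH(2)[OF WhileT.prems(1,2), of "((step W P ^^ m) s1)\<lparr>pc := length p\<rparr>"] m by auto
  have "?n + 1 \<le> length P" using arg_cong[OF P0, of length] by simp
  then have le: "m2 + (1 + (m + ?n)) + length P * t \<le> length P * snd (snd s2)" using m(3) m2(3) by (simp add: algebra_simps)
  have E: "(step W P ^^ (m2 + (1 + (m + ?n)))) cf = (step W P ^^ m2) (((step W P ^^ m) s1)\<lparr>pc := length p\<rparr>)"
    unfolding funpow_add[of m2] using j by (simp only: o_apply)
  show ?case by (rule simI[OF E]) (use m2 le in auto)
qed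

section \<open>Weakest preconditions for total correctness, including the clock\<close>

definition wp :: "nat \<Rightarrow> nat \<Rightarrow> com \<Rightarrow> (state \<Rightarrow> bool) \<Rightarrow> state \<Rightarrow> bool" where
  "wp B b c Q s \<longleftrightarrow> (\<exists>s'. exec B b c s s' \<and> Q s')"

inductive_cases SkipE: "exec B b Skip s s'"
inductive_cases AsgE: "exec B b (Asg x e) s s'"
inductive_cases UpdE: "exec B b (Upd k e1 e2) s s'"
inductive_cases SeqE: "exec B b (c1 ;; c2) s s'"
inductive_cases IfE: "exec B b (If g c1 c2) s s'"

lemma wp_Skip [simp]: "wp B b Skip Q s = Q s"
  unfolding wp_def by (metis SkipE exec.Skip)
lemma wp_Asg [simp]: "wp B b (Asg x e) Q (v, a, t) = (ok B b e v a \<and> x < 63 \<and> Q (v(x := ev e v a), a, t + 1))"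
  unfolding wp_def
  apply (rule iffI)
   apply (elim exE conjE, erule AsgE, simp)
  apply (elim conjE, rule exI, rule conjI, rule exec.Asg, assumption+)
  done
lemma wp_Upd [simp]: "wp B b (Upd k e1 e2) Q (v, a, t) = (ok B b e1 v a \<and> ok B b e2 v a \<and> addr_ok B b k (ev e1 v a) \<and>
    Q (v, a(k := (a k)(ev e1 v a := ev e2 v a)), t + 1))"
  unfolding wp_def
  apply (rule iffI)
   apply (elim exE conjE, erule UpdE, simp)
  apply (elim conjE, rule exI, rule conjI, rule exec.Upd, assumption+)
  done
lemma wp_Seq [simp]: "wp B b (c1 ;; c2) Q s = wp B b c1 (wp B b c2 Q) s"
  unfolding wp_def by (metis SeqE exec.Seq)
lemma wp_If [simp]: "wp B b (If g c1 c2) Q (v, a, t) = (cok B b g v a \<and>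
    (cval g v a \<longrightarrow> wp B b c1 Q (v, a, t + 2)) \<and> (\<not> cval g v a \<longrightarrow> wp B b c2 Q (v, a, t + 2)))"
  unfolding wp_def
  apply (rule iffI)
   apply (elim exE conjE, erule IfE, auto)[1]
  apply (cases "cval g v a")
   apply (metis exec.IfT)
  apply (metis exec.IfF)
  done

text \<open>The number \<open>n\<close> of rounds is fixed beforehand, so the index of the invariant
  serves at once as termination measure and as the basis of the time bound.\<close>

lemma wp_While:
  assumes inv: "Inv 0 v a t"
    and step: "\<And>i v a t. i < n \<Longrightarrow> Inv i v a t \<Longrightarrow> cok B b g v a \<and> cval g v a \<and>
      wp B b c (\<lambda>(v, a, t). Inv (Suc i) v a t) (v, a, t + 3)"
    and fin: "\<And>v a t. Inv n v a t \<Longrightarrow> cok B b g v a \<and> \<not> cval g v a \<and> Q (v, a, t + 2)"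
  shows "wp B b (While g c) Q (v, a, t)"
proof -
  have "wp B b (While g c) Q (v, a, t)" if "i \<le> n" "Inv i v a t" for i v a t
    using that
  proof (induction "n - i" arbitrary: i v a t)
    case 0
    then have "Inv n v a t" by simp
    from fin[OF this] show ?case unfolding wp_def by (blast intro: exec.WhileF)
  next
    case (Suc k)
    then have "i < n" by simp
    from step[OF this Suc.prems(2)] obtain s where s: "cok B b g v a" "cval g v a" "exec B b c (v, a, t + 3) s"
      "case s of (v, a, t) \<Rightarrow> Inv (Suc i) v a t" unfolding wp_def by blast
    obtain v' a' t' where s': "s = (v', a', t')" by (cases s) auto
    have "wp B b (While g c) Q s" unfolding s' by (rule Suc.hyps(1)[of "Suc i"]) (use Suc s s' in auto)
    then show ?case using s unfolding wp_def by (blast intro: exec.WhileT)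
  qed
  from this[of 0] inv show ?thesis by simp
qed

text \<open>Puts the length \<open>2 * n + 2\<close> of the input into register 63, where every
  address computation expects it.\<close>

definition prologue :: program where
  "prologue = [Const 64 0, Load 64 64, Op Add 64 64 64, Const 65 2, Op Add 63 64 65]"

definition compile :: "com \<Rightarrow> program" where
  "compile c = prologue @ ccom 5 c"

lemma compile_correct:
  assumes W: "32 < (2::nat) ^ W" and xs: "xs \<noteq> []" "\<forall>x\<in>set xs. x < 2 ^ W" and b: "length xs = 2 * hd xs + 2" "length xs < 2 ^ W"
    and wp: "wp (2 ^ W) (length xs) c Q ((\<lambda>_. 0)(63 := length xs), (\<lambda>k i. if k = 0 \<and> i < length xs then xs ! i else 0), 0)"
  shows "\<exists>T v a t. (let s = (step W (compile c) ^^ T) (init_config xs) in halted (compile c) s \<and>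
     (\<forall>i<length xs. mem s i = a 0 i)) \<and> Q (v, a, t) \<and> T \<le> 5 + length (compile c) * t"
proof -
  let ?P = "compile c" and ?b = "length xs"
  let ?v = "(\<lambda>_. 0)(63 := ?b)" and ?a = "\<lambda>k i. if k = 0 \<and> i < ?b then xs ! i else 0"
  define s0 where "s0 = init_config xs"
  define s1 where "s1 = fold (exec_instr W) prologue s0"
  have len: "length prologue = 5" by (simp add: prologue_def)
  have pre: "?P = [] @ prologue @ ccom 5 c" "pc s0 = length []" "\<forall>i\<in>set prologue. \<not> jump i"
    by (auto simp: compile_def s0_def init_config_def prologue_def)
  have "(step W ?P ^^ length prologue) s0 = s1 \<and> pc s1 = length ([] :: instr list) + length prologue"
    unfolding s1_def by (rule straight_line[OF pre])
  then have st: "(step W ?P ^^ 5) s0 = s1 \<and> pc s1 = 5" unfolding len by simp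
  have tb: "x < 2 ^ W \<Longrightarrow> take_bit W x = x" for x :: nat by (simp add: take_bit_nat_eq_self_iff)
  have h: "xs ! 0 = hd xs" using xs by (simp add: hd_conv_nth)
  have "hd xs + hd xs < 2 ^ W" "2 * hd xs + 2 < 2 ^ W" "2 < (2::nat) ^ W" using b less_trans[OF _ W, of 2] by auto
  note t = this[THEN tb]
  have s1: "s1 = \<lparr>pc = 5, regs = (\<lambda>_. 0)(64 := 2 * hd xs, 65 := 2, 63 := ?b), mem = (\<lambda>i. if i < ?b then xs ! i else 0)\<rparr>"
    using xs t h b by (simp add: mult_2 s1_def s0_def prologue_def init_config_def fun_upd_twist)
  have bnd: "2 * hd xs < 2 ^ W" "(2::nat) < 2 ^ W" "0 < (2::nat) ^ W" using b W by auto
  have r: "rel W ?b ?v ?a s1"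
    unfolding rel_def s1 using xs b bnd by (auto simp: nth_mem)
  obtain s' where s': "exec (2 ^ W) ?b c (?v, ?a, 0) s'" "Q s'" using wp unfolding wp_def by blast
  have P: "?P = prologue @ ccom (length prologue) c @ []" unfolding len by (simp add: compile_def)
  obtain m where m: "rel W ?b (fst s') (fst (snd s')) ((step W ?P ^^ m) s1)"
     "pc ((step W ?P ^^ m) s1) = length prologue + clen c" "m + length ?P * 0 \<le> length ?P * snd (snd s')"
    using exec_sim[OF s'(1) W P, of s1] r st by (auto simp: prologue_def)
  have e: "(step W ?P ^^ (m + 5)) s0 = (step W ?P ^^ m) s1" unfolding funpow_add o_apply using st by simp
  have lP: "length ?P = length prologue + clen c" by (simp add: compile_def length_ccom)
  have "halted ?P ((step W ?P ^^ (m + 5)) s0)" "\<forall>i<?b. mem ((step W ?P ^^ (m + 5)) s0) i = fst (snd s') 0 i"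
    unfolding e using m lP by (auto simp: halted_def rel_def)
  then show ?thesis using s'(2) m(3) unfolding s0_def Let_def
    by (intro exI[of _ "m + 5"] exI[of _ "fst s'"] exI[of _ "fst (snd s')"] exI[of _ "snd (snd s')"]) auto
qed

section \<open>The program\<close>

text \<open>Allocation of the variables: 0 number of items, 1 capacity, 2 maximal weight, 10 maximal key, 12 whether an item was left out,
  13 weight of the greedy prefix, 14 break index, 15 square root and 16 twice the maximal weight rounded up (to a power of 2),
  17 half the width of the table, 22--24 break item with its profit and weight, 25 slack, 26 number of candidates, 27 row length.
  Arrays: 0 input and output, 1 weights, 2 profits, 3 keys, 4 sorted order, 8 solution, 9 logarithms, 10 bit reversal, 11 candidates,
  12 their keys, 13 table; 16--21 class sizes, quotas and admitted ranks, even for insertions and odd for removals.\<close>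

declare add_2_eq_Suc [simp del] add_2_eq_Suc' [simp del]

abbreviation Plus (infixl "|+|" 65) where "e1 |+| e2 \<equiv> Bin Add e1 e2"
abbreviation Minus (infixl "|-|" 65) where "e1 |-| e2 \<equiv> Bin Sub e1 e2"
abbreviation Times (infixl "|*|" 70) where "e1 |*| e2 \<equiv> Bin Mul e1 e2"
abbreviation Quot (infixl "|div|" 70) where "e1 |div| e2 \<equiv> Bin Div e1 e2"
abbreviation Rest (infixl "|mod|" 70) where "e1 |mod| e2 \<equiv> Bin Mod e1 e2"
abbreviation Inc :: "nat \<Rightarrow> com" where "Inc x \<equiv> Asg x (V x |+| N 1)"

text \<open>\<open>IM\<close> is a common bound for indices and intermediate values. The single
  assumption discharges overflow and address conditions through \<open>ltB\<close> and
  \<open>addr\<close>.\<close>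

locale mach =
  fixes B b IM :: nat
  assumes big: "(IM + b) * 32 + 31 < B"
begin

lemma ltB: "x \<le> IM \<Longrightarrow> x < B"
proof -
  have "IM + b \<le> (IM + b) * 32" by simp
  then show "x \<le> IM \<Longrightarrow> x < B" using big by linarith
qed
lemma addr: "0 < k \<Longrightarrow> k < 32 \<Longrightarrow> x \<le> IM \<Longrightarrow> addr_ok B b k x"
proof -
  assume "0 < k" "k < 32" "x \<le> IM"
  moreover then have "(x + b) * 32 \<le> (IM + b) * 32" by simp
  ultimately show ?thesis using big by (simp add: addr_ok_def)
qed

end

text \<open>One pass of a bucket sort: variable 20 is the number of elements, variable 21 the number of buckets, array \<open>oa\<close>
  the list of elements, array \<open>da\<close> maps an element to its bucket.\<close>

definition bucket_pass :: "nat \<Rightarrow> nat \<Rightarrow> com" where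
  "bucket_pass oa da =
     Asg 3 (N 0) ;;
     While (Less (V 3) (V 20))
      (Asg 5 (A oa (V 3)) ;; Asg 6 (A da (V 5)) ;;
       Upd 7 (V 6 |*| V 20 |+| A 6 (V 6)) (V 5) ;;
       Upd 6 (V 6) (A 6 (V 6) |+| N 1) ;;
       Inc 3) ;;
     Asg 7 (N 0) ;; Asg 6 (N 0) ;;
     While (Less (V 6) (V 21))
      (Asg 8 (N 0) ;;
       While (Less (V 8) (A 6 (V 6)))
        (Upd oa (V 7) (A 7 (V 6 |*| V 20 |+| V 8)) ;; Inc 7 ;; Inc 8) ;;
       Upd 6 (V 6) (N 0) ;;
       Inc 6)"

lemma mult_add_cancel: "(y::nat) * n + i = y' * n + j \<Longrightarrow> i < n \<Longrightarrow> j < n \<Longrightarrow> y = y' \<and> i = j"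
proof -
  assume e: "y * n + i = y' * n + j" and ij: "i < n" "j < n"
  have "(y * n + i) div n = (y' * n + j) div n" using e by (rule arg_cong)
  then have "y = y'" using ij by simp
  then show ?thesis using e by simp
qed

context mach
begin

text \<open>The postcondition is a continuation \<open>Q\<close> under frame conditions, so that
  specifications of consecutive commands chain through \<open>wp_Seq\<close>. Array 6 must be zero
  on entry and is cleared again on the way, which makes passes repeatable. Array 7 stores the
  buckets as rows of length \<open>m\<close>.\<close>

lemma bucket_pass:
  assumes v: "v 20 = m" "v 21 = Bn" and xs: "length xs = m" "\<And>i. i < m \<Longrightarrow> a oa i = xs ! i"
    and f: "\<And>x. x \<in> set xs \<Longrightarrow> a da x = f x \<and> f x < Bn \<and> x \<le> IM"
    and cnt: "\<And>y. a 6 y = 0"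
    and ids: "0 < oa" "oa < 32" "oa \<noteq> 6" "oa \<noteq> 7" "0 < da" "da < 32" "da \<noteq> 6" "da \<noteq> 7" "da \<noteq> oa"
    and IM: "Bn * m + m + Bn + 1 \<le> IM"
    and Q: "\<And>v' a' t'. \<lbrakk>\<forall>x. x \<notin> {3, 5, 6, 7, 8} \<longrightarrow> v' x = v x; \<forall>k. k \<notin> {oa, 6, 7} \<longrightarrow> a' k = a k;
       \<And>i. i < m \<Longrightarrow> a' oa i = bucket f Bn xs ! i; \<And>y. a' 6 y = 0; t' \<le> t + 20 * m + 20 * Bn + 20\<rbrakk> \<Longrightarrow> Q (v', a', t')"
  shows "wp B b (bucket_pass oa da) Q (v, a, t)"
proof -
  define fl where "fl y = filter (\<lambda>x. f x = y)" for y
  have fl_len: "length (fl y (take i xs)) \<le> m" for y i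
    using xs(1) order_trans[OF length_filter_le, of "take i xs" m] by (simp add: fl_def)
  have lenb: "length (bucket f y xs) \<le> m" for y using length_filter_le[of _ xs] xs(1) by (simp add: length_bucket_filter)
  define I1 where "I1 i v' a' t' \<longleftrightarrow> v' 3 = i \<and> (\<forall>x. x \<notin> {3, 5, 6} \<longrightarrow> v' x = v x) \<and> (\<forall>k. k \<notin> {6, 7} \<longrightarrow> a' k = a k) \<and>
     (\<forall>y. a' 6 y = length (fl y (take i xs)) \<and> (\<forall>j<length (fl y (take i xs)). a' 7 (y * m + j) = fl y (take i xs) ! j)) \<and>
     t' \<le> t + 1 + 8 * i" for i and v' :: vars and a' :: arrs and t' :: nat
  have step1: "cok B b (Less (V 3) (V 20)) v' a' \<and> cval (Less (V 3) (V 20)) v' a' \<and>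
      wp B b (Asg 5 (A oa (V 3)) ;; Asg 6 (A da (V 5)) ;;
       Upd 7 (V 6 |*| V 20 |+| A 6 (V 6)) (V 5) ;; Upd 6 (V 6) (A 6 (V 6) |+| N 1) ;; Inc 3)
       (\<lambda>(v, a, t). I1 (Suc i) v a t) (v', a', t' + 3)" if i: "i < m" and I: "I1 i v' a' t'" for i v' a' t'
  proof -
    let ?x = "xs ! i" let ?y = "f ?x"
    have x: "?x \<in> set xs" using i xs by simp
    note fx = f[OF x]
    have tk: "take (Suc i) xs = take i xs @ [?x]" using i xs by (simp add: take_Suc_conv_app_nth)
    have v3: "v' 3 = i" "v' 20 = m" using I v by (auto simp: I1_def)
    have ao: "a' oa i = ?x" "a' da ?x = ?y" using I ids xs(2)[OF i] fx by (auto simp: I1_def)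
    define c where "c = length (fl ?y (take i xs))"
    have c: "a' 6 ?y = c" using I fx by (simp add: I1_def c_def)
    have flt: "fl y (take (Suc i) xs) = fl y (take i xs) @ (if y = ?y then [?x] else [])" for y by (simp add: fl_def tk)
    have cm: "c < m" using fl_len[of ?y "Suc i"] flt[of ?y] by (simp add: c_def)
    have lty: "?y * m + c < Bn * m"
    proof -
      have "Suc ?y * m \<le> Bn * m" using fx by (intro mult_le_mono1) simp
      then show ?thesis using cm by simp
    qed
    have new: "(\<forall>y. (if y = ?y then Suc c else a' 6 y) = length (fl y (take (Suc i) xs)) \<and>
       (\<forall>j<length (fl y (take (Suc i) xs)). (if y * m + j = ?y * m + c then ?x else a' 7 (y * m + j)) = fl y (take (Suc i) xs) ! j))"
    proof (intro allI impI conjI)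
      fix y
      have I': "a' 6 y = length (fl y (take i xs))" "\<And>j. j < length (fl y (take i xs)) \<Longrightarrow> a' 7 (y * m + j) = fl y (take i xs) ! j"
        using I by (auto simp: I1_def)
      show "(if y = ?y then Suc c else a' 6 y) = length (fl y (take (Suc i) xs))" using I' flt[of y] by (simp add: c_def)
      fix j assume j: "j < length (fl y (take (Suc i) xs))"
      then have jm: "j < m" using fl_len[of y "Suc i"] by linarith
      show "(if y * m + j = ?y * m + c then ?x else a' 7 (y * m + j)) = fl y (take (Suc i) xs) ! j"
      proof (cases "y * m + j = ?y * m + c")
        case True
        then have "y = ?y \<and> j = c" using mult_add_cancel jm cm by blast
        then show ?thesis using flt[of ?y] by (simp add: c_def)
      next
        case False
        then have "j < length (fl y (take i xs))" using j flt[of y] by (auto simp: c_def less_Suc_eq split: if_splits)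
        then show ?thesis using I'(2)[of j] False flt[of y] by (simp add: nth_append)
      qed
    qed
    have "I1 (Suc i) (v'(5 := ?x, 6 := ?y, 3 := Suc i)) (a'(7 := (a' 7)(?y * m + c := ?x), 6 := (a' 6)(?y := Suc c))) (t' + 8)"
      using I new unfolding I1_def by (auto simp: fun_upd_apply)
    then show ?thesis using v3 ao c cm i xs fx lty IM ids
      by (auto simp: fun_upd_twist algebra_simps intro!: addr ltB)
  qed
  define I2 where "I2 y v' a' t' \<longleftrightarrow> v' 6 = y \<and> v' 7 = length (bucket f y xs) \<and> (\<forall>x. x \<notin> {3, 5, 6, 7, 8} \<longrightarrow> v' x = v x) \<and>
     (\<forall>k. k \<notin> {oa, 6, 7} \<longrightarrow> a' k = a k) \<and> (\<forall>i<length (bucket f y xs). a' oa i = bucket f y xs ! i) \<and>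
     (\<forall>z. a' 6 z = (if z < y then 0 else length (fl z xs))) \<and>
     (\<forall>z. \<forall>j<length (fl z xs). a' 7 (z * m + j) = fl z xs ! j) \<and>
     t' \<le> t + 5 + 8 * m + 8 * y + 6 * length (bucket f y xs)" for y and v' :: vars and a' :: arrs and t' :: nat
  have step2: "cok B b (Less (V 6) (V 21)) v' a' \<and> cval (Less (V 6) (V 21)) v' a' \<and>
      wp B b (Asg 8 (N 0) ;;
       While (Less (V 8) (A 6 (V 6)))
        (Upd oa (V 7) (A 7 (V 6 |*| V 20 |+| V 8)) ;; Inc 7 ;; Inc 8) ;;
       Upd 6 (V 6) (N 0) ;; Inc 6)
       (\<lambda>(v, a, t). I2 (Suc y) v a t) (v', a', t' + 3)" if y: "y < Bn" and I: "I2 y v' a' t'" for y v' a' t'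
  proof -
    let ?g = "fl y xs" let ?k = "length (bucket f y xs)"
    have bs: "bucket f (Suc y) xs = bucket f y xs @ ?g" by (simp add: bucket_Suc fl_def)
    have kg: "?k + length ?g \<le> m" using lenb[of "Suc y"] bs by simp
    have v0: "v' 6 = y" "v' 21 = Bn" "v' 20 = m" "v' 7 = ?k" using I v by (auto simp: I2_def)
    have lty: "y * m + j < Bn * m" if "j < m" for j
    proof -
      have "Suc y * m \<le> Bn * m" using y by (intro mult_le_mono1) simp
      then show ?thesis using that by simp
    qed
    define J where "J j v'' a'' t'' \<longleftrightarrow> v'' 8 = j \<and> v'' 7 = ?k + j \<and> (\<forall>x. x \<notin> {7, 8} \<longrightarrow> v'' x = v' x) \<and>
      (\<forall>k. k \<noteq> oa \<longrightarrow> a'' k = a' k) \<and> (\<forall>i<?k + j. a'' oa i = (bucket f y xs @ take j ?g) ! i) \<and> t'' \<le> t' + 4 + 6 * j"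
      for j and v'' :: vars and a'' :: arrs and t'' :: nat
    have inner: "wp B b (While (Less (V 8) (A 6 (V 6))) (Upd oa (V 7) (A 7 (V 6 |*| V 20 |+| V 8)) ;; Inc 7 ;; Inc 8)) R (v1, a1, t1)"
      if J0: "J 0 v1 a1 t1" and fin: "\<And>v2 a2 t2. J (length ?g) v2 a2 t2 \<Longrightarrow> R (v2, a2, t2 + 2)" for R v1 a1 t1
    proof (rule wp_While[of J, OF J0, where n = "length ?g"])
      fix j v2 a2 t2 assume j: "j < length ?g" and J: "J j v2 a2 t2"
      have jm: "j < m" using j kg by simp
      have e: "v2 8 = j" "v2 7 = ?k + j" "v2 6 = y" "v2 20 = m" "a2 6 y = length ?g" "a2 7 (y * m + j) = ?g ! j"
        using J I v0 ids y j by (auto simp: J_def I2_def)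
      have tk: "take (Suc j) ?g = take j ?g @ [?g ! j]" using j by (rule take_Suc_conv_app_nth)
      have "J (Suc j) (v2(7 := Suc (?k + j), 8 := Suc j)) (a2(oa := (a2 oa)(?k + j := ?g ! j))) (t2 + 6)"
        using J j unfolding J_def by (auto simp: tk nth_append less_Suc_eq)
      then show "cok B b (Less (V 8) (A 6 (V 6))) v2 a2 \<and> cval (Less (V 8) (A 6 (V 6))) v2 a2 \<and>
        wp B b (Upd oa (V 7) (A 7 (V 6 |*| V 20 |+| V 8)) ;; Inc 7 ;; Inc 8) (\<lambda>(v, a, t). J (Suc j) v a t) (v2, a2, t2 + 3)"
        using e j y IM ids kg lty[OF jm] by (auto simp: fun_upd_twist algebra_simps intro!: addr ltB)
    next
      fix v2 a2 t2 assume J: "J (length ?g) v2 a2 t2"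
      have e: "v2 8 = length ?g" "v2 6 = y" "a2 6 y = length ?g" using J I v0 ids y by (auto simp: J_def I2_def)
      show "cok B b (Less (V 8) (A 6 (V 6))) v2 a2 \<and> \<not> cval (Less (V 8) (A 6 (V 6))) v2 a2 \<and> R (v2, a2, t2 + 2)"
        using e y IM fin[OF J] by (auto intro!: addr ltB)
    qed
    have "wp B b (While (Less (V 8) (A 6 (V 6))) (Upd oa (V 7) (A 7 (V 6 |*| V 20 |+| V 8)) ;; Inc 7 ;; Inc 8))
       (wp B b (Upd 6 (V 6) (N 0) ;; Inc 6) (\<lambda>(v, a, t). I2 (Suc y) v a t)) (v'(8 := 0), a', t' + 4)"
    proof (rule inner)
      show "J 0 (v'(8 := 0)) a' (t' + 4)" using I by (auto simp: J_def I2_def)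
      fix v2 a2 t2 assume J: "J (length ?g) v2 a2 t2"
      have e: "v2 6 = y" using J v0 by (auto simp: J_def)
      have "I2 (Suc y) (v2(6 := Suc y)) (a2(6 := (a2 6)(y := 0))) (t2 + 4)"
        using J I ids y unfolding J_def I2_def by (auto simp: bs less_Suc_eq)
      then show "wp B b (Upd 6 (V 6) (N 0) ;; Inc 6) (\<lambda>(v, a, t). I2 (Suc y) v a t) (v2, a2, t2 + 2)"
        using e y IM by (auto simp: ac_simps intro!: addr ltB)
    qed
    then show ?thesis using v0 y IM by (auto simp: ac_simps intro!: ltB)
  qed
  let ?b1 = "Asg 5 (A oa (V 3)) ;; Asg 6 (A da (V 5)) ;; Upd 7 (V 6 |*| V 20 |+| A 6 (V 6)) (V 5) ;;
       Upd 6 (V 6) (A 6 (V 6) |+| N 1) ;; Inc 3"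
  let ?W2 = "While (Less (V 6) (V 21))
      (Asg 8 (N 0) ;; While (Less (V 8) (A 6 (V 6))) (Upd oa (V 7) (A 7 (V 6 |*| V 20 |+| V 8)) ;; Inc 7 ;; Inc 8) ;;
       Upd 6 (V 6) (N 0) ;; Inc 6)"
  have "wp B b (While (Less (V 3) (V 20)) ?b1) (wp B b (Asg 7 (N 0) ;; Asg 6 (N 0) ;; ?W2) Q) (v(3 := 0), a, t + 1)"
  proof (rule wp_While[of I1, where n = m])
    show "I1 0 (v(3 := 0)) a (t + 1)" using cnt by (simp add: I1_def fl_def)
    fix v1 a1 t1 assume I: "I1 m v1 a1 t1"
    have "wp B b ?W2 Q (v1(7 := 0, 6 := 0), a1, t1 + 4)"
    proof (rule wp_While[of I2, where n = Bn])
      show "I2 0 (v1(7 := 0, 6 := 0)) a1 (t1 + 4)" using I xs(1) by (auto simp: I1_def I2_def)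
      fix v2 a2 t2 assume I: "I2 Bn v2 a2 t2"
      have lb: "length (bucket f Bn xs) = m" using length_bucket[of xs f Bn] f xs(1) by auto
      have nil: "fl z xs = []" if "Bn \<le> z" for z using f that by (force simp: fl_def filter_empty_conv)
      have "Q (v2, a2, t2 + 2)" by (rule Q) (use I lb nil in \<open>auto simp: I2_def\<close>)
      then show "cok B b (Less (V 6) (V 21)) v2 a2 \<and> \<not> cval (Less (V 6) (V 21)) v2 a2 \<and> Q (v2, a2, t2 + 2)"
        using I v by (auto simp: I2_def)
    qed (rule step2)
    then show "cok B b (Less (V 3) (V 20)) v1 a1 \<and> \<not> cval (Less (V 3) (V 20)) v1 a1 \<and>
        wp B b (Asg 7 (N 0) ;; Asg 6 (N 0) ;; ?W2) Q (v1, a1, t1 + 2)"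
      using I v ltB[of 0] by (auto simp: I1_def ac_simps)
  qed (rule step1)
  then show ?thesis unfolding bucket_pass_def using ltB[of 0] by simp
qed

end

section \<open>Input, density keys, sorting, greedy prefix and output\<close>

definition read_items :: com where
  "read_items = Asg 0 (A 0 (N 0)) ;; Asg 1 (A 0 (N 1)) ;; Asg 2 (N 0) ;; Asg 3 (N 0) ;;
   While (Less (V 3) (V 0))
    (Asg 5 (A 0 (N 2 |*| V 3 |+| N 2)) ;; If (Less (V 2) (V 5)) (Asg 2 (V 5)) Skip ;;
     Upd 1 (V 3) (V 5) ;; Upd 2 (V 3) (A 0 (N 2 |*| V 3 |+| N 3)) ;; Inc 3)"

definition compute_keys :: com where
  "compute_keys = Asg 10 (N 0) ;; Asg 3 (N 0) ;;
   While (Less (V 3) (V 0))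
    (Asg 5 (A 2 (V 3) |*| V 2 |*| V 2 |div| A 1 (V 3)) ;; If (Less (V 10) (V 5)) (Asg 10 (V 5)) Skip ;;
     Upd 3 (V 3) (V 5) ;; Upd 4 (V 3) (V 3) ;; Inc 3)"

definition radix_sort :: com where
  "radix_sort = Asg 11 (N 1) ;; Asg 20 (V 0) ;; Asg 21 (V 0 |+| N 1) ;;
   While (Less (V 11) (V 10 |+| N 1))
    (Asg 3 (N 0) ;;
     While (Less (V 3) (V 0)) (Upd 5 (V 3) (V 0 |-| (A 3 (V 3) |div| V 11) |mod| V 21) ;; Inc 3) ;;
     bucket_pass 4 5 ;;
     Asg 11 (V 11 |*| V 21))"

definition greedy_prefix :: com where
  "greedy_prefix = Asg 12 (N 0) ;; Asg 13 (N 0) ;; Asg 14 (N 0) ;; Asg 3 (N 0) ;;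
   While (Less (V 3) (V 0))
    (If (Equal (V 12) (N 0))
       (Asg 5 (A 4 (V 3)) ;;
        If (Less (V 1) (V 13 |+| A 1 (V 5))) (Asg 12 (N 1) ;; Asg 14 (V 3))
          (Asg 13 (V 13 |+| A 1 (V 5)) ;; Upd 8 (V 5) (N 1)))
       Skip ;; Inc 3)"

definition write_output :: com where
  "write_output = Asg 3 (N 0) ;; While (Less (V 3) (V 0)) (Upd 0 (V 3) (A 8 (V 3)) ;; Inc 3)"

text \<open>The inserted 0 is the value with which the loops start their running maximum.\<close>

definition mx :: "(nat \<Rightarrow> nat) \<Rightarrow> nat \<Rightarrow> nat" where "mx f i = Max (insert 0 (f ` {..<i}))"

lemma mx_0 [simp]: "mx f 0 = 0" by (simp add: mx_def)
lemma mx_Suc: "mx f (Suc i) = max (f i) (mx f i)"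
proof -
  have "insert 0 (f ` {..<Suc i}) = insert (f i) (insert 0 (f ` {..<i}))" by (auto simp: lessThan_Suc)
  then show ?thesis unfolding mx_def by (simp del: insert_commute)
qed
lemma mx_ge: "j < i \<Longrightarrow> f j \<le> mx f i" by (simp add: mx_def)
lemma mx_less: "(\<And>j. j < i \<Longrightarrow> f j < c) \<Longrightarrow> 0 < c \<Longrightarrow> mx f i < c" by (auto simp: mx_def)
lemma mx_eq_Max: assumes "0 < i" shows "mx f i = Max (f ` {..<i})"
proof -
  have "f ` {..<i} \<noteq> {}" using assms by auto
  then show ?thesis unfolding mx_def by (subst Max_insert) (auto simp: max_def)
qed

context mach
begin

lemma read_items:
  assumes a: "a 0 0 = n" "a 0 1 = t" "\<And>i. i < n \<Longrightarrow> a 0 (2 * i + 2) = wg i \<and> a 0 (2 * i + 3) = pf i"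
    and bn: "b = 2 * n + 2" and IM: "2 * n + 3 \<le> IM"
    and Q: "\<And>v' a' t'. \<lbrakk>\<forall>x. x \<notin> {0, 1, 2, 3, 5} \<longrightarrow> v' x = v x; \<forall>k. k \<notin> {1, 2} \<longrightarrow> a' k = a k; v' 0 = n; v' 1 = t; v' 2 = mx wg n;
       \<And>i. i < n \<Longrightarrow> a' 1 i = wg i \<and> a' 2 i = pf i; t' \<le> t0 + 20 * n + 20\<rbrakk> \<Longrightarrow> Q (v', a', t')"
  shows "wp B b read_items Q (v, a, t0)"
proof -
  define I where "I i v' a' t' \<longleftrightarrow> v' 3 = i \<and> (\<forall>x. x \<notin> {0, 1, 2, 3, 5} \<longrightarrow> v' x = v x) \<and> (\<forall>k. k \<notin> {1, 2} \<longrightarrow> a' k = a k) \<and>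
     v' 0 = n \<and> v' 1 = t \<and> v' 2 = mx wg i \<and> (\<forall>j<i. a' 1 j = wg j \<and> a' 2 j = pf j) \<and> t' \<le> t0 + 4 + 20 * i"
    for i and v' :: vars and a' :: arrs and t' :: nat
  let ?c = "Asg 5 (A 0 (N 2 |*| V 3 |+| N 2)) ;; If (Less (V 2) (V 5)) (Asg 2 (V 5)) Skip ;;
     Upd 1 (V 3) (V 5) ;; Upd 2 (V 3) (A 0 (N 2 |*| V 3 |+| N 3)) ;; Inc 3"
  have raw: "addr_ok B b 0 i" if "i < 2 * n + 2" for i using that bn by (simp add: addr_ok_def)
  have "wp B b (While (Less (V 3) (V 0)) ?c) Q (v(0 := n, 1 := t, 2 := 0, 3 := 0), a, t0 + 1 + 1 + 1 + 1)"
  proof (rule wp_While[of I, where n = n])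
    show "I 0 (v(0 := n, 1 := t, 2 := 0, 3 := 0)) a (t0 + 1 + 1 + 1 + 1)" by (simp add: I_def)
    fix i v' a' t' assume i: "i < n" and J: "I i v' a' t'"
    have e: "v' 3 = i" "v' 0 = n" "a' 0 (2 * i + 2) = wg i" "a' 0 (2 * i + 3) = pf i" "v' 2 = mx wg i"
      using J a(3)[OF i] by (auto simp: I_def)
    have 1: "I (Suc i) (v'(5 := wg i, 2 := wg i, 3 := Suc i)) (a'(1 := (a' 1)(i := wg i), 2 := (a' 2)(i := pf i))) (t' + 10)"
      if "mx wg i < wg i" using J that unfolding I_def by (auto simp: mx_Suc less_Suc_eq)
    have 2: "I (Suc i) (v'(5 := wg i, 3 := Suc i)) (a'(1 := (a' 1)(i := wg i), 2 := (a' 2)(i := pf i))) (t' + 9)"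
      if "\<not> mx wg i < wg i" using J that unfolding I_def by (auto simp: mx_Suc less_Suc_eq)
    show "cok B b (Less (V 3) (V 0)) v' a' \<and> cval (Less (V 3) (V 0)) v' a' \<and> wp B b ?c (\<lambda>(v, a, t). I (Suc i) v a t) (v', a', t' + 3)"
      using e i IM 1 2 by (auto simp: ac_simps intro!: addr ltB raw)
  next
    fix v' a' t' assume J: "I n v' a' t'"
    have "Q (v', a', t' + 2)" by (rule Q) (use J in \<open>auto simp: I_def\<close>)
    then show "cok B b (Less (V 3) (V 0)) v' a' \<and> \<not> cval (Less (V 3) (V 0)) v' a' \<and> Q (v', a', t' + 2)" using J by (auto simp: I_def)
  qed
  then show ?thesis unfolding read_items_def using a(1,2) IM raw[of 0] raw[of 1] ltB[of 0] ltB[of 1] by simp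
qed

lemma compute_keys:
  assumes v: "v 0 = n" "v 2 = wm" and a: "\<And>i. i < n \<Longrightarrow> a 1 i = wg i \<and> a 2 i = pf i"
    and IM: "n + 1 \<le> IM" "\<And>i. i < n \<Longrightarrow> pf i * wm \<le> IM \<and> pf i * wm * wm \<le> IM"
    and Q: "\<And>v' a' t'. \<lbrakk>\<forall>x. x \<notin> {3, 5, 10} \<longrightarrow> v' x = v x; \<forall>k. k \<notin> {3, 4} \<longrightarrow> a' k = a k; v' 10 = mx (\<lambda>i. pf i * wm * wm div wg i) n;
       \<And>i. i < n \<Longrightarrow> a' 3 i = pf i * wm * wm div wg i \<and> a' 4 i = i; t' \<le> t0 + 20 * n + 20\<rbrakk> \<Longrightarrow> Q (v', a', t')"
  shows "wp B b compute_keys Q (v, a, t0)"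
proof -
  define ky where "ky i = pf i * wm * wm div wg i" for i
  define I where "I i v' a' t' \<longleftrightarrow> v' 3 = i \<and> (\<forall>x. x \<notin> {3, 5, 10} \<longrightarrow> v' x = v x) \<and> (\<forall>k. k \<notin> {3, 4} \<longrightarrow> a' k = a k) \<and>
     v' 10 = mx ky i \<and> (\<forall>j<i. a' 3 j = ky j \<and> a' 4 j = j) \<and> t' \<le> t0 + 2 + 20 * i"
    for i and v' :: vars and a' :: arrs and t' :: nat
  let ?c = "Asg 5 (A 2 (V 3) |*| V 2 |*| V 2 |div| A 1 (V 3)) ;; If (Less (V 10) (V 5)) (Asg 10 (V 5)) Skip ;;
     Upd 3 (V 3) (V 5) ;; Upd 4 (V 3) (V 3) ;; Inc 3"
  have "wp B b (While (Less (V 3) (V 0)) ?c) Q (v(10 := 0, 3 := 0), a, t0 + 1 + 1)"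
  proof (rule wp_While[of I, where n = n])
    show "I 0 (v(10 := 0, 3 := 0)) a (t0 + 1 + 1)" by (simp add: I_def)
    fix i v' a' t' assume i: "i < n" and J: "I i v' a' t'"
    have e: "v' 3 = i" "v' 0 = n" "v' 2 = wm" "a' 1 i = wg i" "a' 2 i = pf i" "v' 10 = mx ky i"
      using J a[OF i] v by (auto simp: I_def)
    have k: "pf i * wm * wm div wg i = ky i" by (simp add: ky_def)
    have 1: "I (Suc i) (v'(5 := ky i, 10 := ky i, 3 := Suc i)) (a'(3 := (a' 3)(i := ky i), 4 := (a' 4)(i := i))) (t' + 10)"
      if "mx ky i < ky i" using J that unfolding I_def by (auto simp: mx_Suc less_Suc_eq)
    have 2: "I (Suc i) (v'(5 := ky i, 3 := Suc i)) (a'(3 := (a' 3)(i := ky i), 4 := (a' 4)(i := i))) (t' + 9)"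
      if "\<not> mx ky i < ky i" using J that unfolding I_def by (auto simp: mx_Suc less_Suc_eq)
    show "cok B b (Less (V 3) (V 0)) v' a' \<and> cval (Less (V 3) (V 0)) v' a' \<and> wp B b ?c (\<lambda>(v, a, t). I (Suc i) v a t) (v', a', t' + 3)"
      using e i IM(1) IM(2)[OF i] 1 2 by (auto simp: add.commute k intro!: addr ltB)
  next
    fix v' a' t' assume J: "I n v' a' t'"
    have "Q (v', a', t' + 2)" by (rule Q) (use J in \<open>auto simp: I_def ky_def[abs_def]\<close>)
    then show "cok B b (Less (V 3) (V 0)) v' a' \<and> \<not> cval (Less (V 3) (V 0)) v' a' \<and> Q (v', a', t' + 2)" using J v by (auto simp: I_def)
  qed
  then show ?thesis unfolding compute_keys_def using ltB[of 0] by simp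
qed

lemma radix_digits:
  assumes v: "v 0 = n" "v 11 = d" "v 21 = n + 1" and a: "\<And>i. i < n \<Longrightarrow> a 3 i = key i" and IM: "n + 1 \<le> IM"
    and Q: "\<And>v' a' t'. \<lbrakk>\<forall>x. x \<noteq> 3 \<longrightarrow> v' x = v x; \<forall>k. k \<noteq> 5 \<longrightarrow> a' k = a k;
       \<And>i. i < n \<Longrightarrow> a' 5 i = dig (n + 1) d (key i); t' \<le> t0 + 5 * n + 3\<rbrakk> \<Longrightarrow> Q (v', a', t')"
  shows "wp B b (Asg 3 (N 0) ;; While (Less (V 3) (V 0)) (Upd 5 (V 3) (V 0 |-| (A 3 (V 3) |div| V 11) |mod| V 21) ;; Inc 3)) Q (v, a, t0)"
proof -
  define I where "I i v' a' t' \<longleftrightarrow> v' 3 = i \<and> (\<forall>x. x \<noteq> 3 \<longrightarrow> v' x = v x) \<and> (\<forall>k. k \<noteq> 5 \<longrightarrow> a' k = a k) \<and>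
     (\<forall>j<i. a' 5 j = dig (n + 1) d (key j)) \<and> t' \<le> t0 + 1 + 5 * i" for i and v' :: vars and a' :: arrs and t' :: nat
  have "wp B b (While (Less (V 3) (V 0)) (Upd 5 (V 3) (V 0 |-| (A 3 (V 3) |div| V 11) |mod| V 21) ;; Inc 3)) Q (v(3 := 0), a, t0 + 1)"
  proof (rule wp_While[of I, where n = n])
    show "I 0 (v(3 := 0)) a (t0 + 1)" by (simp add: I_def)
    fix i v' a' t' assume i: "i < n" and J: "I i v' a' t'"
    have e: "v' 3 = i" "v' 0 = n" "v' 11 = d" "v' 21 = n + 1" "a' 3 i = key i" using J a[OF i] v by (auto simp: I_def)
    have md: "key i div d mod (n + 1) \<le> n" using mod_less_divisor[of "n + 1" "key i div d"] by linarith
    have "I (Suc i) (v'(3 := Suc i)) (a'(5 := (a' 5)(i := n - key i div d mod (n + 1)))) (t' + 5)"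
      using J unfolding I_def dig_def by (auto simp: less_Suc_eq)
    then show "cok B b (Less (V 3) (V 0)) v' a' \<and> cval (Less (V 3) (V 0)) v' a' \<and>
      wp B b (Upd 5 (V 3) (V 0 |-| (A 3 (V 3) |div| V 11) |mod| V 21) ;; Inc 3) (\<lambda>(v, a, t). I (Suc i) v a t) (v', a', t' + 3)"
      using e i IM md by (auto simp: add.commute intro!: addr ltB)
  next
    fix v' a' t' assume J: "I n v' a' t'"
    have "Q (v', a', t' + 2)" by (rule Q) (use J in \<open>auto simp: I_def\<close>)
    then show "cok B b (Less (V 3) (V 0)) v' a' \<and> \<not> cval (Less (V 3) (V 0)) v' a' \<and> Q (v', a', t' + 2)" using J v by (auto simp: I_def)
  qed
  then show ?thesis using ltB[of 0] by simp
qed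

text \<open>The keys are below \<open>(n + 1) ^ R\<close>, where \<open>R\<close> will depend only
  on the exponent of the input bound; so digits in base \<open>n + 1\<close> need at most
  \<open>R\<close> passes of linear cost. The loop performs the least sufficient number
  \<open>E\<close> of passes, since it compares the power of the base with the largest key.\<close>

lemma radix_sort:
  assumes v: "v 0 = n" "v 10 = mk" and n0: "0 < n" and a: "\<And>i. i < n \<Longrightarrow> a 3 i = key i \<and> a 4 i = i \<and> key i \<le> mk" "\<And>y. a 6 y = 0"
    and mk: "mk < (n + 1) ^ R"
    and IM: "(n + 1) * n + n + (n + 1) + 1 \<le> IM" "(mk + 1) * (n + 1) \<le> IM"
    and Q: "\<And>v' a' t' xs. \<lbrakk>\<forall>x. x \<notin> {3, 5, 6, 7, 8, 11, 20, 21} \<longrightarrow> v' x = v x; \<forall>k. k \<notin> {4, 5, 6, 7} \<longrightarrow> a' k = a k;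
       distinct xs; set xs = {..<n}; sorted_wrt (\<lambda>x y. key y \<le> key x) xs; \<And>i. i < n \<Longrightarrow> a' 4 i = xs ! i;
       \<forall>y. a' 6 y = 0; t' \<le> t0 + R * (100 * n + 100) + 20\<rbrakk> \<Longrightarrow> Q (v', a', t')"
  shows "wp B b radix_sort Q (v, a, t0)"
proof -
  define E where "E = (LEAST e. mk < (n + 1) ^ e)"
  have E: "mk < (n + 1) ^ E" unfolding E_def using mk by (rule LeastI)
  have ER: "E \<le> R" unfolding E_def using mk by (rule Least_le)
  have lt: "(n + 1) ^ e \<le> mk" if "e < E" for e using not_less_Least[of e "\<lambda>e. mk < (n + 1) ^ e"] that E_def by auto
  define I where "I e v' a' t' \<longleftrightarrow> v' 11 = (n + 1) ^ e \<and> v' 20 = n \<and> v' 21 = n + 1 \<and>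
     (\<forall>x. x \<notin> {3, 5, 6, 7, 8, 11, 20, 21} \<longrightarrow> v' x = v x) \<and> (\<forall>k. k \<notin> {4, 5, 6, 7} \<longrightarrow> a' k = a k) \<and> (\<forall>y. a' 6 y = 0) \<and>
     (\<exists>xs. distinct xs \<and> set xs = {..<n} \<and> sorted_wrt (\<lambda>x y. key y mod (n + 1) ^ e \<le> key x mod (n + 1) ^ e) xs \<and> (\<forall>i<n. a' 4 i = xs ! i)) \<and>
     t' \<le> t0 + 3 + e * (100 * n + 100)" for e and v' :: vars and a' :: arrs and t' :: nat
  let ?dg = "Asg 3 (N 0) ;; While (Less (V 3) (V 0)) (Upd 5 (V 3) (V 0 |-| (A 3 (V 3) |div| V 11) |mod| V 21) ;; Inc 3)"
  let ?c = "Asg 3 (N 0) ;; While (Less (V 3) (V 0)) (Upd 5 (V 3) (V 0 |-| (A 3 (V 3) |div| V 11) |mod| V 21) ;; Inc 3) ;;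
     bucket_pass 4 5 ;; Asg 11 (V 11 |*| V 21)"
  have B1: "1 < B" "0 < B" "n + 1 < B" using IM by (auto intro!: ltB)
  have "wp B b (While (Less (V 11) (V 10 |+| N 1)) ?c) Q (v(11 := 1, 20 := n, 21 := n + 1), a, t0 + 1 + 1 + 1)"
  proof (rule wp_While[of I, where n = E])
    have "sorted_wrt (\<lambda>x y. key y mod (n + 1) ^ 0 \<le> key x mod (n + 1) ^ 0) [0..<n]" by (rule sorted_wrt_mono_rel[of _ "(\<le>)"]) auto
    then show "I 0 (v(11 := 1, 20 := n, 21 := n + 1)) a (t0 + 1 + 1 + 1)"
      unfolding I_def using a by (intro conjI exI[of _ "[0..<n]"]) (auto simp: atLeast0LessThan)
    fix e v' a' t' assume e: "e < E" and J: "I e v' a' t'"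
    let ?d = "(n + 1) ^ e"
    obtain xs where xs: "distinct xs" "set xs = {..<n}" "sorted_wrt (\<lambda>x y. key y mod ?d \<le> key x mod ?d) xs" "\<forall>i<n. a' 4 i = xs ! i"
      using J unfolding I_def by blast
    have len: "length xs = n" using xs distinct_card by fastforce
    have ev: "v' 0 = n" "v' 10 = mk" "v' 11 = ?d" "v' 20 = n" "v' 21 = n + 1" using J v by (auto simp: I_def)
    have a3: "\<And>i. i < n \<Longrightarrow> a' 3 i = key i" using J a by (auto simp: I_def)
    have bound: "?d * (n + 1) \<le> IM" using mult_le_mono1[OF lt[OF e], of "n + 1"] IM(2) by simp
    have mkB: "mk + 1 < B"
    proof (rule ltB)
      have "mk + 1 \<le> (mk + 1) * (n + 1)" by simp
      then show "mk + 1 \<le> IM" using IM(2) by linarith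
    qed
    have "wp B b ?dg (wp B b (bucket_pass 4 5 ;; Asg 11 (V 11 |*| V 21)) (\<lambda>(v, a, t). I (Suc e) v a t)) (v', a', t' + 3)"
    proof (rule radix_digits[where v = v' and a = a' and n = n and d = ?d and key = key])
      show "v' 0 = n" "v' 11 = ?d" "v' 21 = n + 1" using ev by auto
      show "\<And>i. i < n \<Longrightarrow> a' 3 i = key i" by (rule a3)
      show "n + 1 \<le> IM" using IM(1) by linarith
      fix v1 a1 t1 assume r: "\<forall>x. x \<noteq> 3 \<longrightarrow> v1 x = v' x" "\<forall>k. k \<noteq> 5 \<longrightarrow> a1 k = a' k"
        "\<And>i. i < n \<Longrightarrow> a1 5 i = dig (n + 1) ?d (key i)" "t1 \<le> t' + 3 + 5 * n + 3"
      have "wp B b (bucket_pass 4 5) (wp B b (Asg 11 (V 11 |*| V 21)) (\<lambda>(v, a, t). I (Suc e) v a t)) (v1, a1, t1)"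
      proof (rule bucket_pass[where xs = xs and m = n and Bn = "n + 1" and f = "\<lambda>x. dig (n + 1) ?d (key x)"])
        show "v1 20 = n" "v1 21 = n + 1" using r ev by auto
        show "length xs = n" by (rule len)
        show "\<And>i. i < n \<Longrightarrow> a1 4 i = xs ! i" using r xs by simp
        show "a1 5 x = dig (n + 1) ?d (key x) \<and> dig (n + 1) ?d (key x) < n + 1 \<and> x \<le> IM" if "x \<in> set xs" for x
          using that r(3)[of x] xs IM(1) by (auto simp: dig_def)
        show "\<And>y. a1 6 y = 0" using r J by (auto simp: I_def)
        show "(n + 1) * n + n + (n + 1) + 1 \<le> IM" by (rule IM(1))
        fix v2 a2 t2 assume s: "\<forall>x. x \<notin> {3, 5, 6, 7, 8} \<longrightarrow> v2 x = v1 x" "\<forall>k. k \<notin> {4, 6, 7} \<longrightarrow> a2 k = a1 k"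
          "\<And>i. i < n \<Longrightarrow> a2 4 i = bucket (\<lambda>x. dig (n + 1) ?d (key x)) (n + 1) xs ! i" "\<And>y. a2 6 y = 0" "t2 \<le> t1 + 20 * n + 20 * (n + 1) + 20"
        let ?ys = "bucket (\<lambda>x. dig (n + 1) ?d (key x)) (n + 1) xs"
        have "distinct ?ys" using xs(1) by (rule distinct_bucket)
        moreover have dl: "dig (n + 1) ?d y < n + 1" for y by (simp add: dig_def)
        then have "set ?ys = {..<n}" unfolding set_bucket using xs(2) by blast
        moreover have "sorted_wrt (\<lambda>x y. key y mod (?d * (n + 1)) \<le> key x mod (?d * (n + 1))) ?ys"
          by (rule radix_step[OF xs(3)]) simp_all
        ultimately have ys: "\<exists>xs. distinct xs \<and> set xs = {..<n} \<and> sorted_wrt (\<lambda>x y. key y mod (n + 1) ^ Suc e \<le> key x mod (n + 1) ^ Suc e) xs \<and> (\<forall>i<n. a2 4 i = xs ! i)"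
          unfolding power_Suc2 using s(3) by (intro exI[of _ ?ys] conjI) blast+
        have t2: "t2 + 1 \<le> t0 + 3 + Suc e * (100 * n + 100)"
        proof -
          have "t' \<le> t0 + 3 + e * (100 * n + 100)" using J by (simp add: I_def)
          then show ?thesis using r(4) s(5) by simp
        qed
        have "I (Suc e) (v2(11 := ?d * (n + 1))) a2 (t2 + 1)"
          unfolding I_def using r(1,2) s(1,2,4) ev J ys t2 by (intro conjI) (auto simp: I_def)
        moreover have "v2 11 = ?d" "v2 21 = n + 1" using r s ev by auto
        ultimately show "wp B b (Asg 11 (V 11 |*| V 21)) (\<lambda>(v, a, t). I (Suc e) v a t) (v2, a2, t2)"
          using ltB[OF bound] by simp
      qed auto
      then show "wp B b (bucket_pass 4 5 ;; Asg 11 (V 11 |*| V 21)) (\<lambda>(v, a, t). I (Suc e) v a t) (v1, a1, t1)" by simp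
    qed
    then show "cok B b (Less (V 11) (V 10 |+| N 1)) v' a' \<and> cval (Less (V 11) (V 10 |+| N 1)) v' a' \<and> wp B b ?c (\<lambda>(v, a, t). I (Suc e) v a t) (v', a', t' + 3)"
      using ev lt[OF e] mkB B1 by (simp add: le_imp_less_Suc)
  next
    fix v' a' t' assume J: "I E v' a' t'"
    then obtain xs where xs: "distinct xs" "set xs = {..<n}" "sorted_wrt (\<lambda>x y. key y mod (n + 1) ^ E \<le> key x mod (n + 1) ^ E) xs" "\<forall>i<n. a' 4 i = xs ! i"
      unfolding I_def by blast
    have k: "key x mod (n + 1) ^ E = key x" if "x \<in> set xs" for x using that xs(2) a(1)[of x] E by auto
    have srt: "sorted_wrt (\<lambda>x y. key y \<le> key x) xs" using xs(3) k by (simp add: sorted_wrt_iff_nth_less)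
    have ev: "v' 10 = mk" "v' 11 = (n + 1) ^ E" using J v by (auto simp: I_def)
    have mkB: "mk + 1 < B"
    proof (rule ltB)
      have "mk + 1 \<le> (mk + 1) * (n + 1)" by simp
      then show "mk + 1 \<le> IM" using IM(2) by linarith
    qed
    have "E * (100 * n + 100) \<le> R * (100 * n + 100)" using ER by (rule mult_le_mono1)
    then have "t' + 2 \<le> t0 + R * (100 * n + 100) + 20" using J unfolding I_def by linarith
    then have "Q (v', a', t' + 2)" by (intro Q[of v' a' xs]) (use J xs srt in \<open>auto simp: I_def\<close>)
    then show "cok B b (Less (V 11) (V 10 |+| N 1)) v' a' \<and> \<not> cval (Less (V 11) (V 10 |+| N 1)) v' a' \<and> Q (v', a', t' + 2)"
      using ev E mkB B1 by simp
  qed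
  then show ?thesis unfolding radix_sort_def using v B1 by simp
qed

lemma greedy_prefix:
  assumes v: "v 0 = n" "v 1 = t" and xs: "distinct xs" "set xs = {..<n}" "\<And>i. i < n \<Longrightarrow> a 4 i = xs ! i"
    and a: "\<And>i. i < n \<Longrightarrow> a 1 i = wg i" "\<And>x. x < n \<Longrightarrow> a 8 x = 0" and IM: "n + 1 \<le> IM" "\<And>i. i < n \<Longrightarrow> t + wg i \<le> IM"
    and Q: "\<And>v' a' t' q. \<lbrakk>\<forall>x. x \<notin> {3, 5, 12, 13, 14} \<longrightarrow> v' x = v x; \<forall>k. k \<notin> {8} \<longrightarrow> a' k = a k;
       q \<le> n; v' 13 = (\<Sum>k<q. wg (xs ! k)); v' 13 \<le> t; \<And>x. x < n \<Longrightarrow> a' 8 x = (if x \<in> set (take q xs) then 1 else 0);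
       v' 12 = 0 \<and> q = n \<or> v' 12 = 1 \<and> q < n \<and> v' 14 = q \<and> t < (\<Sum>k<Suc q. wg (xs ! k)); t' \<le> t0 + 20 * n + 20\<rbrakk> \<Longrightarrow> Q (v', a', t')"
  shows "wp B b greedy_prefix Q (v, a, t0)"
proof -
  define S where "S q = (\<Sum>k<q. wg (xs ! k))" for q
  have len: "length xs = n" using xs distinct_card by fastforce
  \<comment> \<open>The witness \<open>q\<close> follows the loop index until an item does not fit,
    and is frozen from then on.\<close>
  define I where "I i v' a' t' \<longleftrightarrow> v' 3 = i \<and> (\<forall>x. x \<notin> {3, 5, 12, 13, 14} \<longrightarrow> v' x = v x) \<and> (\<forall>k. k \<notin> {8} \<longrightarrow> a' k = a k) \<and>
     (\<exists>q\<le>i. v' 13 = S q \<and> S q \<le> t \<and> (\<forall>x<n. a' 8 x = (if x \<in> set (take q xs) then 1 else 0)) \<and>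
        (v' 12 = 0 \<and> q = i \<or> v' 12 = 1 \<and> q < i \<and> v' 14 = q \<and> t < S (Suc q))) \<and> t' \<le> t0 + 4 + 20 * i"
    for i and v' :: vars and a' :: arrs and t' :: nat
  let ?c = "If (Equal (V 12) (N 0))
       (Asg 5 (A 4 (V 3)) ;;
        If (Less (V 1) (V 13 |+| A 1 (V 5))) (Asg 12 (N 1) ;; Asg 14 (V 3))
          (Asg 13 (V 13 |+| A 1 (V 5)) ;; Upd 8 (V 5) (N 1)))
       Skip ;; Inc 3"
  have "wp B b (While (Less (V 3) (V 0)) ?c) Q (v(12 := 0, 13 := 0, 14 := 0, 3 := 0), a, t0 + 1 + 1 + 1 + 1)"
  proof (rule wp_While[of I, where n = n])
    show "I 0 (v(12 := 0, 13 := 0, 14 := 0, 3 := 0)) a (t0 + 1 + 1 + 1 + 1)" using a(2) by (auto simp: I_def S_def)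
    fix i v' a' t' assume i: "i < n" and J: "I i v' a' t'"
    let ?x = "xs ! i"
    have x: "?x < n" using xs len i nth_mem[of i xs] by auto
    obtain q where q: "q \<le> i" "v' 13 = S q" "S q \<le> t" "\<forall>x<n. a' 8 x = (if x \<in> set (take q xs) then 1 else 0)"
      "v' 12 = 0 \<and> q = i \<or> v' 12 = 1 \<and> q < i \<and> v' 14 = q \<and> t < S (Suc q)" using J unfolding I_def by blast
    have e: "v' 3 = i" "v' 0 = n" "v' 1 = t" "a' 4 i = ?x" "a' 1 ?x = wg ?x"
      using J v xs(3)[OF i] a(1)[OF x] by (auto simp: I_def)
    have fr: "\<forall>x. x \<notin> {3, 5, 12, 13, 14} \<longrightarrow> v' x = v x" "\<forall>k. k \<notin> {8} \<longrightarrow> a' k = a k" "t' \<le> t0 + 4 + 20 * i" using J by (auto simp: I_def)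
    have SS: "S (Suc i) = S i + wg ?x" by (simp add: S_def)
    have tk: "set (take (Suc i) xs) = insert ?x (set (take i xs))" using i len by (simp add: take_Suc_conv_app_nth)
    show "cok B b (Less (V 3) (V 0)) v' a' \<and> cval (Less (V 3) (V 0)) v' a' \<and> wp B b ?c (\<lambda>(v, a, t). I (Suc i) v a t) (v', a', t' + 3)"
    proof (cases "v' 12 = 0")
      case True
      then have qi: "q = i" using q by simp
      have 1: "I (Suc i) (v'(5 := ?x, 12 := 1, 14 := i, 3 := Suc i)) a' (t' + 11)" if "t < S i + wg ?x"
        using that fr q qi SS unfolding I_def by (intro conjI exI[of _ i]) auto
      have 2: "I (Suc i) (v'(5 := ?x, 13 := S i + wg ?x, 3 := Suc i)) (a'(8 := (a' 8)(?x := 1))) (t' + 11)" if "\<not> t < S i + wg ?x"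
        using that fr q qi SS True tk unfolding I_def by (intro conjI exI[of _ "Suc i"]) auto
      show ?thesis using e i IM(1) IM(2)[OF x] 1 2 q(2,3) qi True x by (auto simp: add.commute intro!: addr ltB)
    next
      case False
      have "I (Suc i) (v'(3 := Suc i)) a' (t' + 6)"
        unfolding I_def using fr q False by (intro conjI exI[of _ q]) auto
      then show ?thesis using e i IM(1) False by (auto simp: add.commute intro!: addr ltB)
    qed
  next
    fix v' a' t' assume J: "I n v' a' t'"
    then obtain q where q: "q \<le> n" "v' 13 = S q" "S q \<le> t" "\<forall>x<n. a' 8 x = (if x \<in> set (take q xs) then 1 else 0)"
      "v' 12 = 0 \<and> q = n \<or> v' 12 = 1 \<and> q < n \<and> v' 14 = q \<and> t < S (Suc q)" unfolding I_def by blast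
    have "Q (v', a', t' + 2)" by (rule Q[of v' a' q]) (use J q in \<open>auto simp: I_def S_def\<close>)
    then show "cok B b (Less (V 3) (V 0)) v' a' \<and> \<not> cval (Less (V 3) (V 0)) v' a' \<and> Q (v', a', t' + 2)" using J v by (auto simp: I_def)
  qed
  then show ?thesis unfolding greedy_prefix_def using ltB[of 0] by simp
qed

lemma write_output:
  assumes v: "v 0 = n" and bn: "n \<le> b" and IM: "n + 1 \<le> IM"
    and Q: "\<And>v' a' t'. \<lbrakk>\<And>i. i < n \<Longrightarrow> a' 0 i = a 8 i; t' \<le> t0 + 20 * n + 20\<rbrakk> \<Longrightarrow> Q (v', a', t')"
  shows "wp B b write_output Q (v, a, t0)"
proof -
  define I where "I i v' a' t' \<longleftrightarrow> v' 3 = i \<and> v' 0 = n \<and> a' 8 = a 8 \<and> (\<forall>j<i. a' 0 j = a 8 j) \<and> t' \<le> t0 + 1 + 20 * i"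
    for i and v' :: vars and a' :: arrs and t' :: nat
  have raw: "addr_ok B b 0 i" if "i < n" for i using that bn by (simp add: addr_ok_def)
  have "wp B b (While (Less (V 3) (V 0)) (Upd 0 (V 3) (A 8 (V 3)) ;; Inc 3)) Q (v(3 := 0), a, t0 + 1)"
  proof (rule wp_While[of I, where n = n])
    show "I 0 (v(3 := 0)) a (t0 + 1)" using v by (auto simp: I_def)
    fix i v' a' t' assume i: "i < n" and J: "I i v' a' t'"
    have "I (Suc i) (v'(3 := Suc i)) (a'(0 := (a' 0)(i := a 8 i))) (t' + 5)"
      using J unfolding I_def by (auto simp: less_Suc_eq)
    then show "cok B b (Less (V 3) (V 0)) v' a' \<and> cval (Less (V 3) (V 0)) v' a' \<and>
      wp B b (Upd 0 (V 3) (A 8 (V 3)) ;; Inc 3) (\<lambda>(v, a, t). I (Suc i) v a t) (v', a', t' + 3)"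
      using J i IM by (auto simp: I_def add.commute intro!: addr ltB raw)
  next
    fix v' a' t' assume J: "I n v' a' t'"
    have "Q (v', a', t' + 2)" by (rule Q) (use J in \<open>auto simp: I_def\<close>)
    then show "cok B b (Less (V 3) (V 0)) v' a' \<and> \<not> cval (Less (V 3) (V 0)) v' a' \<and> Q (v', a', t' + 2)" using J v by (auto simp: I_def)
  qed
  then show ?thesis unfolding write_output_def using IM ltB[of 0] by (auto simp: ac_simps)
qed

end

section \<open>Tables of logarithms and bit reversals, and the square root\<close>

definition lg_table :: com where
  "lg_table = Asg 3 (N 2) ;; While (Less (V 3) (V 2 |+| N 1)) (Upd 9 (V 3) (A 9 (V 3 |div| N 2) |+| N 1) ;; Inc 3)"

definition sqrt_loop :: com where
  "sqrt_loop = Asg 15 (N 0) ;; While (Less (V 15 |*| V 15) (V 2)) (Inc 15)"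

definition brev_table :: com where
  "brev_table = Asg 16 (N 1) ;; While (Less (V 16) (N 2 |*| V 2))
    (Asg 3 (N 0) ;;
     While (Less (V 3) (V 16))
      (Upd 10 (V 3 |+| V 16) (N 2 |*| A 10 (V 3) |+| N 1) ;; Upd 10 (V 3) (N 2 |*| A 10 (V 3)) ;; Inc 3) ;;
     Asg 16 (N 2 |*| V 16))"

text \<open>The ceiling of the square root of \<open>w\<close>; likewise \<open>hgt w\<close> below
  is, for positive \<open>w\<close>, the ceiling of the binary logarithm of
  \<open>2 * w\<close>.\<close>

definition sqr :: "nat \<Rightarrow> nat" where "sqr w = (LEAST s. w \<le> s * s)"
definition hgt :: "nat \<Rightarrow> nat" where "hgt w = (LEAST h. 2 * w \<le> 2 ^ h)"

lemma sqr: "w \<le> sqr w * sqr w" "sqr w \<le> w" "s < sqr w \<Longrightarrow> s * s < w"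
proof -
  show "w \<le> sqr w * sqr w" unfolding sqr_def by (rule LeastI[of _ w]) (cases w, auto)
  show "sqr w \<le> w" unfolding sqr_def by (rule Least_le) (cases w, auto)
  show "s < sqr w \<Longrightarrow> s * s < w" unfolding sqr_def using not_less_Least by force
qed

lemma hgt: "2 * w \<le> 2 ^ hgt w" "h < hgt w \<Longrightarrow> 2 ^ h < 2 * w"
proof -
  show "2 * w \<le> 2 ^ hgt w" unfolding hgt_def by (rule LeastI[of _ "2 * w"]) (rule less_imp_le[OF less_exp])
  show "h < hgt w \<Longrightarrow> 2 ^ h < 2 * w" unfolding hgt_def using not_less_Least by force
qed

lemma hgt_le: "0 < w \<Longrightarrow> 2 ^ hgt w \<le> 4 * w"
  using hgt(2)[of "hgt w - 1" w] by (cases "hgt w") auto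

lemma hgt_lg2: assumes "0 < w" shows "hgt w \<le> lg2 w + 2"
  unfolding hgt_def using lg2_bounds[OF assms] by (intro Least_le) (simp add: power_add)

lemma lg2_le: "lg2 v \<le> v"
proof (cases "v = 0")
  case False
  have "lg2 v < 2 ^ lg2 v" by (rule less_exp)
  then show ?thesis using lg2_bounds[of v] False by linarith
qed (simp add: lg2.simps)

context mach
begin

lemma lg_table:
  assumes v: "v 2 = wm" and w0: "0 < wm" and a: "\<And>y. a 9 y = 0" and IM: "wm + 2 \<le> IM"
    and Q: "\<And>v' a' t'. \<lbrakk>\<forall>x. x \<noteq> 3 \<longrightarrow> v' x = v x; \<forall>k. k \<noteq> 9 \<longrightarrow> a' k = a k; \<And>y. y \<le> wm \<Longrightarrow> a' 9 y = lg2 y; t' \<le> t0 + 10 * wm + 20\<rbrakk> \<Longrightarrow> Q (v', a', t')"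
  shows "wp B b lg_table Q (v, a, t0)"
proof -
  define I where "I i v' a' t' \<longleftrightarrow> v' 3 = i + 2 \<and> (\<forall>x. x \<noteq> 3 \<longrightarrow> v' x = v x) \<and> (\<forall>k. k \<noteq> 9 \<longrightarrow> a' k = a k) \<and>
     (\<forall>y<i + 2. a' 9 y = lg2 y) \<and> t' \<le> t0 + 1 + 10 * i" for i and v' :: vars and a' :: arrs and t' :: nat
  let ?c = "Upd 9 (V 3) (A 9 (V 3 |div| N 2) |+| N 1) ;; Inc 3"
  have "wp B b (While (Less (V 3) (V 2 |+| N 1)) ?c) Q (v(3 := 2), a, t0 + 1)"
  proof (rule wp_While[of I, where n = "wm - 1"])
    have "lg2 y = 0" if "y < 2" for y using that by (subst lg2.simps) simp
    then show "I 0 (v(3 := 2)) a (t0 + 1)" using a by (simp add: I_def)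
    fix i v' a' t' assume i: "i < wm - 1" and J: "I i v' a' t'"
    have e: "v' 3 = i + 2" "v' 2 = wm" "a' 9 ((i + 2) div 2) = lg2 ((i + 2) div 2)" using J v by (auto simp: I_def)
    have l: "lg2 (i + 2) = lg2 ((i + 2) div 2) + 1" by (subst lg2.simps) simp
    have "I (Suc i) (v'(3 := i + 3)) (a'(9 := (a' 9)(i + 2 := lg2 ((i + 2) div 2) + 1))) (t' + 5)"
      unfolding I_def
    proof (intro conjI allI impI)
      fix y assume "y < Suc i + 2"
      then show "(a'(9 := (a' 9)(i + 2 := lg2 ((i + 2) div 2) + 1))) 9 y = lg2 y"
        using J l by (cases "y = i + 2") (auto simp: I_def)
    qed (use J in \<open>auto simp: I_def\<close>)
    moreover have "lg2 ((i + 2) div 2) + 1 < B"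
      by (rule ltB) (use lg2_le[of "(i + 2) div 2"] i IM in linarith)
    moreover have "i + 3 < B" "wm + 1 < B" "2 < B" "1 < B" "addr_ok B b 9 (i + 2)" "addr_ok B b 9 ((i + 2) div 2)"
      using i IM by (auto intro!: ltB addr)
    ultimately show "cok B b (Less (V 3) (V 2 |+| N 1)) v' a' \<and> cval (Less (V 3) (V 2 |+| N 1)) v' a' \<and>
       wp B b ?c (\<lambda>(v, a, t). I (Suc i) v a t) (v', a', t' + 3)"
      using e i by (auto simp: add.commute)
  next
    fix v' a' t' assume J: "I (wm - 1) v' a' t'"
    have "Q (v', a', t' + 2)" by (rule Q) (use J w0 in \<open>auto simp: I_def\<close>)
    moreover have "wm + 1 < B" "1 < B" using IM by (auto intro!: ltB)
    ultimately show "cok B b (Less (V 3) (V 2 |+| N 1)) v' a' \<and> \<not> cval (Less (V 3) (V 2 |+| N 1)) v' a' \<and> Q (v', a', t' + 2)"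
      using J v w0 by (auto simp: I_def)
  qed
  then show ?thesis unfolding lg_table_def using ltB[of 2] IM by simp
qed

lemma sqrt_loop:
  assumes v: "v 2 = wm" and IM: "(wm + 1) * (wm + 1) \<le> IM"
    and Q: "\<And>v' t'. \<lbrakk>\<forall>x. x \<noteq> 15 \<longrightarrow> v' x = v x; v' 15 = sqr wm; t' \<le> t0 + 10 * wm + 20\<rbrakk> \<Longrightarrow> Q (v', a, t')"
  shows "wp B b sqrt_loop Q (v, a, t0)"
proof -
  define I where "I i v' a' t' \<longleftrightarrow> v' 15 = i \<and> (\<forall>x. x \<noteq> 15 \<longrightarrow> v' x = v x) \<and> a' = a \<and> t' \<le> t0 + 1 + 4 * i"
    for i and v' :: vars and a' :: arrs and t' :: nat
  have sq: "s * s < B \<and> s + 1 < B" if "s \<le> wm" for s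
  proof -
    have "s * s \<le> (wm + 1) * (wm + 1)" using that by (intro mult_le_mono) auto
    moreover have "s + 1 \<le> (wm + 1) * (wm + 1)" using that by simp
    ultimately show ?thesis using IM ltB by (meson le_trans)
  qed
  have "wp B b (While (Less (V 15 |*| V 15) (V 2)) (Inc 15)) Q (v(15 := 0), a, t0 + 1)"
  proof (rule wp_While[of I, where n = "sqr wm"])
    show "I 0 (v(15 := 0)) a (t0 + 1)" by (simp add: I_def)
    fix i v' a' t' assume i: "i < sqr wm" and J: "I i v' a' t'"
    have "I (Suc i) (v'(15 := Suc i)) a' (t' + 4)" using J by (auto simp: I_def)
    then show "cok B b (Less (V 15 |*| V 15) (V 2)) v' a' \<and> cval (Less (V 15 |*| V 15) (V 2)) v' a' \<and> wp B b (Inc 15) (\<lambda>(v, a, t). I (Suc i) v a t) (v', a', t' + 3)"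
      using J v sqr(3)[OF i] sq[of i] sqr(2)[of wm] i by (auto simp: I_def add.commute)
  next
    fix v' a' t' assume J: "I (sqr wm) v' a' t'"
    have "Q (v', a, t' + 2)" by (rule Q) (use J sqr(2)[of wm] in \<open>auto simp: I_def\<close>)
    then show "cok B b (Less (V 15 |*| V 15) (V 2)) v' a' \<and> \<not> cval (Less (V 15 |*| V 15) (V 2)) v' a' \<and> Q (v', a', t' + 2)"
      using J v sqr(1)[of wm] sq[of "sqr wm"] sqr(2)[of wm] by (auto simp: I_def)
  qed
  then show ?thesis unfolding sqrt_loop_def using ltB[of 0] by simp
qed

text \<open>The table for \<open>h\<close> bits is doubled in place, the new upper half receiving
  the odd values. The costs of the rounds form a geometric sum, hence the potential
  \<open>15 * 2 ^ h\<close> in the invariant.\<close>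

lemma brev_table:
  assumes v: "v 2 = wm" and w0: "0 < wm" and a: "\<And>y. a 10 y = 0" and IM: "8 * wm + 2 \<le> IM"
    and Q: "\<And>v' a' t'. \<lbrakk>\<forall>x. x \<notin> {3, 16} \<longrightarrow> v' x = v x; \<forall>k. k \<noteq> 10 \<longrightarrow> a' k = a k; v' 16 = 2 ^ hgt wm;
      \<And>x. x < 2 ^ hgt wm \<Longrightarrow> a' 10 x = brev (hgt wm) x; t' \<le> t0 + 100 * wm + 20\<rbrakk> \<Longrightarrow> Q (v', a', t')"
  shows "wp B b brev_table Q (v, a, t0)"
proof -
  define I where "I h v' a' t' \<longleftrightarrow> v' 16 = 2 ^ h \<and> (\<forall>x. x \<notin> {3, 16} \<longrightarrow> v' x = v x) \<and> (\<forall>k. k \<noteq> 10 \<longrightarrow> a' k = a k) \<and>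
     (\<forall>x<2 ^ h. a' 10 x = brev h x) \<and> t' + 15 \<le> t0 + 1 + 15 * 2 ^ h" for h and v' :: vars and a' :: arrs and t' :: nat
  let ?b = "Upd 10 (V 3 |+| V 16) (N 2 |*| A 10 (V 3) |+| N 1) ;; Upd 10 (V 3) (N 2 |*| A 10 (V 3)) ;; Inc 3"
  let ?c = "Asg 3 (N 0) ;; While (Less (V 3) (V 16)) (Upd 10 (V 3 |+| V 16) (N 2 |*| A 10 (V 3) |+| N 1) ;; Upd 10 (V 3) (N 2 |*| A 10 (V 3)) ;; Inc 3) ;;
     Asg 16 (N 2 |*| V 16)"
  have B2: "2 * wm < B" "0 < B" "1 < B" "2 < B" using IM by (auto intro!: ltB)
  have "wp B b (While (Less (V 16) (N 2 |*| V 2)) ?c) Q (v(16 := 1), a, t0 + 1)"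
  proof (rule wp_While[of I, where n = "hgt wm"])
    show "I 0 (v(16 := 1)) a (t0 + 1)" using a by (simp add: I_def)
    fix h v' a' t' assume h: "h < hgt wm" and I: "I h v' a' t'"
    let ?P = "2 ^ h :: nat"
    have hw: "?P < 2 * wm" by (rule hgt(2)[OF h])
    have e: "v' 16 = ?P" "v' 2 = wm" using I v by (auto simp: I_def)
    define J where "J i v2 a2 t2 \<longleftrightarrow> v2 3 = i \<and> (\<forall>x. x \<noteq> 3 \<longrightarrow> v2 x = v' x) \<and> (\<forall>k. k \<noteq> 10 \<longrightarrow> a2 k = a' k) \<and>
      (\<forall>x<?P. a2 10 x = (if x < i then 2 * brev h x else brev h x)) \<and> (\<forall>x<i. a2 10 (x + ?P) = 2 * brev h x + 1) \<and> t2 \<le> t' + 4 + 6 * i"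
      for i and v2 :: vars and a2 :: arrs and t2 :: nat
    have "wp B b (While (Less (V 3) (V 16)) ?b) (wp B b (Asg 16 (N 2 |*| V 16)) (\<lambda>(v, a, t). I (Suc h) v a t)) (v'(3 := 0), a', t' + 4)"
    proof (rule wp_While[of J, where n = ?P])
      show "J 0 (v'(3 := 0)) a' (t' + 4)" using I by (auto simp: J_def I_def)
      fix i v2 a2 t2 assume i: "i < ?P" and Ji: "J i v2 a2 t2"
      have e2: "v2 3 = i" "v2 16 = ?P" "a2 10 i = brev h i" using Ji e i by (auto simp: J_def)
      have br: "brev h i < ?P" by (rule brev_less)
      have "J (Suc i) (v2(3 := Suc i)) (a2(10 := ((a2 10)(i + ?P := 2 * brev h i + 1))(i := 2 * brev h i))) (t2 + 6)"
        using Ji i unfolding J_def by (auto simp: less_Suc_eq)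
      moreover have "i + ?P < B" "2 * brev h i + 1 < B" "Suc i < B" "addr_ok B b 10 (i + ?P)" "addr_ok B b 10 i"
        using i br hw IM by (auto intro!: ltB addr)
      ultimately show "cok B b (Less (V 3) (V 16)) v2 a2 \<and> cval (Less (V 3) (V 16)) v2 a2 \<and> wp B b ?b (\<lambda>(v, a, t). J (Suc i) v a t) (v2, a2, t2 + 3)"
        using e2 i B2 by (auto simp: add.commute)
    next
      fix v2 a2 t2 assume Ji: "J ?P v2 a2 t2"
      have e2: "v2 3 = ?P" "v2 16 = ?P" using Ji e by (auto simp: J_def)
      have "I (Suc h) (v2(16 := 2 * ?P)) a2 (t2 + 3)"
        unfolding I_def
      proof (intro conjI allI impI)
        fix x :: nat assume x: "x < 2 ^ Suc h"
        show "a2 10 x = brev (Suc h) x"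
        proof (cases "x < ?P")
          case True then show ?thesis using Ji by (simp add: J_def)
        next
          case False
          then have "a2 10 ((x - ?P) + ?P) = 2 * brev h (x - ?P) + 1" using Ji x unfolding J_def by (metis less_diff_conv2 linorder_not_less mult_2 power_Suc)
          then show ?thesis using False by simp
        qed
      next
        have "t2 \<le> t' + 4 + 6 * ?P" using Ji by (simp add: J_def)
        moreover have "t' + 15 \<le> t0 + 1 + 15 * ?P" using I by (simp add: I_def)
        moreover have "1 \<le> ?P" by simp
        ultimately show "t2 + 3 + 15 \<le> t0 + 1 + 15 * 2 ^ Suc h" unfolding power_Suc by linarith
      qed (use Ji I e in \<open>auto simp: J_def I_def\<close>)
      moreover have "2 * ?P < B" using hw IM by (intro ltB) linarith
      ultimately show "cok B b (Less (V 3) (V 16)) v2 a2 \<and> \<not> cval (Less (V 3) (V 16)) v2 a2 \<and>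
         wp B b (Asg 16 (N 2 |*| V 16)) (\<lambda>(v, a, t). I (Suc h) v a t) (v2, a2, t2 + 2)" using e2 B2 by (auto simp: add.commute)
    qed
    then show "cok B b (Less (V 16) (N 2 |*| V 2)) v' a' \<and> cval (Less (V 16) (N 2 |*| V 2)) v' a' \<and> wp B b ?c (\<lambda>(v, a, t). I (Suc h) v a t) (v', a', t' + 3)"
      using e hw B2 by (auto simp: add.commute)
  next
    fix v' a' t' assume I: "I (hgt wm) v' a' t'"
    have "15 * 2 ^ hgt wm \<le> 60 * wm" using hgt_le[OF w0] by linarith
    then have "t' + 2 \<le> t0 + 100 * wm + 20" using I unfolding I_def by linarith
    then have "Q (v', a', t' + 2)" by (intro Q) (use I in \<open>auto simp: I_def\<close>)
    then show "cok B b (Less (V 16) (N 2 |*| V 2)) v' a' \<and> \<not> cval (Less (V 16) (N 2 |*| V 2)) v' a' \<and> Q (v', a', t' + 2)"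
      using I v hgt(1)[of wm] B2 by (auto simp: I_def)
  qed
  then show ?thesis unfolding brev_table_def using B2 by simp
qed

end

section \<open>Selection of the candidates by two scans outwards from the break item\<close>

definition quota_part :: "nat \<Rightarrow> com" where
  "quota_part s = Asg 8 (A 9 (V 5) |*| V 16 |+| V 6) ;; Upd (18 + s) (V 8) (A (18 + s) (V 8) |+| N 1) ;;
     If (Less (A (18 + s) (V 8)) (N 8 |*| V 2 |div| (V 6 |+| N 1) |+| N 3)) (Upd (20 + s) (V 5 |*| V 16 |+| V 6) (N 1)) Skip"

text \<open>The tested item of rank \<open>r div 2 - 1\<close> is nearer than the current one of
  rank \<open>r\<close>, so it has been scanned and its flag is final. Ranks 0 and 1 are selected
  without a test.\<close>

definition select_part :: "nat \<Rightarrow> com" where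
  "select_part s = If (Less (V 6) (N 2)) (Asg 9 (N 1)) (Asg 9 (A (20 + s) (V 5 |*| V 16 |+| (V 6 |div| N 2 |-| N 1)))) ;;
     If (Equal (V 9) (N 1)) (Upd 11 (V 26) (V 7) ;; Upd 12 (V 7) (A 10 (V 6)) ;; Inc 26) Skip"

text \<open>In outward order the number of earlier items of the same weight is the rank. Ranks from
  \<open>2 ^ H\<close> on are skipped: \<open>good_solution\<close> does without them, and the rows
  of the tables have that length.\<close>

definition scan_body :: "nat \<Rightarrow> com" where
  "scan_body s = Asg 5 (A 1 (A 4 (V 7))) ;; Asg 6 (A (16 + s) (V 5)) ;; Upd (16 + s) (V 5) (V 6 |+| N 1) ;;
     If (Less (V 6) (V 16)) (quota_part s ;; select_part s) Skip"

definition scan_out :: com where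
  "scan_out = Asg 3 (N 0) ;; While (Less (V 3) (V 0 |-| V 14)) (Asg 7 (V 14 |+| V 3) ;; scan_body 0 ;; Inc 3)"

definition scan_in :: com where
  "scan_in = Asg 3 (N 0) ;; While (Less (V 3) (V 14)) (Asg 7 (V 14 |-| (V 3 |+| N 1)) ;; scan_body 1 ;; Inc 3)"

locale algo = mach B b IM + cand n bk wm wt pen for B b IM n bk wm :: nat and wt pen :: "nat \<Rightarrow> nat" +
  fixes H P :: nat and wg :: "nat \<Rightarrow> nat" and xs :: "nat list"
  assumes P: "P = 2 ^ H" and bkn: "bk \<le> n"
    and xs: "length xs = n" "set xs = {..<n}" and wt_eq: "\<And>k. k < n \<Longrightarrow> wt k = wg (xs ! k)"
    and scan_IM: "(wm + 1) * P + 8 * wm + 2 * P + n + 10 \<le> IM"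
begin

text \<open>The order of the scans: index \<open>i\<close> is the item with \<open>pos\<close> equal
  to \<open>i + 1\<close>, among the insertions for \<open>s = 0\<close> and among the removals for
  \<open>s = 1\<close>.\<close>

definition kk :: "nat \<Rightarrow> nat \<Rightarrow> nat" where "kk s i = (if s = 0 then bk + i else bk - (i + 1))"
definition len :: "nat \<Rightarrow> nat" where "len s = (if s = 0 then n - bk else bk)"

lemma kk: assumes "i < len s" shows "kk s i < n" "(bk \<le> kk s i) = (s = 0)" "pos bk (kk s i) = i + 1"
  using assms bkn by (cases "s = 0"; simp add: kk_def len_def pos_def)+

lemma kk_surj: assumes "k < n" "(bk \<le> k) = (s = 0)" shows "\<exists>i<len s. k = kk s i \<and> pos bk k = i + 1"
  using assms bkn by (intro exI[of _ "pos bk k - 1"]) (cases "s = 0"; simp add: kk_def len_def pos_def)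

lemma kk_inj: assumes "i < len s" "j < len s" "kk s i = kk s j" shows "i = j"
proof -
  have "i + 1 = pos bk (kk s j)" unfolding assms(3)[symmetric] by (rule kk(3)[OF assms(1), symmetric])
  then show ?thesis unfolding kk(3)[OF assms(2)] by simp
qed

lemma card_kk:
  assumes "i \<le> len s"
  shows "card {k. k < n \<and> (bk \<le> k) = (s = 0) \<and> R k \<and> pos bk k \<le> i} = card {j. j < i \<and> R (kk s j)}"
proof -
  have "{k. k < n \<and> (bk \<le> k) = (s = 0) \<and> R k \<and> pos bk k \<le> i} = kk s ` {j. j < i \<and> R (kk s j)}"
  proof (intro set_eqI iffI)
    fix k assume k: "k \<in> {k. k < n \<and> (bk \<le> k) = (s = 0) \<and> R k \<and> pos bk k \<le> i}"
    then obtain j where j: "j < len s" "k = kk s j" "pos bk k = j + 1" using kk_surj[of k s] by auto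
    then have "j \<in> {j. j < i \<and> R (kk s j)}" using k by simp
    then show "k \<in> kk s ` {j. j < i \<and> R (kk s j)}" using j(2) by blast
  next
    fix k assume "k \<in> kk s ` {j. j < i \<and> R (kk s j)}"
    then obtain j where j: "j < i" "R (kk s j)" "k = kk s j" by blast
    then have "j < len s" using assms by simp
    then show "k \<in> {k. k < n \<and> (bk \<le> k) = (s = 0) \<and> R k \<and> pos bk k \<le> i}" using kk[of j s] j by simp
  qed
  moreover have "inj_on (kk s) {j. j < i \<and> R (kk s j)}" by (rule inj_onI, rule kk_inj[of _ s]) (use assms in auto)
  ultimately show ?thesis by (simp add: card_image)
qed

lemma rank_kk: assumes "i < len s" shows "rank (kk s i) = card {j. j < i \<and> wt (kk s j) = wt (kk s i)}"
proof -
  have "{k' \<in> cls (bk \<le> kk s i) (wt (kk s i)). pos bk k' < pos bk (kk s i)} =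
    {k. k < n \<and> (bk \<le> k) = (s = 0) \<and> wt k = wt (kk s i) \<and> pos bk k \<le> i}"
    using kk[OF assms] by (auto simp: cls_def)
  then show ?thesis using card_kk[of i s "\<lambda>k. wt k = wt (kk s i)"] assms by (simp add: rank_def)
qed

definition Qf :: "nat \<Rightarrow> nat \<Rightarrow> nat \<Rightarrow> nat \<Rightarrow> nat" where
  "Qf s i g r = card {j. j < i \<and> rank (kk s j) = r \<and> lg2 (wt (kk s j)) = g}"

definition OKf :: "nat \<Rightarrow> nat \<Rightarrow> nat \<Rightarrow> nat \<Rightarrow> nat" where
  "OKf s i v r = (if \<exists>j<i. wt (kk s j) = v \<and> rank (kk s j) = r \<and> quota_ok (kk s j) then 1 else 0)"

definition Cf :: "nat \<Rightarrow> nat \<Rightarrow> nat \<Rightarrow> nat" where "Cf s i v = card {j. j < i \<and> wt (kk s j) = v}"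

definition SL :: "nat \<Rightarrow> nat \<Rightarrow> nat list" where
  "SL s i = filter (\<lambda>k. sel k \<and> rank k < P) (map (kk s) [0..<i])"

lemma card_Suc_Collect: "card {j. j < Suc i \<and> R j} = card {j. j < i \<and> R j} + (if R i then 1 else 0)"
proof -
  have "{j. j < Suc i \<and> R j} = (if R i then insert i {j. j < i \<and> R j} else {j. j < i \<and> R j})" by (auto simp: less_Suc_eq)
  then show ?thesis by simp
qed

lemma Cf_Suc: "Cf s (Suc i) v = Cf s i v + (if wt (kk s i) = v then 1 else 0)"
  unfolding Cf_def by (rule card_Suc_Collect)

lemma Qf_Suc: "Qf s (Suc i) g r = Qf s i g r + (if rank (kk s i) = r \<and> lg2 (wt (kk s i)) = g then 1 else 0)"
  unfolding Qf_def by (rule card_Suc_Collect)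

lemma OKf_Suc: "OKf s (Suc i) v r = (if wt (kk s i) = v \<and> rank (kk s i) = r \<and> quota_ok (kk s i) then 1 else OKf s i v r)"
  unfolding OKf_def less_Suc_eq by auto

lemma SL_Suc: "SL s (Suc i) = SL s i @ (if sel (kk s i) \<and> rank (kk s i) < P then [kk s i] else [])"
  by (simp add: SL_def)

text \<open>The quota counts items no farther away than \<open>kk s i\<close>. In scan order these
  are among the first \<open>Suc i\<close>, so the running counter, once incremented, already has
  its final value.\<close>

lemma quota_kk:
  assumes "i < len s"
  shows "quota_ok (kk s i) \<longleftrightarrow> Qf s (Suc i) (lg2 (wt (kk s i))) (rank (kk s i)) < 8 * wm div (rank (kk s i) + 1) + 3"
proof -
  have "{k. k < n \<and> (bk \<le> k) = (bk \<le> kk s i) \<and> rank k = rank (kk s i) \<and> lg2 (wt k) = lg2 (wt (kk s i)) \<and> pos bk k \<le> pos bk (kk s i)} =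
    {k. k < n \<and> (bk \<le> k) = (s = 0) \<and> (rank k = rank (kk s i) \<and> lg2 (wt k) = lg2 (wt (kk s i))) \<and> pos bk k \<le> Suc i}"
    using kk[OF assms] by auto
  then have "quota_ok (kk s i) \<longleftrightarrow> Qf s (Suc i) (lg2 (wt (kk s i))) (rank (kk s i)) \<le> 8 * wm div (rank (kk s i) + 1) + 2"
    unfolding quota_ok_def Qf_def using card_kk[of "Suc i" s "\<lambda>k. rank k = rank (kk s i) \<and> lg2 (wt k) = lg2 (wt (kk s i))"] assms by simp
  then show ?thesis by linarith
qed

text \<open>A tested item that admits \<open>kk s i\<close> has smaller rank in the same class,
  hence is nearer and precedes it in the scan; so the search for a witness can be limited to scanned
  items.\<close>

lemma sel_kk:
  assumes i: "i < len s"
  shows "sel (kk s i) \<longleftrightarrow> rank (kk s i) < 2 \<or> OKf s (Suc i) (wt (kk s i)) (rank (kk s i) div 2 - 1) = 1"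
proof (cases "rank (kk s i) < 2")
  case False
  let ?k = "kk s i"
  have "(\<exists>e \<in> cls (bk \<le> ?k) (wt ?k). rank e + 1 = rank ?k div 2 \<and> quota_ok e) \<longleftrightarrow>
     (\<exists>j<Suc i. wt (kk s j) = wt ?k \<and> rank (kk s j) = rank ?k div 2 - 1 \<and> quota_ok (kk s j))"
  proof safe
    fix e assume e: "e \<in> cls (bk \<le> ?k) (wt ?k)" "rank e + 1 = rank ?k div 2" "quota_ok e"
    have kc: "?k \<in> cls (bk \<le> ?k) (wt ?k)" by (rule in_cls[OF kk(1)[OF i]])
    obtain j where j: "e = kk s j" "pos bk e = j + 1" using kk_surj[of e s] e(1) kk(2)[OF i] by (auto simp: cls_def)
    have "rank e \<le> rank ?k" using e(2) by linarith
    then have "pos bk e \<le> pos bk ?k" using rank_le_iff[OF e(1) kc] by simp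
    then have "j < Suc i" using j kk(3)[OF i] by simp
    then show "\<exists>j<Suc i. wt (kk s j) = wt ?k \<and> rank (kk s j) = rank ?k div 2 - 1 \<and> quota_ok (kk s j)"
      using e j by (intro exI[of _ j]) (auto simp: cls_def)
  next
    fix j assume j: "j < Suc i" "wt (kk s j) = wt ?k" "rank (kk s j) = rank ?k div 2 - 1" "quota_ok (kk s j)"
    have jl: "j < len s" using j i by simp
    have "kk s j \<in> cls (bk \<le> ?k) (wt ?k)" using kk[OF jl] kk[OF i] j by (auto simp: cls_def)
    moreover have "rank (kk s j) + 1 = rank ?k div 2" using j False by simp
    ultimately show "\<exists>e \<in> cls (bk \<le> ?k) (wt ?k). rank e + 1 = rank ?k div 2 \<and> quota_ok e" using j by blast
  qed
  then show ?thesis using False by (simp add: sel_def OKf_def)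
qed (simp add: sel_def)

text \<open>Contents of all tables after \<open>i\<close> items of side \<open>s\<close>. The last
  clause about array 12 protects the keys that the scan of the other side has written.\<close>

definition SInv :: "nat \<Rightarrow> vars \<Rightarrow> arrs \<Rightarrow> nat list \<Rightarrow> nat \<Rightarrow> nat \<Rightarrow> vars \<Rightarrow> arrs \<Rightarrow> nat \<Rightarrow> bool" where
  "SInv s v a sl t0 i v' a' t' \<longleftrightarrow> v' 3 = i \<and> (\<forall>x. x \<notin> {3, 5, 6, 7, 8, 9, 26} \<longrightarrow> v' x = v x) \<and>
     (\<forall>k. k \<notin> {11, 12, 16 + s, 18 + s, 20 + s} \<longrightarrow> a' k = a k) \<and>
     (\<forall>y. a' (16 + s) y = Cf s i y) \<and> (\<forall>g. \<forall>r<P. a' (18 + s) (g * P + r) = Qf s i g r) \<and>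
     (\<forall>y. \<forall>r<P. a' (20 + s) (y * P + r) = OKf s i y r) \<and>
     v' 26 = length (sl @ SL s i) \<and> (\<forall>j<length (sl @ SL s i). a' 11 j = (sl @ SL s i) ! j) \<and>
     (\<forall>k\<in>set (SL s i). a' 12 k = brev H (rank k)) \<and> (\<forall>k. k \<notin> kk s ` {..<i} \<longrightarrow> a' 12 k = a 12 k) \<and> t' \<le> t0 + 1 + 40 * i"

definition scan_pre :: "vars \<Rightarrow> arrs \<Rightarrow> bool" where
  "scan_pre v a \<longleftrightarrow> v 0 = n \<and> v 2 = wm \<and> v 14 = bk \<and> v 16 = P \<and> (\<forall>k<n. a 1 k = wg k) \<and> (\<forall>k<n. a 4 k = xs ! k) \<and>
     (\<forall>y\<le>wm. a 9 y = lg2 y) \<and> (\<forall>x<P. a 10 x = brev H x)"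

lemma scan_step:
  assumes s: "s \<le> 1" and pre: "scan_pre v a" and i: "i < len s" and I: "SInv s v a sl t0 i v0 a0 t1" and sln: "length sl + len s \<le> n"
    and v': "v' 7 = kk s i" "\<forall>x. x \<noteq> 7 \<longrightarrow> v' x = v0 x" and t': "t' \<le> t1 + 4"
  shows "wp B b (scan_body s ;; Inc 3) (\<lambda>(v', a', t'). SInv s v a sl t0 (Suc i) v' a' t') (v', a0, t')"
proof -
  let ?k = "kk s i"
  define w where "w = wt ?k"
  define r where "r = rank ?k"
  define g where "g = lg2 w"
  have kn: "?k < n" by (rule kk(1)[OF i])
  have w: "0 < w" "w \<le> wm" using wt[OF kn] by (auto simp: w_def)
  have xk: "xs ! ?k < n" using xs kn nth_mem[of ?k xs] by auto
  have fr: "v0 x = v x" if "x \<notin> {3, 5, 6, 7, 8, 9, 26}" for x using I that unfolding SInv_def by blast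
  have fa: "a0 k = a k" if "k \<notin> {11, 12, 16 + s, 18 + s, 20 + s}" for k using I that unfolding SInv_def by blast
  have e: "v' 2 = wm" "v' 16 = P" "v' 3 = i" "v' 26 = length (sl @ SL s i)" "v' 7 = ?k"
    using v' fr[of 2] fr[of 16] I pre by (auto simp: SInv_def scan_pre_def)
  have ae: "a0 4 ?k = xs ! ?k" "a0 1 (xs ! ?k) = w" "a0 9 w = g" "a0 (16 + s) w = r"
  proof -
    have "a0 4 = a 4" "a0 1 = a 1" "a0 9 = a 9" using s by (auto intro!: fa)
    then show "a0 4 ?k = xs ! ?k" "a0 1 (xs ! ?k) = w" "a0 9 w = g"
      using pre kn xk w wt_eq[OF kn] by (auto simp: scan_pre_def w_def g_def)
    show "a0 (16 + s) w = r" using I rank_kk[OF i] by (simp add: SInv_def Cf_def w_def r_def)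
  qed
  have "SL s i = filter (\<lambda>k. sel k \<and> rank k < P) (map (kk s) [0..<i])" by (rule SL_def)
  then have lSL: "length (SL s i) \<le> i" using length_filter_le[of "\<lambda>k. sel k \<and> rank k < P" "map (kk s) [0..<i]"] by simp
  have Mn: "length (sl @ SL s i) < n" using lSL sln i by simp
  have knew: "?k \<notin> set (SL s i)" "?k \<notin> kk s ` {..<i}"
  proof -
    show 1: "?k \<notin> kk s ` {..<i}"
    proof
      assume "?k \<in> kk s ` {..<i}"
      then obtain j where "j < i" "kk s i = kk s j" by blast
      then show False using kk_inj[of i s j] i by simp
    qed
    have "set (SL s i) \<subseteq> kk s ` {..<i}" by (auto simp: SL_def)
    then show "?k \<notin> set (SL s i)" using 1 by blast
  qed
  define v1 where "v1 = v'(5 := w, 6 := r)"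
  define a1 where "a1 = a0(16 + s := (a0 (16 + s))(w := r + 1))"
  have IMw: "w * P + P \<le> IM" "g * P + P \<le> IM" "r < n"
  proof -
    have "w * P + P \<le> (wm + 1) * P" using w by simp
    then show "w * P + P \<le> IM" using scan_IM by linarith
    have "g \<le> wm" using lg2_le[of w] w by (simp add: g_def)
    then have "g * P + P \<le> (wm + 1) * P" by simp
    then show "g * P + P \<le> IM" using scan_IM by linarith
    have "r \<le> card {j. j < i}" unfolding r_def rank_kk[OF i] by (rule card_mono) auto
    moreover have "i < n" using i bkn by (auto simp: len_def split: if_splits)
    ultimately show "r < n" by simp
  qed
  have small: "wm \<le> IM" "n + 10 \<le> IM" "8 * wm + 10 \<le> IM" "2 * P + 10 \<le> IM" using scan_IM by linarith+
  note cst = ltB[of 0] ltB[of 1] ltB[of 2] ltB[of 3] ltB[of 8]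
  have cB: "0 < B" "1 < B" "2 < B" "3 < B" "8 < B" using cst small by auto
  have C1: "\<forall>y. a1 (16 + s) y = Cf s (Suc i) y" using I ae unfolding a1_def by (auto simp: Cf_Suc SInv_def w_def)
  \<comment> \<open>The state between quota test and selection; both outcomes of the test establish
    it.\<close>
  define Mid where "Mid v2 a2 t2 \<longleftrightarrow> (\<forall>x. x \<noteq> 8 \<longrightarrow> v2 x = v1 x) \<and> (\<forall>k. k \<notin> {18 + s, 20 + s} \<longrightarrow> a2 k = a1 k) \<and>
     (\<forall>g. \<forall>r<P. a2 (18 + s) (g * P + r) = Qf s (Suc i) g r) \<and> (\<forall>y. \<forall>r<P. a2 (20 + s) (y * P + r) = OKf s (Suc i) y r) \<and> t2 \<le> t' + 10"
    for v2 :: vars and a2 :: arrs and t2 :: nat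
  have fin: "wp B b (Inc 3) (\<lambda>(v', a', t'). SInv s v a sl t0 (Suc i) v' a' t') (v3, a3, t3)"
    if f1: "\<forall>x. x \<notin> {8, 9, 26} \<longrightarrow> v3 x = v1 x" and f2: "\<forall>k. k \<notin> {11, 12, 18 + s, 20 + s} \<longrightarrow> a3 k = a1 k"
      and f3: "\<forall>g. \<forall>r<P. a3 (18 + s) (g * P + r) = Qf s (Suc i) g r" "\<forall>y. \<forall>r<P. a3 (20 + s) (y * P + r) = OKf s (Suc i) y r"
      and f4: "v3 26 = length (sl @ SL s (Suc i))" "\<forall>j<length (sl @ SL s (Suc i)). a3 11 j = (sl @ SL s (Suc i)) ! j"
        "\<forall>k\<in>set (SL s (Suc i)). a3 12 k = brev H (rank k)" "\<forall>k. k \<notin> kk s ` {..<Suc i} \<longrightarrow> a3 12 k = a 12 k" and f5: "t3 \<le> t' + 30" for v3 a3 t3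
  proof -
    have v3: "v3 3 = i" using f1 e by (simp add: v1_def)
    have "SInv s v a sl t0 (Suc i) (v3(3 := Suc i)) a3 (t3 + 1)"
      unfolding SInv_def
    proof (intro conjI)
      show "\<forall>x. x \<notin> {3, 5, 6, 7, 8, 9, 26} \<longrightarrow> (v3(3 := Suc i)) x = v x" using f1 v' fr by (simp add: v1_def)
      show "\<forall>k. k \<notin> {11, 12, 16 + s, 18 + s, 20 + s} \<longrightarrow> a3 k = a k" using f2 fa by (simp add: a1_def)
      show "\<forall>y. a3 (16 + s) y = Cf s (Suc i) y" using f2 C1 s by simp
      show "t3 + 1 \<le> t0 + 1 + 40 * Suc i" using f5 t' I by (simp add: SInv_def)
    qed (use f3 f4 in auto)
    moreover have "i + 1 < B" using i small bkn by (intro ltB) (auto simp: len_def split: if_splits)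
    ultimately show ?thesis using v3 cB by simp
  qed
  have S12: "\<forall>k\<in>set (SL s i). a0 12 k = brev H (rank k)" "\<forall>k. k \<notin> kk s ` {..<i} \<longrightarrow> a0 12 k = a 12 k"
    "\<forall>j<length (sl @ SL s i). a0 11 j = (sl @ SL s i) ! j" using I by (auto simp: SInv_def)
  have ids: "18 + s \<noteq> 11" "18 + s \<noteq> 12" "20 + s \<noteq> 11" "20 + s \<noteq> 12" "16 + s \<noteq> 11" "16 + s \<noteq> 12" "16 + s \<noteq> 10" "18 + s \<noteq> 10" "20 + s \<noteq> 10"
    "16 + s \<noteq> 20 + s" "16 + s \<noteq> 18 + s" "18 + s \<noteq> 20 + s" "20 + s \<noteq> 18 + s" "16 + s < 32" "18 + s < 32" "20 + s < 32" using s by auto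
  have sel_wp: "wp B b (select_part s ;; Inc 3) (\<lambda>(v', a', t'). SInv s v a sl t0 (Suc i) v' a' t') (v2, a2, t2)"
    if M: "Mid v2 a2 t2" and rP: "r < P" for v2 a2 t2
  proof -
    have ev2: "v2 5 = w" "v2 6 = r" "v2 16 = P" "v2 26 = length (sl @ SL s i)" "v2 7 = ?k" using M e by (auto simp: Mid_def v1_def)
    have a12: "a2 11 = a0 11" "a2 12 = a0 12" "a2 10 = a 10" using M ids fa[of 10] by (auto simp: Mid_def a1_def)
    have br: "a2 10 r = brev H r" using a12 pre rP by (simp add: scan_pre_def)
    have okv: "a2 (20 + s) (w * P + (r div 2 - 1)) = OKf s (Suc i) w (r div 2 - 1)" using M rP unfolding Mid_def by (metis diff_le_self div_le_dividend le_less_trans)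
    have selr: "sel ?k \<longleftrightarrow> r < 2 \<or> OKf s (Suc i) w (r div 2 - 1) = 1" using sel_kk[OF i] by (simp add: r_def w_def)
    have yes: "wp B b (Upd 11 (V 26) (V 7) ;; Upd 12 (V 7) (A 10 (V 6)) ;; Inc 26) (wp B b (Inc 3) (\<lambda>(v', a', t'). SInv s v a sl t0 (Suc i) v' a' t')) (v2(9 := x), a2, t3)"
      if "sel ?k" "t3 \<le> t2 + 6" for x t3
    proof -
      have SLS: "SL s (Suc i) = SL s i @ [?k]" using that rP by (simp add: SL_Suc r_def)
      have "wp B b (Inc 3) (\<lambda>(v', a', t'). SInv s v a sl t0 (Suc i) v' a' t')
        (v2(9 := x, 26 := Suc (length (sl @ SL s i))), a2(11 := (a2 11)(length (sl @ SL s i) := ?k), 12 := (a2 12)(?k := brev H r)), t3 + 1 + 1 + 1)"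
      proof (rule fin)
        show "\<forall>j<length (sl @ SL s (Suc i)). (a2(11 := (a2 11)(length (sl @ SL s i) := ?k), 12 := (a2 12)(?k := brev H r))) 11 j = (sl @ SL s (Suc i)) ! j"
        proof (intro allI impI)
          fix j assume j: "j < length (sl @ SL s (Suc i))"
          have SS: "sl @ SL s (Suc i) = (sl @ SL s i) @ [?k]" using SLS by simp
          show "(a2(11 := (a2 11)(length (sl @ SL s i) := ?k), 12 := (a2 12)(?k := brev H r))) 11 j = (sl @ SL s (Suc i)) ! j"
          proof (cases "j = length (sl @ SL s i)")
            case True then show ?thesis unfolding SS nth_append by simp
          next
            case False
            then have jl: "j < length (sl @ SL s i)" using j unfolding SS by simp
            then show ?thesis using S12(3) a12 False unfolding SS nth_append[of "sl @ SL s i"] by simp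
          qed
        qed
        show "\<forall>k\<in>set (SL s (Suc i)). (a2(11 := (a2 11)(length (sl @ SL s i) := ?k), 12 := (a2 12)(?k := brev H r))) 12 k = brev H (rank k)"
          using S12 a12 knew by (auto simp: SLS r_def)
        show "\<forall>k. k \<notin> kk s ` {..<Suc i} \<longrightarrow> (a2(11 := (a2 11)(length (sl @ SL s i) := ?k), 12 := (a2 12)(?k := brev H r))) 12 k = a 12 k"
          using S12 a12 by (auto simp: lessThan_Suc)
        show "t3 + 1 + 1 + 1 \<le> t' + 30" using that M by (simp add: Mid_def)
      qed (use M ids SLS in \<open>auto simp: Mid_def\<close>)
      moreover have "length (sl @ SL s i) + 1 < B" "addr_ok B b 11 (length (sl @ SL s i))" "addr_ok B b 12 ?k" "addr_ok B b 10 r"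
        using Mn kn IMw small by (auto intro!: ltB addr)
      ultimately show ?thesis using ev2 br cB by simp
    qed
    have no: "wp B b (Inc 3) (\<lambda>(v', a', t'). SInv s v a sl t0 (Suc i) v' a' t') (v2(9 := x), a2, t3)"
      if "\<not> sel ?k" "t3 \<le> t2 + 6" for x t3
    proof -
      have SLS: "SL s (Suc i) = SL s i" using that by (simp add: SL_Suc)
      show ?thesis
      proof (rule fin)
        show "\<forall>k. k \<notin> kk s ` {..<Suc i} \<longrightarrow> a2 12 k = a 12 k" using S12 a12 by (auto simp: lessThan_Suc)
        show "t3 \<le> t' + 30" using that M by (simp add: Mid_def)
      qed (use M ids SLS S12 a12 ev2 in \<open>auto simp: Mid_def\<close>)
    qed
    have ad: "w * P + (r div 2 - 1) \<le> IM" "w * P \<le> IM" using IMw rP by linarith+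
    have "r \<le> IM" using IMw small by linarith
    have bnds: "w * P + (r div 2 - 1) < B" "w * P < B" "addr_ok B b (20 + s) (w * P + (r div 2 - 1))"
      using ad ids by (auto intro!: ltB addr)
    have sel01: "sel ?k \<longleftrightarrow> (if r < 2 then 1 else OKf s (Suc i) w (r div 2 - 1)) = 1" using selr by simp
    show ?thesis
    proof (cases "r < 2")
      case True
      then show ?thesis unfolding select_part_def using ev2 cB yes[of "t2 + 2 + 1 + 2" 1] selr by simp
    next
      case False
      then have r1: "1 \<le> r div 2" by simp
      show ?thesis
      proof (cases "sel ?k")
        case True
        then have "OKf s (Suc i) w (r div 2 - 1) = 1" using selr False by simp
        then show ?thesis unfolding select_part_def using ev2 cB yes[of "t2 + 2 + 1 + 2" 1] True False bnds okv r1 by simp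
      next
        case F: False
        then have "OKf s (Suc i) w (r div 2 - 1) \<noteq> 1" using selr False by simp
        then show ?thesis unfolding select_part_def using ev2 cB no[of "t2 + 2 + 1 + 2" "OKf s (Suc i) w (r div 2 - 1)"] F False bnds okv r1 by simp
      qed
    qed
  qed
  have quota_wp: "wp B b (quota_part s) (wp B b (select_part s) (wp B b (Inc 3) (\<lambda>(v', a', t'). SInv s v a sl t0 (Suc i) v' a' t'))) (v1, a1, t' + 1 + 1 + 1 + 2)"
    if rP: "r < P"
  proof -
    let ?g = "g * P + r" and ?o = "w * P + r" let ?q = "Qf s i g r"
    have aQ: "a1 (18 + s) ?g = ?q" using I rP ids by (simp add: a1_def SInv_def)
    have a9: "a1 9 w = g" using ae s by (simp add: a1_def)
    define a2 where "a2 = a1(18 + s := (a1 (18 + s))(?g := ?q + 1))"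
    have Q2: "\<forall>g'. \<forall>r'<P. a2 (18 + s) (g' * P + r') = Qf s (Suc i) g' r'"
    proof (intro allI impI)
      fix g' r' assume r': "r' < P"
      have "g' * P + r' = ?g \<longleftrightarrow> g' = g \<and> r' = r" using mult_add_cancel[of g' P r' g r] r' rP by auto
      then show "a2 (18 + s) (g' * P + r') = Qf s (Suc i) g' r'"
        using I r' ids by (auto simp: a2_def a1_def SInv_def Qf_Suc g_def w_def r_def)
    qed
    have O1: "a1 (20 + s) (y * P + r') = OKf s i y r'" if "r' < P" for y r' using I that ids by (simp add: a1_def SInv_def)
    have qk: "quota_ok ?k \<longleftrightarrow> ?q + 1 < 8 * wm div (r + 1) + 3"
      using quota_kk[OF i] by (simp add: Qf_Suc g_def w_def r_def)
    have q_le: "?q \<le> i" unfolding Qf_def using card_mono[of "{..<i}" "{j. j < i \<and> rank (kk s j) = r \<and> lg2 (wt (kk s j)) = g}"] by auto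
    have iln: "i < n" using i bkn by (auto simp: len_def split: if_splits)
    have bnds: "g * P < B" "g * P + r < B" "w * P < B" "w * P + r < B" "?q + 1 < B" "8 * wm < B" "r + 1 < B"
      using IMw rP small q_le iln by (auto intro!: ltB)
    have "8 * wm div (r + 1) + 3 \<le> 8 * wm + 3" by simp
    then have bnd3: "8 * wm div (r + 1) + 3 < B" using small by (intro ltB) linarith
    have "?g \<le> IM" "?o \<le> IM" "w \<le> IM" using IMw rP small w by linarith+
    then have ad: "addr_ok B b (18 + s) ?g" "addr_ok B b (20 + s) ?o" "addr_ok B b 9 w" using ids by (auto intro!: addr)
    have ev1: "v1 5 = w" "v1 6 = r" "v1 16 = P" "v1 2 = wm" using e by (auto simp: v1_def)
    have yes: "wp B b (select_part s ;; Inc 3) (\<lambda>(v', a', t'). SInv s v a sl t0 (Suc i) v' a' t') (v1(8 := ?g), a2(20 + s := (a2 (20 + s))(?o := 1)), t' + 1 + 1 + 1 + 2 + 1 + 1 + 2 + 1)"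
      if q: "quota_ok ?k"
    proof (rule sel_wp[OF _ rP])
      have "(a2(20 + s := (a2 (20 + s))(?o := 1))) (20 + s) (y * P + r') = OKf s (Suc i) y r'" if r': "r' < P" for y r'
      proof -
        have "y * P + r' = ?o \<longleftrightarrow> y = w \<and> r' = r" using mult_add_cancel[of y P r' w r] r' rP by auto
        then show ?thesis using O1[OF r', of y] q ids by (auto simp: a2_def OKf_Suc w_def r_def)
      qed
      then show "Mid (v1(8 := ?g)) (a2(20 + s := (a2 (20 + s))(?o := 1))) (t' + 1 + 1 + 1 + 2 + 1 + 1 + 2 + 1)"
        unfolding Mid_def using Q2 ids by (auto simp: a2_def)
    qed
    have no: "wp B b (select_part s ;; Inc 3) (\<lambda>(v', a', t'). SInv s v a sl t0 (Suc i) v' a' t') (v1(8 := ?g), a2, t' + 1 + 1 + 1 + 2 + 1 + 1 + 2)"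
      if q: "\<not> quota_ok ?k"
    proof (rule sel_wp[OF _ rP])
      have "a2 (20 + s) (y * P + r') = OKf s (Suc i) y r'" if r': "r' < P" for y r'
        using O1[OF r', of y] q ids by (auto simp: a2_def OKf_Suc)
      then show "Mid (v1(8 := ?g)) a2 (t' + 1 + 1 + 1 + 2 + 1 + 1 + 2)" unfolding Mid_def using Q2 ids by (auto simp: a2_def)
    qed
    have g2: "a2 (18 + s) ?g = ?q + 1" by (simp add: a2_def)
    show ?thesis
    proof (cases "quota_ok ?k")
      case True
      then have "?q + 1 < 8 * wm div (r + 1) + 3" using qk by simp
      then show ?thesis unfolding quota_part_def using yes[OF True] ev1 aQ a9 bnds bnd3 ad cB g2
        by (simp add: a2_def)
    next
      case False
      then have "\<not> ?q + 1 < 8 * wm div (r + 1) + 3" using qk by simp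
      then show ?thesis unfolding quota_part_def using no[OF False] ev1 aQ a9 bnds bnd3 ad cB g2
        by (simp add: a2_def)
    qed
  qed
  have b1: "addr_ok B b 4 ?k" "addr_ok B b 1 (xs ! ?k)" "addr_ok B b (16 + s) w" "r + 1 < B"
    using kn xk w IMw small ids by (auto intro!: addr ltB)
  show ?thesis
  proof (cases "r < P")
    case True
    then show ?thesis unfolding scan_body_def using quota_wp[OF True] e ae b1 cB
      by (simp add: v1_def a1_def)
  next
    case False
    have SLS: "SL s (Suc i) = SL s i" using False by (simp add: SL_Suc r_def)
    have "wp B b (Inc 3) (\<lambda>(v', a', t'). SInv s v a sl t0 (Suc i) v' a' t') (v1, a1, t' + 1 + 1 + 1 + 2)"
    proof (rule fin)
      show "\<forall>g. \<forall>r<P. a1 (18 + s) (g * P + r) = Qf s (Suc i) g r" using I ids False by (auto simp: a1_def SInv_def Qf_Suc r_def)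
      show "\<forall>y. \<forall>r<P. a1 (20 + s) (y * P + r) = OKf s (Suc i) y r" using I ids False by (auto simp: a1_def SInv_def OKf_Suc r_def)
      show "v1 26 = length (sl @ SL s (Suc i))" using e SLS by (simp add: v1_def)
      show "\<forall>k. k \<notin> kk s ` {..<Suc i} \<longrightarrow> a1 12 k = a 12 k" using S12 ids by (auto simp: a1_def lessThan_Suc)
    qed (use SLS S12 ids in \<open>auto simp: a1_def\<close>)
    then show ?thesis unfolding scan_body_def using False e ae b1 cB by (simp add: v1_def a1_def)
  qed
qed

lemma scan_out:
  assumes pre: "scan_pre v a" and M: "v 26 = 0" and z: "\<And>y. a 16 y = 0" "\<And>y. a 18 y = 0" "\<And>y. a 20 y = 0"
    and Q: "\<And>v' a' t'. \<lbrakk>\<forall>x. x \<notin> {3, 5, 6, 7, 8, 9, 26} \<longrightarrow> v' x = v x; \<forall>k. k \<notin> {11, 12, 16, 18, 20} \<longrightarrow> a' k = a k;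
       v' 26 = length (SL 0 (len 0)); \<And>j. j < length (SL 0 (len 0)) \<Longrightarrow> a' 11 j = SL 0 (len 0) ! j;
       \<And>k. k \<in> set (SL 0 (len 0)) \<Longrightarrow> a' 12 k = brev H (rank k); t' \<le> t0 + 40 * n + 10\<rbrakk> \<Longrightarrow> Q (v', a', t')"
  shows "wp B b scan_out Q (v, a, t0)"
proof -
  let ?I = "SInv 0 v a [] t0"
  have small: "n + 10 \<le> IM" using scan_IM by linarith
  have "wp B b (While (Less (V 3) (V 0 |-| V 14)) (Asg 7 (V 14 |+| V 3) ;; scan_body 0 ;; Inc 3)) Q (v(3 := 0), a, t0 + 1)"
  proof (rule wp_While[of ?I, where n = "len 0"])
    show "?I 0 (v(3 := 0)) a (t0 + 1)" using M z by (simp add: SInv_def Cf_def Qf_def OKf_def SL_def)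
    fix i v' a' t' assume i: "i < len 0" and I: "?I i v' a' t'"
    have e: "v' 3 = i" "v' 0 = n" "v' 14 = bk" using I pre by (auto simp: SInv_def scan_pre_def)
    have k: "bk + i = kk 0 i" by (simp add: kk_def)
    have "wp B b (scan_body 0 ;; Inc 3) (\<lambda>(v', a', t'). ?I (Suc i) v' a' t') (v'(7 := bk + i), a', t' + 3 + 1)"
      by (rule scan_step[OF _ pre i I]) (use k bkn in \<open>auto simp: len_def\<close>)
    moreover have "bk + i < B" using i small by (intro ltB) (simp add: len_def)
    ultimately show "cok B b (Less (V 3) (V 0 |-| V 14)) v' a' \<and> cval (Less (V 3) (V 0 |-| V 14)) v' a' \<and>
      wp B b (Asg 7 (V 14 |+| V 3) ;; scan_body 0 ;; Inc 3) (\<lambda>(v', a', t'). ?I (Suc i) v' a' t') (v', a', t' + 3)"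
      using e i bkn by (simp add: len_def)
  next
    fix v' a' t' assume I: "?I (len 0) v' a' t'"
    have "len 0 \<le> n" by (simp add: len_def)
    then have "Q (v', a', t' + 2)" by (intro Q) (use I in \<open>auto simp: SInv_def\<close>)
    then show "cok B b (Less (V 3) (V 0 |-| V 14)) v' a' \<and> \<not> cval (Less (V 3) (V 0 |-| V 14)) v' a' \<and> Q (v', a', t' + 2)"
      using I pre bkn by (auto simp: SInv_def scan_pre_def len_def)
  qed
  then show ?thesis unfolding scan_out_def using ltB[of 0] by simp
qed

lemma scan_in:
  assumes pre: "scan_pre v a" and M: "v 26 = length sl" and sl: "\<And>j. j < length sl \<Longrightarrow> a 11 j = sl ! j" "length sl + bk \<le> n"
    and slk: "\<And>k. k \<in> set sl \<Longrightarrow> bk \<le> k \<and> a 12 k = brev H (rank k)"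
    and z: "\<And>y. a 17 y = 0" "\<And>y. a 19 y = 0" "\<And>y. a 21 y = 0"
    and Q: "\<And>v' a' t'. \<lbrakk>\<forall>x. x \<notin> {3, 5, 6, 7, 8, 9, 26} \<longrightarrow> v' x = v x; \<forall>k. k \<notin> {11, 12, 17, 19, 21} \<longrightarrow> a' k = a k;
       v' 26 = length (sl @ SL 1 bk); \<And>j. j < length (sl @ SL 1 bk) \<Longrightarrow> a' 11 j = (sl @ SL 1 bk) ! j;
       \<And>k. k \<in> set (sl @ SL 1 bk) \<Longrightarrow> a' 12 k = brev H (rank k); t' \<le> t0 + 40 * n + 10\<rbrakk> \<Longrightarrow> Q (v', a', t')"
  shows "wp B b scan_in Q (v, a, t0)"
proof -
  let ?I = "SInv 1 v a sl t0"
  have small: "n + 10 \<le> IM" using scan_IM by linarith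
  have l1: "len 1 = bk" by (simp add: len_def)
  have "wp B b (While (Less (V 3) (V 14)) (Asg 7 (V 14 |-| (V 3 |+| N 1)) ;; scan_body 1 ;; Inc 3)) Q (v(3 := 0), a, t0 + 1)"
  proof (rule wp_While[of ?I, where n = "len 1"])
    show "?I 0 (v(3 := 0)) a (t0 + 1)" using M z sl by (simp add: SInv_def Cf_def Qf_def OKf_def SL_def)
    fix i v' a' t' assume i: "i < len 1" and I: "?I i v' a' t'"
    have e: "v' 3 = i" "v' 14 = bk" using I pre by (auto simp: SInv_def scan_pre_def)
    have k: "bk - (i + 1) = kk 1 i" by (simp add: kk_def)
    have "wp B b (scan_body 1 ;; Inc 3) (\<lambda>(v', a', t'). ?I (Suc i) v' a' t') (v'(7 := bk - (i + 1)), a', t' + 3 + 1)"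
      by (rule scan_step[OF _ pre i I]) (use k bkn sl l1 in \<open>auto simp: len_def\<close>)
    moreover have "i + 1 < B" "1 < B" using i small bkn by (auto intro!: ltB simp: len_def)
    ultimately show "cok B b (Less (V 3) (V 14)) v' a' \<and> cval (Less (V 3) (V 14)) v' a' \<and>
      wp B b (Asg 7 (V 14 |-| (V 3 |+| N 1)) ;; scan_body 1 ;; Inc 3) (\<lambda>(v', a', t'). ?I (Suc i) v' a' t') (v', a', t' + 3)"
      using e i bkn by (simp add: len_def)
  next
    fix v' a' t' assume I: "?I (len 1) v' a' t'"
    have I2: "\<forall>k. k \<notin> kk 1 ` {..<bk} \<longrightarrow> a' 12 k = a 12 k" "\<forall>k\<in>set (SL 1 bk). a' 12 k = brev H (rank k)" using I l1 by (auto simp: SInv_def)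
    have "k \<notin> kk 1 ` {..<bk}" if "bk \<le> k" for k using that by (auto simp: kk_def)
    then have k12: "a' 12 k = brev H (rank k)" if "k \<in> set (sl @ SL 1 bk)" for k using that I2 slk by auto
    have "Q (v', a', t' + 2)" by (rule Q) (use I bkn k12 in \<open>auto simp: SInv_def len_def\<close>)
    then show "cok B b (Less (V 3) (V 14)) v' a' \<and> \<not> cval (Less (V 3) (V 14)) v' a' \<and> Q (v', a', t' + 2)"
      using I pre bkn by (auto simp: SInv_def scan_pre_def len_def)
  qed
  then show ?thesis unfolding scan_in_def using ltB[of 0] by simp
qed

lemma set_SL: "set (SL s (len s)) = {k. k < n \<and> (bk \<le> k) = (s = 0) \<and> sel k \<and> rank k < P}"
proof (intro set_eqI iffI)
  fix k assume "k \<in> set (SL s (len s))"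
  then obtain i where "i < len s" "k = kk s i" "sel k" "rank k < P" by (auto simp: SL_def)
  then show "k \<in> {k. k < n \<and> (bk \<le> k) = (s = 0) \<and> sel k \<and> rank k < P}" using kk[of i s] by simp
next
  fix k assume k: "k \<in> {k. k < n \<and> (bk \<le> k) = (s = 0) \<and> sel k \<and> rank k < P}"
  then obtain i where "i < len s" "k = kk s i" using kk_surj[of k s] by auto
  then show "k \<in> set (SL s (len s))" using k by (auto simp: SL_def)
qed

lemma distinct_SL: "i \<le> len s \<Longrightarrow> distinct (SL s i)"
proof -
  assume i: "i \<le> len s"
  have "inj_on (kk s) (set [0..<i])" by (rule inj_onI, rule kk_inj[of _ s]) (use i in auto)
  then show ?thesis unfolding SL_def by (intro distinct_filter) (simp add: distinct_map)
qed

abbreviation "SLS \<equiv> SL 0 (len 0) @ SL 1 bk"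

lemma set_SLS: "set SLS = {k. k < n \<and> sel k \<and> rank k < P}"
proof -
  have "len 1 = bk" by (simp add: len_def)
  then show ?thesis using set_SL[of 0] set_SL[of 1] by auto
qed

lemma distinct_SLS: "distinct SLS"
proof -
  have l: "len 1 = bk" by (simp add: len_def)
  have "set (SL 0 (len 0)) \<inter> set (SL 1 (len 1)) = {}" unfolding set_SL by auto
  then show ?thesis using distinct_SL[of "len 0" 0] distinct_SL[of "len 1" 1] l by simp
qed

lemma length_SLS: "length SLS = card {k. k < n \<and> sel k \<and> rank k < P}" "length SLS \<le> n"
proof -
  show e: "length SLS = card {k. k < n \<and> sel k \<and> rank k < P}" using distinct_card[OF distinct_SLS] set_SLS by simp
  have "card {k. k < n \<and> sel k \<and> rank k < P} \<le> card {..<n}" by (rule card_mono) auto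
  then show "length SLS \<le> n" unfolding e by simp
qed

end

section \<open>The table, its best cell and backtracking\<close>

definition dp_cell :: com where
  "dp_cell = Asg 6 (V 2 |+| V 8) ;; Asg 9 (A 13 (V 28 |*| V 27 |+| V 6)) ;;
     If (Less (V 7) (V 14)) (Asg 30 (A 13 (V 28 |*| V 27 |+| (V 6 |+| V 5)))) (Asg 30 (A 13 (V 28 |*| V 27 |+| (V 6 |-| V 5)))) ;;
     If (Equal (V 30) (N 0)) Skip
      (Asg 30 (V 30 |+| V 29) ;; If (Equal (V 9) (N 0)) (Asg 9 (V 30)) (If (Less (V 30) (V 9)) (Asg 9 (V 30)) Skip)) ;;
     Upd 13 ((V 28 |+| N 1) |*| V 27 |+| V 6) (V 9) ;; Inc 8"

definition dp_table :: com where
  "dp_table = Asg 27 (N 2 |*| V 17 |+| N 2 |*| V 2 |+| N 1) ;; Upd 13 (V 2 |+| V 17) (N 1) ;; Asg 28 (N 0) ;;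
   While (Less (V 28) (V 26))
    (Asg 7 (A 11 (V 28)) ;; Asg 31 (A 4 (V 7)) ;; Asg 5 (A 1 (V 31)) ;;
     If (Less (V 7) (V 14)) (Asg 29 (A 2 (V 31) |*| V 24 |-| V 23 |*| V 5)) (Asg 29 (V 23 |*| V 5 |-| A 2 (V 31) |*| V 24)) ;;
     Asg 8 (N 0) ;;
     While (Less (V 8) (N 2 |*| V 17 |+| N 1)) dp_cell ;;
     Inc 28)"

definition best_sum :: com where
  "best_sum = Asg 32 (N 0) ;; Asg 33 (N 0) ;; Asg 8 (N 0) ;;
   While (Less (V 8) (V 25 |+| N 1))
    (Asg 30 (A 13 (V 26 |*| V 27 |+| (V 2 |+| V 17 |+| V 8))) ;;
     If (Equal (V 30) (N 0)) Skip
      (If (Less (V 33 |+| V 30) (V 23 |*| V 8 |+| N 1)) (Asg 33 (V 23 |*| V 8 |+| N 1 |-| V 30) ;; Asg 32 (V 8)) Skip) ;;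
     Inc 8)"

definition backtrack :: com where
  "backtrack = Asg 6 (V 2 |+| V 17 |+| V 32) ;; Asg 28 (V 26) ;;
   While (Less (N 0) (V 28))
    (Asg 28 (V 28 |-| N 1) ;;
     If (Equal (A 13 ((V 28 |+| N 1) |*| V 27 |+| V 6)) (A 13 (V 28 |*| V 27 |+| V 6))) Skip
      (Asg 7 (A 11 (V 28)) ;; Asg 31 (A 4 (V 7)) ;; Upd 8 (V 31) (N 1 |-| A 8 (V 31)) ;;
       If (Less (V 7) (V 14)) (Asg 6 (V 6 |+| A 1 (V 31))) (Asg 6 (V 6 |-| A 1 (V 31)))))"

locale solver = algo B b IM n bk wm wt pen H P wg xs + dp n bk wm wt pen L its
  for B b IM n bk wm :: nat and wt pen :: "nat \<Rightarrow> nat" and H P :: nat and wg :: "nat \<Rightarrow> nat" and xs :: "nat list"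
    and L :: nat and its :: "nat list" +
  fixes pf :: "nat \<Rightarrow> nat" and pb wb PM u :: nat
  assumes pen_out: "bk \<le> k \<Longrightarrow> k < n \<Longrightarrow> pf (xs ! k) * wb \<le> pb * wt k \<and> pen k = pb * wt k - pf (xs ! k) * wb"
    and pen_in: "k < bk \<Longrightarrow> pb * wt k \<le> pf (xs ! k) * wb \<and> pen k = pf (xs ! k) * wb - pb * wt k"
    and PM: "k < n \<Longrightarrow> pf (xs ! k) * wb \<le> PM" "pb * wm \<le> PM"
    and uL: "u \<le> L" "u < wm"
    and dp_IM: "(n + 1) * (2 * L + 2 * wm + 1) + (n + 1) * PM + 20 \<le> IM"
    and dxs: "distinct xs"
begin

abbreviation "WD \<equiv> 2 * L + 2 * wm + 1"
abbreviation "M \<equiv> length its"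

lemma M_le: "M \<le> n"
  using distinct_card[OF its(2)] card_mono[OF finite_lessThan its(1)] by simp

lemma pbwt: "k < n \<Longrightarrow> pb * wt k \<le> PM" using wt[of k] PM(2) mult_le_mono2[of "wt k" wm pb] by linarith

lemma pen_le: "k < n \<Longrightarrow> pen k \<le> PM"
  using pen_out[of k] pen_in[of k] PM(1)[of k] pbwt[of k] by (cases "bk \<le> k") auto

lemma F_le: "k \<le> M \<Longrightarrow> F k y \<le> k * PM + 1"
proof (induction k arbitrary: y)
  case (Suc k)
  have "pen (its ! k) \<le> PM" using pen_le its_nth Suc by simp
  then have "relax (F k y) (F k (prv (its ! k) y)) (pen (its ! k)) \<le> Suc k * PM + 1"
    using Suc.IH[of y] Suc.IH[of "prv (its ! k) y"] Suc.prems by (auto simp: relax_def)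
  then show ?case by simp
qed simp

text \<open>The empty set has sum and penalty 0, and 1 is the least nonzero entry. This justifies
  that \<open>best_sum\<close> starts with sum 0 and value 0.\<close>

lemma F_base: "F k (wm + L) = 1"
  by (induction k) (auto simp: relax_def)

lemma idx: assumes "k \<le> M" "y < WD" shows "k * WD + y \<le> IM" "k * WD \<le> IM"
proof -
  have "k * WD + y \<le> (n + 1) * WD"
  proof -
    have "k * WD \<le> n * WD" using assms(1) M_le by (intro mult_le_mono1) linarith
    then show ?thesis using assms(2) by simp
  qed
  then show "k * WD + y \<le> IM" "k * WD \<le> IM" using dp_IM by linarith+
qed

lemma small: "WD + 10 \<le> IM" "n + 10 \<le> IM" "PM + 10 \<le> IM" "F k y + 10 \<le> IM" "F k y + PM + 9 \<le> IM" if "k \<le> M"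
proof -
  have "WD \<le> (n + 1) * WD" "PM \<le> (n + 1) * PM" by simp_all
  moreover have "n + 1 \<le> (n + 1) * WD" by simp
  moreover have "k * PM \<le> n * PM" using that M_le by (intro mult_le_mono1) linarith
  moreover have "n * PM + PM = (n + 1) * PM" by simp
  moreover note F_le[OF that, of y]
  ultimately show "WD + 10 \<le> IM" "n + 10 \<le> IM" "PM + 10 \<le> IM" "F k y + 10 \<le> IM" "F k y + PM + 9 \<le> IM" using dp_IM by linarith+
qed

definition dp_pre :: "vars \<Rightarrow> arrs \<Rightarrow> bool" where
  "dp_pre v a \<longleftrightarrow> v 0 = n \<and> v 2 = wm \<and> v 14 = bk \<and> v 17 = L \<and> v 23 = pb \<and> v 24 = wb \<and> v 25 = u \<and> v 26 = M \<and>
     (\<forall>k<n. a 1 k = wg k) \<and> (\<forall>k<n. a 2 k = pf k) \<and> (\<forall>k<n. a 4 k = xs ! k) \<and> (\<forall>j<M. a 11 j = its ! j)"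

lemma dp_cell:
  assumes m: "m < M" and j: "j < 2 * L + 1" and k: "k = its ! m"
    and v: "v 2 = wm" "v 8 = j" "v 28 = m" "v 27 = WD" "v 7 = k" "v 14 = bk" "v 5 = wt k" "v 29 = pen k"
    and a: "\<And>y. y < WD \<Longrightarrow> a 13 (m * WD + y) = F m y"
    and Q: "\<And>v' t'. \<lbrakk>\<forall>x. x \<notin> {6, 8, 9, 30} \<longrightarrow> v' x = v x; v' 8 = Suc j; t' \<le> t0 + 20\<rbrakk> \<Longrightarrow>
       Q (v', a(13 := (a 13)(Suc m * WD + (wm + j) := F (Suc m) (wm + j))), t')"
  shows "wp B b dp_cell Q (v, a, t0)"
proof -
  let ?y = "wm + j" let ?p = "prv k ?y"
  have kn: "k < n" using its_nth[OF m] k by simp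
  have wk: "wt k \<le> wm" using wt[OF kn] by simp
  have yW: "?y < WD" "?p < WD" using j wk by (auto simp: prv_def)
  have Fy: "F (Suc m) ?y = relax (F m ?y) (F m ?p) (pen k)" using j by (simp add: k)
  have mM: "m \<le> M" "Suc m \<le> M" using m by auto
  note i1 = idx[OF mM(1) yW(1)] idx[OF mM(1) yW(2)] idx[OF mM(2) yW(1)]
  note sm = small[OF mM(1)]
  have b1: "?y < B" "m * WD < B" "m * WD + ?y < B" "m * WD + ?p < B" "Suc m * WD < B" "Suc m * WD + ?y < B" "m + 1 < B" "j + 1 < B" "1 < B" "0 < B"
    "?y + wt k < B"
    using i1 sm m M_le j wk by (auto intro!: ltB)
  have Fp: "F m ?p + pen k < B" using small(5)[OF mM(1), of ?p] pen_le[OF kn] by (intro ltB) linarith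
  have ad: "addr_ok B b 13 (m * WD + ?y)" "addr_ok B b 13 (m * WD + ?p)" "addr_ok B b 13 (Suc m * WD + ?y)" using i1 by (auto intro!: addr)
  have fin: "wp B b (Upd 13 ((V 28 |+| N 1) |*| V 27 |+| V 6) (V 9)) (wp B b (Inc 8) Q) (v3, a, t3)"
    if v3: "\<forall>x. x \<notin> {6, 9, 30} \<longrightarrow> v3 x = v x" "v3 6 = ?y" "v3 9 = F (Suc m) ?y" and t3: "t3 \<le> t0 + 14" for v3 t3
  proof -
    have e: "v3 28 = m" "v3 27 = WD" "v3 8 = j" using v3 v by auto
    have "Q (v3(8 := Suc j), a(13 := (a 13)(Suc m * WD + ?y := F (Suc m) ?y)), t3 + 1 + 1)"
      by (rule Q) (use v3 t3 in auto)
    then show ?thesis using e v3(2,3) b1 ad by (simp del: F.simps)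
  qed
  define c where "c = F m ?p" define x where "x = F m ?y"
  have rel: "wp B b (If (Equal (V 30) (N 0)) Skip
      (Asg 30 (V 30 |+| V 29) ;; If (Equal (V 9) (N 0)) (Asg 9 (V 30)) (If (Less (V 30) (V 9)) (Asg 9 (V 30)) Skip)))
     (wp B b (Upd 13 ((V 28 |+| N 1) |*| V 27 |+| V 6) (V 9)) (wp B b (Inc 8) Q)) (v(6 := ?y, 9 := x, 30 := c), a, t3)"
    if t3: "t3 \<le> t0 + 5" for t3
  proof (cases "c = 0")
    case True
    then have "F (Suc m) ?y = x" using Fy by (simp add: relax_def c_def x_def)
    then have "wp B b (Upd 13 ((V 28 |+| N 1) |*| V 27 |+| V 6) (V 9)) (wp B b (Inc 8) Q) (v(6 := ?y, 9 := x, 30 := c), a, t3 + 2)"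
      using t3 by (intro fin) auto
    then show ?thesis using True b1 by simp
  next
    case False
    show ?thesis
    proof (cases "x = 0 \<or> c + pen k < x")
      case True
      then have "F (Suc m) ?y = c + pen k" using Fy False by (simp add: relax_def c_def x_def)
      then have *: "wp B b (Upd 13 ((V 28 |+| N 1) |*| V 27 |+| V 6) (V 9)) (wp B b (Inc 8) Q) (v(6 := ?y, 9 := c + pen k, 30 := c + pen k), a, t4)"
        if "t4 \<le> t3 + 9" for t4 using that t3 by (intro fin) auto
      show ?thesis
      proof (cases "x = 0")
        case True
        then show ?thesis using *[of "t3 + 2 + 1 + 2 + 1"] False b1 Fp v by (simp add: c_def fun_upd_twist)
      next
        case x0: False
        then show ?thesis using *[of "t3 + 2 + 1 + 2 + 2 + 1"] False True b1 Fp v by (simp add: c_def fun_upd_twist)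
      qed
    next
      case nlt: False
      then have "F (Suc m) ?y = x" using Fy False by (simp add: relax_def c_def x_def)
      then have "wp B b (Upd 13 ((V 28 |+| N 1) |*| V 27 |+| V 6) (V 9)) (wp B b (Inc 8) Q) (v(6 := ?y, 9 := x, 30 := c + pen k), a, t3 + 2 + 1 + 2 + 2)"
        using t3 by (intro fin) auto
      then show ?thesis using False nlt b1 Fp v by (simp add: c_def fun_upd_twist)
    qed
  qed
  have ax: "a 13 (m * WD + ?y) = x" "a 13 (m * WD + ?p) = c" using a yW by (auto simp: x_def c_def)
  show ?thesis
  proof (cases "k < bk")
    case True
    then have p: "?p = ?y + wt k" by (simp add: prv_def)
    show ?thesis unfolding dp_cell_def using rel[of "t0 + 1 + 1 + 2 + 1"] True v ax b1 ad unfolding p by simp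
  next
    case False
    then have p: "?p = ?y - wt k" by (simp add: prv_def)
    have le: "wt k \<le> ?y" using wk by simp
    show ?thesis unfolding dp_cell_def using rel[of "t0 + 1 + 1 + 2 + 1"] False v ax b1 ad le unfolding p by simp
  qed
qed

text \<open>Beyond the initial entry, only cells of the window are written. The margins keep their
  initial 0, which by \<open>F_range\<close> is also their value in \<open>F\<close>. The nested
  loops give the dominant term of the running time.\<close>

lemma dp_table:
  assumes pre: "dp_pre v a" and z: "\<And>y. a 13 y = 0"
    and Q: "\<And>v' a' t'. \<lbrakk>\<forall>x. x \<notin> {5, 6, 7, 8, 9, 27, 28, 29, 30, 31} \<longrightarrow> v' x = v x; v' 27 = WD; \<forall>k. k \<noteq> 13 \<longrightarrow> a' k = a k;
       \<And>k y. k \<le> M \<Longrightarrow> y < WD \<Longrightarrow> a' 13 (k * WD + y) = F k y; t' \<le> t0 + M * (30 * (2 * L + 1) + 30) + 20\<rbrakk> \<Longrightarrow> Q (v', a', t')"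
  shows "wp B b dp_table Q (v, a, t0)"
proof -
  define I where "I m v' a' t' \<longleftrightarrow> v' 28 = m \<and> v' 27 = WD \<and> (\<forall>x. x \<notin> {5, 6, 7, 8, 9, 27, 28, 29, 30, 31} \<longrightarrow> v' x = v x) \<and>
     (\<forall>k. k \<noteq> 13 \<longrightarrow> a' k = a k) \<and> (\<forall>k. \<forall>y<WD. a' 13 (k * WD + y) = (if k \<le> m then F k y else 0)) \<and>
     t' \<le> t0 + 3 + m * (30 * (2 * L + 1) + 30)" for m and v' :: vars and a' :: arrs and t' :: nat
  let ?pq = "If (Less (V 7) (V 14)) (Asg 29 (A 2 (V 31) |*| V 24 |-| V 23 |*| V 5)) (Asg 29 (V 23 |*| V 5 |-| A 2 (V 31) |*| V 24))"
  let ?c = "Asg 7 (A 11 (V 28)) ;; Asg 31 (A 4 (V 7)) ;; Asg 5 (A 1 (V 31)) ;; If (Less (V 7) (V 14)) (Asg 29 (A 2 (V 31) |*| V 24 |-| V 23 |*| V 5)) (Asg 29 (V 23 |*| V 5 |-| A 2 (V 31) |*| V 24)) ;;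
     Asg 8 (N 0) ;; While (Less (V 8) (N 2 |*| V 17 |+| N 1)) dp_cell ;; Inc 28"
  note s0 = small[of 0]
  have cB: "0 < B" "1 < B" "2 < B" "2 * L < B" "2 * L + 1 < B" "2 * wm < B" "2 * L + 2 * wm < B" "WD < B" "wm + L < B"
    "addr_ok B b 13 (wm + L)" using s0 by (auto intro!: ltB addr)
  have zy: "k' * WD + y = wm + L \<longleftrightarrow> k' = 0 \<and> y = wm + L" if "y < WD" for k' y
    using mult_add_cancel[of k' WD y 0 "wm + L"] that by auto
  have "wp B b (While (Less (V 28) (V 26)) ?c) Q (v(27 := WD, 28 := 0), a(13 := (a 13)(wm + L := 1)), t0 + 1 + 1 + 1)"
  proof (rule wp_While[of I, where n = M])
    show "I 0 (v(27 := WD, 28 := 0)) (a(13 := (a 13)(wm + L := 1))) (t0 + 1 + 1 + 1)" using z zy by (auto simp: I_def)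
    fix m v' a' t' assume m: "m < M" and I: "I m v' a' t'"
    let ?k = "its ! m"
    have kn: "?k < n" by (rule its_nth[OF m])
    have xk: "xs ! ?k < n" using xs kn nth_mem[of ?k xs] by auto
    have pr: "v' 2 = wm" "v' 14 = bk" "v' 17 = L" "v' 23 = pb" "v' 24 = wb" "v' 26 = M" "v' 28 = m" "v' 27 = WD"
      "a' 11 m = ?k" "a' 4 ?k = xs ! ?k" "a' 1 (xs ! ?k) = wt ?k" "a' 2 (xs ! ?k) = pf (xs ! ?k)"
      using I pre m kn xk wt_eq[OF kn] by (auto simp: I_def dp_pre_def)
    note sm = small[of m]
    have bb: "addr_ok B b 11 m" "addr_ok B b 4 ?k" "addr_ok B b 1 (xs ! ?k)" "addr_ok B b 2 (xs ! ?k)" "pf (xs ! ?k) * wb < B" "pb * wt ?k < B" "m + 1 < B"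
      using sm m M_le kn xk PM(1)[OF kn] pbwt[OF kn] by (auto intro!: addr ltB)
    define v1 where "v1 = v'(7 := ?k, 31 := xs ! ?k, 5 := wt ?k, 29 := pen ?k, 8 := 0)"
    define J where "J j v2 a2 t2 \<longleftrightarrow> v2 8 = j \<and> (\<forall>x. x \<notin> {6, 8, 9, 30} \<longrightarrow> v2 x = v1 x) \<and> (\<forall>k. k \<noteq> 13 \<longrightarrow> a2 k = a' k) \<and>
      (\<forall>k. \<forall>y<WD. a2 13 (k * WD + y) = (if k \<le> m then F k y else if k = Suc m \<and> y < wm + j then F (Suc m) y else 0)) \<and>
      t2 \<le> t' + 10 + 23 * j" for j and v2 :: vars and a2 :: arrs and t2 :: nat
    have inner: "wp B b (While (Less (V 8) (N 2 |*| V 17 |+| N 1)) dp_cell) (wp B b (Inc 28) (\<lambda>(v, a, t). I (Suc m) v a t)) (v1, a', t1)"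
      if t1: "t1 \<le> t' + 10" for t1
    proof (rule wp_While[of J, where n = "2 * L + 1"])
      have "F (Suc m) y = 0" if "y < wm" for y using F_range[of "Suc m" y] that by (metis not_less)
      then show "J 0 v1 a' t1" using I t1 by (auto simp: J_def I_def v1_def simp del: F.simps)
      fix j v2 a2 t2 assume j: "j < 2 * L + 1" and J: "J j v2 a2 t2"
      have e: "v2 17 = L" "v2 8 = j" "v2 2 = wm" "v2 28 = m" "v2 27 = WD" "v2 7 = ?k" "v2 14 = bk" "v2 5 = wt ?k" "v2 29 = pen ?k"
        using J pr by (auto simp: J_def v1_def)
      have "wp B b dp_cell (\<lambda>(v, a, t). J (Suc j) v a t) (v2, a2, t2 + 3)"
      proof (rule dp_cell[OF m j refl e(3,2,4,5,6,7,8,9)])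
        show "\<And>y. y < WD \<Longrightarrow> a2 13 (m * WD + y) = F m y" using J by (simp add: J_def)
        fix v3 t3 assume r: "\<forall>x. x \<notin> {6, 8, 9, 30} \<longrightarrow> v3 x = v2 x" "v3 8 = Suc j" "t3 \<le> t2 + 3 + 20"
        let ?a = "a2(13 := (a2 13)(Suc m * WD + (wm + j) := F (Suc m) (wm + j)))"
        have "J (Suc j) v3 ?a t3" unfolding J_def
        proof (intro conjI)
          show "\<forall>k. \<forall>y<WD. ?a 13 (k * WD + y) = (if k \<le> m then F k y else if k = Suc m \<and> y < wm + Suc j then F (Suc m) y else 0)"
          proof (intro allI impI)
            fix k y assume y: "y < WD"
            have eq: "k * WD + y = Suc m * WD + (wm + j) \<longleftrightarrow> k = Suc m \<and> y = wm + j"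
              using mult_add_cancel[of k WD y "Suc m" "wm + j"] y j by auto
            have old: "a2 13 (k * WD + y) = (if k \<le> m then F k y else if k = Suc m \<and> y < wm + j then F (Suc m) y else 0)"
              using J y unfolding J_def by blast
            show "?a 13 (k * WD + y) = (if k \<le> m then F k y else if k = Suc m \<and> y < wm + Suc j then F (Suc m) y else 0)"
            proof (cases "k = Suc m \<and> y = wm + j")
              case True then show ?thesis by (simp del: F.simps mult_Suc)
            next
              case False
              then have "k * WD + y \<noteq> Suc m * WD + (wm + j)" using eq by blast
              then have "?a 13 (k * WD + y) = a2 13 (k * WD + y)" unfolding fun_upd_same by (rule fun_upd_other)
              then show ?thesis using old False by (auto simp del: F.simps mult_Suc)
            qed
          qed
        qed (use r J in \<open>auto simp: J_def simp del: F.simps\<close>)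
        then show "case (v3, ?a, t3) of (v, a, t) \<Rightarrow> J (Suc j) v a t" by simp
      qed
      then show "cok B b (Less (V 8) (N 2 |*| V 17 |+| N 1)) v2 a2 \<and> cval (Less (V 8) (N 2 |*| V 17 |+| N 1)) v2 a2 \<and>
        wp B b dp_cell (\<lambda>(v, a, t). J (Suc j) v a t) (v2, a2, t2 + 3)" using e j cB by simp
    next
      fix v2 a2 t2 assume J: "J (2 * L + 1) v2 a2 t2"
      have e: "v2 17 = L" "v2 8 = 2 * L + 1" "v2 28 = m" using J pr by (auto simp: J_def v1_def)
      have out: "F (Suc m) y = 0" if "\<not> y < wm + (2 * L + 1)" for y
      proof (rule ccontr)
        assume "F (Suc m) y \<noteq> 0"
        from F_range[OF this] show False using that by linarith
      qed
      have "I (Suc m) (v2(28 := Suc m)) a2 (t2 + 2 + 1)"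
        unfolding I_def
      proof (intro conjI)
        show "\<forall>k. \<forall>y<WD. a2 13 (k * WD + y) = (if k \<le> Suc m then F k y else 0)"
        proof (intro allI impI)
          fix k y assume y: "y < WD"
          have "a2 13 (k * WD + y) = (if k \<le> m then F k y else if k = Suc m \<and> y < wm + (2 * L + 1) then F (Suc m) y else 0)"
            using J y unfolding J_def by blast
          then show "a2 13 (k * WD + y) = (if k \<le> Suc m then F k y else 0)" using out[of y] by (auto simp: le_Suc_eq simp del: F.simps)
        qed
        have "t2 \<le> t' + 10 + 23 * (2 * L + 1)" using J unfolding J_def by blast
        moreover have "t' \<le> t0 + 3 + m * (30 * (2 * L + 1) + 30)" using I unfolding I_def by blast
        ultimately show "t2 + 2 + 1 \<le> t0 + 3 + Suc m * (30 * (2 * L + 1) + 30)" unfolding mult_Suc by linarith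
      qed (use J I in \<open>auto simp: J_def I_def v1_def\<close>)
      then show "cok B b (Less (V 8) (N 2 |*| V 17 |+| N 1)) v2 a2 \<and> \<not> cval (Less (V 8) (N 2 |*| V 17 |+| N 1)) v2 a2 \<and>
        wp B b (Inc 28) (\<lambda>(v, a, t). I (Suc m) v a t) (v2, a2, t2 + 2)" using e cB bb by simp
    qed
    show "cok B b (Less (V 28) (V 26)) v' a' \<and> cval (Less (V 28) (V 26)) v' a' \<and> wp B b ?c (\<lambda>(v, a, t). I (Suc m) v a t) (v', a', t' + 3)"
    proof (cases "?k < bk")
      case True
      then show ?thesis using inner[of "t' + 3 + 1 + 1 + 1 + 2 + 1 + 1"] pr bb cB m pen_in[OF True] unfolding v1_def by simp
    next
      case False
      then have "pf (xs ! ?k) * wb \<le> pb * wt ?k" "pen ?k = pb * wt ?k - pf (xs ! ?k) * wb" using pen_out[of ?k] kn by auto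
      then show ?thesis using inner[of "t' + 3 + 1 + 1 + 1 + 2 + 1 + 1"] pr bb cB m False unfolding v1_def by simp
    qed
  next
    fix v' a' t' assume I: "I M v' a' t'"
    have "Q (v', a', t' + 2)"
    proof (rule Q)
      show "a' 13 (k * WD + y) = F k y" if "k \<le> M" "y < WD" for k y using I that unfolding I_def by simp
    qed (use I in \<open>auto simp: I_def\<close>)
    then show "cok B b (Less (V 28) (V 26)) v' a' \<and> \<not> cval (Less (V 28) (V 26)) v' a' \<and> Q (v', a', t' + 2)"
      using I pre by (auto simp: I_def dp_pre_def)
  qed
  then show ?thesis unfolding dp_table_def using pre cB by (simp add: dp_pre_def)
qed

text \<open>The gain of the best set known for the change of weight \<open>j\<close>; the table
  stores one more than its penalty.\<close>

definition worth :: "nat \<Rightarrow> int" where "worth j = int (pb * j) - (int (F M (wm + L + j)) - 1)"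

text \<open>The running maximum starts with the worth 0 of the empty set and only grows, so it is a
  natural number. The comparison in the program is written with sums alone, because the worth of a
  cell may be negative.\<close>

lemma best_sum:
  assumes pre: "dp_pre v a" and v27: "v 27 = WD" and tab: "\<And>k y. k \<le> M \<Longrightarrow> y < WD \<Longrightarrow> a 13 (k * WD + y) = F k y"
    and Q: "\<And>v' t' s. \<lbrakk>\<forall>x. x \<notin> {8, 30, 32, 33} \<longrightarrow> v' x = v x; v' 32 = s; s \<le> u; F M (wm + L + s) \<noteq> 0; 0 \<le> worth s;
       \<And>j. j \<le> u \<Longrightarrow> F M (wm + L + j) \<noteq> 0 \<Longrightarrow> worth j \<le> worth s; t' \<le> t0 + 30 * u + 40\<rbrakk> \<Longrightarrow> Q (v', a, t')"
  shows "wp B b best_sum Q (v, a, t0)"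
proof -
  define I where "I j v' a' t' \<longleftrightarrow> v' 8 = j \<and> (\<forall>x. x \<notin> {8, 30, 32, 33} \<longrightarrow> v' x = v x) \<and> a' = a \<and> v' 32 \<le> u \<and> F M (wm + L + v' 32) \<noteq> 0 \<and>
     int (v' 33) = worth (v' 32) \<and> (\<forall>i<j. F M (wm + L + i) \<noteq> 0 \<longrightarrow> worth i \<le> int (v' 33)) \<and> t' \<le> t0 + 3 + 30 * j"
    for j and v' :: vars and a' :: arrs and t' :: nat
  let ?c = "Asg 30 (A 13 (V 26 |*| V 27 |+| (V 2 |+| V 17 |+| V 8))) ;;
     If (Equal (V 30) (N 0)) Skip
      (If (Less (V 33 |+| V 30) (V 23 |*| V 8 |+| N 1)) (Asg 33 (V 23 |*| V 8 |+| N 1 |-| V 30) ;; Asg 32 (V 8)) Skip) ;; Inc 8"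
  note s0 = small[of M]
  have uu: "u + 1 < B" using s0(1) uL by (intro ltB) linarith
  have cB: "0 < B" "1 < B" using s0 by (auto intro!: ltB)
  have pbj: "pb * j \<le> PM" if "j \<le> u" for j using that uL PM(2) mult_le_mono2[of j wm pb] by linarith
  have pr: "v 2 = wm" "v 17 = L" "v 23 = pb" "v 25 = u" "v 26 = M" using pre by (auto simp: dp_pre_def)
  have "wp B b (While (Less (V 8) (V 25 |+| N 1)) ?c) Q (v(32 := 0, 33 := 0, 8 := 0), a, t0 + 1 + 1 + 1)"
  proof (rule wp_While[of I, where n = "u + 1"])
    show "I 0 (v(32 := 0, 33 := 0, 8 := 0)) a (t0 + 1 + 1 + 1)" using F_base[of M] by (simp add: I_def worth_def)
    fix j v' a' t' assume j: "j < u + 1" and I: "I j v' a' t'"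
    define c where "c = F M (wm + L + j)"
    have e: "v' 8 = j" "v' 2 = wm" "v' 17 = L" "v' 23 = pb" "v' 25 = u" "v' 26 = M" "v' 27 = WD" "a' = a"
      using I pr v27 by (auto simp: I_def)
    have yW: "wm + L + j < WD" using j uL by simp
    have ac: "a 13 (M * WD + (wm + L + j)) = c" using tab[OF _ yW] by (simp add: c_def)
    note ix = idx[OF order_refl yW]
    have w33: "v' 33 \<le> PM"
    proof -
      have "int (v' 33) = worth (v' 32)" "v' 32 \<le> u" "F M (wm + L + v' 32) \<noteq> 0" using I by (auto simp: I_def)
      then have "int (v' 33) \<le> int (pb * v' 32)" unfolding worth_def by linarith
      then show ?thesis using pbj[OF \<open>v' 32 \<le> u\<close>] by linarith
    qed
    have pj: "pb * j \<le> PM" using pbj j by simp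
    have bb: "wm + L < B" "wm + L + j < B" "M * WD < B" "M * WD + (wm + L + j) < B" "addr_ok B b 13 (M * WD + (wm + L + j))"
      "pb * j < B" "pb * j + 1 < B" "j + 1 < B"
      using ix s0(1,3) j uL pj by (auto intro!: ltB addr)
    have bc: "v' 33 + c < B" using s0(5)[of "wm + L + j"] w33 by (intro ltB) (simp add: c_def)
    have skip: "I (Suc j) (v'(30 := c, 8 := Suc j)) a tt" if "c = 0 \<or> \<not> v' 33 + c < pb * j + 1" "tt \<le> t' + 30" for tt
    proof -
      have "worth j \<le> int (v' 33)" if "F M (wm + L + j) \<noteq> 0"
      proof -
        have "pb * j + 1 \<le> v' 33 + c" using that \<open>c = 0 \<or> \<not> v' 33 + c < pb * j + 1\<close> by (auto simp: c_def)
        then show ?thesis unfolding worth_def c_def by linarith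
      qed
      then show ?thesis using I that e unfolding I_def by (auto simp: less_Suc_eq)
    qed
    have take: "I (Suc j) (v'(30 := c, 33 := pb * j + 1 - c, 32 := j, 8 := Suc j)) a tt"
      if c0: "c \<noteq> 0" and lt: "v' 33 + c < pb * j + 1" and "tt \<le> t' + 30" for tt
    proof -
      have wj: "int (pb * j + 1 - c) = worth j" using lt unfolding worth_def c_def by linarith
      have "int (v' 33) \<le> worth j" using wj lt by linarith
      then have "worth i \<le> worth j" if "i < Suc j" "F M (wm + L + i) \<noteq> 0" for i
        using that I unfolding I_def by (auto simp: less_Suc_eq intro: order_trans)
      then show ?thesis using I that e j wj unfolding I_def by (auto simp: c_def)
    qed
    show "cok B b (Less (V 8) (V 25 |+| N 1)) v' a' \<and> cval (Less (V 8) (V 25 |+| N 1)) v' a' \<and> wp B b ?c (\<lambda>(v, a, t). I (Suc j) v a t) (v', a', t' + 3)"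
    proof (cases "c = 0")
      case True
      then show ?thesis using skip[of "t' + 3 + 1 + 2 + 1"] e ac bb bc uu cB j by simp
    next
      case c0: False
      show ?thesis
      proof (cases "v' 33 + c < pb * j + 1")
        case True
        then have "c \<le> pb * j + 1" by simp
        then show ?thesis using take[of "t' + 3 + 1 + 2 + 2 + 1 + 1 + 1"] True c0 e ac bb bc uu cB j by (simp add: fun_upd_twist)
      next
        case False
        then show ?thesis using skip[of "t' + 3 + 1 + 2 + 2 + 1"] c0 e ac bb bc uu cB j by simp
      qed
    qed
  next
    fix v' a' t' assume I: "I (u + 1) v' a' t'"
    have "Q (v', a, t' + 2)" by (rule Q[of v' "v' 32"]) (use I in \<open>auto simp: I_def\<close>)
    then show "cok B b (Less (V 8) (V 25 |+| N 1)) v' a' \<and> \<not> cval (Less (V 8) (V 25 |+| N 1)) v' a' \<and> Q (v', a', t' + 2)"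
      using I pr uu cB by (auto simp: I_def)
  qed
  then show ?thesis unfolding best_sum_def using cB by simp
qed

lemma backtrack:
  assumes pre: "dp_pre v a" and v27: "v 27 = WD" and tab: "\<And>k y. k \<le> M \<Longrightarrow> y < WD \<Longrightarrow> a 13 (k * WD + y) = F k y"
    and s: "v 32 = s" "s \<le> u" "F M (wm + L + s) \<noteq> 0" and a8: "\<And>k. k < n \<Longrightarrow> a 8 (xs ! k) = (if k < bk then 1 else 0)"
    and Q: "\<And>v' a' t'. \<lbrakk>v' 0 = v 0; \<And>k. k < n \<Longrightarrow> a' 8 (xs ! k) = (if (k < bk) \<noteq> (k \<in> bt M (wm + L + s)) then 1 else 0);
       t' \<le> t0 + 30 * n + 40\<rbrakk> \<Longrightarrow> Q (v', a', t')"
  shows "wp B b backtrack Q (v, a, t0)"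
proof -
  let ?D = "bt M (wm + L + s)"
  \<comment> \<open>\<open>T\<close> is the part of the set found so far. It avoids the items still
    to be examined, so no entry of array 8 is toggled twice.\<close>
  define I where "I i v' a' t' \<longleftrightarrow> v' 28 = M - i \<and> (\<forall>x. x \<notin> {6, 7, 28, 31} \<longrightarrow> v' x = v x) \<and> (\<forall>k. k \<noteq> 8 \<longrightarrow> a' k = a k) \<and>
     F (M - i) (v' 6) \<noteq> 0 \<and> (\<exists>T. ?D = T \<union> bt (M - i) (v' 6) \<and> T \<inter> set (take (M - i) its) = {} \<and>
       (\<forall>k<n. a' 8 (xs ! k) = (if (k < bk) \<noteq> (k \<in> T) then 1 else 0))) \<and> t' \<le> t0 + 2 + 30 * i"
    for i and v' :: vars and a' :: arrs and t' :: nat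
  let ?e = "Asg 7 (A 11 (V 28)) ;; Asg 31 (A 4 (V 7)) ;; Upd 8 (V 31) (N 1 |-| A 8 (V 31)) ;;
       If (Less (V 7) (V 14)) (Asg 6 (V 6 |+| A 1 (V 31))) (Asg 6 (V 6 |-| A 1 (V 31)))"
  let ?c = "Asg 28 (V 28 |-| N 1) ;;
     If (Equal (A 13 ((V 28 |+| N 1) |*| V 27 |+| V 6)) (A 13 (V 28 |*| V 27 |+| V 6))) Skip
      (Asg 7 (A 11 (V 28)) ;; Asg 31 (A 4 (V 7)) ;; Upd 8 (V 31) (N 1 |-| A 8 (V 31)) ;;
       If (Less (V 7) (V 14)) (Asg 6 (V 6 |+| A 1 (V 31))) (Asg 6 (V 6 |-| A 1 (V 31))))"
  note s0 = small[of M]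
  have pr: "v 2 = wm" "v 14 = bk" "v 17 = L" "v 26 = M" using pre by (auto simp: dp_pre_def)
  have cB: "0 < B" "1 < B" "wm + L < B" "wm + L + s < B" using s0(1) s(2) uL by (auto intro!: ltB)
  have "wp B b (While (Less (N 0) (V 28)) ?c) Q (v(6 := wm + L + s, 28 := M), a, t0 + 1 + 1)"
  proof (rule wp_While[of I, where n = M])
    show "I 0 (v(6 := wm + L + s, 28 := M)) a (t0 + 1 + 1)" unfolding I_def using s a8 by (intro conjI exI[of _ "{}"]) auto
    fix i v' a' t' assume i: "i < M" and I: "I i v' a' t'"
    define m where "m = M - Suc i"
    have m: "M - i = Suc m" "m < M" "M - Suc i = m" using i by (auto simp: m_def)
    define y where "y = v' 6"
    let ?k = "its ! m"
    obtain T where T: "?D = T \<union> bt (Suc m) y" "T \<inter> set (take (Suc m) its) = {}"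
      "\<forall>k<n. a' 8 (xs ! k) = (if (k < bk) \<noteq> (k \<in> T) then 1 else 0)" using I unfolding I_def m(1) y_def by blast
    have Fn: "F (Suc m) y \<noteq> 0" and fr: "\<forall>x. x \<notin> {6, 7, 28, 31} \<longrightarrow> v' x = v x" "\<forall>k. k \<noteq> 8 \<longrightarrow> a' k = a k" "v' 28 = Suc m" "t' \<le> t0 + 2 + 30 * i"
      using I unfolding I_def m(1) y_def by auto
    have yr: "wm \<le> y" "y \<le> wm + 2 * L" using F_range[OF Fn] by auto
    have kn: "?k < n" by (rule its_nth[OF m(2)])
    have xk: "xs ! ?k < n" using xs kn nth_mem[of ?k xs] by auto
    have wk: "wt ?k \<le> wm" using wt[OF kn] by simp
    have yW: "y < WD" using yr by linarith
    have tk: "set (take (Suc m) its) = insert ?k (set (take m its))" using m(2) by (simp add: take_Suc_conv_app_nth)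
    have "distinct (take (Suc m) its)" using its(2) by simp
    then have kt: "?k \<notin> set (take m its)" using m(2) by (simp add: take_Suc_conv_app_nth)
    have e: "v' 27 = WD" "v' 14 = bk" "v' 6 = y" using fr pr v27 by (auto simp: y_def)
    have a13: "a' 13 = a 13" using fr(2) by simp
    have ta: "a' 13 (Suc m * WD + y) = F (Suc m) y" "a' 13 (m * WD + y) = F m y"
      unfolding a13 by (rule tab[OF _ yW]; use m(2) in linarith)+
    have aa: "a' 11 m = ?k" "a' 4 ?k = xs ! ?k" "a' 1 (xs ! ?k) = wt ?k" using pre fr m(2) kn xk wt_eq[OF kn] by (auto simp: dp_pre_def)
    have ix: "Suc m * WD + y \<le> IM" "Suc m * WD \<le> IM" "m * WD + y \<le> IM" "m * WD \<le> IM"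
      using idx[of "Suc m" y] idx[of m y] yW m(2) by auto
    have bb: "Suc m * WD + y < B" "Suc m * WD < B" "m * WD + y < B" "m * WD < B" "m + 1 < B" "y + wt ?k < B"
      "addr_ok B b 13 (Suc m * WD + y)" "addr_ok B b 13 (m * WD + y)" "addr_ok B b 11 m" "addr_ok B b 4 ?k" "addr_ok B b 8 (xs ! ?k)" "addr_ok B b 1 (xs ! ?k)"
      using ix s0(1,2) m(2) M_le kn xk yr wk by (auto intro!: ltB addr)
    have skip: "I (Suc i) (v'(28 := m)) a' tt" if eq: "F (Suc m) y = F m y" and tt: "tt \<le> t' + 30" for tt
    proof -
      have "bt (Suc m) y = bt m y" using eq by (simp del: F.simps)
      then have D: "?D = T \<union> bt m y" using T(1) by simp
      have Fm: "F m y \<noteq> 0" using Fn eq by simp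
      have dj: "T \<inter> set (take m its) = {}" using T(2) tk by blast
      have v6: "(v'(28 := m)) 6 = y" by (simp add: y_def)
      show ?thesis unfolding I_def m(3) v6 using fr Fm tt
        by (intro conjI exI[of _ T] D dj T(3)) auto
    qed
    have go: "I (Suc i) (v'(28 := m, 7 := ?k, 31 := xs ! ?k, 6 := prv ?k y)) (a'(8 := (a' 8)(xs ! ?k := 1 - a' 8 (xs ! ?k)))) tt"
      if ne: "F (Suc m) y \<noteq> F m y" and tt: "tt \<le> t' + 30" for tt
    proof -
      have b1: "bt (Suc m) y = insert ?k (bt m (prv ?k y))" using ne by (simp del: F.simps)
      have Fp: "F m (prv ?k y) \<noteq> 0" using ne yr by (auto simp: relax_def split: if_splits)
      have kT: "?k \<notin> T" using T(2) tk by blast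
      have xin: "xs ! k = xs ! ?k \<longleftrightarrow> k = ?k" if "k < n" for k using nth_eq_iff_index_eq[OF dxs] xs(1) that kn by simp
      have new8: "(a'(8 := (a' 8)(xs ! ?k := 1 - a' 8 (xs ! ?k)))) 8 (xs ! k) = (if (k < bk) \<noteq> (k \<in> insert ?k T) then 1 else 0)" if k: "k < n" for k
        using T(3) kn k xin[OF k] kT by auto
      show ?thesis unfolding I_def m(3)
      proof (intro conjI exI[of _ "insert ?k T"])
        show "?D = insert ?k T \<union> bt m ((v'(28 := m, 7 := ?k, 31 := xs ! ?k, 6 := prv ?k y)) 6)" unfolding T(1) b1 by simp
        show "insert ?k T \<inter> set (take m its) = {}" using T(2) tk kt by blast
        show "\<forall>k<n. (a'(8 := (a' 8)(xs ! ?k := 1 - a' 8 (xs ! ?k)))) 8 (xs ! k) = (if (k < bk) \<noteq> (k \<in> insert ?k T) then 1 else 0)"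
          using new8 by blast
      qed (use fr Fp tt in auto)
    qed
    have a81: "a' 8 (xs ! ?k) \<le> 1" using T(3) kn by auto
    have cond: "cok B b (Less (N 0) (V 28)) v' a' \<and> cval (Less (N 0) (V 28)) v' a'" using fr(3) cB by simp
    show "cok B b (Less (N 0) (V 28)) v' a' \<and> cval (Less (N 0) (V 28)) v' a' \<and> wp B b ?c (\<lambda>(v, a, t). I (Suc i) v a t) (v', a', t' + 3)"
    proof (cases "F (Suc m) y = F m y")
      case True
      then show ?thesis using skip[of "t' + 3 + 1 + 2"] cond e fr(3) ta bb cB by (simp del: F.simps)
    next
      case ne: False
      show ?thesis
      proof (cases "?k < bk")
        case True
        then have p: "prv ?k y = y + wt ?k" by (simp add: prv_def)
        show ?thesis using go[OF ne, of "t' + 3 + 1 + 2 + 1 + 1 + 1 + 2 + 1"] ne True cond e fr(3) ta aa bb cB a81 unfolding p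
          by (simp add: fun_upd_twist del: F.simps)
      next
        case False
        then have p: "prv ?k y = y - wt ?k" by (simp add: prv_def)
        have "wt ?k \<le> y" using wk yr by linarith
        then show ?thesis using go[OF ne, of "t' + 3 + 1 + 2 + 1 + 1 + 1 + 2 + 1"] ne False cond e fr(3) ta aa bb cB a81 unfolding p
          by (simp add: fun_upd_twist del: F.simps)
      qed
    qed
  next
    fix v' a' t' assume I: "I M v' a' t'"
    then obtain T where "?D = T \<union> bt (M - M) (v' 6)" "\<forall>k<n. a' 8 (xs ! k) = (if (k < bk) \<noteq> (k \<in> T) then 1 else 0)" unfolding I_def by blast
    then have D: "\<forall>k<n. a' 8 (xs ! k) = (if (k < bk) \<noteq> (k \<in> ?D) then 1 else 0)" by simp
    have "t' \<le> t0 + 2 + 30 * M" "v' 0 = v 0" "v' 28 = 0" using I unfolding I_def by auto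
    then have "Q (v', a', t' + 2)" by (intro Q) (use D M_le in auto)
    then show "cok B b (Less (N 0) (V 28)) v' a' \<and> \<not> cval (Less (N 0) (V 28)) v' a' \<and> Q (v', a', t' + 2)"
      using \<open>v' 28 = 0\<close> cB by simp
  qed
  then show ?thesis unfolding backtrack_def using pr s cB by simp
qed

end

section \<open>Optimality of the set read off the table\<close>

context greedy
begin

text \<open>A competitor \<open>E\<close> is replaced by the set of \<open>good_solution\<close>,
  with equal change of weight and no larger penalty. Its prefix sums stay in the window, so the
  table entry for that change of weight is at least as good, and the cell chosen by
  \<open>best\<close> is no worse.\<close>

lemma dp_optimal:
  assumes dp: "dp n b W w pn its" and set_its: "set its = {k. k < n \<and> sel k \<and> rank k < 2 ^ H}"
    and srt_its: "sorted (map (\<lambda>k. brev H (rank k)) its)"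
    and sq: "W \<le> sq * sq" and H: "2 * W \<le> 2 ^ H" and L: "W + (H + 1) * W * (16 * sq * (lg2 W + 1) ^ 2) \<le> L"
    and s: "s \<le> slack" "dp.F b W w pn L its (length its) (W + L + s) \<noteq> 0"
      "0 \<le> int (p b * s) - (int (dp.F b W w pn L its (length its) (W + L + s)) - 1)"
    and best: "\<And>j. j \<le> slack \<Longrightarrow> dp.F b W w pn L its (length its) (W + L + j) \<noteq> 0 \<Longrightarrow>
      int (p b * j) - (int (dp.F b W w pn L its (length its) (W + L + j)) - 1)
      \<le> int (p b * s) - (int (dp.F b W w pn L its (length its) (W + L + s)) - 1)"
  defines "D \<equiv> dp.bt b W w pn L its (length its) (W + L + s)"
  shows "sum w (flip D) \<le> t" "S \<subseteq> {..<n} \<Longrightarrow> sum w S \<le> t \<Longrightarrow> sum p S \<le> sum p (flip D)"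
proof -
  interpret dp n b W w pn L its by (rule dp)
  let ?M = "length its"
  have bt: "D \<subseteq> set its" "sum val D = int s" "F ?M (W + L + s) = sum pn D + 1"
    using bt_correct[OF order_refl s(2)] unfolding D_def by simp_all
  have gD: "gain D = int (p b * s) - (int (F ?M (W + L + s)) - 1)" unfolding gain_def bt by simp
  have Dn: "D \<subseteq> {..<n}" using bt(1) set_its by blast
  have v: "sum val D \<le> int slack" using bt(2) s(1) by simp
  have g0: "0 \<le> gain D" using gD s(3) by simp
  have opt: "gain E \<le> gain D" if E: "E \<subseteq> {..<n}" "0 \<le> sum val E" "sum val E \<le> int slack" for E
  proof -
    have "sum val E < int W" using E(3) slack by linarith
    then obtain D' where D': "D' \<subseteq> {..<n}" "sum val D' = sum val E" "sum pn D' \<le> sum pn E" "\<And>k. k \<in> D' \<Longrightarrow> sel k \<and> rank k < 2 ^ H"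
      and disc: "\<And>i E. E \<subseteq> {k \<in> D'. brev H (rank k) = i} \<Longrightarrow>
       \<bar>sum val ({k \<in> D'. brev H (rank k) < i} \<union> E)\<bar> \<le> int (W + (H + 1) * W * (16 * sq * (lg2 W + 1) ^ 2))"
      using good_solution[OF E(1,2) _ sq H] by blast
    have D'its: "D' \<subseteq> set its" using D'(1,4) set_its by blast
    have "\<bar>sum val (D' \<inter> set (take k its))\<bar> \<le> int L" for k
    proof -
      obtain i E' where E': "E' \<subseteq> {x \<in> D'. brev H (rank x) = i}" "D' \<inter> set (take k its) = {x \<in> D'. brev H (rank x) < i} \<union> E'"
        using prefix_of_sorted[OF D'its srt_its, of k] by (elim exE conjE) (rule that)
      have "\<bar>sum val (D' \<inter> set (take k its))\<bar> \<le> int (W + (H + 1) * W * (16 * sq * (lg2 W + 1) ^ 2))" unfolding E'(2) by (intro disc E'(1))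
      then show ?thesis using L by linarith
    qed
    then have F: "F ?M (nat (int (W + L) + sum val (D' \<inter> set (take ?M its)))) \<noteq> 0"
      "F ?M (nat (int (W + L) + sum val (D' \<inter> set (take ?M its)))) \<le> sum pn (D' \<inter> set (take ?M its)) + 1"
      using F_complete[OF D'its _ order_refl] by auto
    define j where "j = nat (sum val E)"
    have j: "int j = sum val E" "j \<le> slack" using E by (auto simp: j_def)
    have "D' \<inter> set (take ?M its) = D'" using D'its by auto
    moreover have "nat (int (W + L) + sum val D') = W + L + j" using D'(2) j(1) by linarith
    ultimately have Fj: "F ?M (W + L + j) \<noteq> 0" "F ?M (W + L + j) \<le> sum pn D' + 1" using F by simp_all
    have "gain E = int (p b * j) - int (sum pn E)" unfolding gain_def j(1)[symmetric] by simp
    also have "\<dots> \<le> int (p b * j) - (int (F ?M (W + L + j)) - 1)" using Fj(2) D'(3) by linarith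
    also have "\<dots> \<le> gain D" unfolding gD by (rule best[OF j(2) Fj(1)])
    finally show ?thesis .
  qed
  show "sum w (flip D) \<le> t" "S \<subseteq> {..<n} \<Longrightarrow> sum w S \<le> t \<Longrightarrow> sum p S \<le> sum p (flip D)"
    by (rule flip_optimal[OF Dn v g0 opt]; assumption)+
qed

end

text \<open>Distinct densities differ by at least \<open>1 / wm\<^sup>2\<close>, so scaling by \<open>wm\<^sup>2\<close> before rounding keeps their order.\<close>

lemma density_key:
  fixes px wx py wy wm :: nat
  assumes "0 < wx" "wx \<le> wm" "0 < wy" "wy \<le> wm" "py * wm * wm div wy \<le> px * wm * wm div wx"
  shows "py * wx \<le> px * wy"
proof (rule ccontr)
  assume "\<not> py * wx \<le> px * wy"
  then have lt: "px * wy + 1 \<le> py * wx" by simp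
  define k where "k = px * wm * wm div wx"
  have "k * wx \<le> px * wm * wm" unfolding k_def by simp
  then have "(k + 1) * wx * wy \<le> px * wm * wm * wy + wx * wy"
    using mult_le_mono1[of "k * wx" "px * wm * wm" wy] by (simp add: algebra_simps)
  also have "\<dots> \<le> px * wm * wm * wy + wm * wm" using assms(2,4) by (simp add: mult_le_mono)
  also have "\<dots> = wm * wm * (px * wy + 1)" by (simp add: algebra_simps)
  also have "\<dots> \<le> wm * wm * (py * wx)" using lt by (rule mult_le_mono2)
  finally have "wx * ((k + 1) * wy) \<le> wx * (py * wm * wm)" by (simp add: algebra_simps)
  then have "(k + 1) * wy \<le> py * wm * wm" using assms(1) by simp
  then have "k + 1 \<le> py * wm * wm div wy" using assms(3) by (simp add: less_eq_div_iff_mult_less_eq)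
  then show False using assms(5) k_def by simp
qed

section \<open>Assembly of the improvement phase\<close>

definition improve :: com where
  "improve = Asg 22 (A 4 (V 14)) ;; Asg 23 (A 2 (V 22)) ;; Asg 24 (A 1 (V 22)) ;; Asg 25 (V 1 |-| V 13) ;;
     lg_table ;; sqrt_loop ;; brev_table ;;
     Asg 18 (A 9 (V 2) |+| N 3) ;; Asg 17 (N 17 |*| V 18 |*| V 18 |*| V 18 |*| V 15 |*| V 2) ;; Asg 26 (N 0) ;;
     scan_out ;; scan_in ;; Asg 20 (V 26) ;; Asg 21 (V 16) ;; bucket_pass 11 12 ;;
     dp_table ;; best_sum ;; backtrack"

text \<open>The factor 17 is 16 from \<open>prefix_sum_bound\<close> plus 1 for its separate summand
  \<open>w\<close>; \<open>lg2 w + 3\<close> bounds both \<open>hgt w + 1\<close> and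
  \<open>lg2 w + 1\<close>, as \<open>window_ge\<close> checks.\<close>

definition window :: "nat \<Rightarrow> nat" where
  "window w = 17 * (lg2 w + 3) * (lg2 w + 3) * (lg2 w + 3) * sqr w * w"

lemma sqr_pos: "0 < w \<Longrightarrow> 0 < sqr w" using sqr(1)[of w] by (cases "sqr w") auto

context solver
begin

text \<open>The arrays listed in \<open>z\<close> are those that some stage expects to be zero:
  counters, flags, and tables that are filled from a zero start. The frame conditions of the stages
  carry everything else along.\<close>

lemma improve:
  assumes H: "H = hgt wm" and L: "L = window wm" and its_eq: "its = bucket (\<lambda>k. brev H (rank k)) P SLS" and w0: "0 < wm" and bn: "bk < n"
    and v: "v 0 = n" "v 1 = t" "v 2 = wm" "v 13 = G" "v 14 = bk" and u: "u = t - G" "G \<le> t"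
    and pb: "pb = pf (xs ! bk)" "wb = wg (xs ! bk)"
    and a: "\<And>k. k < n \<Longrightarrow> a 1 k = wg k \<and> a 2 k = pf k \<and> a 4 k = xs ! k"
    and z: "\<And>k y. k \<in> {6, 9, 10, 13, 16, 17, 18, 19, 20, 21} \<Longrightarrow> a k y = 0"
    and a8: "\<And>k. k < n \<Longrightarrow> a 8 (xs ! k) = (if k < bk then 1 else 0)"
    and IM: "(wm + 1) * (wm + 1) \<le> IM" "8 * wm + 20 \<le> IM" "P * n + n + P + 1 \<le> IM"
    and Q: "\<And>v' a' t' s. \<lbrakk>v' 0 = n; s \<le> u; F M (wm + L + s) \<noteq> 0; 0 \<le> worth s;
       \<And>j. j \<le> u \<Longrightarrow> F M (wm + L + j) \<noteq> 0 \<Longrightarrow> worth j \<le> worth s;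
       \<And>k. k < n \<Longrightarrow> a' 8 (xs ! k) = (if (k < bk) \<noteq> (k \<in> bt M (wm + L + s)) then 1 else 0);
       t' \<le> t0 + 300 + 150 * wm + 110 * n + 20 * M + 20 * P + M * (30 * (2 * L + 1) + 30)\<rbrakk> \<Longrightarrow> Q (v', a', t')"
  shows "wp B b improve Q (v, a, t0)"
proof -
  have xb: "xs ! bk < n" using xs bn nth_mem[of bk xs] by auto
  note s0 = small[of 0]
  have SLS_n: "length SLS \<le> n" by (rule length_SLS(2))
  have key: "brev H (rank k) < P" if "k \<in> set SLS" for k using that set_SLS brev_less P by auto
  have M_len: "length its = length SLS" unfolding its_eq using key by (rule length_bucket)
  define q where "q = lg2 wm + 3"
  have Lq: "L = 17 * q * q * q * sqr wm * wm" by (simp add: L window_def q_def)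
  have LIM: "L \<le> IM" using s0(1) by simp
  have q0: "0 < q" "0 < sqr wm" using sqr_pos[OF w0] by (auto simp: q_def)
  have Lparts: "17 * q \<le> L" "17 * q * q \<le> L" "17 * q * q * q \<le> L" "17 * q * q * q * sqr wm \<le> L"
    using q0 w0 by (simp_all add: Lq)
  have cB: "0 < B" "3 < B" "17 < B" "17 * q < B" "17 * q * q < B" "17 * q * q * q < B" "17 * q * q * q * sqr wm < B" "L < B" "q < B"
    using Lparts LIM IM(2) lg2_le[of wm] by (auto intro!: ltB simp: q_def)
  have ad: "addr_ok B b 4 bk" "addr_ok B b 2 (xs ! bk)" "addr_ok B b 1 (xs ! bk)" "addr_ok B b 9 wm"
    using s0(2) xb bn IM(2) by (auto intro!: addr)
  define v1 where "v1 = v(22 := xs ! bk, 23 := pb, 24 := wb, 25 := u)"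
  have "wp B b (lg_table ;; sqrt_loop ;; brev_table ;;
     Asg 18 (A 9 (V 2) |+| N 3) ;; Asg 17 (N 17 |*| V 18 |*| V 18 |*| V 18 |*| V 15 |*| V 2) ;; Asg 26 (N 0) ;;
     scan_out ;; scan_in ;; Asg 20 (V 26) ;; Asg 21 (V 16) ;; bucket_pass 11 12 ;;
     dp_table ;; best_sum ;; backtrack) Q (v1, a, t0 + 1 + 1 + 1 + 1)"
    unfolding wp_Seq
  proof (rule lg_table[where wm = wm], goal_cases)
    case 1 then show ?case using v by (simp add: v1_def)
  next
    case 2 then show ?case by (rule w0)
  next
    case 3 then show ?case using z by simp
  next
    case 4 then show ?case using IM(2) by simp
  next
    case (5 v2 a2 t2)
    note r2 = this
    show ?case
    proof (rule sqrt_loop[where wm = wm], goal_cases)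
      case 1 then show ?case using r2 v by (simp add: v1_def)
    next
      case 2 then show ?case by (rule IM(1))
    next
      case (3 v3 t3)
      note r3 = this
      show ?case
      proof (rule brev_table[where wm = wm], goal_cases)
        case 1 then show ?case using r2 r3 v by (simp add: v1_def)
      next
        case 2 then show ?case by (rule w0)
      next
        case 3 then show ?case using z r2 by simp
      next
        case 4 then show ?case using IM(2) by simp
      next
        case (5 v4 a4 t4)
        note r4 = this
        define v5 where "v5 = v4(18 := q, 17 := L, 26 := 0)"
        have fr5: "v5 0 = n" "v5 2 = wm" "v5 14 = bk" "v5 16 = P" "v5 17 = L" "v5 22 = xs ! bk" "v5 23 = pb" "v5 24 = wb" "v5 25 = u" "v5 26 = 0"
          and e4: "v4 2 = wm" "v4 15 = sqr wm" "a4 9 wm = lg2 wm"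
          using r2 r3 r4 v P H by (auto simp: v5_def v1_def)
        have fa: "a4 k = a k" if "k \<noteq> 9" "k \<noteq> 10" for k using r2 r4 that by simp
        have sp: "scan_pre v5 a4" unfolding scan_pre_def using fr5 a fa r2 r4 P H by auto
        have "wp B b scan_out (wp B b scan_in (wp B b (Asg 20 (V 26)) (wp B b (Asg 21 (V 16)) (wp B b (bucket_pass 11 12)
          (wp B b dp_table (wp B b best_sum (wp B b backtrack Q))))))) (v5, a4, t4 + 1 + 1 + 1)"
        proof (rule scan_out[OF sp fr5(10)], goal_cases)
          case 1 then show ?case using z fa by simp
        next
          case 2 then show ?case using z fa by simp
        next
          case 3 then show ?case using z fa by simp
        next
          case (4 v6 a6 t6)
          note r6 = this
          have fa6: "a6 k = a4 k" if "k \<notin> {11, 12, 16, 18, 20}" for k using r6(2) that by blast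
          have fr6: "v6 x = v5 x" if "x \<notin> {3, 5, 6, 7, 8, 9, 26}" for x using r6(1) that by blast
          have sp6: "scan_pre v6 a6" using sp fa6 fr6 unfolding scan_pre_def by simp
          have l0: "length (SL 0 (len 0)) + bk \<le> n"
          proof -
            have "length (SL 0 (len 0)) \<le> len 0" unfolding SL_def by (rule order_trans[OF length_filter_le]) simp
            then show ?thesis using bkn by (simp add: len_def)
          qed
          show ?case unfolding wp_Seq
          proof (rule scan_in[OF sp6 r6(3) r6(4) l0], goal_cases)
            case 1 then show ?case by assumption
          next
            case (2 k) then show ?case using r6(5) set_SL[of 0] by auto
          next
            case 3 then show ?case using z fa fa6 by simp
          next
            case 4 then show ?case using z fa fa6 by simp
          next
            case 5 then show ?case using z fa fa6 by simp
          next
            case (6 v7 a7 t7)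
            note r7 = this
            have fa7: "a7 k = a k" if "k \<notin> {9, 10, 11, 12, 16, 17, 18, 19, 20, 21}" for k using r7(2) fa6 fa that by simp
            have fr7: "v7 x = v5 x" if "x \<notin> {3, 5, 6, 7, 8, 9, 26}" for x using r7(1) fr6 that by simp
            define v8 where "v8 = v7(20 := M, 21 := P)"
            have e7: "v7 26 = M" "v7 16 = P" using r7(3) M_len fr7 fr5 by auto
            have "wp B b (bucket_pass 11 12) (wp B b dp_table (wp B b best_sum (wp B b backtrack Q))) (v8, a7, t7 + 1 + 1)"
            proof (rule bucket_pass[where m = M and Bn = P and xs = SLS and f = "\<lambda>k. brev H (rank k)"], goal_cases)
              case 1 then show ?case by (simp add: v8_def)
            next
              case 2 then show ?case by (simp add: v8_def)
            next
              case 3 then show ?case using M_len by simp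
            next
              case (4 i) then show ?case using r7(4) M_len by simp
            next
              case (5 x)
              then have "x < n" using set_SLS by auto
              then show ?case using r7(5)[OF 5] key[OF 5] s0(2) by simp
            next
              case 6 then show ?case using fa7 z by simp
            next
              case 16
              have "P * M \<le> P * n" using M_le by simp
              then show ?case using IM(3) M_le by linarith
            next
              case (17 v9 a9 t9)
              note r9 = this
              have fa9: "a9 k = a k" if "k \<notin> {6, 7, 9, 10, 11, 12, 16, 17, 18, 19, 20, 21}" for k using r9(2) fa7 that by simp
              have fr9: "v9 x = v5 x" if "x \<notin> {3, 5, 6, 7, 8, 9, 20, 21, 26}" for x using r9(1) fr7 that by (simp add: v8_def)
              have v26: "v9 26 = M" using r9(1) e7 by (simp add: v8_def)
              have dpp: "dp_pre v9 a9" unfolding dp_pre_def using fr9 fr5 fa9 a v26 r9(3) its_eq by simp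
              have t9: "t9 \<le> t0 + 4 + (10 * wm + 20) + (10 * wm + 20) + (100 * wm + 20) + 3 + (40 * n + 10) + (40 * n + 10) + 2 + 20 * M + 20 * P + 20"
                using r2(4) r3(3) r4(5) r6(6) r7(6) r9(5) by linarith
              show ?case unfolding wp_Seq
              proof (rule dp_table[OF dpp], goal_cases)
                case 1 then show ?case using fa9 z by simp
              next
                case (2 v10 a10 t10)
                note r10 = this
                have dpp10: "dp_pre v10 a10" using dpp r10(1,3) unfolding dp_pre_def by simp
                show ?case
                proof (rule best_sum[OF dpp10 r10(2) r10(4)], goal_cases)
                  case 1 then show ?case by simp
                next
                  case 2 then show ?case by simp
                next
                  case (3 v11 t11 s)
                  note r11 = this
                  have dpp11: "dp_pre v11 a10" using dpp10 r11(1) unfolding dp_pre_def by simp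
                  have v27: "v11 27 = WD" using r10(2) r11(1) by simp
                  have a8': "a10 8 (xs ! k) = (if k < bk then 1 else 0)" if "k < n" for k using r10(3) fa9[of 8] a8[OF that] by simp
                  show ?case
                  proof (rule backtrack[OF dpp11 v27 r10(4) r11(2,3,4) a8'], goal_cases)
                    case 1 then show ?case by simp
                  next
                    case 2 then show ?case by simp
                  next
                    case 3 then show ?case by simp
                  next
                    case (4 v12 a12 t12)
                    note r12 = this
                    have v0: "v12 0 = n" using r12(1) dpp11 unfolding dp_pre_def by simp
                    have tt: "t12 \<le> t0 + 300 + 150 * wm + 110 * n + 20 * M + 20 * P + M * (30 * (2 * L + 1) + 30)"
                      using t9 r10(5) r11(7) r12(3) uL(2) by linarith
                    show ?case by (rule Q[where v' = v12 and a' = a12 and t' = t12 and s = s, OF v0 r11(3,4,5,6) r12(2) tt])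
                  qed
                qed
              qed
            qed simp_all
            then show ?case using e7 by (simp add: v8_def)
          qed
        qed
        then show ?case using e4 cB ad by (simp add: v5_def q_def Lq)
      qed
    qed
  qed
  then show ?thesis unfolding improve_def using v a[OF bn] a[OF xb] ad u by (simp add: v1_def pb)
qed

end

definition knapsack :: com where
  "knapsack = read_items ;; compute_keys ;; radix_sort ;; greedy_prefix ;; If (Equal (V 12) (N 0)) Skip improve ;; write_output"

section \<open>Polynomial bounds for indices and values, and correctness of the whole
  program\<close>

lemma two_power_mult_le: "2 \<le> X \<Longrightarrow> 2 ^ j * X ^ i \<le> X ^ (i + j)" for X :: nat
  using power_mono[of 2 X j] by (simp add: power_add mult.commute)

lemma window_le: assumes "2 \<le> X" "w \<le> X" shows "window w \<le> 459 * X ^ 5"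
proof -
  \<comment> \<open>The constant 459 is 17 times 27, from three factors
    \<open>3 * X\<close>.\<close>
  have q: "lg2 w + 3 \<le> 3 * X" using lg2_le[of w] assms by simp
  have "window w \<le> 17 * (3 * X) * (3 * X) * (3 * X) * X * X"
    unfolding window_def using q sqr(2)[of w] assms(2) by (intro mult_le_mono order_refl) auto
  moreover have "X ^ 5 = X * X * X * X * X" by (simp add: eval_nat_numeral)
  ultimately show ?thesis by simp
qed

text \<open>\<open>X\<close> will bound every input number and \<open>n + 1\<close>. The exponent 20
  is generous: as \<open>X \<ge> 2\<close>, constant factors are absorbed by further powers of
  \<open>X\<close> through \<open>two_power_mult_le\<close>.\<close>

lemma poly_bounds:
  fixes X :: nat
  assumes X: "2 \<le> X" and n: "n + 1 \<le> X" and wm: "wm \<le> X" and P: "P \<le> 4 * wm"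
  shows "8 * X + 20 \<le> X ^ 20" "X * X \<le> X ^ 20" "X * X * X \<le> X ^ 20" "(n + 1) * n + n + (n + 1) + 1 \<le> X ^ 20"
    "(X * X * X + 1) * (n + 1) \<le> X ^ 20" "(wm + 1) * P + 8 * wm + 2 * P + n + 10 \<le> X ^ 20" "(wm + 1) * (wm + 1) \<le> X ^ 20"
    "P * n + n + P + 1 \<le> X ^ 20" "(n + 1) * (2 * window wm + 2 * wm + 1) + (n + 1) * (X * X) + 20 \<le> X ^ 20"
proof -
  have mono: "X ^ i \<le> X ^ j" if "i \<le> j" for i j using X that by (intro power_increasing) auto
  have m: "1 \<le> X" "X \<le> X ^ 2" "X ^ 2 \<le> X ^ 3" "X ^ 3 \<le> X ^ 4" "X ^ 4 \<le> X ^ 5" "X ^ 5 \<le> X ^ 6" "X ^ 6 \<le> X ^ 16"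
    using mono[of 1 2] mono[of 2 3] mono[of 3 4] mono[of 4 5] mono[of 5 6] mono[of 6 16] X by auto
  have p: "X * X = X ^ 2" "X * X * X = X ^ 3" "X ^ 3 * X = X ^ 4" "X * X ^ 2 = X ^ 3" "X * X ^ 5 = X ^ 6" by (simp_all add: eval_nat_numeral)
  have b4: "64 * X ^ 4 \<le> X ^ 20"
    using two_power_mult_le[OF X, of 6 4] mono[of 10 20] by simp
  have wP: "(wm + 1) * P \<le> (X + 1) * (4 * X)" "P * n \<le> 4 * X * X" "(n + 1) * n \<le> X * X" "(wm + 1) * (wm + 1) \<le> (X + 1) * (X + 1)"
    using n wm P by (intro mult_le_mono; linarith)+
  have e: "(X + 1) * (4 * X) = 4 * X ^ 2 + 4 * X" "(X + 1) * (X + 1) = X ^ 2 + 2 * X + 1" "4 * X * X = 4 * X ^ 2"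
    by (simp_all add: algebra_simps power2_eq_square)
  note wP' = wP[unfolded e p]
  show "8 * X + 20 \<le> X ^ 20" "X * X \<le> X ^ 20" "X * X * X \<le> X ^ 20" using b4 m p by linarith+
  show "(n + 1) * n + n + (n + 1) + 1 \<le> X ^ 20" using wP' n m b4 by linarith
  show "(wm + 1) * P + 8 * wm + 2 * P + n + 10 \<le> X ^ 20" using wP' n m b4 wm P by linarith
  show "(wm + 1) * (wm + 1) \<le> X ^ 20" using wP' m b4 by linarith
  show "P * n + n + P + 1 \<le> X ^ 20" using wP' n m b4 wm P by linarith
  have "(X * X * X + 1) * (n + 1) \<le> (X ^ 3 + 1) * X" unfolding p(2) using n by (intro mult_le_mono) auto
  also have "\<dots> = X ^ 4 + X" using p by (simp add: algebra_simps)
  finally show "(X * X * X + 1) * (n + 1) \<le> X ^ 20" using m b4 by linarith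
  \<comment> \<open>The coefficient 921 is twice the 459 of \<open>window_le\<close> plus 3 for the
    remaining terms.\<close>
  have "(n + 1) * (2 * window wm + 2 * wm + 1) \<le> X * (921 * X ^ 5)"
    using window_le[OF X wm] m wm n by (intro mult_le_mono; linarith)
  also have "\<dots> = 921 * X ^ 6" using p by simp
  finally have 1: "(n + 1) * (2 * window wm + 2 * wm + 1) \<le> 921 * X ^ 6" .
  have 2: "(n + 1) * (X * X) \<le> X ^ 3" using mult_le_mono1[OF n, of "X ^ 2"] p by simp
  have "1024 * X ^ 6 \<le> X ^ 16" "4 * X ^ 16 \<le> X ^ 18" "X ^ 18 \<le> X ^ 20"
    using two_power_mult_le[OF X, of 10 6] two_power_mult_le[OF X, of 2 16] mono[of 18 20] by simp_all
  then show "(n + 1) * (2 * window wm + 2 * wm + 1) + (n + 1) * (X * X) + 20 \<le> X ^ 20" using 1 2 m by linarith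
qed

text \<open>Carries optimality from positions in the sorted order back to the original
  indices.\<close>

lemma nth_solution:
  fixes wg pf :: "nat \<Rightarrow> nat"
  assumes xs: "distinct xs" "set xs = {..<n}" and T: "T \<subseteq> {..<n}" "(\<Sum>k\<in>T. wg (xs ! k)) \<le> t"
    and opt: "\<And>S. S \<subseteq> {..<n} \<Longrightarrow> (\<Sum>k\<in>S. wg (xs ! k)) \<le> t \<Longrightarrow> (\<Sum>k\<in>S. pf (xs ! k)) \<le> (\<Sum>k\<in>T. pf (xs ! k))"
  shows "sum wg ((!) xs ` T) \<le> t" "S \<subseteq> {..<n} \<Longrightarrow> sum wg S \<le> t \<Longrightarrow> sum pf S \<le> sum pf ((!) xs ` T)"
    "(!) xs ` T \<subseteq> {..<n}" "k < n \<Longrightarrow> xs ! k \<in> (!) xs ` T \<longleftrightarrow> k \<in> T"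
proof -
  have len: "length xs = n" using distinct_card[OF xs(1)] xs(2) by simp
  have inj: "inj_on ((!) xs) {..<n}" using xs(1) len by (auto simp: inj_on_def nth_eq_iff_index_eq)
  have "(!) xs ` {..<n} = set xs" unfolding set_conv_nth len by auto
  then have img: "(!) xs ` {..<n} = {..<n}" using xs(2) by simp
  have re: "sum f ((!) xs ` U) = (\<Sum>k\<in>U. f (xs ! k))" if "U \<subseteq> {..<n}" for f :: "nat \<Rightarrow> nat" and U
    using inj_on_subset[OF inj that] by (simp add: sum.reindex)
  show "sum wg ((!) xs ` T) \<le> t" using re[OF T(1)] T(2) by simp
  show "(!) xs ` T \<subseteq> {..<n}" using image_mono[OF T(1), of "(!) xs"] img by simp
  show "xs ! k \<in> (!) xs ` T \<longleftrightarrow> k \<in> T" if "k < n" using inj_on_image_mem_iff[OF inj _ T(1)] that by simp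
  show "sum pf S \<le> sum pf ((!) xs ` T)" if S: "S \<subseteq> {..<n}" "sum wg S \<le> t"
  proof -
    have "S \<subseteq> (!) xs ` {..<n}" using S(1) img by simp
    then obtain U where U: "U \<subseteq> {..<n}" "S = (!) xs ` U" unfolding subset_image_iff by blast
    show ?thesis using opt[OF U(1)] S(2) re[OF U(1)] re[OF T(1)] U(2) by simp
  qed
qed

lemma bucket_sorted: "sorted (map f (bucket f m xs))"
proof -
  have "sorted_wrt (\<lambda>x y. True) xs" by (induction xs) auto
  from sorted_wrt_bucket[OF this, of f m] show ?thesis unfolding sorted_wrt_map by (rule sorted_wrt_mono_rel[rotated]) auto
qed

lemma window_ge:
  assumes "0 < w" shows "w + (hgt w + 1) * w * (16 * sqr w * (lg2 w + 1) ^ 2) \<le> window w"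
proof -
  define q where "q = lg2 w + 3"
  have "(hgt w + 1) * w * (16 * sqr w * (lg2 w + 1) ^ 2) \<le> q * w * (16 * sqr w * q ^ 2)"
    unfolding q_def using hgt_lg2[OF assms] by (intro mult_le_mono power_mono order_refl) auto
  moreover have "w \<le> q * w * (sqr w * q ^ 2)" using sqr_pos[OF assms] by (simp add: q_def)
  moreover have "q * w * (16 * sqr w * q ^ 2) + q * w * (sqr w * q ^ 2) = window w"
    unfolding window_def q_def[symmetric] by (simp add: power2_eq_square)
  ultimately show ?thesis by linarith
qed

definition sel_bound :: "nat \<Rightarrow> nat" where
  "sel_bound w = 4 * w + 2 * ((lg2 w + 1) * (16 * hgt w * w + 2 * 2 ^ hgt w))"

context mach
begin

text \<open>The combinatorial locales index items by sorted position, the weight and profit arrays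
  by original number; \<open>xs\<close> translates. Here all locales are instantiated with the data
  that the earlier stages have computed.\<close>

lemma improve_optimal:
  fixes wg pf :: "nat \<Rightarrow> nat" and xs :: "nat list"
  defines "w \<equiv> \<lambda>k. wg (xs ! k)" and "p \<equiv> \<lambda>k. pf (xs ! k)"
  assumes n0: "0 < n" and bnd: "\<And>i. i < n \<Longrightarrow> 0 < wg i \<and> wg i \<le> wm \<and> pf i \<le> X"
    and X: "2 \<le> X" "n + 1 \<le> X" "wm \<le> X" "X ^ 20 \<le> IM"
    and xs: "distinct xs" "set xs = {..<n}" and srt: "\<And>i j. i \<le> j \<Longrightarrow> j < n \<Longrightarrow> p j * w i \<le> p i * w j"
    and q: "q < n" "sum w {..<q} \<le> t" "t < sum w {..<Suc q}"
    and v: "v 0 = n" "v 1 = t" "v 2 = wm" "v 13 = sum w {..<q}" "v 14 = q"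
    and a: "\<And>k. k < n \<Longrightarrow> a 1 k = wg k \<and> a 2 k = pf k \<and> a 4 k = xs ! k"
    and z: "\<And>k y. k \<in> {6, 9, 10, 13, 16, 17, 18, 19, 20, 21} \<Longrightarrow> a k y = 0"
    and a8: "\<And>k. k < n \<Longrightarrow> a 8 (xs ! k) = (if k < q then 1 else 0)"
    and Q: "\<And>v' a' t' T M. \<lbrakk>v' 0 = n; T \<subseteq> {..<n}; sum w T \<le> t; \<And>S. S \<subseteq> {..<n} \<Longrightarrow> sum w S \<le> t \<Longrightarrow> sum p S \<le> sum p T;
       \<And>k. k < n \<Longrightarrow> a' 8 (xs ! k) = (if k \<in> T then 1 else 0); M \<le> n; M \<le> sel_bound wm;
       t' \<le> t0 + 300 + 230 * wm + 110 * n + 20 * M + M * (30 * (2 * window wm + 1) + 30)\<rbrakk> \<Longrightarrow> Q (v', a', t')"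
  shows "wp B b improve Q (v, a, t0)"
proof -
  have len: "length xs = n" using distinct_card[OF xs(1)] xs(2) by simp
  have xn: "xs ! k < n" if "k < n" for k using that xs(2) len nth_mem[of k xs] by auto
  have wk: "0 < w k \<and> w k \<le> wm" if "k < n" for k using bnd[OF xn[OF that]] by (simp add: w_def)
  have w0: "0 < wm" using wk[OF n0] by simp
  have pe: "pf (xs ! k) = p k" for k by (simp add: p_def)
  define H where "H = hgt wm"
  define P :: nat where "P = 2 ^ H"
  define L where "L = window wm"
  have P4: "P \<le> 4 * wm" unfolding P_def H_def by (rule hgt_le[OF w0])
  note pb = poly_bounds[OF X(1-3) P4, THEN order_trans, OF X(4)]
  interpret g: greedy n q t wm w p by standard (use wk srt q in auto)
  interpret alg: algo B b IM n q wm w g.pn H P wg xs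
    by standard (use P_def q len xs pb(6) in \<open>auto simp: w_def\<close>)
  define its where "its = bucket (\<lambda>k. brev H (g.rank k)) P alg.SLS"
  have key: "brev H (g.rank k) < P" for k unfolding P_def by (rule brev_less)
  have set_its: "set its = {k. k < n \<and> g.sel k \<and> g.rank k < 2 ^ H}" unfolding its_def set_bucket alg.set_SLS using key by (auto simp: P_def)
  have dits: "distinct its" unfolding its_def by (rule distinct_bucket[OF alg.distinct_SLS])
  interpret d: dp n q wm w g.pn L its by standard (use set_its dits in auto)
  define PM where "PM = X * X"
  have pX: "p k \<le> X" "w k \<le> X" if "k < n" for k using bnd[OF xn[OF that]] X by (auto simp: p_def w_def)
  have slk: "t - sum w {..<q} < wm" using g.slack by simp
  have wmL: "wm \<le> L" using window_ge[OF w0] unfolding L_def by linarith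
  interpret s: solver B b IM n q wm w g.pn H P wg xs L its pf "p q" "w q" PM "t - sum w {..<q}"
  proof standard
    show "pf (xs ! k) * w q \<le> p q * w k \<and> g.pn k = p q * w k - pf (xs ! k) * w q" if "q \<le> k" "k < n" for k
      using srt[OF that] that by (simp add: g.pn_def pe)
    show "p q * w k \<le> pf (xs ! k) * w q \<and> g.pn k = pf (xs ! k) * w q - p q * w k" if "k < q" for k
      using srt[of k q] that q(1) by (simp add: g.pn_def pe)
    show "pf (xs ! k) * w q \<le> PM" if "k < n" for k
      using pX(1)[OF that] pX(2)[OF q(1)] unfolding PM_def pe by (intro mult_le_mono)
    show "p q * wm \<le> PM" using pX(1)[OF q(1)] X unfolding PM_def by (intro mult_le_mono)
    show "t - sum w {..<q} \<le> L" "t - sum w {..<q} < wm" using slk wmL by linarith+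
    show "(n + 1) * (2 * L + 2 * wm + 1) + (n + 1) * PM + 20 \<le> IM" using pb(9) unfolding L_def PM_def .
    show "distinct xs" by (rule xs(1))
  qed
  have Mlen: "length its = card {k. k < n \<and> g.sel k \<and> g.rank k < 2 ^ H}" using distinct_card[OF dits] set_its by simp
  have M1: "length its \<le> sel_bound wm" unfolding Mlen sel_bound_def H_def by (rule g.selected_count)
  show ?thesis
  proof (rule s.improve[OF H_def L_def its_def w0 q(1) v refl q(2) _ _ a z a8], goal_cases)
    case (9 v' a' t' s)
    note r = this
    let ?D = "d.bt (length its) (wm + L + s)"
    have srt_its: "sorted (map (\<lambda>k. brev H (g.rank k)) its)" unfolding its_def by (rule bucket_sorted)
    have H2: "2 * wm \<le> 2 ^ H" unfolding H_def by (rule hgt(1))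
    have L2: "wm + (H + 1) * wm * (16 * sqr wm * (lg2 wm + 1) ^ 2) \<le> L" unfolding H_def L_def by (rule window_ge[OF w0])
    note opt = g.dp_optimal[OF d.dp_axioms set_its srt_its sqr(1) H2 L2 r(2,3) r(4,5)[unfolded s.worth_def]]
    have Dn: "?D \<subseteq> {..<n}" using d.bt_correct[OF order_refl r(3)] set_its by auto
    have sub: "g.flip ?D \<subseteq> {..<n}" by (rule g.flip_sub[OF Dn])
    have out: "a' 8 (xs ! k) = (if k \<in> g.flip ?D then 1 else 0)" if "k < n" for k using r(6)[OF that] by (auto simp: g.flip_def)
    have tt: "t' \<le> t0 + 300 + 230 * wm + 110 * n + 20 * length its + length its * (30 * (2 * window wm + 1) + 30)"
      using r(7) P4 unfolding L_def by linarith
    show ?case by (rule Q[where v' = v' and a' = a' and t' = t' and T = "g.flip ?D" and M = "length its",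
        OF r(1) sub opt(1) opt(2) out s.M_le M1 tt])
  qed (use pb X in \<open>auto simp: p_def w_def\<close>)
qed

end

context mach
begin

lemma knapsack:
  fixes wg pf :: "nat \<Rightarrow> nat" and n :: nat
  defines "wm \<equiv> mx wg n"
  assumes a: "a 0 0 = n" "a 0 1 = t" "\<And>i. i < n \<Longrightarrow> a 0 (2 * i + 2) = wg i \<and> a 0 (2 * i + 3) = pf i"
    and z: "\<And>k y. 0 < k \<Longrightarrow> a k y = 0" and bn: "b = 2 * n + 2" and n0: "0 < n"
    and bnd: "\<And>i. i < n \<Longrightarrow> 0 < wg i \<and> wg i \<le> X \<and> pf i \<le> X"
    and X: "2 \<le> X" "n + 1 \<le> X" "t \<le> X" "X ^ 20 \<le> IM" "X * X * X < (n + 1) ^ R"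
    and Q: "\<And>v' a' t' S M. \<lbrakk>S \<subseteq> {..<n}; sum wg S \<le> t; \<And>S'. S' \<subseteq> {..<n} \<Longrightarrow> sum wg S' \<le> t \<Longrightarrow> sum pf S' \<le> sum pf S;
       \<And>i. i < n \<Longrightarrow> a' 0 i = (if i \<in> S then 1 else 0); M \<le> n; M \<le> sel_bound wm;
       t' \<le> t0 + 420 + R * (100 * n + 100) + 230 * wm + 190 * n + 20 * M + M * (30 * (2 * window wm + 1) + 30)\<rbrakk> \<Longrightarrow> Q (v', a', t')"
  shows "wp B b knapsack Q (v, a, t0)"
proof -
  have wm: "wg i \<le> wm" if "i < n" for i using mx_ge[OF that] by (simp add: wm_def)
  have wmX: "wm \<le> X"
  proof -
    have "wm < X + 1" unfolding wm_def by (rule mx_less) (use bnd in \<open>auto simp: less_Suc_eq_le\<close>)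
    then show ?thesis by simp
  qed
  let ?key = "\<lambda>i. pf i * wm * wm div wg i"
  note pb = poly_bounds[OF X(1,2) wmX zero_le, THEN order_trans, OF X(4)]
  have pk: "pf i * wm * wm \<le> X * X * X" "pf i * wm \<le> X * X" if "i < n" for i
    using bnd[OF that] wmX by (intro mult_le_mono; simp)+
  have keyX: "?key i \<le> X * X * X" if "i < n" for i using pk(1)[OF that] div_le_dividend order_trans by blast
  define mk where "mk = mx ?key n"
  have mkX: "mk \<le> X * X * X"
  proof -
    have "mk < X * X * X + 1" unfolding mk_def by (rule mx_less) (use keyX in \<open>auto simp: less_Suc_eq_le\<close>)
    then show ?thesis by simp
  qed
  have nIM: "2 * n + 3 \<le> IM" "n + 1 \<le> IM" using pb(1) X(2) by linarith+
  show ?thesis unfolding knapsack_def wp_Seq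
  proof (rule read_items[where a = a and n = n and wg = wg and pf = pf and t = t, OF a(1) a(2) a(3) bn nIM(1)], goal_cases)
    case (1 i) then show ?case by assumption
  next
    case (2 v1 a1 t1)
    note r1 = this
    show ?case
    proof (rule compute_keys[where a = a1 and v = v1 and n = n and wm = wm and wg = wg and pf = pf, OF r1(3) r1(5)[folded wm_def] r1(6) nIM(2)], goal_cases)
      case 1 then show ?case by assumption
    next
      case (2 i) then show ?case using pk[OF 2] pb(2,3) by linarith
    next
      case (3 v2 a2 t2)
      note r2 = this
      have v2: "v2 0 = n" "v2 1 = t" "v2 2 = wm" using r1 r2(1) by (simp_all add: wm_def)
      have fa2: "a2 k = a k" if "k \<notin> {1, 2, 3, 4}" for k using r1(2) r2(2) that by simp
      show ?case
      proof (rule radix_sort[where a = a2 and v = v2 and n = n and mk = mk and key = ?key and R = R, OF v2(1) r2(3)[folded mk_def] n0], goal_cases)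
        case (1 i) then show ?case using r2(4)[OF 1] mx_ge[OF 1, of ?key] by (simp add: mk_def)
      next
        case (2 y) then show ?case using fa2[of 6] z by simp
      next
        case 3 then show ?case using mkX X(5) by linarith
      next
        case 4 then show ?case by (rule pb(4))
      next
        case 5
        have "(mk + 1) * (n + 1) \<le> (X * X * X + 1) * (n + 1)" using mkX by (intro mult_le_mono1) simp
        then show ?case using pb(5) by linarith
      next
        case (6 v3 a3 t3 xs)
        note r3 = this
        have v3: "v3 0 = n" "v3 1 = t" "v3 2 = wm" using v2 r3(1) by simp_all
        have fa3: "a3 k = a k" if "k \<notin> {1, 2, 3, 4, 5, 6, 7}" for k using fa2 r3(2) that by simp
        have len: "length xs = n" using distinct_card[OF r3(3)] r3(4) by simp
        have xn: "xs ! k < n" if "k < n" for k using that r3(4) len nth_mem[of k xs] by auto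
        have a12: "a3 1 k = wg k" "a3 2 k = pf k" if "k < n" for k using r1(6)[OF that] r2(2) r3(2) by simp_all
        show ?case
        proof (rule greedy_prefix[where a = a3 and v = v3 and n = n and t = t and xs = xs and wg = wg, OF v3(1,2) r3(3,4,6)], goal_cases)
          case 1 then show ?case by assumption
        next
          case 2 then show ?case by (rule a12)
        next
          case 3 then show ?case using fa3[of 8] z by simp
        next
          case 4 then show ?case by (rule nIM(2))
        next
          case (5 i) then show ?case using bnd[OF 5] X(3) pb(1) by linarith
        next
          case (6 v4 a4 t4 q)
          note r4 = this
          have v4: "v4 0 = n" "v4 1 = t" "v4 2 = wm" using v3 r4(1) by simp_all
          have fa4: "a4 k = a3 k" if "k \<noteq> 8" for k using r4(2) that by simp
          have a48: "a4 8 (xs ! k) = (if k < q then 1 else 0)" if k: "k < n" for k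
          proof -
            have "xs ! k \<in> set (take q xs) \<longleftrightarrow> k < q"
            proof
              assume "xs ! k \<in> set (take q xs)"
              then obtain i where "i < q" "i < n" "xs ! i = xs ! k" using len by (auto simp: in_set_conv_nth)
              then show "k < q" using nth_eq_iff_index_eq[OF r3(3)] k len by simp
            next
              assume "k < q" then show "xs ! k \<in> set (take q xs)" using k len r4(3) by (auto simp: in_set_conv_nth intro!: exI[of _ k])
            qed
            then show ?thesis using r4(6)[OF xn[OF k]] by simp
          qed
          have t4: "t4 \<le> t0 + (20 * n + 20) + (20 * n + 20) + (R * (100 * n + 100) + 20) + (20 * n + 20)"
            using r1(7) r2(5) r3(8) r4(8) by linarith
          have fin: "wp B b write_output Q (v5, a5, t5)"
            if T: "v5 0 = n" "T \<subseteq> {..<n}" "(\<Sum>k\<in>T. wg (xs ! k)) \<le> t"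
              and opt: "\<And>S. S \<subseteq> {..<n} \<Longrightarrow> (\<Sum>k\<in>S. wg (xs ! k)) \<le> t \<Longrightarrow> (\<Sum>k\<in>S. pf (xs ! k)) \<le> (\<Sum>k\<in>T. pf (xs ! k))"
              and a5: "\<And>k. k < n \<Longrightarrow> a5 8 (xs ! k) = (if k \<in> T then 1 else 0)" and M: "M \<le> n" "M \<le> sel_bound wm"
              and t5: "t5 \<le> t4 + 2 + 300 + 230 * wm + 110 * n + 20 * M + M * (30 * (2 * window wm + 1) + 30)"
            for v5 a5 t5 T M
          proof -
            note ns = nth_solution[OF r3(3,4) T(2,3) opt]
            have nb: "n \<le> b" using bn by simp
            show ?thesis
            proof (rule write_output[where a = a5 and v = v5 and n = n, OF T(1) nb nIM(2)], goal_cases)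
              case (1 v6 a6 t6)
              note r6 = this
              have "a6 0 i = (if i \<in> (!) xs ` T then 1 else 0)" if i: "i < n" for i
              proof -
                obtain k where "k < n" "i = xs ! k" using i r3(4) len by (metis in_set_conv_nth lessThan_iff)
                then show ?thesis using r6(1)[OF i] a5 ns(4)[of k] by simp
              qed
              note o = this
              have tt: "t6 \<le> t0 + 420 + R * (100 * n + 100) + 230 * wm + 190 * n + 20 * M + M * (30 * (2 * window wm + 1) + 30)"
                using t4 t5 r6(2) by linarith
              show ?case by (rule Q[where v' = v6 and a' = a6 and t' = t6 and S = "(!) xs ` T" and M = M, OF ns(3,1) ns(2) o M tt]; assumption)
            qed
          qed
          have cB: "0 < B" by (rule ltB) simp
          show ?case
          proof (cases "v4 12 = 0")
            case True
            \<comment> \<open>Everything fits, so the greedy prefix is optimal; no candidate is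
              examined, and \<open>M = 0\<close> meets both bounds.\<close>
            then have q: "q = n" using r4(7) by simp
            have "wp B b write_output Q (v4, a4, t4 + 2)"
            proof (rule fin[where T = "{..<n}" and M = 0])
              show "(\<Sum>k\<in>{..<n}. wg (xs ! k)) \<le> t" using r4(4,5) q by simp
              show "(\<Sum>k\<in>S. pf (xs ! k)) \<le> (\<Sum>k\<in>{..<n}. pf (xs ! k))" if "S \<subseteq> {..<n}" for S using that by (intro sum_mono2) auto
              show "a4 8 (xs ! k) = (if k \<in> {..<n} then 1 else 0)" if "k < n" for k using a48[OF that] that q by simp
            qed (use v4 in auto)
            then show ?thesis using True cB by simp
          next
            case False
            then have q: "v4 12 = 1" "q < n" "v4 14 = q" "t < (\<Sum>k<Suc q. wg (xs ! k))" using r4(7) by auto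
            have srt: "pf (xs ! j) * wg (xs ! i) \<le> pf (xs ! i) * wg (xs ! j)" if ij: "i \<le> j" "j < n" for i j
            proof (cases "i = j")
              case False
              then have "?key (xs ! j) \<le> ?key (xs ! i)" using sorted_wrt_nth_less[OF r3(5), of i j] ij len by simp
              then show ?thesis using density_key[of "wg (xs ! i)" wm "wg (xs ! j)" "pf (xs ! j)" "pf (xs ! i)"] bnd wm xn ij by simp
            qed simp
            have "wp B b improve (wp B b write_output Q) (v4, a4, t4 + 2)"
            proof (rule improve_optimal[where a = a4 and v = v4 and n = n and wg = wg and pf = pf and X = X and xs = xs and wm = wm and q = q and t = t, OF n0 _ X(1,2) wmX X(4) r3(3,4) srt q(2)], goal_cases)
              case (1 i) then show ?case using bnd[OF 1] wm[OF 1] by simp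
            next
              case 4 then show ?case using r4(4,5) by simp
            next
              case 5 then show ?case by (rule q(4))
            next
              case 6 then show ?case by (rule v4)
            next
              case 7 then show ?case by (rule v4)
            next
              case 8 then show ?case by (rule v4)
            next
              case 9 then show ?case by (rule r4(4))
            next
              case 10 then show ?case by (rule q(3))
            next
              case (11 k) then show ?case using a12[OF 11] r3(6)[OF 11] fa4 by simp
            next
              case (12 k y) 
              show ?case
              proof (cases "k = 6")
                case True then show ?thesis using fa4 r3(7) by simp
              next
                case False
                then have "a4 k = a k" using fa4 fa3 12 by auto
                then show ?thesis using z[of k y] 12 by auto
              qed
            next
              case (13 k) then show ?case by (rule a48)
            next
              case (14 v5 a5 t5 T M)
              note r5 = this
              show ?case by (rule fin[where T = T and M = M and ?v5.0 = v5 and ?a5.0 = a5 and ?t5.0 = t5, OF r5(1,2,3) r5(4) r5(5) r5(6,7)]; use r5(8) in simp)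
            qed simp_all
            then show ?thesis using False cB by simp
          qed
        qed
      qed
    qed
  qed 
qed

end

section \<open>The time bounds\<close>

text \<open>For positive \<open>w\<close> the logarithm of \<open>w + 1\<close> is at least 1, so
  additive constants turn into factors.\<close>

lemma lg2_le_log: assumes "0 < w" shows "real (lg2 w) + 3 \<le> 4 * log 2 (real (w + 1))" "1 \<le> log 2 (real (w + 1))"
proof -
  have "real (lg2 w) \<le> log 2 (real w)" 
  proof (rule le_log_of_power)
    have "real (2 ^ lg2 w) \<le> real w" using lg2_bounds[OF assms] by (intro of_nat_mono) simp
    then show "2 ^ lg2 w \<le> real w" by simp
  qed simp
  also have "\<dots> \<le> log 2 (real (w + 1))" using assms by simp
  finally have 1: "real (lg2 w) \<le> log 2 (real (w + 1))" .
  show 2: "1 \<le> log 2 (real (w + 1))" using assms by (simp add: le_log_iff)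
  show "real (lg2 w) + 3 \<le> 4 * log 2 (real (w + 1))" using 1 2 by linarith
qed

lemma sqr_le_sqrt: assumes "0 < w" shows "real (sqr w) \<le> 2 * sqrt (real w)"
proof -
  have "(sqr w - 1) * (sqr w - 1) < w" using sqr(3)[of "sqr w - 1" w] sqr_pos[OF assms] by simp
  then have "real (sqr w - 1) * real (sqr w - 1) < real w" unfolding of_nat_mult[symmetric] of_nat_less_iff .
  moreover have "real (sqr w - 1) = real (sqr w) - 1" using sqr_pos[OF assms] by simp
  ultimately have "(real (sqr w) - 1)\<^sup>2 < real w" by (simp add: power2_eq_square)
  then have "real (sqr w) - 1 \<le> sqrt (real w)" by (intro real_le_rsqrt) simp
  moreover have "1 \<le> sqrt (real w)" using assms by simp
  ultimately show ?thesis by linarith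
qed

lemma window_le_powr:
  assumes w: "0 < w" shows "real (window w) + 1 \<le> 2304 * (real w powr 1.5 * log 2 (real (w + 1)) ^ 3)"
proof -
  define l where "l = log 2 (real (w + 1))"
  have l: "1 \<le> l" "real (lg2 w) + 3 \<le> 4 * l" unfolding l_def by (rule lg2_le_log[OF w])+
  have pw: "real w powr 1.5 = real w * sqrt (real w)"
  proof -
    have "real w powr 1.5 = real w powr 1 * real w powr (1 / 2)" unfolding powr_add[symmetric] by simp
    then show ?thesis using w by (simp add: powr_half_sqrt)
  qed
  have "real (window w) = 17 * ((real (lg2 w) + 3) ^ 3 * (real (sqr w) * real w))" by (simp add: window_def power3_eq_cube)
  \<comment> \<open>The product of 17, 64 and 2 is 2176, from \<open>lg2_le_log\<close> and
    \<open>sqr_le_sqrt\<close>; the further 128 in the claim pay for the summand 1.\<close>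
  also have "\<dots> \<le> 17 * ((4 * l) ^ 3 * (2 * sqrt (real w) * real w))"
    using l sqr_le_sqrt[OF w] by (intro mult_left_mono mult_mono power_mono mult_right_mono) auto
  also have "\<dots> = 2176 * (real w powr 1.5 * l ^ 3)" unfolding pw by (simp add: power_mult_distrib)
  finally have 1: "real (window w) \<le> 2176 * (real w powr 1.5 * l ^ 3)" .
  have "1 * 1 \<le> real w powr 1.5 * l ^ 3" using w l(1) by (intro mult_mono ge_one_powr_ge_zero one_le_power) auto
  then show ?thesis using 1 unfolding l_def by linarith
qed

lemma sel_bound_le: assumes w: "0 < w" shows "real (sel_bound w) \<le> 576 * (real w * log 2 (real (w + 1)) ^ 2)"
proof -
  define l where "l = log 2 (real (w + 1))"
  define q where "q = lg2 w"
  have "16 * hgt w * w + 2 * 2 ^ hgt w \<le> 16 * (q + 2) * w + 2 * (4 * w)"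
    using hgt_lg2[OF w] hgt_le[OF w] unfolding q_def by (intro add_mono mult_le_mono) auto
  from mult_le_mono2[OF this, of "q + 1"]
  have "sel_bound w \<le> 4 * w + 2 * ((q + 1) * (16 * (q + 2) * w + 2 * (4 * w)))"
    unfolding sel_bound_def q_def[symmetric] by linarith
  also have "\<dots> \<le> 36 * (w * (q + 3) ^ 2)" by (simp add: power2_eq_square algebra_simps)
  finally have "real (sel_bound w) \<le> 36 * (real w * (real q + 3) ^ 2)"
    unfolding of_nat_le_iff[symmetric, where ?'a = real] by simp
  also have "\<dots> \<le> 36 * (real w * (4 * l) ^ 2)"
    using lg2_le_log[OF w] unfolding q_def l_def by (intro mult_left_mono power_mono) auto
  finally show ?thesis unfolding l_def by (simp add: power_mult_distrib)
qed

lemma length_input_words: "length (input_words t items) = 2 * length items + 2"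
proof -
  have "length (concat (map (\<lambda>(w, p). [w, p]) items)) = 2 * length items" for items :: "item list" by (induction items) auto
  then show ?thesis by (simp add: input_words_def)
qed

lemma nth_input_words:
  assumes "i < length items"
  shows "input_words t items ! (2 * i + 2) = fst (items ! i)" "input_words t items ! (2 * i + 3) = snd (items ! i)"
proof -
  have "concat (map (\<lambda>(w, p). [w, p]) items) ! (2 * i) = fst (items ! i) \<and> concat (map (\<lambda>(w, p). [w, p]) items) ! (2 * i + 1) = snd (items ! i)"
    using assms
  proof (induction items arbitrary: i)
    case (Cons x xs)
    then show ?case by (cases i; cases x) auto
  qed simp
  then show "input_words t items ! (2 * i + 2) = fst (items ! i)" "input_words t items ! (2 * i + 3) = snd (items ! i)"
    by (simp_all add: input_words_def numeral_eq_Suc)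
qed

lemma w_max_eq_mx: "items \<noteq> [] \<Longrightarrow> w_max items = mx (\<lambda>i. fst (items ! i)) (length items)"
proof -
  assume "items \<noteq> []"
  moreover have "fst ` set items = (\<lambda>i. fst (items ! i)) ` {..<length items}" by (auto simp: set_conv_nth)
  ultimately show ?thesis by (simp add: w_max_def mx_eq_Max)
qed

text \<open>With \<open>X = (n + 1) ^ (c + 1)\<close>, indices and values stay within
  \<open>X ^ 20\<close> and addresses below \<open>X ^ 27\<close>; a word length of
  \<open>27 * (c + 1)\<close> logarithms provides that much. The exponent \<open>c + 1\<close> keeps
  \<open>n + 1 \<le> X\<close> even for \<open>c = 0\<close>, and \<open>R\<close> radix passes
  suffice because keys are at most \<open>X ^ 3\<close>.\<close>

lemma knapsack_solves:
  fixes c W t :: nat and items :: "item list"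
  defines "n \<equiv> length items" and "wm \<equiv> w_max items" and "R \<equiv> 3 * (c + 1) + 1"
  assumes inst: "knapsack_instance t items" and small: "\<forall>x \<in> set (input_words t items). x \<le> (length items + 1) ^ c"
    and W: "real (27 * (c + 1)) * log 2 (real (length items + 1)) \<le> real W"
  shows "0 < wm \<and> (\<exists>M. M \<le> n \<and> M \<le> sel_bound wm \<and>
    solves_within W (compile knapsack) t items (real (5 + length (compile knapsack) *
      (420 + R * (100 * n + 100) + 230 * wm + 190 * n + 20 * M + M * (30 * (2 * window wm + 1) + 30)))))"
proof -
  let ?xs = "input_words t items"
  define wg where "wg i = fst (items ! i)" for i
  define pf where "pf i = snd (items ! i)" for i
  define X where "X = (n + 1) ^ (c + 1)"
  have ne: "items \<noteq> []" and t0: "0 < t" and pos: "\<And>i. i < n \<Longrightarrow> 0 < wg i \<and> 0 < pf i"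
    using inst unfolding knapsack_instance_def n_def wg_def pf_def by (auto simp: case_prod_beta)
  have n0: "0 < n" using ne by (simp add: n_def)
  have wm: "wm = mx wg n" unfolding wm_def n_def wg_def by (rule w_max_eq_mx[OF ne])
  have cX: "(n + 1) ^ c \<le> X" unfolding X_def by simp
  have nX: "n + 1 \<le> X" unfolding X_def by (rule self_le_power) auto
  have X2: "2 \<le> X" using nX n0 by simp
  have le: "x \<le> X" if "x \<in> set ?xs" for x using small that cX unfolding n_def by (meson order_trans)
  have len: "length ?xs = 2 * n + 2" unfolding n_def by (rule length_input_words)
  have nth: "?xs ! (2 * i + 2) = wg i" "?xs ! (2 * i + 3) = pf i" if "i < n" for i
    using nth_input_words[of i items t] that by (simp_all add: n_def wg_def pf_def)
  have bnd: "0 < wg i \<and> wg i \<le> X \<and> pf i \<le> X" if i: "i < n" for i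
  proof -
    have "?xs ! (2 * i + 2) \<in> set ?xs" "?xs ! (2 * i + 3) \<in> set ?xs" using i len by (intro nth_mem; linarith)+
    then show ?thesis using le nth[OF i] pos[OF i] by simp
  qed
  have tX: "t \<le> X" by (rule le) (simp add: input_words_def)
  have big: "X ^ 27 \<le> 2 ^ W"
  proof -
    have "real ((n + 1) ^ (27 * (c + 1))) = 2 powr (real (27 * (c + 1)) * log 2 (real (n + 1)))"
    proof -
      define y k where "y = real (n + 1)" and "k = 27 * (c + 1)"
      have y: "0 < y" by (simp add: y_def)
      have "2 powr (real k * log 2 y) = (2 powr log 2 y) powr real k" by (simp add: powr_powr mult.commute)
      also have "\<dots> = y ^ k" using y by (simp add: powr_realpow)
      finally show ?thesis unfolding y_def k_def by (simp only: of_nat_power)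
    qed
    also have "\<dots> \<le> 2 powr real W" using W unfolding n_def by simp
    also have "\<dots> = real (2 ^ W)" by (simp add: powr_realpow)
    finally have "(n + 1) ^ (27 * (c + 1)) \<le> 2 ^ W" using of_nat_le_iff by blast
    then show ?thesis unfolding X_def power_mult[symmetric] by (simp only: mult.commute)
  qed
  have Xp: "32 * X ^ 20 \<le> X ^ 25" "4 * X ^ 25 \<le> X ^ 27" "64 * X ^ 1 \<le> X ^ 7" "X ^ 7 \<le> X ^ 25" "32 * X ^ 0 \<le> X ^ 5" "X ^ 5 \<le> X ^ 25"
    using two_power_mult_le[OF X2, of 5 20] two_power_mult_le[OF X2, of 2 25] two_power_mult_le[OF X2, of 6 1] two_power_mult_le[OF X2, of 5 0] X2
    by (auto intro!: power_increasing)
  have B1: "(X ^ 20 + length ?xs) * 32 + 31 < 2 ^ W" using Xp big nX unfolding len by simp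
  have XW: "X < 2 ^ W" "32 < (2::nat) ^ W" "length ?xs < 2 ^ W" using B1 Xp big nX unfolding len by simp_all
  interpret mach "2 ^ W" "length ?xs" "X ^ 20" by standard (rule B1)
  have R: "X * X * X < (n + 1) ^ R"
  proof -
    have "X * X * X = (n + 1) ^ (3 * (c + 1))" unfolding X_def power_add[symmetric] by (rule arg_cong[of _ _ "(^) (n + 1)"]) simp
    also have "\<dots> < (n + 1) ^ R" unfolding R_def using n0 by (intro power_strict_increasing) auto
    finally show ?thesis .
  qed
  let ?a = "\<lambda>k i. if k = 0 \<and> i < length ?xs then ?xs ! i else 0 :: nat"
  let ?T = "\<lambda>M. 420 + R * (100 * n + 100) + 230 * wm + 190 * n + 20 * M + M * (30 * (2 * window wm + 1) + 30)"
  define Q where "Q s \<longleftrightarrow> (\<exists>S M. S \<subseteq> {..<n} \<and> sum wg S \<le> t \<and> (\<forall>S'. S' \<subseteq> {..<n} \<longrightarrow> sum wg S' \<le> t \<longrightarrow> sum pf S' \<le> sum pf S) \<and>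
     (\<forall>i<n. fst (snd s) 0 i = (if i \<in> S then 1 else 0)) \<and> M \<le> n \<and> M \<le> sel_bound wm \<and> snd (snd s) \<le> ?T M)" for s :: state
  have "wp (2 ^ W) (length ?xs) knapsack Q ((\<lambda>_. 0)(63 := length ?xs), ?a, 0)"
  proof (rule knapsack[where n = n and t = t and wg = wg and pf = pf and X = X and R = R], goal_cases)
    case 1 then show ?case unfolding len by (simp add: input_words_def n_def)
  next
    case 2 then show ?case unfolding len by (simp add: input_words_def)
  next
    case (3 i) then show ?case using nth[OF 3] unfolding len by simp
  next
    case (13 v' a' t' S M)
    then show ?case unfolding Q_def wm by (intro exI[of _ S] exI[of _ M]) auto
  qed (use len n0 bnd X2 nX tX R in auto)
  note run = this
  have xs: "?xs \<noteq> []" "length ?xs = 2 * hd ?xs + 2" unfolding len by (simp_all add: input_words_def n_def)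
  have "\<forall>x\<in>set ?xs. x < 2 ^ W" using le_less_trans[OF le XW(1)] by blast
  from compile_correct[OF XW(2) xs(1) this xs(2) XW(3) run] obtain T v a t' where run: "halted (compile knapsack) ((step W (compile knapsack) ^^ T) (init_config ?xs))"
      "\<forall>i<length ?xs. mem ((step W (compile knapsack) ^^ T) (init_config ?xs)) i = a 0 i" and Q': "Q (v, a, t')"
      and T: "T \<le> 5 + length (compile knapsack) * t'"
    unfolding Let_def by blast
  define s where "s = (step W (compile knapsack) ^^ T) (init_config ?xs)"
  from Q' obtain S M where S: "S \<subseteq> {..<n}" "sum wg S \<le> t" "\<And>S'. S' \<subseteq> {..<n} \<Longrightarrow> sum wg S' \<le> t \<Longrightarrow> sum pf S' \<le> sum pf S"
    "\<And>i. i < n \<Longrightarrow> a 0 i = (if i \<in> S then 1 else 0)" and M: "M \<le> n" "M \<le> sel_bound wm" "t' \<le> ?T M"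
    unfolding Q_def by auto
  have ms: "mem s i = (if i \<in> S then 1 else 0)" if "i < n" for i using run(2) S(4)[OF that] that len unfolding s_def by simp
  have out: "output_set n s = S" using S(1) ms by (auto simp: output_set_def split: if_splits)
  have sol: "knapsack_solution t items S"
    unfolding knapsack_solution_def is_arg_max_def feasible_def using S(1-3)
    unfolding wg_def pf_def n_def by (auto simp: not_less)
  have "T \<le> 5 + length (compile knapsack) * ?T M"
    using T mult_le_mono2[OF M(3), of "length (compile knapsack)"] by linarith
  then have "real T \<le> real (5 + length (compile knapsack) * ?T M)" by (rule of_nat_mono)
  then have "solves_within W (compile knapsack) t items (real (5 + length (compile knapsack) * ?T M))"
    unfolding solves_within_def Let_def using run(1) ms out sol unfolding s_def n_def by (intro exI[of _ T] conjI) auto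
  moreover have "0 < wm" using pos[OF n0] mx_ge[OF n0, of wg] wm by simp
  ultimately show ?thesis using M by blast
qed

lemma knapsack_time:
  fixes n w M R len :: nat
  assumes "0 < n"
  shows "real (5 + len * (420 + R * (100 * n + 100) + 230 * w + 190 * n + 20 * M + M * (30 * (2 * window w + 1) + 30)))
    \<le> real (5 + len * (610 + 200 * R)) * (real n + real w + real M * (real (window w) + 1))"
proof -
  let ?E = "n + w + M * (window w + 1)"
  have "420 + R * (100 * n + 100) + 230 * w + 190 * n + 20 * M + M * (30 * (2 * window w + 1) + 30) \<le> (610 + 200 * R) * ?E"
  proof -
    have "R * (100 * n + 100) \<le> R * (200 * ?E)" by (rule mult_le_mono2) (use assms in simp)
    moreover have "420 + 230 * w + 190 * n + 20 * M + M * (30 * (2 * window w + 1) + 30) \<le> 610 * ?E"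
      using assms by (simp add: algebra_simps)
    moreover have "(610 + 200 * R) * E = 610 * E + R * (200 * E)" for E by (simp add: algebra_simps)
    ultimately show ?thesis by (simp only:)
  qed
  then have "len * (420 + R * (100 * n + 100) + 230 * w + 190 * n + 20 * M + M * (30 * (2 * window w + 1) + 30)) \<le> len * ((610 + 200 * R) * ?E)"
    by (rule mult_le_mono2)
  moreover have "5 \<le> 5 * ?E" using assms by simp
  ultimately have "5 + len * (420 + R * (100 * n + 100) + 230 * w + 190 * n + 20 * M + M * (30 * (2 * window w + 1) + 30)) \<le> (5 + len * (610 + 200 * R)) * ?E"
    by (simp add: algebra_simps)
  from of_nat_mono[OF this, where ?'a = real] show ?thesis by (simp add: distrib_left)
qed

text \<open>One program serves both bounds: its time is governed by
  \<open>n + w + M * (window w + 1)\<close>, where \<open>M\<close> is at most \<open>n\<close> and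
  at most \<open>sel_bound w\<close>, so a bound may use whichever estimate of \<open>M\<close>
  suits it.\<close>

lemma solvable_if_dominates:
  fixes f :: "nat \<Rightarrow> nat \<Rightarrow> real"
  assumes K: "\<And>n w M. \<lbrakk>0 < n; 0 < w; M \<le> n; M \<le> sel_bound w\<rbrakk> \<Longrightarrow> real n + real w + real M * (real (window w) + 1) \<le> K * f n w"
  shows "knapsack_solvable_in_O f"
  unfolding knapsack_solvable_in_O_def
proof (rule exI[of _ "compile knapsack"], rule allI, rule exI[of _ "27 * (c + 1)" for c], intro conjI allI)
  fix c b :: nat
  show "c < 27 * (c + 1)" by simp
  let ?A = "real (5 + length (compile knapsack) * (610 + 200 * (3 * (c + 1) + 1)))"
  show "\<exists>C::real. \<forall>W t items. knapsack_instance t items \<longrightarrow> (\<forall>x \<in> set (input_words t items). x \<le> (length items + 1) ^ c) \<longrightarrow>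
        real (27 * (c + 1)) * log 2 (real (length items + 1)) \<le> real W \<longrightarrow>
        real W \<le> real b * log 2 (real (length items + 1)) \<longrightarrow>
        solves_within W (compile knapsack) t items (C * f (length items) (w_max items))"
  proof (intro exI[of _ "?A * K"] allI impI)
    fix W t items
    assume inst: "knapsack_instance t items" "\<forall>x \<in> set (input_words t items). x \<le> (length items + 1) ^ c"
      "real (27 * (c + 1)) * log 2 (real (length items + 1)) \<le> real W"
    let ?n = "length items" and ?w = "w_max items"
    have n0: "0 < ?n" using inst(1) by (simp add: knapsack_instance_def)
    obtain M where w0: "0 < ?w" and M: "M \<le> ?n" "M \<le> sel_bound ?w" and sol: "solves_within W (compile knapsack) t items (real (5 + length (compile knapsack) *
      (420 + (3 * (c + 1) + 1) * (100 * ?n + 100) + 230 * ?w + 190 * ?n + 20 * M + M * (30 * (2 * window ?w + 1) + 30))))"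
      using knapsack_solves[OF inst] by blast
    note knapsack_time[OF n0, of "length (compile knapsack)" "3 * (c + 1) + 1" ?w M]
    also have "?A * (real ?n + real ?w + real M * (real (window ?w) + 1)) \<le> ?A * (K * f ?n ?w)"
      by (intro mult_left_mono K n0 w0 M) simp
    finally show "solves_within W (compile knapsack) t items (?A * K * f ?n ?w)"
      using sol unfolding solves_within_def mult.assoc by (meson order_trans)
  qed
qed

theorem theorem1p1:
  "(\<exists>d::nat. knapsack_solvable_in_O
      (\<lambda>n wmax. real n + real wmax powr 2.5 * log 2 (real (wmax + 1)) ^ d))
   \<and> (\<exists>d::nat. knapsack_solvable_in_O
      (\<lambda>n wmax. real n * real wmax powr 1.5 * log 2 (real (wmax + 1)) ^ d))"
proof (intro conjI exI)
  show "knapsack_solvable_in_O (\<lambda>n wmax. real n + real wmax powr 2.5 * log 2 (real (wmax + 1)) ^ 5)"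
  \<comment> \<open>The product of 576 and 2304, from \<open>sel_bound_le\<close> and
    \<open>window_le_powr\<close>, plus 1 for the summand \<open>w\<close>. The powers 2 and 3 of
    the logarithm in these lemmas give the exponent 5.\<close>
  proof (rule solvable_if_dominates[where K = 1327105])
    fix n w M :: nat assume n: "0 < n" and w: "0 < w" and M: "M \<le> n" "M \<le> sel_bound w"
    define l where "l = log 2 (real (w + 1))"
    have l: "1 \<le> l" unfolding l_def by (rule lg2_le_log[OF w])
    have pw: "real w powr 2.5 = real w * real w powr 1.5"
    proof -
      have "real w powr 2.5 = real w powr 1 * real w powr 1.5" unfolding powr_add[symmetric] by simp
      then show ?thesis using w by simp
    qed
    have "real M \<le> 576 * (real w * l ^ 2)" using M(2) sel_bound_le[OF w] unfolding l_def by linarith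
    then have "real M * (real (window w) + 1) \<le> (576 * (real w * l ^ 2)) * (2304 * (real w powr 1.5 * l ^ 3))"
      using window_le_powr[OF w] unfolding l_def by (intro mult_mono) auto
    also have "\<dots> = 1327104 * (real w powr 2.5 * l ^ 5)" unfolding pw by (simp add: eval_nat_numeral)
    finally have 1: "real M * (real (window w) + 1) \<le> 1327104 * (real w powr 2.5 * l ^ 5)" .
    have "real w * 1 \<le> real w powr 2.5 * l ^ 5"
    proof (intro mult_mono one_le_power l)
      show "real w \<le> real w powr 2.5" using powr_mono[of 1 "2.5" "real w"] w by simp
    qed auto
    then show "real n + real w + real M * (real (window w) + 1) \<le> 1327105 * (real n + real w powr 2.5 * log 2 (real (w + 1)) ^ 5)"
      using 1 unfolding l_def distrib_left by linarith
  qed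
  show "knapsack_solvable_in_O (\<lambda>n wmax. real n * real wmax powr 1.5 * log 2 (real (wmax + 1)) ^ 3)"
  \<comment> \<open>Here \<open>M \<le> n\<close> is the useful estimate: 2304 for the table, and 1
    each for the summands \<open>n\<close> and \<open>w\<close>.\<close>
  proof (rule solvable_if_dominates[where K = 2306])
    fix n w M :: nat assume n: "0 < n" and w: "0 < w" and M: "M \<le> n" "M \<le> sel_bound w"
    define g where "g = real w powr 1.5 * log 2 (real (w + 1)) ^ 3"
    have "real w * 1 \<le> g" unfolding g_def
    proof (intro mult_mono one_le_power lg2_le_log[OF w])
      show "real w \<le> real w powr 1.5" using powr_mono[of 1 "1.5" "real w"] w by simp
    qed auto
    then have g: "real w \<le> g" "1 \<le> g" using w by simp_all
    have "real M * (real (window w) + 1) \<le> real n * (2304 * g)"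
      using window_le_powr[OF w] M(1) unfolding g_def by (intro mult_mono) auto
    moreover have "real w \<le> real n * g" using mult_mono[of 1 "real n" "real w" g] n g by simp
    moreover have "real n \<le> real n * g" using mult_left_mono[OF g(2), of "real n"] by simp
    ultimately have "real n + real w + real M * (real (window w) + 1) \<le> 2306 * (real n * g)" by linarith
    then show "real n + real w + real M * (real (window w) + 1) \<le> 2306 * (real n * real w powr 1.5 * log 2 (real (w + 1)) ^ 3)"
      unfolding g_def by (simp add: mult.assoc)
  qed
qed

end
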